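(* Let $V$ be a simple real Jordan algebra of dimension $n$ and rank $r$. For all $(\lambda,\varepsilon)$ and $(\mu,\eta)$ in $\mathbb C\times\{\pm\}$ and for all integers $k\ge 1$, the operator $B^{(k)}_{\lambda,\mu}=\operatorname{res}\circ F_{\lambda+k-1,\mu+k-1}\circ\cdots\circ F_{\lambda,\mu}$ is covariant with respect to $(\pi_{\lambda,\varepsilon}\otimes\pi_{\mu,\eta},\ \pi_{\lambda+\mu+2k,\varepsilon\eta})$, i.e. for any $g\in G$, $$ B_{\lambda, \mu}^{(k)} \circ\left(\pi_{\lambda, \varepsilon}(g) \otimes \pi_{\mu, \eta}(g)\right)=\pi_{\lambda+\mu+2 k, \varepsilon \eta}(g) \circ B_{\lambda, \mu}^{(k)}. $$
   Context: Jordan setting. $V$ is a simple real Jordan algebra with unit, dimension $n$; its rank $r$ is the degree of the generic minimal polynomial $\lambda^r-a_1(x)\lambda^{r-1}+\cdots+(-1)^ra_r(x)$; $\operatorname{tr}=a_1$, ${\bf det}=a_r$, $\tau(x,y)=\operatorname{tr}(xy)$. $V^\times$ is the set of invertible elements. $t^{s,+}=|t|^s$, $t^{s,-}=\operatorname{sign}(t)|t|^s$ for $t\in\mathbb R^\times$, $s\in\mathbb C$. Signs $\varepsilon\eta$ are multiplied in the obvious way. Group. $\operatorname{Str}(V)$ is the group of $g\in GL(V)$ for which there is $\chi(g)\in\mathbb R^\times$ with ${\bf det}(gx)=\chi(g){\bf det}(x)$ for all invertible $x$; $\operatorname{Str}(V)^+=\{\chi>0\}$. $\operatorname{Co}(V)^+$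 is the group of rational transformations of $V$ generated by $\operatorname{Str}(V)^+$, the translations $n_v:x\mapsto x+v$, and $\imath:x\mapsto -x^{-1}$. For $g\in \operatorname{Co}(V)^+$ and $x$ in the open dense set $V_g$ where $g$ is defined, $c(g,x)=\chi(Dg(x))^{-1}$; there is a polynomial $p_g$ on $V$, unique up to sign, with $p_g^2=c(g,\cdot)$ on $V_g$. $G=\{(g,p_g): g\in\operatorname{Co}(V)^+,\ p_g \text{ polynomial},\ p_g^2=c(g,\cdot)\}$, with the group law making $a((g,p_g),x):=p_g(x)$ a cocycle, $a(gh,x)=a(g,h(x))a(h,x)$. $\bar P\subset G$ is the parabolic subgroup opposite to the subgroup of affine transformations (the stabilizer of $0\in V$), and $\mathcal X=G/\bar P$ is the conformal compactification of $V$, in which $V$ embeds as an open dense subset via $v\mapsto n_v\bar P$. Representations. $\mathcal H_{\lambda,\varepsilon}$ is the space of smooth $f:G\to\mathbb C$ with $f(g\bar p)=\chi_{\lambda,\varepsilon}(\bar p)^{-1}f(g)$, $\chi_{\lambda,\varepsilon}(\bar p)=a(\bar p,0)^{\lambda,\varepsilon}$. In the chart $V$ (noncompact picture), $G$ acts by $(\pi_{\lambda,\varepsilon}(g)f)(x)=a(g^{-1},x)^{-\lambda,\varepsilon}f(g^{-1}(x))$. $\mathcal H_{\lambda,\varepsilon}\otimes\mathcal H_{\mu,\eta}$ is the completed tensor product (smooth sections over $\mathcal X\times\mathcal X$), realized as functions on $V\times V$. The restriction operator is $\operatorname{res}(f)(x)=f(x,x)$. Source operator. Let $D_{s,t}$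 ($s,t\in\mathbb C$) be the unique differential operator with polynomial coefficients on $V\times V$, in variables $(\xi,\zeta)$, such that on $V^\times\times V^\times$, for $\varepsilon,\eta\in\{\pm\}$, $${\bf det}\left(\tfrac{\partial}{\partial \xi}-\tfrac{\partial}{\partial \zeta}\right)\circ {\bf det} (\xi)^{s,\varepsilon}{\bf det} (\zeta)^{t,\eta} ={\bf det} (\xi)^{s-1,-\varepsilon}{\bf det}( \zeta)^{t-1,-\eta}\circ D_{s,t},$$ where ${\bf det}(\frac{\partial}{\partial\xi}-\frac{\partial}{\partial\zeta})$ is the constant coefficient operator with ${\bf det}(\frac{\partial}{\partial\xi}-\frac{\partial}{\partial\zeta})e^{\tau(\xi,x)+\tau(\zeta,y)}={\bf det}(x-y)e^{\tau(\xi,x)+\tau(\zeta,y)}$ (such $D_{s,t}$ exists and its coefficients are polynomial in $(s,t)$). Then $F_{\lambda,\mu}$ is the differential operator with polynomial coefficients on $V\times V$ in variables $(x,y)$ determined by $$F_{\lambda,\mu}\,e^{i(\tau(x,\xi)+\tau(y,\zeta))}=D_{\lambda-\frac nr+1,\ \mu-\frac nr+1}\,e^{i(\tau(x,\xi)+\tau(y,\zeta))},$$ $F_{\lambda,\mu}$ acting in $(x,y)$ and $D$ acting in $(\xi,\zeta)$. (Up to a meromorphic factor in $(\lambda,\mu)$ it equals the composition $(I_{\frac{2n}r-\lambda-1,-\varepsilon}\otimes I_{\frac{2n}r-\mu-1,-\eta})\circ M\circ(I_{\lambda,\varepsilon}\otimes I_{\mu,\eta})$, where $M$ is multiplication by ${\bf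 det}(x-y)$ and $I_{\lambda,\varepsilon}$ is the Knapp–Stein operator, convolution by ${\bf det}(x)^{-\frac{2n}r+\lambda,\varepsilon}$.) It satisfies $F_{\lambda,\mu}\circ(\pi_{\lambda,\varepsilon}(g)\otimes\pi_{\mu,\eta}(g))=(\pi_{\lambda+1,-\varepsilon}(g)\otimes\pi_{\mu+1,-\eta}(g))\circ F_{\lambda,\mu}$ for all $g\in G$. *)

theory Defs
  imports "HOL-Analysis.Analysis" "HOL-Computational_Algebra.Polynomial"
begin

section \<open>Smooth functions and differential operators\<close>

text \<open>Derivative of \<open>f\<close> along the directions \<open>vs\<close>. The value at a point depends only on the germ of
  \<open>f\<close> there, so these operators also apply to functions that are smooth on an open subset only.\<close>

fun dir_deriv :: "'b::real_normed_vector list \<Rightarrow> ('b \<Rightarrow> complex) \<Rightarrow> 'b \<Rightarrow> complex" where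
  "dir_deriv [] f = f"
| "dir_deriv (v # vs) f = (\<lambda>x. frechet_derivative (dir_deriv vs f) (at x) v)"

definition smooth_on :: "'b::real_normed_vector set \<Rightarrow> ('b \<Rightarrow> complex) \<Rightarrow> bool" where
  "smooth_on S f \<longleftrightarrow>
     (\<forall>vs. continuous_on S (dir_deriv vs f) \<and> (\<forall>x\<in>S. dir_deriv vs f differentiable (at x)))"

text \<open>A differential operator is a finite sum of terms \<open>p \<cdot> \<partial>\<^sub>v\<^sub>1 \<dots> \<partial>\<^sub>v\<^sub>m\<close>, listed as pairs
  \<open>(p, [v1, \<dots>, vm])\<close>.\<close>

definition diff_op ::
  "(('b::real_normed_vector \<Rightarrow> complex) \<times> 'b list) list \<Rightarrow> ('b \<Rightarrow> complex) \<Rightarrow> 'b \<Rightarrow> complex" where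
  "diff_op T f x = (\<Sum>(p, vs)\<leftarrow>T. p x * dir_deriv vs f x)"

definition poly_diff_op :: "(('b::real_normed_vector \<Rightarrow> complex) \<Rightarrow> 'b \<Rightarrow> complex) \<Rightarrow> bool" where
  "poly_diff_op A \<longleftrightarrow> (\<exists>T. (\<forall>(p, vs)\<in>set T. polynomial_function p) \<and> A = diff_op T)"

definition const_diff_op :: "(('b::real_normed_vector \<Rightarrow> complex) \<Rightarrow> 'b \<Rightarrow> complex) \<Rightarrow> bool" where
  "const_diff_op A \<longleftrightarrow> (\<exists>T. (\<forall>(p, vs)\<in>set T. \<exists>c. p = (\<lambda>_. c)) \<and> A = diff_op T)"


section \<open>Simple real Jordan algebras\<close>

text \<open>The vector space is a type of class \<open>euclidean_space\<close>, which stands for an arbitrary nonzero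
  real vector space of finite dimension \<open>DIM('a)\<close>; its inner product plays no role. The Jordan
  product is the parameter \<open>J\<close>.\<close>

definition jordan_algebra :: "('a::euclidean_space \<Rightarrow> 'a \<Rightarrow> 'a) \<Rightarrow> bool" where
  "jordan_algebra J \<longleftrightarrow> bilinear J \<and> (\<forall>x y. J x y = J y x) \<and>
     (\<forall>x y. J (J x x) (J x y) = J x (J (J x x) y))"

definition jordan_ideal :: "('a::euclidean_space \<Rightarrow> 'a \<Rightarrow> 'a) \<Rightarrow> 'a set \<Rightarrow> bool" where
  "jordan_ideal J I \<longleftrightarrow> subspace I \<and> (\<forall>x\<in>I. \<forall>y. J y x \<in> I)"

definition simple_unital_jordan_algebra :: "('a::euclidean_space \<Rightarrow> 'a \<Rightarrow> 'a) \<Rightarrow> bool" where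
  "simple_unital_jordan_algebra J \<longleftrightarrow> jordan_algebra J \<and> (\<exists>e. \<forall>x. J e x = x) \<and>
     (\<forall>I. jordan_ideal J I \<longrightarrow> I = {0} \<or> I = UNIV)"

definition junit :: "('a::euclidean_space \<Rightarrow> 'a \<Rightarrow> 'a) \<Rightarrow> 'a" where
  "junit J = (THE e. \<forall>x. J e x = x)"

fun jpow :: "('a::euclidean_space \<Rightarrow> 'a \<Rightarrow> 'a) \<Rightarrow> 'a \<Rightarrow> nat \<Rightarrow> 'a" where
  "jpow J x 0 = junit J"
| "jpow J x (Suc m) = J x (jpow J x m)"

definition jpoly :: "('a::euclidean_space \<Rightarrow> 'a \<Rightarrow> 'a) \<Rightarrow> real poly \<Rightarrow> 'a \<Rightarrow> 'a" where
  "jpoly J p x = (\<Sum>i\<le>degree p. coeff p i *\<^sub>R jpow J x i)"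

definition jminpoly :: "('a::euclidean_space \<Rightarrow> 'a \<Rightarrow> 'a) \<Rightarrow> 'a \<Rightarrow> real poly" where
  "jminpoly J x = (THE p. lead_coeff p = 1 \<and> jpoly J p x = 0 \<and>
     (\<forall>q. q \<noteq> 0 \<and> jpoly J q x = 0 \<longrightarrow> degree p \<le> degree q))"

definition jrank :: "('a::euclidean_space \<Rightarrow> 'a \<Rightarrow> 'a) \<Rightarrow> nat" where
  "jrank J = Max (range (\<lambda>x. degree (jminpoly J x)))"

definition jregular :: "('a::euclidean_space \<Rightarrow> 'a \<Rightarrow> 'a) \<Rightarrow> 'a \<Rightarrow> bool" where
  "jregular J x \<longleftrightarrow> degree (jminpoly J x) = jrank J"

text \<open>The coefficient \<open>a\<^sub>j\<close> of the generic minimal polynomial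
  \<open>\<lambda>\<^sup>r - a\<^sub>1(x) \<lambda>\<^sup>r\<^sup>-\<^sup>1 + \<dots> + (-1)\<^sup>r a\<^sub>r(x)\<close>: the polynomial function on the algebra for which this
  expression is the minimal polynomial of every regular \<open>x\<close>.\<close>

definition gen_coeff :: "('a::euclidean_space \<Rightarrow> 'a \<Rightarrow> 'a) \<Rightarrow> nat \<Rightarrow> 'a \<Rightarrow> real" where
  "gen_coeff J j = (THE a. real_polynomial_function a \<and>
     (\<forall>x. jregular J x \<longrightarrow> a x = (-1) ^ j * coeff (jminpoly J x) (jrank J - j)))"

definition jtr :: "('a::euclidean_space \<Rightarrow> 'a \<Rightarrow> 'a) \<Rightarrow> 'a \<Rightarrow> real" where
  "jtr J = gen_coeff J 1"

definition jdet :: "('a::euclidean_space \<Rightarrow> 'a \<Rightarrow> 'a) \<Rightarrow> 'a \<Rightarrow> real" where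
  "jdet J = gen_coeff J (jrank J)"

definition jtau :: "('a::euclidean_space \<Rightarrow> 'a \<Rightarrow> 'a) \<Rightarrow> 'a \<Rightarrow> 'a \<Rightarrow> real" where
  "jtau J x y = jtr J (J x y)"

text \<open>Invertibility and inverses are taken in the associative subalgebra generated by \<open>x\<close> and the unit.\<close>

definition jinv_rel :: "('a::euclidean_space \<Rightarrow> 'a \<Rightarrow> 'a) \<Rightarrow> 'a \<Rightarrow> 'a \<Rightarrow> bool" where
  "jinv_rel J x y \<longleftrightarrow> (\<exists>p. y = jpoly J p x) \<and> J x y = junit J"

definition invertibles :: "('a::euclidean_space \<Rightarrow> 'a \<Rightarrow> 'a) \<Rightarrow> 'a set" where
  "invertibles J = {x. \<exists>y. jinv_rel J x y}"

definition jinv :: "('a::euclidean_space \<Rightarrow> 'a \<Rightarrow> 'a) \<Rightarrow> 'a \<Rightarrow> 'a" where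
  "jinv J x = (THE y. jinv_rel J x y)"


section \<open>The structure group and the conformal group\<close>

definition str_group :: "('a::euclidean_space \<Rightarrow> 'a \<Rightarrow> 'a) \<Rightarrow> ('a \<Rightarrow> 'a) set" where
  "str_group J = {g. linear g \<and> bij g \<and>
     (\<exists>c. c \<noteq> 0 \<and> (\<forall>x\<in>invertibles J. jdet J (g x) = c * jdet J x))}"

definition str_char :: "('a::euclidean_space \<Rightarrow> 'a \<Rightarrow> 'a) \<Rightarrow> ('a \<Rightarrow> 'a) \<Rightarrow> real" where
  "str_char J g = (THE c. c \<noteq> 0 \<and> (\<forall>x\<in>invertibles J. jdet J (g x) = c * jdet J x))"

definition str_group_pos :: "('a::euclidean_space \<Rightarrow> 'a \<Rightarrow> 'a) \<Rightarrow> ('a \<Rightarrow> 'a) set" where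
  "str_group_pos J = {g \<in> str_group J. str_char J g > 0}"

text \<open>A rational transformation is the partial map given by a fraction \<open>P / Q\<close> on its maximal domain,
  that is, at all points where some fraction \<open>P' / Q'\<close> equal to \<open>P / Q\<close> has \<open>Q' \<noteq> 0\<close>. The set
  \<open>V\<^sub>g\<close> is then \<open>dom g\<close>, and equality of rational transformations is equality of partial maps.\<close>

definition rational_map :: "('a::euclidean_space \<rightharpoonup> 'a) \<Rightarrow> bool" where
  "rational_map g \<longleftrightarrow> (\<exists>P Q. polynomial_function P \<and> real_polynomial_function Q \<and> (\<exists>z. Q z \<noteq> 0) \<and>
     (\<forall>x y. g x = Some y \<longleftrightarrow>
        (\<exists>P' Q'. polynomial_function P' \<and> real_polynomial_function Q' \<and>
           (\<forall>z. Q z *\<^sub>R P' z = Q' z *\<^sub>R P z) \<and> Q' x \<noteq> 0 \<and> y = P' x /\<^sub>R Q' x)))"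

text \<open>Composition of rational transformations: the rational map that extends the pointwise composite.\<close>

definition rat_comp :: "('a::euclidean_space \<rightharpoonup> 'a) \<Rightarrow> ('a \<rightharpoonup> 'a) \<Rightarrow> ('a \<rightharpoonup> 'a)" where
  "rat_comp g h = (THE k. rational_map k \<and> (\<forall>x y z. h x = Some y \<and> g y = Some z \<longrightarrow> k x = Some z))"

definition linear_tr :: "('a \<Rightarrow> 'a) \<Rightarrow> ('a \<rightharpoonup> 'a)" where
  "linear_tr g = (\<lambda>x. Some (g x))"

definition translation_tr :: "'a::euclidean_space \<Rightarrow> ('a \<rightharpoonup> 'a)" where
  "translation_tr v = (\<lambda>x. Some (x + v))"

definition inversion_tr :: "('a::euclidean_space \<Rightarrow> 'a \<Rightarrow> 'a) \<Rightarrow> ('a \<rightharpoonup> 'a)" where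
  "inversion_tr J = (\<lambda>x. if x \<in> invertibles J then Some (- jinv J x) else None)"

text \<open>The set of generators is closed under inversion (\<open>inversion_tr\<close> is an involution), so the group
  that it generates is its closure under composition.\<close>

inductive_set co_group :: "('a::euclidean_space \<Rightarrow> 'a \<Rightarrow> 'a) \<Rightarrow> ('a \<rightharpoonup> 'a) set"
  for J :: "'a::euclidean_space \<Rightarrow> 'a \<Rightarrow> 'a" where
  str: "g \<in> str_group_pos J \<Longrightarrow> linear_tr g \<in> co_group J"
| trans: "translation_tr v \<in> co_group J"
| inversion: "inversion_tr J \<in> co_group J"
| comp: "g \<in> co_group J \<Longrightarrow> h \<in> co_group J \<Longrightarrow> rat_comp g h \<in> co_group J"

definition cocycle_c :: "('a::euclidean_space \<Rightarrow> 'a \<Rightarrow> 'a) \<Rightarrow> ('a \<rightharpoonup> 'a) \<Rightarrow> 'a \<Rightarrow> real" where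
  "cocycle_c J g x = inverse (str_char J (frechet_derivative (\<lambda>z. the (g z)) (at x)))"

type_synonym 'a gelem = "('a \<rightharpoonup> 'a) \<times> ('a \<Rightarrow> real)"

definition G_carrier :: "('a::euclidean_space \<Rightarrow> 'a \<Rightarrow> 'a) \<Rightarrow> 'a gelem set" where
  "G_carrier J = {(g, p). g \<in> co_group J \<and> real_polynomial_function p \<and>
     (\<forall>x\<in>dom g. (p x)\<^sup>2 = cocycle_c J g x)}"

text \<open>The second component of a product is the polynomial given on \<open>V\<^sub>h\<close> by the cocycle rule
  \<open>p(h(x)) q(x)\<close>.\<close>

definition G_mult :: "'a::euclidean_space gelem \<Rightarrow> 'a gelem \<Rightarrow> 'a gelem" where
  "G_mult g h = (rat_comp (fst g) (fst h),
     THE r. real_polynomial_function r \<and>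
       (\<forall>x y. fst h x = Some y \<and> y \<in> dom (fst g) \<longrightarrow> r x = snd g y * snd h x))"

definition G_one :: "'a::euclidean_space gelem" where
  "G_one = (Some, \<lambda>_. 1)"

definition G_inv :: "('a::euclidean_space \<Rightarrow> 'a \<Rightarrow> 'a) \<Rightarrow> 'a gelem \<Rightarrow> 'a gelem" where
  "G_inv J g = (THE h. h \<in> G_carrier J \<and> G_mult h g = G_one)"

definition G_trans :: "'a::euclidean_space \<Rightarrow> 'a gelem" where
  "G_trans v = (translation_tr v, \<lambda>_. 1)"

definition P_bar :: "('a::euclidean_space \<Rightarrow> 'a \<Rightarrow> 'a) \<Rightarrow> 'a gelem set" where
  "P_bar J = {g \<in> G_carrier J. fst g 0 = Some 0}"


section \<open>The representations\<close>

text \<open>\<open>t\<^sup>s\<^sup>,\<^sup>\<epsilon>\<close> for \<open>t \<noteq> 0\<close>; the signs \<open>+\<close> and \<open>-\<close> are the integers \<open>1\<close> and \<open>-1\<close>.\<close>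

definition sgn_powr :: "real \<Rightarrow> complex \<Rightarrow> int \<Rightarrow> complex" where
  "sgn_powr t s \<epsilon> = (if \<epsilon> = 1 then 1 else of_real (sgn t)) * of_real \<bar>t\<bar> powr s"

definition P_char :: "complex \<Rightarrow> int \<Rightarrow> 'a::euclidean_space gelem \<Rightarrow> complex" where
  "P_char l \<epsilon> p = sgn_powr (snd p 0) l \<epsilon>"

text \<open>Smoothness on \<open>G\<close> of a function that transforms under \<open>P_bar\<close> by the character is smoothness of
  the corresponding section over \<open>G / P_bar\<close>. It is tested along the local sections \<open>v \<mapsto> g n\<^sub>v\<close>, whose
  images cover \<open>G / P_bar\<close> by open sets as \<open>g\<close> runs through \<open>G\<close>.\<close>

definition ind_space :: "('a::euclidean_space \<Rightarrow> 'a \<Rightarrow> 'a) \<Rightarrow> complex \<Rightarrow> int \<Rightarrow> ('a gelem \<Rightarrow> complex) set" where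
  "ind_space J l \<epsilon> = {f.
     (\<forall>g\<in>G_carrier J. \<forall>p\<in>P_bar J. f (G_mult g p) = inverse (P_char l \<epsilon> p) * f g) \<and>
     (\<forall>g\<in>G_carrier J. smooth_on UNIV (\<lambda>v. f (G_mult g (G_trans v))))}"

text \<open>The completed tensor product: smooth sections over \<open>G / P_bar \<times> G / P_bar\<close>.\<close>

definition ind_space2 :: "('a::euclidean_space \<Rightarrow> 'a \<Rightarrow> 'a) \<Rightarrow> complex \<Rightarrow> int \<Rightarrow> complex \<Rightarrow> int \<Rightarrow>
    ('a gelem \<times> 'a gelem \<Rightarrow> complex) set" where
  "ind_space2 J l \<epsilon> m \<eta> = {f.
     (\<forall>g\<in>G_carrier J. \<forall>h\<in>G_carrier J. \<forall>p\<in>P_bar J. \<forall>q\<in>P_bar J.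
        f (G_mult g p, G_mult h q) = inverse (P_char l \<epsilon> p) * inverse (P_char m \<eta> q) * f (g, h)) \<and>
     (\<forall>g\<in>G_carrier J. \<forall>h\<in>G_carrier J.
        smooth_on UNIV (\<lambda>(v, w). f (G_mult g (G_trans v), G_mult h (G_trans w))))}"

text \<open>The noncompact pictures of both spaces.\<close>

definition H_space :: "('a::euclidean_space \<Rightarrow> 'a \<Rightarrow> 'a) \<Rightarrow> complex \<Rightarrow> int \<Rightarrow> ('a \<Rightarrow> complex) set" where
  "H_space J l \<epsilon> = {\<lambda>x. f (G_trans x) | f. f \<in> ind_space J l \<epsilon>}"

definition H_space2 :: "('a::euclidean_space \<Rightarrow> 'a \<Rightarrow> 'a) \<Rightarrow> complex \<Rightarrow> int \<Rightarrow> complex \<Rightarrow> int \<Rightarrow>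
    ('a \<times> 'a \<Rightarrow> complex) set" where
  "H_space2 J l \<epsilon> m \<eta> = {\<lambda>(x, y). f (G_trans x, G_trans y) | f. f \<in> ind_space2 J l \<epsilon> m \<eta>}"

text \<open>The action formula determines \<open>\<pi>(g) f\<close> on the open dense set where \<open>g\<^sup>-\<^sup>1\<close> is defined, and
  \<open>\<pi>(g) f\<close> is the continuous extension to the whole of the algebra.\<close>

definition rep :: "('a::euclidean_space \<Rightarrow> 'a \<Rightarrow> 'a) \<Rightarrow> complex \<Rightarrow> int \<Rightarrow> 'a gelem \<Rightarrow>
    ('a \<Rightarrow> complex) \<Rightarrow> ('a \<Rightarrow> complex)" where
  "rep J l \<epsilon> g f = (THE \<psi>. continuous_on UNIV \<psi> \<and>
     (\<forall>x x'. fst (G_inv J g) x = Some x' \<longrightarrow>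
        \<psi> x = sgn_powr (snd (G_inv J g) x) (- l) \<epsilon> * f x'))"

definition rep2 :: "('a::euclidean_space \<Rightarrow> 'a \<Rightarrow> 'a) \<Rightarrow> complex \<Rightarrow> int \<Rightarrow> complex \<Rightarrow> int \<Rightarrow> 'a gelem \<Rightarrow>
    ('a \<times> 'a \<Rightarrow> complex) \<Rightarrow> ('a \<times> 'a \<Rightarrow> complex)" where
  "rep2 J l \<epsilon> m \<eta> g f = (THE \<psi>. continuous_on UNIV \<psi> \<and>
     (\<forall>x x' y y'. fst (G_inv J g) x = Some x' \<and> fst (G_inv J g) y = Some y' \<longrightarrow>
        \<psi> (x, y) = sgn_powr (snd (G_inv J g) x) (- l) \<epsilon> *
                   sgn_powr (snd (G_inv J g) y) (- m) \<eta> * f (x', y')))"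


section \<open>The source operators\<close>

text \<open>\<open>\<Delta>\<close> is the constant coefficient operator \<open>det(\<partial>/\<partial>\<xi> - \<partial>/\<partial>\<zeta>)\<close>.\<close>

definition is_det_diff_op :: "('a::euclidean_space \<Rightarrow> 'a \<Rightarrow> 'a) \<Rightarrow>
    (('a \<times> 'a \<Rightarrow> complex) \<Rightarrow> 'a \<times> 'a \<Rightarrow> complex) \<Rightarrow> bool" where
  "is_det_diff_op J \<Delta> \<longleftrightarrow> const_diff_op \<Delta> \<and>
     (\<forall>x y. \<Delta> (\<lambda>(\<xi>, \<zeta>). exp (of_real (jtau J \<xi> x + jtau J \<zeta> y))) =
        (\<lambda>(\<xi>, \<zeta>). of_real (jdet J (x - y)) * exp (of_real (jtau J \<xi> x + jtau J \<zeta> y))))"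

definition is_source_D :: "('a::euclidean_space \<Rightarrow> 'a \<Rightarrow> 'a) \<Rightarrow>
    (('a \<times> 'a \<Rightarrow> complex) \<Rightarrow> 'a \<times> 'a \<Rightarrow> complex) \<Rightarrow> complex \<Rightarrow> complex \<Rightarrow>
    (('a \<times> 'a \<Rightarrow> complex) \<Rightarrow> 'a \<times> 'a \<Rightarrow> complex) \<Rightarrow> bool" where
  "is_source_D J \<Delta> s t D \<longleftrightarrow> poly_diff_op D \<and>
     (\<forall>\<epsilon>\<in>{1, -1}. \<forall>\<eta>\<in>{1, -1}. \<forall>f. smooth_on (invertibles J \<times> invertibles J) f \<longrightarrow>
        (\<forall>\<xi>\<in>invertibles J. \<forall>\<zeta>\<in>invertibles J.
           \<Delta> (\<lambda>(\<xi>, \<zeta>). sgn_powr (jdet J \<xi>) s \<epsilon> * sgn_powr (jdet J \<zeta>) t \<eta> * f (\<xi>, \<zeta>)) (\<xi>, \<zeta>) =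
           sgn_powr (jdet J \<xi>) (s - 1) (- \<epsilon>) * sgn_powr (jdet J \<zeta>) (t - 1) (- \<eta>) * D f (\<xi>, \<zeta>)))"

definition is_source_F :: "('a::euclidean_space \<Rightarrow> 'a \<Rightarrow> 'a) \<Rightarrow>
    (complex \<Rightarrow> complex \<Rightarrow> ('a \<times> 'a \<Rightarrow> complex) \<Rightarrow> 'a \<times> 'a \<Rightarrow> complex) \<Rightarrow> complex \<Rightarrow> complex \<Rightarrow>
    (('a \<times> 'a \<Rightarrow> complex) \<Rightarrow> 'a \<times> 'a \<Rightarrow> complex) \<Rightarrow> bool" where
  "is_source_F J D l m F \<longleftrightarrow> poly_diff_op F \<and>
     (let \<rho> = of_nat DIM('a) / of_nat (jrank J) in
      \<forall>x y \<xi> \<zeta>.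
        F (\<lambda>(x, y). exp (\<i> * of_real (jtau J x \<xi> + jtau J y \<zeta>))) (x, y) =
        D (l - \<rho> + 1) (m - \<rho> + 1)
          (\<lambda>(\<xi>, \<zeta>). exp (\<i> * of_real (jtau J x \<xi> + jtau J y \<zeta>))) (\<xi>, \<zeta>))"

definition res :: "('a \<times> 'a \<Rightarrow> complex) \<Rightarrow> 'a \<Rightarrow> complex" where
  "res f x = f (x, x)"

fun iter_F :: "(complex \<Rightarrow> complex \<Rightarrow> ('a \<times> 'a \<Rightarrow> complex) \<Rightarrow> 'a \<times> 'a \<Rightarrow> complex) \<Rightarrow>
    complex \<Rightarrow> complex \<Rightarrow> nat \<Rightarrow> ('a \<times> 'a \<Rightarrow> complex) \<Rightarrow> 'a \<times> 'a \<Rightarrow> complex" where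
  "iter_F F l m 0 = id"
| "iter_F F l m (Suc k) = F (l + of_nat k) (m + of_nat k) \<circ> iter_F F l m k"

definition B_op :: "(complex \<Rightarrow> complex \<Rightarrow> ('a \<times> 'a \<Rightarrow> complex) \<Rightarrow> 'a \<times> 'a \<Rightarrow> complex) \<Rightarrow>
    complex \<Rightarrow> complex \<Rightarrow> nat \<Rightarrow> ('a \<times> 'a \<Rightarrow> complex) \<Rightarrow> 'a \<Rightarrow> complex" where
  "B_op F l m k = res \<circ> iter_F F l m k"

end

theory Submission
 imports Defs "HOL-Computational_Algebra.Computational_Algebra" "HOL-Computational_Algebra.Field_as_Ring"
  "Jordan_Normal_Form.Char_Poly"
begin

text \<open>
 Testing on exponentials \<open>e\<^bsup>c(\<tau>(x,\<xi>) + \<tau>(y,\<zeta>))\<^esup>\<close> turns \<open>F\<close> into the source operator \<open>D\<close>. The infinitesimal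
 action of the inverted translation along \<open>e\<close> becomes a Bessel operator, whose parameter is raised by one by
 \<open>\<Delta>\<close> and exchanged with its dual under conjugation by powers of \<open>det\<close>; hence \<open>F\<close> intertwines the infinitesimal
 actions, and so does \<open>B\<^sup>(\<^sup>k\<^sup>)\<close>. Integrating along the flow \<open>q\<^sub>s(v) = v (e - s v)\<^sup>-\<^sup>1\<close> gives covariance under \<open>q\<^sub>1\<close> near
 \<open>0\<close>, and \<open>x \<mapsto> -x\<^sup>-\<^sup>1\<close> is \<open>q\<^sub>1\<close> between two translations near \<open>-e\<close>. Both sides of the covariance relation of the
 inversion, applied to exponentials, are rational up to common factors, so that it extends to all invertible
 points. Translations and \<open>Str(V)\<^sup>+\<close> are handled on exponentials; composites of generators follow by density, and
 the charts \<open>v \<mapsto> g n\<^sub>v\<close> of the compactification carry the result to sections.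
\<close>

text \<open>Flow covariance is available only where the whole segment \<open>e - s v\<close>,
  \<open>0 \<le> s \<le> 1\<close>, consists of invertible elements. These may form several
  components, so no connectedness argument reaches a general point; rationality does. Composition in
  the conformal group is another obstacle: a composite is the rational extension of the pointwise
  one, hence may be defined where the factors are not. The quadratic vector fields
  \<open>qf\<close>, stable under pull-back by every generator, control the differential at such
  points and make the cocycle polynomial. Its polynomial square roots rest on unique factorisation
  along lines. The shift \<open>n/r\<close> enters through \<open>Trc (J z) = (n/r) tr z\<close>,
  where simplicity acts: the element representing the trace form is central and turns out to be a
  scalar. Determinant and trace are specified only as polynomials that agree with the minimal
  polynomials of regular elements, so their very existence needs an argument, namely Gauss's lemma
  along lines.\<close>

no_notation scalar_prod (infix "\<bullet>" 70)
hide_const (open) Module.smult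
no_notation matrix_matrix_mult (infixl "**" 70)

abbreviation (input) "cor \<equiv> complex_of_real"
abbreviation (input) "psmult \<equiv> Polynomial.smult"
abbreviation (input) "root_poly ls \<equiv> \<Prod>l\<leftarrow>ls. [:- l, 1:]"
abbreviation (input) "dd \<equiv> dir_deriv"
abbreviation (input) "fderiv \<equiv> frechet_derivative"
abbreviation (input) "pfun \<equiv> polynomial_function"
abbreviation (input) "rpoly \<equiv> real_polynomial_function"
lemmas rpoly_intros = real_polynomial_function.intros

section \<open>Calculus of directional derivatives\<close>

lemma fderiv_cong_open:
 assumes "open S" "x \<in> S" "!!y. y \<in> S ==> f y = g y"
 shows "fderiv f (at x) = fderiv g (at x)"
proof -
 have "(f has_derivative D) (at x) \<longleftrightarrow> (g has_derivative D) (at x)" for D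
  using has_derivative_transform_within_open[of f D x UNIV S g]
   has_derivative_transform_within_open[of g D x UNIV S f] assms by auto
 thus ?thesis by (simp add: frechet_derivative_def)
qed

lemma differentiable_cong_open:
 assumes "open S" "x \<in> S" "!!y. y \<in> S ==> f y = g y" "f differentiable (at x)"
 shows "g differentiable (at x)"
 using assms has_derivative_transform_within_open[of f _ x UNIV S g]
 unfolding differentiable_def by blast

lemma dd_cong:
 assumes "open S" "!!y. y \<in> S ==> f y = g y" "x \<in> S"
 shows "dd vs f x = dd vs g x"
 using assms(3)
proof (induction vs arbitrary: x)
 case (Cons v vs)
 have "fderiv (dd vs f) (at x) = fderiv (dd vs g) (at x)"
  by (rule fderiv_cong_open[OF assms(1) Cons.prems]) (rule Cons.IH)
 thus ?case by simp
qed (simp add: assms)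

lemma dd_append: "dd (us @ vs) f = dd us (dd vs f)"
 by (induction us) auto

lemma sm_altdef:
 "smooth_on S f \<longleftrightarrow> (\<forall>vs. \<forall>x\<in>S. dd vs f differentiable (at x))"
 unfolding smooth_on_def
 by (meson continuous_at_imp_continuous_on differentiable_imp_continuous_within)

lemma sm_differentiable:
 "smooth_on S f ==> x \<in> S ==> f differentiable (at x)"
 unfolding sm_altdef by (metis dir_deriv.simps(1))

lemma sm_continuous: "smooth_on S f ==> continuous_on S f"
 unfolding smooth_on_def by (metis dir_deriv.simps(1))

lemma sm_hasd:
 "smooth_on S f ==> x \<in> S ==> (f has_derivative fderiv f (at x)) (at x)"
 using sm_differentiable frechet_derivative_works by blast

lemma sm_dir_deriv: "smooth_on S f ==> smooth_on S (dd vs f)"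
 unfolding sm_altdef by (metis dd_append)

lemma sm_frechet: "smooth_on S f ==> smooth_on S (%x. fderiv f (at x) v)"
 using sm_dir_deriv[of S f "[v]"] by simp

lemma sm_subset: "smooth_on S f ==> T \<subseteq> S ==> smooth_on T f"
 unfolding sm_altdef by blast

lemma sm_cong:
 assumes "open S" "!!y. y \<in> S ==> f y = g y" "smooth_on S f"
 shows "smooth_on S g"
 unfolding sm_altdef
proof (intro allI ballI)
 fix vs x assume "x \<in> S"
 show "dd vs g differentiable (at x)"
  by (rule differentiable_cong_open[OF assms(1) \<open>x \<in> S\<close>, of "dd vs f"])
   (use dd_cong[OF assms(1,2)] assms(3) \<open>x \<in> S\<close> in \<open>auto simp: sm_altdef\<close>)
qed

lemma sm_local:
 assumes "!!x. x \<in> S ==> \<exists>T. x \<in> T & smooth_on T f"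
 shows "smooth_on S f"
 using assms unfolding sm_altdef by blast

text \<open>Smoothness by coinduction up to sums and products.\<close>

inductive_set scl :: "'b::real_normed_vector set => ('b => complex) set => ('b => complex) set"
 for S F where
 base: "f \<in> F ==> f \<in> scl S F"
| smooth: "smooth_on S f ==> f \<in> scl S F"
| add: "f \<in> scl S F ==> g \<in> scl S F ==> (%x. f x + g x) \<in> scl S F"
| mult: "f \<in> scl S F ==> g \<in> scl S F ==> (%x. f x * g x) \<in> scl S F"

lemma fderiv_eqI: "(f has_derivative D) (at x) ==> fderiv f (at x) v = D v"
 using frechet_derivative_at by metis

text \<open>Derivatives of the generators stay in the closure up to equality on \<open>S\<close>,
  and sums and products inherit this by the Leibniz rule; so every iterated derivative agrees on
  \<open>S\<close> with a differentiable member of the closure. Openness of \<open>S\<close> lets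
  such agreements be differentiated.\<close>

theorem sm_upto:
 assumes "open S" and d: "!!f x. f \<in> F ==> x \<in> S ==> f differentiable (at x)"
  and e: "!!f v. f \<in> F ==> \<exists>g\<in>scl S F. \<forall>x\<in>S. fderiv f (at x) v = g x"
  and "f \<in> scl S F"
 shows "smooth_on S f"
proof -
 have 1: "(\<forall>x\<in>S. h differentiable (at x)) &
   (\<forall>v. \<exists>g\<in>scl S F. \<forall>x\<in>S. fderiv h (at x) v = g x)"
  if "h \<in> scl S F" for h
  using that
 proof induction
  case (base f) thus ?case using d e by blast
 next
  case (smooth f)
  have "(%x. fderiv f (at x) v) \<in> scl S F" for v
   by (rule scl.smooth[OF sm_frechet[OF smooth]])
  moreover have "\<forall>x\<in>S. f differentiable (at x)" using sm_differentiable[OF smooth] by blast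
  ultimately show ?case by (intro conjI allI) (auto intro!: bexI[of _ "%x. fderiv f (at x) _"])
 next
  case (add f g)
  have df: "x \<in> S ==> f differentiable (at x)" "x \<in> S ==> g differentiable (at x)" for x
   using add by auto
  moreover have "\<exists>k\<in>scl S F. \<forall>x\<in>S. fderiv (%x. f x + g x) (at x) v = k x" for v
  proof -
   obtain f' g' where "f' \<in> scl S F" "g' \<in> scl S F" "\<forall>x\<in>S. fderiv f (at x) v = f' x"
    "\<forall>x\<in>S. fderiv g (at x) v = g' x" using add.IH by blast
   moreover from this have "fderiv (%x. f x + g x) (at x) v = f' x + g' x" if "x \<in> S" for x
    using has_derivative_add[OF df[OF that, unfolded frechet_derivative_works]]
     fderiv_eqI that by fastforce
   ultimately show ?thesis by (intro bexI[of _ "%x. f' x + g' x"] scl.add ballI) auto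
  qed
  ultimately show ?case by auto
 next
  case (mult f g)
  have df: "x \<in> S ==> f differentiable (at x)" "x \<in> S ==> g differentiable (at x)" for x
   using mult by auto
  moreover have "\<exists>k\<in>scl S F. \<forall>x\<in>S. fderiv (%x. f x * g x) (at x) v = k x" for v
  proof -
   obtain f' g' where *: "f' \<in> scl S F" "g' \<in> scl S F" "\<forall>x\<in>S. fderiv f (at x) v = f' x"
    "\<forall>x\<in>S. fderiv g (at x) v = g' x" using mult.IH by blast
   have "fderiv (%x. f x * g x) (at x) v = f x * g' x + f' x * g x" if "x \<in> S" for x
    using has_derivative_mult[OF df[OF that, unfolded frechet_derivative_works]]
     fderiv_eqI * that by fastforce
   thus ?thesis using * mult.hyps
    by (intro bexI[of _ "%x. f x * g' x + f' x * g x"] scl.add scl.mult ballI) auto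
  qed
  ultimately show ?case by auto
 qed
 have 2: "\<exists>g\<in>scl S F. \<forall>x\<in>S. dd vs f x = g x" for vs
 proof (induction vs)
  case Nil thus ?case using assms(4) by auto
 next
  case (Cons v vs)
  then obtain g where g: "g \<in> scl S F" "\<forall>x\<in>S. dd vs f x = g x" by auto
  then obtain k where "k \<in> scl S F" "\<forall>x\<in>S. fderiv g (at x) v = k x" using 1 by blast
  moreover have "\<forall>x\<in>S. fderiv (dd vs f) (at x) = fderiv g (at x)"
   using fderiv_cong_open[OF assms(1)] g by blast
  ultimately show ?case by auto
 qed
 show ?thesis unfolding sm_altdef
 proof (intro allI ballI)
  fix vs x assume "x \<in> S"
  obtain g where g: "g \<in> scl S F" "\<forall>x\<in>S. dd vs f x = g x" using 2 by blast
  show "dd vs f differentiable (at x)"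
   by (rule differentiable_cong_open[OF assms(1) \<open>x \<in> S\<close>, of g])
    (use g 1[OF g(1)] \<open>x \<in> S\<close> in auto)
 qed
qed

lemma sm_const [simp]: "smooth_on S (%x. c)"
proof -
 have z: "dd vs (%x::'a. 0) = (%x. 0 :: complex)" for vs
  by (induction vs) auto
 have "dd vs (%x. c) = (%x::'a. if vs = [] then c else 0)" for vs
 proof (induction vs)
  case (Cons v vs)
  thus ?case by (cases "vs = []") simp_all
 qed simp
 thus ?thesis unfolding sm_altdef by auto
qed

lemma sm_add:
 "open S ==> smooth_on S f ==> smooth_on S g ==> smooth_on S (%x. f x + g x)"
 by (rule sm_upto[where F = "{}"]) (auto intro: scl.intros)

lemma sm_mult:
 "open S ==> smooth_on S f ==> smooth_on S g ==> smooth_on S (%x. f x * g x)"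
 by (rule sm_upto[where F = "{}"]) (auto intro: scl.intros)

lemma sm_sum:
 "open S ==> (!!i. i \<in> I ==> smooth_on S (f i)) ==> smooth_on S (%x. \<Sum>i\<in>I. f i x)"
 by (induction I rule: infinite_finite_induct) (auto intro: sm_add)

lemma sm_sum_list:
 "open S ==> (!!i. i \<in> set I ==> smooth_on S (f i)) ==> smooth_on S (%x. \<Sum>i\<leftarrow>I. f i x)"
 by (induction I) (auto intro: sm_add)

lemma sm_bounded_linear:
 assumes "open S" "bounded_linear f" shows "smooth_on S f"
proof (rule sm_upto[where F = "Collect bounded_linear"])
 fix f :: "'a => complex" and v assume "f \<in> Collect bounded_linear"
 thus "\<exists>g\<in>scl S (Collect bounded_linear). \<forall>x\<in>S. fderiv f (at x) v = g x"
  by (intro bexI[of _ "%_. f v"] scl.smooth)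
   (auto intro!: fderiv_eqI bounded_linear_imp_has_derivative)
qed (use assms in \<open>auto intro: scl.base bounded_linear_imp_differentiable\<close>)

lemma scl_sum: "(!!i. i \<in> I ==> f i \<in> scl S F) ==> (%x. \<Sum>i\<in>I. f i x) \<in> scl S F"
 by (induction I rule: infinite_finite_induct) (auto intro: scl.intros)

lemma sm_real_poly:
 assumes "rpoly p"
 shows "smooth_on S (%x. cor (p x))"
proof -
 have "smooth_on UNIV (%x. cor (p x))"
  using assms
 proof induction
  case (linear f)
  thus ?case
   by (intro sm_bounded_linear bounded_linear_compose[OF bounded_linear_of_real]) auto
 next
  case (add f g) thus ?case using sm_add[OF open_UNIV add.IH] by simp
 next
  case (mult f g) thus ?case using sm_mult[OF open_UNIV mult.IH] by simp
 qed simp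
 thus ?thesis by (rule sm_subset) simp
qed

lemma sm_poly:
 assumes "pfun (p :: 'b::real_normed_vector => complex)"
 shows "smooth_on S p"
proof -
 have "rpoly (%x. Re (p x))" "rpoly (%x. Im (p x))"
  using assms bounded_linear_Re bounded_linear_Im unfolding polynomial_function_def o_def by auto
 hence "smooth_on UNIV (%x. cor (Re (p x)) + \<i> * cor (Im (p x)))"
  by (intro sm_add sm_mult sm_real_poly) auto
 hence "smooth_on UNIV p" by (simp flip: complex_eq)
 thus ?thesis by (rule sm_subset) simp
qed

text \<open>Tested through complex-valued components, so that the one calculus of
  \<open>smooth_on\<close> serves for maps too. All directions \<open>b\<close> are allowed, which
  keeps the notion independent of a basis.\<close>

definition smooth_map :: "'c::real_normed_vector set => ('c => 'b::euclidean_space) => bool" where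
 "smooth_map S ps \<longleftrightarrow> (\<forall>b. smooth_on S (%x. cor (ps x \<bullet> b)))"

lemma of_real_differentiable_iff:
 "(%x. cor (f x)) differentiable (at x) \<longleftrightarrow> f differentiable (at x)"
proof
 assume "(%x. cor (f x)) differentiable (at x)"
 then obtain D where "((%x. cor (f x)) has_derivative D) (at x)"
  by (auto simp: differentiable_def)
 from bounded_linear.has_derivative[OF bounded_linear_Re this]
 show "f differentiable (at x)" by (auto simp: differentiable_def)
next
 assume "f differentiable (at x)"
 then obtain D where "(f has_derivative D) (at x)"
  by (auto simp: differentiable_def)
 from bounded_linear.has_derivative[OF bounded_linear_of_real this]
 show "(%x. cor (f x)) differentiable (at x)" by (auto simp: differentiable_def)
qed

lemma smap_differentiable: "smooth_map S ps ==> x \<in> S ==> ps differentiable (at x)"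
 unfolding smooth_map_def
 by (subst differentiable_componentwise_within)
  (use sm_differentiable of_real_differentiable_iff in blast)

lemma smap_continuous: "smooth_map S ps ==> continuous_on S ps"
 by (meson continuous_at_imp_continuous_on differentiable_imp_continuous_within
   smap_differentiable)

lemma smap_hasd:
 "smooth_map S ps ==> x \<in> S ==> (ps has_derivative fderiv ps (at x)) (at x)"
 using smap_differentiable frechet_derivative_works by blast

lemma smap_frechet_inner:
 assumes "smooth_map S ps" "x \<in> S"
 shows "cor (fderiv ps (at x) v \<bullet> b) =
  fderiv (%x. cor (ps x \<bullet> b)) (at x) v"
proof -
 have "((%x. cor (ps x \<bullet> b)) has_derivative
   (%v. cor (fderiv ps (at x) v \<bullet> b))) (at x)"
  by (rule bounded_linear.has_derivative[OF bounded_linear_of_real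
    has_derivative_inner_left[OF smap_hasd[OF assms]]])
 from fderiv_eqI[OF this] show ?thesis by simp
qed

lemma smap_subset: "smooth_map S ps ==> T \<subseteq> S ==> smooth_map T ps"
 unfolding smooth_map_def using sm_subset by blast

lemma smap_cong:
 "open S ==> (!!y. y \<in> S ==> f y = g y) ==> smooth_map S f ==> smooth_map S g"
 unfolding smooth_map_def
proof
 fix b
 assume *: "open S" "!!y. y \<in> S ==> f y = g y" "\<forall>b. smooth_on S (%x. cor (f x \<bullet> b))"
 show "smooth_on S (%x. cor (g x \<bullet> b))"
  by (rule sm_cong[of S "%x. cor (f x \<bullet> b)"]) (use * in auto)
qed

lemma smap_frechet:
 "open S ==> smooth_map S ps ==> smooth_map S (%x. fderiv ps (at x) v)"
 unfolding smooth_map_def[of _ "%x. fderiv ps (at x) v"]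
proof
 fix b assume *: "open S" "smooth_map S ps"
 have "smooth_on S (%x. fderiv (%x. cor (ps x \<bullet> b)) (at x) v)"
  using * sm_frechet unfolding smooth_map_def by blast
 thus "smooth_on S (%x. cor (fderiv ps (at x) v \<bullet> b))"
  by (rule sm_cong[rotated 2]) (use *(1) smap_frechet_inner[OF *(2)] in auto)
qed

lemma fderiv_compose_smooth:
 assumes "smooth_on T f" "smooth_map S ps" "x \<in> S" "ps x \<in> T"
 shows "fderiv (%x. f (ps x)) (at x) v =
  (\<Sum>b\<in>Basis. cor (fderiv ps (at x) v \<bullet> b) * fderiv f (at (ps x)) b)"
proof -
 let ?D = "fderiv f (at (ps x))" and ?w = "fderiv ps (at x) v"
 have D: "(f has_derivative ?D) (at (ps x))" using assms sm_hasd by blast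
 hence l: "linear ?D" by (rule has_derivative_linear)
 have "fderiv (%x. f (ps x)) (at x) v = ?D ?w"
  by (rule fderiv_eqI)
   (rule has_derivative_compose[OF smap_hasd[OF assms(2,3)] D])
 also have "... = ?D (\<Sum>b\<in>Basis. (?w \<bullet> b) *\<^sub>R b)" by (simp only: euclidean_representation)
 also have "... = (\<Sum>b\<in>Basis. (?w \<bullet> b) *\<^sub>R ?D b)" by (simp add: linear_sum[OF l] linear_scale[OF l])
 finally show ?thesis by (simp add: scaleR_conv_of_real)
qed

text \<open>By the chain rule the derivative of a composite with \<open>ps\<close> is a sum of
  composites with \<open>ps\<close>, multiplied by smooth coefficients; so the family of all
  composites is closed under differentiation up to sums and products.\<close>

theorem sm_compose:
 assumes "open S" "smooth_on T f" "smooth_map S ps" "ps ` S \<subseteq> T"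
 shows "smooth_on S (%x. f (ps x))"
proof (rule sm_upto[where F = "{%x. g (ps x) | g. smooth_on T g}"])
 fix f x assume f: "f \<in> {%x. g (ps x) | g. smooth_on T g}" and "x \<in> S"
 then obtain g where g: "f = (%x. g (ps x))" "smooth_on T g" "ps x \<in> T" using assms by auto
 show "f differentiable (at x)"
  using differentiable_chain_at[OF smap_differentiable[OF assms(3) \<open>x \<in> S\<close>]
    sm_differentiable[OF g(2,3)]] by (simp add: g o_def)
next
 let ?F = "{%x. g (ps x) | g. smooth_on T g}"
 fix f v assume f: "f \<in> ?F"
 then obtain g where g: "f = (%x. g (ps x))" "smooth_on T g" by auto
 let ?k = "%x. \<Sum>b\<in>Basis. cor (fderiv ps (at x) v \<bullet> b) *
  fderiv g (at (ps x)) b"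
 have "?k \<in> scl S ?F"
  using smap_frechet[OF assms(1,3)] sm_frechet[OF g(2)]
  by (intro scl_sum scl.mult scl.smooth scl.base) (auto simp: smooth_map_def)
 moreover have "\<forall>x\<in>S. fderiv f (at x) v = ?k x"
  using fderiv_compose_smooth[OF g(2) assms(3)] assms(4) g by auto
 ultimately show "\<exists>g\<in>scl S ?F. \<forall>x\<in>S. fderiv f (at x) v = g x"
  by (intro bexI[of _ ?k])
qed (use assms in \<open>auto intro: scl.base\<close>)

lemma sm_inverse:
 assumes "open S" "smooth_on S c" "!!x. x \<in> S ==> c x ~= 0"
 shows "smooth_on S (%x. inverse (c x))"
proof (rule sm_upto[where F = "{%x. inverse (c x)}"])
 have D: "((%x. inverse (c x)) has_derivative
   (%v. - (inverse (c x) * fderiv c (at x) v * inverse (c x)))) (at x)" if "x \<in> S" for x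
  using sm_hasd[OF assms(2) that] assms(3)[OF that]
  by (auto intro!: derivative_eq_intros)
 fix f v
 assume f: "f \<in> {%x. inverse (c x)}"
 have 1: "(%x. - 1 * (inverse (c x) * fderiv c (at x) v * inverse (c x)))
   \<in> scl S {%x. inverse (c x)}"
  by (intro scl.mult scl.base scl.smooth[OF sm_frechet] scl.smooth[OF sm_const] assms) auto
 have 2: "fderiv (%x. inverse (c x)) (at x) v =
   - 1 * (inverse (c x) * fderiv c (at x) v * inverse (c x))" if "x \<in> S" for x
  using fderiv_eqI[OF D[OF that]] by simp
 show "\<exists>g\<in>scl S {%x. inverse (c x)}. \<forall>x\<in>S. fderiv f (at x) v = g x"
  using 2 f by (intro bexI[OF _ 1]) auto
 fix x assume "x \<in> S"
 thus "f differentiable (at x)" using D f unfolding differentiable_def by blast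
qed (use assms in \<open>auto intro: scl.base\<close>)

lemma sm_exp:
 assumes "open S" "smooth_on S c"
 shows "smooth_on S (%x. exp (c x) :: complex)"
proof (rule sm_upto[where F = "{%x. exp (c x)}"])
 have D: "((%x. exp (c x)) has_derivative (%v. exp (c x) * fderiv c (at x) v)) (at x)"
  if "x \<in> S" for x
 proof -
  have "(exp has_derivative (%v. exp (c x) * v)) (at (c x))"
   using DERIV_exp[of "c x"] by (simp add: has_field_derivative_def)
  from has_derivative_compose[OF sm_hasd[OF assms(2) that] this]
  show ?thesis .
 qed
 fix f v
 assume f: "f \<in> {%x. exp (c x)}"
 have 1: "(%x. exp (c x) * fderiv c (at x) v) \<in> scl S {%x. exp (c x)}"
  by (intro scl.mult scl.base scl.smooth[OF sm_frechet] assms) auto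
 show "\<exists>g\<in>scl S {%x. exp (c x)}. \<forall>x\<in>S. fderiv f (at x) v = g x"
  using fderiv_eqI[OF D] f by (intro bexI[OF _ 1]) auto
 fix x assume "x \<in> S"
 thus "f differentiable (at x)" using D f unfolding differentiable_def by blast
qed (use assms in \<open>auto intro: scl.base\<close>)

text \<open>On the half-line containing \<open>t\<close> the power is a constant sign times
  \<open>exp (s ln (sgn t * u))\<close>. Its derivative carries the factor \<open>1/t\<close>, the
  sign of \<open>t\<close> over its modulus, which lowers the exponent and flips the sign character
  at once.\<close>

lemma sgn_powr_hasd:
 assumes "t ~= 0" "ep \<in> {1, -1}"
 shows "((%t. sgn_powr t s ep) has_derivative (%h. s * sgn_powr t (s - 1) (- ep) * of_real h)) (at t)"
proof -
 let ?S = "{u. sgn t * u > 0}"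
 have "open ?S" by (intro open_Collect_less continuous_intros)
 have t: "t \<in> ?S" using assms by (simp add: sgn_if)
 have eq: "sgn_powr u s ep = (if ep = 1 then 1 else of_real (sgn t)) * exp (s * of_real (ln (sgn t * u)))"
  if "u \<in> ?S" for u
 proof -
  have "\<bar>u\<bar> = sgn t * u" "sgn u = sgn t" using that by (auto simp: sgn_if split: if_splits)
  moreover have "cor r powr s = exp (s * of_real (ln r))" if "r > 0" for r
   using that by (simp add: powr_def Ln_of_real)
  ultimately show ?thesis using that by (simp add: sgn_powr_def del: of_real_mult)
 qed
 have "((%u. ln (sgn t * u)) has_real_derivative inverse t) (at t)"
  using t assms(1) by (auto intro!: derivative_eq_intros simp: field_simps sgn_if)
 hence "((%u. of_real (ln (sgn t * u)) :: complex) has_derivative (%h. of_real (inverse t * h))) (at t)"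
  by (intro bounded_linear.has_derivative[OF bounded_linear_of_real]) (simp add: has_field_derivative_def)
 hence 1: "((%u. s * of_real (ln (sgn t * u)) :: complex) has_derivative (%h. s * of_real (inverse t * h))) (at t)"
  by (rule has_derivative_mult_right)
 have "(exp has_derivative (%v. exp (s * of_real (ln (sgn t * t))) * v)) (at (s * of_real (ln (sgn t * t)) :: complex))"
  using DERIV_exp by (simp add: has_field_derivative_def)
 from has_derivative_mult_right[OF has_derivative_compose[OF 1 this]]
 have "((%u. (if ep = 1 then 1 else of_real (sgn t)) * exp (s * of_real (ln (sgn t * u)))) has_derivative
   (%h. (if ep = 1 then 1 else of_real (sgn t)) * (exp (s * of_real (ln (sgn t * t))) * (s * of_real (inverse t * h))))) (at t)" .
 hence "((%u. sgn_powr u s ep) has_derivative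
   (%h. (if ep = 1 then 1 else of_real (sgn t)) * (exp (s * of_real (ln (sgn t * t))) * (s * of_real (inverse t * h))))) (at t)"
  by (rule has_derivative_transform_within_open[OF _ \<open>open ?S\<close> t]) (simp add: eq)
 moreover have "(if ep = 1 then 1 else of_real (sgn t)) * (exp (s * of_real (ln (sgn t * t))) * (s * of_real (inverse t * h)))
   = s * sgn_powr t (s - 1) (- ep) * of_real h" for h
 proof -
  have "exp (of_real (ln \<bar>t\<bar>) :: complex) = of_real \<bar>t\<bar>" using assms by (simp add: exp_of_real)
  moreover have "exp (of_real (ln \<bar>t\<bar>) * (s - 1)) * exp (of_real (ln \<bar>t\<bar>)) = exp (of_real (ln \<bar>t\<bar>) * s)"
   by (simp add: algebra_simps flip: exp_add)
  ultimately have "exp (of_real (ln \<bar>t\<bar>) * (s - 1)) * of_real \<bar>t\<bar> = exp (of_real (ln \<bar>t\<bar>) * s)"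
   by simp
  hence "exp (of_real (ln \<bar>t\<bar>) * s) = of_real \<bar>t\<bar> * exp ((s - 1) * of_real (ln \<bar>t\<bar>))"
   by (simp add: mult.commute)
  moreover have "sgn t * t = \<bar>t\<bar>" by (simp add: sgn_if)
  ultimately show ?thesis using assms
   by (auto simp: sgn_powr_def powr_def Ln_of_real mult_ac sgn_if)
 qed
 ultimately show ?thesis by (simp only:)
qed

lemma sgn_powr_compose_hasd:
 assumes "(c has_derivative c') (at x)" "c x ~= 0" "ep \<in> {1, -1}"
 shows "((%x. sgn_powr (c x) s ep) has_derivative (%h. s * sgn_powr (c x) (s - 1) (- ep) * of_real (c' h))) (at x)"
 using has_derivative_compose[OF assms(1) sgn_powr_hasd[OF assms(2,3)]] .

lemma sm_sgn_powr:
 assumes "open S" and c: "smooth_on S (%x. cor (c x))" and nz: "!!x. x \<in> S ==> c x ~= 0"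
  and "ep \<in> {1, -1}"
 shows "smooth_on S (%x. sgn_powr (c x) s ep)"
\<comment> \<open>Differentiation changes both the exponent and the sign, so the generating family
  ranges over all of them.\<close>
proof (rule sm_upto[where F = "{%x. sgn_powr (c x) s ep |s ep. ep \<in> {1, -1}}"])
 let ?F = "{%x. sgn_powr (c x) s ep |s ep. ep \<in> {1, -1 :: int}}"
 have cd: "(c has_derivative fderiv c (at x)) (at x)" if "x \<in> S" for x
  using sm_differentiable[OF c that] of_real_differentiable_iff frechet_derivative_works by blast
 fix f v assume "f \<in> ?F"
 then obtain s and ep :: int where f: "f = (%x. sgn_powr (c x) s ep)" "ep \<in> {1, -1}" by blast
 have D: "(f has_derivative (%h. s * sgn_powr (c x) (s - 1) (- ep) * of_real (fderiv c (at x) h))) (at x)"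
  if "x \<in> S" for x
  unfolding f by (rule sgn_powr_compose_hasd[OF cd nz]) (use that f in auto)
 have "fderiv (%x. cor (c x)) (at x) v = of_real (fderiv c (at x) v)"
  if "x \<in> S" for x
  by (rule fderiv_eqI, rule bounded_linear.has_derivative[OF bounded_linear_of_real cd[OF that]])
 hence "\<forall>x\<in>S. fderiv f (at x) v =
  s * sgn_powr (c x) (s - 1) (- ep) * fderiv (%x. cor (c x)) (at x) v"
  using fderiv_eqI[OF D] by simp
 moreover have "(%x. s * sgn_powr (c x) (s - 1) (- ep) * fderiv (%x. cor (c x)) (at x) v) \<in> scl S ?F"
 proof (intro scl.mult)
  show "(%x. s) \<in> scl S ?F" by (intro scl.smooth sm_const)
  have "- ep \<in> {1, -1}" using f by auto
  thus "(%x. sgn_powr (c x) (s - 1) (- ep)) \<in> scl S ?F" by (intro scl.base) blast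
  show "(%x. fderiv (%x. cor (c x)) (at x) v) \<in> scl S ?F"
   by (intro scl.smooth sm_frechet c)
 qed
 ultimately show "\<exists>g\<in>scl S ?F. \<forall>x\<in>S. fderiv f (at x) v = g x"
  by (intro bexI[of _ "%x. s * sgn_powr (c x) (s - 1) (- ep) * fderiv (%x. cor (c x)) (at x) v"])
 fix x assume "x \<in> S"
 thus "f differentiable (at x)" using D unfolding differentiable_def by blast
next
 show "(%x. sgn_powr (c x) s ep) \<in> scl S {%x. sgn_powr (c x) s ep |s ep. ep \<in> {1, -1 :: int}}"
  using assms(4) by (intro scl.base) blast
qed (use assms in auto)

lemma dd_add:
 assumes "open S" "smooth_on S f" "smooth_on S g" "x \<in> S"
 shows "dd vs (%x. f x + g x) x = dd vs f x + dd vs g x"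
 using assms(4)
proof (induction vs arbitrary: x)
 case (Cons v vs)
 have "fderiv (dd vs (%x. f x + g x)) (at x) v =
   fderiv (%x. dd vs f x + dd vs g x) (at x) v"
  using fderiv_cong_open[OF assms(1) Cons.prems, of "dd vs (%x. f x + g x)"
    "%x. dd vs f x + dd vs g x"] Cons.IH by simp
 also have "... = fderiv (dd vs f) (at x) v + fderiv (dd vs g) (at x) v"
  by (rule fderiv_eqI)
   (intro has_derivative_add sm_hasd[OF sm_dir_deriv[OF assms(2)] Cons.prems]
    sm_hasd[OF sm_dir_deriv[OF assms(3)] Cons.prems])
 finally show ?case by simp
qed simp

lemma dd_cmult:
 assumes "open S" "smooth_on S f" "x \<in> S"
 shows "dd vs (%x. c * f x) x = c * dd vs f x"
 using assms(3)
proof (induction vs arbitrary: x)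
 case (Cons v vs)
 have "fderiv (dd vs (%x. c * f x)) (at x) v =
   fderiv (%x. c * dd vs f x) (at x) v"
  using fderiv_cong_open[OF assms(1) Cons.prems, of "dd vs (%x. c * f x)"
    "%x. c * dd vs f x"] Cons.IH by simp
 also have "... = c * fderiv (dd vs f) (at x) v"
  by (rule fderiv_eqI)
   (intro has_derivative_mult_right sm_hasd[OF sm_dir_deriv[OF assms(2)] Cons.prems])
 finally show ?case by simp
qed simp

lemma dd_zero: "dd vs (%x. 0) = (%x. 0)"
 by (induction vs) auto

lemma dd_sum:
 assumes "open S" "!!i. i \<in> I ==> smooth_on S (f i)" "x \<in> S"
 shows "dd vs (%x. \<Sum>i\<in>I. f i x) x = (\<Sum>i\<in>I. dd vs (f i) x)"
 using assms(2)
 by (induction I rule: infinite_finite_induct)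
  (simp_all add: dd_zero dd_add[OF assms(1) _ sm_sum assms(3)] assms(1))

lemma sm_linear_deriv:
 assumes "smooth_on S f" "x \<in> S"
 shows "linear (fderiv f (at x))"
 using sm_hasd[OF assms] has_derivative_linear by blast

lemma dd_affine:
 assumes "open S" "smooth_on S f" "bounded_linear A" "a + A x \<in> S"
 shows "dd vs (%x. f (a + A x)) x = dd (map A vs) f (a + A x)"
 using assms(4)
proof (induction vs arbitrary: x)
 case (Cons v vs)
 let ?T = "{x. a + A x \<in> S}"
 have "continuous_on UNIV (%x. a + A x)"
  by (intro continuous_intros linear_continuous_on assms)
 hence o: "open ?T" using assms(1) open_vimage[of S "%x. a + A x"] by (simp add: vimage_def)
 have "fderiv (dd vs (%x. f (a + A x))) (at x) v =
   fderiv (%x. dd (map A vs) f (a + A x)) (at x) v"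
  using fderiv_cong_open[OF o, of x "dd vs (%x. f (a + A x))"
    "%x. dd (map A vs) f (a + A x)"] Cons by auto
 also have "... = fderiv (dd (map A vs) f) (at (a + A x)) (A v)"
 proof (rule fderiv_eqI)
  have "((%x. a + A x) has_derivative A) (at x)"
   using has_derivative_add[OF has_derivative_const bounded_linear_imp_has_derivative[OF assms(3)]]
   by simp
  from has_derivative_compose[OF this sm_hasd[OF sm_dir_deriv[OF assms(2)] Cons.prems]]
  show "((%x. dd (map A vs) f (a + A x)) has_derivative
   (%v. fderiv (dd (map A vs) f) (at (a + A x)) (A v))) (at x)" .
 qed
 finally show ?case by simp
qed simp

lemma sm_affine:
 assumes "open S" "smooth_on S f" "bounded_linear A"
 shows "smooth_on {x. a + A x \<in> S} (%x. f (a + A x))"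
 unfolding sm_altdef
proof (intro allI ballI)
 fix vs x assume x: "x \<in> {x. a + A x \<in> S}"
 let ?T = "{x. a + A x \<in> S}"
 have "continuous_on UNIV (%x. a + A x)"
  by (intro continuous_intros linear_continuous_on assms)
 hence o: "open ?T" using assms(1) open_vimage[of S "%x. a + A x"] by (simp add: vimage_def)
 have "((%x. a + A x) has_derivative A) (at x)"
  using has_derivative_add[OF has_derivative_const bounded_linear_imp_has_derivative[OF assms(3)]]
  by simp
 from has_derivative_compose[OF this sm_hasd[OF sm_dir_deriv[OF assms(2)]]] x
 have "(%x. dd (map A vs) f (a + A x)) differentiable (at x)"
  unfolding differentiable_def by blast
 thus "dd vs (%x. f (a + A x)) differentiable (at x)"
  by (rule differentiable_cong_open[OF o x, rotated]) (use dd_affine[OF assms(1,2,3)] in auto)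
qed

text \<open>The increment in direction \<open>v\<close> is the integral of \<open>dd [v] f\<close>.
  Differentiating it under the integral sign along \<open>u\<close>, and then in the upper limit at
  \<open>0\<close>, gives one order of derivatives; differentiating the increment directly gives the
  other.\<close>

lemma dd_swap:
 assumes "open S" "smooth_on S f" "x \<in> S"
 shows "dd [u, v] f x = dd [v, u] f x"
proof -
 let ?p = "%s t. x + (s *\<^sub>R u + t *\<^sub>R v)"
 have "continuous_on UNIV (%w. ?p (fst w) (snd w))" by (intro continuous_intros)
 from open_vimage[OF assms(1) this]
 obtain e where e: "e > 0" "ball (0, 0) e \<subseteq> (%w. ?p (fst w) (snd w)) -` S"
  by (rule openE[of _ "(0, 0)"]) (simp add: assms(3), rule that)
 \<comment> \<open>A third of the radius keeps the square of side \<open>d\<close> inside the ball,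
   since its points have norm at most \<open>2 * e / 3\<close>.\<close>
 define d where "d = e / 3"
 have d: "d > 0" using e by (simp add: d_def)
 have pS: "?p s t \<in> S" if "s \<in> {0..d}" "t \<in> {0..d}" for s t
 proof -
  have "norm (s, t) \<le> \<bar>s\<bar> + \<bar>t\<bar>" using sqrt_sum_squares_le_sum_abs by (simp add: norm_Pair)
  also have "... < e" using that e by (auto simp: d_def)
  finally have "(s, t) \<in> ball (0, 0) e" by (simp add: dist_norm norm_Pair)
  thus ?thesis using e(2) by auto
 qed
 note fd = sm_hasd[OF sm_dir_deriv[OF assms(2)] pS]
 have D: "((%s. dd ws f (?p s t)) has_vector_derivative dd (u # ws) f (?p s t)) (at s within A)"
  "((%t. dd ws f (?p s t)) has_vector_derivative dd (v # ws) f (?p s t)) (at t within A)"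
  if st: "s \<in> {0..d}" "t \<in> {0..d}" for s t ws A
 proof -
  have 1: "((%s. ?p s t) has_derivative (%h. h *\<^sub>R u)) (at s within A)"
   "((%t. ?p s t) has_derivative (%h. h *\<^sub>R v)) (at t within A)" by (auto intro!: derivative_eq_intros)
  show "((%s. dd ws f (?p s t)) has_vector_derivative dd (u # ws) f (?p s t)) (at s within A)"
   "((%t. dd ws f (?p s t)) has_vector_derivative dd (v # ws) f (?p s t)) (at t within A)"
   using has_derivative_compose[OF 1(1) fd[OF st]] has_derivative_compose[OF 1(2) fd[OF st]]
    linear_scale[OF has_derivative_linear[OF fd[OF st]]] by (simp_all add: has_vector_derivative_def)
 qed
 have cont: "continuous_on A (%w. dd ws f (?p (fst w) (snd w)))" if "A \<subseteq> {0..d} \<times> {0..d}" for A ws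
  by (rule continuous_on_compose2[OF sm_continuous[OF sm_dir_deriv[OF assms(2)]]])
   (use that pS in \<open>force intro!: continuous_intros\<close>)+
 have FTC: "((%\<tau>. dd [v] f (?p s \<tau>)) has_integral f (?p s t) - f (?p s 0)) {0..t}"
  if "s \<in> {0..d}" "t \<in> {0..d}" for s t
  using that D(2)[where ws = "[]"] by (intro fundamental_theorem_of_calculus) auto
 have int: "integral {0..t} (%\<tau>. dd [u, v] f (?p 0 \<tau>)) = dd [u] f (?p 0 t) - dd [u] f (?p 0 0)"
  if t: "t \<in> {0..d}" for t
 proof -
  have "((%s. integral (cbox 0 t) (%\<tau>. dd [v] f (?p s \<tau>))) has_vector_derivative
   integral (cbox 0 t) (%\<tau>. dd [u, v] f (?p 0 \<tau>))) (at 0 within {0..d})"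
  proof (rule leibniz_rule_vector_derivative)
   show "continuous_on ({0..d} \<times> cbox 0 t) (%(s, \<tau>). dd [u, v] f (?p s \<tau>))"
    unfolding case_prod_unfold by (rule cont) (use t in auto)
  qed (use t d D(1)[where ws = "[v]"] in \<open>auto intro!: has_integral_integrable[OF FTC] simp del: dir_deriv.simps\<close>)
  hence "((%s. f (?p s t) - f (?p s 0)) has_vector_derivative
   integral (cbox 0 t) (%\<tau>. dd [u, v] f (?p 0 \<tau>))) (at 0 within {0..d})"
   by (rule has_vector_derivative_transform[rotated 2]) (use integral_unique[OF FTC] t d in auto)
  moreover have "((%s. f (?p s t) - f (?p s 0)) has_vector_derivative
   dd [u] f (?p 0 t) - dd [u] f (?p 0 0)) (at 0 within {0..d})"
   by (intro has_vector_derivative_diff) (use D(1)[of 0 t "[]"] D(1)[of 0 0 "[]"] t d in auto)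
  ultimately show ?thesis using vector_derivative_unique_within_closed_interval[of 0 d 0] d by auto
 qed
 have "((%t. integral {0..t} (%\<tau>. dd [u, v] f (?p 0 \<tau>))) has_vector_derivative dd [u, v] f (?p 0 0)) (at 0 within {0..d})"
 proof (rule integral_has_vector_derivative)
  have "continuous_on {0..d} (%\<tau>. (%w. dd [u, v] f (?p (fst w) (snd w))) (0, \<tau>))"
   by (rule continuous_on_compose2[OF cont[of "{0..d} \<times> {0..d}"]]) (use d in \<open>auto intro!: continuous_intros\<close>)
  thus "continuous_on {0..d} (%\<tau>. dd [u, v] f (?p 0 \<tau>))" by simp
 qed (use d in simp)
 hence "((%t. dd [u] f (?p 0 t) - dd [u] f (?p 0 0)) has_vector_derivative dd [u, v] f (?p 0 0)) (at 0 within {0..d})"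
  by (rule has_vector_derivative_transform[rotated 2]) (use int d in auto)
 moreover have "((%t. dd [u] f (?p 0 t) - dd [u] f (?p 0 0)) has_vector_derivative dd [v, u] f (?p 0 0) - 0) (at 0 within {0..d})"
  by (intro has_vector_derivative_diff has_vector_derivative_const D(2)) (use d in auto)
 ultimately show ?thesis using vector_derivative_unique_within_closed_interval[of 0 d 0] d by auto
qed

lemma dd_perm:
 assumes "open S" "smooth_on S f" "x \<in> S" "mset us = mset vs"
 shows "dd us f x = dd vs f x"
proof -
 have move: "dd (v # ws @ zs) f y = dd (ws @ v # zs) f y" if "y \<in> S" for v ws zs y
  using that
 proof (induction ws arbitrary: y)
  case (Cons w ws)
  have "dd (v # w # ws @ zs) f y = dd [v, w] (dd (ws @ zs) f) y" by simp
  also have "... = dd [w, v] (dd (ws @ zs) f) y"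
   by (rule dd_swap[OF assms(1) sm_dir_deriv[OF assms(2)] Cons.prems])
  also have "... = dd [w] (dd (v # ws @ zs) f) y" by simp
  also have "... = dd [w] (dd (ws @ v # zs) f) y"
   by (rule dd_cong[OF assms(1) _ Cons.prems]) (rule Cons.IH)
  finally show ?case by simp
 qed simp
 show ?thesis using assms(3,4)
 proof (induction us arbitrary: vs x)
  case (Cons u us)
  from Cons.prems(2) have "u \<in> set vs" by (metis list.set_intros(1) mset_eq_setD)
  then obtain ws zs where vs: "vs = ws @ u # zs" by (meson split_list)
  hence m: "mset us = mset (ws @ zs)" using Cons.prems(2) by simp
  have "dd (u # us) f x = dd [u] (dd us f) x" by simp
  also have "... = dd [u] (dd (ws @ zs) f) x"
   by (rule dd_cong[OF assms(1) _ Cons.prems(1)]) (rule Cons.IH[OF _ m])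
  also have "... = dd (u # ws @ zs) f x" by simp
  also have "... = dd vs f x" unfolding vs by (rule move[OF Cons.prems(1)])
  finally show ?case .
 qed simp
qed

section \<open>Differential operators and exponentials\<close>

lemma words_Suc_sum:
 assumes "finite A"
 shows "(\<Sum>u | set u \<subseteq> A & length u = Suc m. g u) =
  (\<Sum>b\<in>A. \<Sum>u | set u \<subseteq> A & length u = m. g (b # u))"
proof -
 let ?W = "%m. {u. set u \<subseteq> A & length u = m}"
 have "?W (Suc m) = (%(b, u). b # u) ` (A \<times> ?W m)"
  by (auto simp: image_iff length_Suc_conv)
 moreover have "inj_on (%(b, u). b # u) (A \<times> ?W m)" by (auto simp: inj_on_def)
 ultimately have "sum g (?W (Suc m)) = (\<Sum>(b, u)\<in>A \<times> ?W m. g (b # u))"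
  by (simp add: sum.reindex o_def case_prod_unfold)
 thus ?thesis by (simp add: sum.cartesian_product)
qed

text \<open>The coefficient of the basis word \<open>u\<close> when the derivative along the word
  \<open>ws\<close> is expanded multilinearly.\<close>

definition wcoef :: "'b::euclidean_space list => 'b list => real" where
 "wcoef ws u = prod_list (map2 (\<bullet>) ws u)"

lemma wcoef_Cons [simp]: "wcoef (w # ws) (b # u) = (w \<bullet> b) * wcoef ws u"
 by (simp add: wcoef_def)

definition bwords :: "nat => 'b::euclidean_space list set" where
 "bwords m = {u. set u \<subseteq> Basis & length u = m}"

lemma finite_bwords [simp]: "finite (bwords m)"
 unfolding bwords_def by (rule finite_lists_length_eq) simp

lemma dd_expand:
 assumes "open S" "smooth_on S f" "x \<in> S"
 shows "dd ws f x = (\<Sum>u\<in>bwords (length ws). of_real (wcoef ws u) * dd u f x)"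
 using assms(3)
proof (induction ws arbitrary: x)
 case Nil
 have "bwords 0 = {[] :: 'a list}" by (auto simp: bwords_def)
 thus ?case by (simp add: wcoef_def)
next
 case (Cons w ws)
 let ?g = "%u. dd u f"
 have "fderiv (dd ws f) (at x) w = fderiv
   (%x. \<Sum>u\<in>bwords (length ws). of_real (wcoef ws u) * ?g u x) (at x) w"
  by (rule arg_cong[of _ _ "%D. D w"], rule fderiv_cong_open[OF assms(1) Cons.prems])
   (rule Cons.IH)
 also have "... = (\<Sum>u\<in>bwords (length ws). of_real (wcoef ws u) * fderiv (?g u) (at x) w)"
  by (rule fderiv_eqI, intro has_derivative_sum has_derivative_mult_right
    sm_hasd[OF sm_dir_deriv[OF assms(2)] Cons.prems])
 also have "... = (\<Sum>u\<in>bwords (length ws). \<Sum>b\<in>Basis. of_real (wcoef (w # ws) (b # u)) * dd (b # u) f x)"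
 proof (rule sum.cong[OF refl])
  fix u
  have l: "linear (fderiv (?g u) (at x))"
   by (rule sm_linear_deriv[OF sm_dir_deriv[OF assms(2)] Cons.prems])
  have "fderiv (?g u) (at x) w = fderiv (?g u) (at x) (\<Sum>b\<in>Basis. (w \<bullet> b) *\<^sub>R b)"
   by (simp only: euclidean_representation)
  also have "... = (\<Sum>b\<in>Basis. of_real (w \<bullet> b) * fderiv (?g u) (at x) b)"
   by (simp add: linear_sum[OF l] linear_scale[OF l] scaleR_conv_of_real)
  finally show "of_real (wcoef ws u) * fderiv (?g u) (at x) w =
   (\<Sum>b\<in>Basis. of_real (wcoef (w # ws) (b # u)) * dd (b # u) f x)"
   by (simp add: sum_distrib_left mult_ac)
 qed
 also have "... = (\<Sum>u\<in>bwords (length (w # ws)). of_real (wcoef (w # ws) u) * dd u f x)"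
  unfolding bwords_def length_Cons by (subst words_Suc_sum[OF finite_Basis]) (rule sum.swap)
 finally show ?case by simp
qed

lemma prod_list_expand:
 fixes th :: "'b::euclidean_space"
 shows "(\<Prod>w\<leftarrow>ws. c * cor (w \<bullet> th)) =
  (\<Sum>u\<in>bwords (length ws). of_real (wcoef ws u) * (\<Prod>b\<leftarrow>u. c * of_real (b \<bullet> th)))"
proof (induction ws)
 case Nil
 have "bwords 0 = {[]::'b list}" by (auto simp: bwords_def)
 thus ?case by (simp add: wcoef_def)
next
 case (Cons w ws)
 have "cor (w \<bullet> th) = (\<Sum>b\<in>Basis. of_real (w \<bullet> b) * of_real (b \<bullet> th))"
  by (subst euclidean_inner) (simp add: inner_commute)
 hence "(\<Prod>w\<leftarrow>w # ws. c * cor (w \<bullet> th)) =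
   (\<Sum>u\<in>bwords (length ws). \<Sum>b\<in>Basis. of_real (wcoef (w # ws) (b # u)) * (\<Prod>b\<leftarrow>b # u. c * of_real (b \<bullet> th)))"
  by (simp add: Cons.IH sum_distrib_left sum_distrib_right mult_ac)
 also have "... = (\<Sum>u\<in>bwords (length (w # ws)). of_real (wcoef (w # ws) u) * (\<Prod>b\<leftarrow>u. c * of_real (b \<bullet> th)))"
  unfolding bwords_def length_Cons by (subst words_Suc_sum[OF finite_Basis]) (rule sum.swap)
 finally show ?case .
qed

lemma poly_vanish_real:
 fixes a :: "nat => complex"
 assumes "c ~= 0" "!!s::real. (\<Sum>k\<le>n. (c * of_real s) ^ k * a k) = 0" "k \<le> n"
 shows "a k = 0"
proof -
 define p where "p = (\<Sum>k\<le>n. monom (c ^ k * a k) k)"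
 have "poly p (of_real s) = 0" for s :: real
  using assms(2)[of s] by (simp add: p_def poly_sum poly_monom power_mult_distrib mult_ac)
 hence "range cor \<subseteq> {z. poly p z = 0}" by auto
 moreover have "infinite (range cor)"
  using finite_imageD[of cor UNIV] infinite_UNIV_char_0[where 'a = real] by (auto simp: inj_def)
 ultimately have "p = 0" using poly_roots_finite finite_subset by blast
 hence "coeff p k = 0" by simp
 moreover have "coeff p k = c ^ k * a k" using assms(3) by (simp add: p_def coeff_sum)
 ultimately show ?thesis using assms(1) by simp
qed

text \<open>Induction on the set of letters. Words count as commutative monomials by
  \<open>dd_perm\<close>; grouping them by the number of occurrences of \<open>b\<close> makes the
  symbol a polynomial in the \<open>b\<close>-coordinate of \<open>th\<close>, whose coefficients
  vanish and are symbols in the remaining letters. The derivatives along \<open>b\<close> are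
  absorbed into \<open>f\<close>, which is why \<open>f\<close> varies in the induction.\<close>

lemma symbol_zero_basis:
 fixes z :: "'b::euclidean_space"
 assumes "finite B" "open S" "z \<in> S" "c ~= (0::complex)"
 shows "B \<subseteq> Basis ==> finite I ==> (!!i. i \<in> I ==> set (w i) \<subseteq> B) ==>
  (!!th. (\<Sum>i\<in>I. a i * (\<Prod>b\<leftarrow>w i. c * cor (b \<bullet> th))) = 0) ==>
  smooth_on S f ==> (\<Sum>i\<in>(I :: 'i set). a i * dd (w i) f z) = 0"
 using assms(1)
proof (induction B arbitrary: I a w f rule: finite_induct)
 case empty
 hence "!!i. i \<in> I ==> w i = []" by auto
 hence "(\<Sum>i\<in>I. a i * dd (w i) f z) = (\<Sum>i\<in>I. a i) * f z"
  by (simp add: sum_distrib_right cong: sum.cong)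
 also have "(\<Sum>i\<in>I. a i) = 0"
  using empty(4)[of 0] \<open>!!i. i \<in> I ==> w i = []\<close> by (simp cong: sum.cong)
 finally show ?case by simp
next
 case (insert b B)
 define ct where "ct i = count_list (w i) b" for i
 define w' where "w' i = filter (%x. x ~= b) (w i)" for i
 define N where "N = Max (insert 0 (ct ` I))"
 have N: "ct i \<le> N" if "i \<in> I" for i unfolding N_def using insert.prems(2) that by (intro Max_ge) auto
 have mw: "mset (w i) = mset (w' i @ replicate (ct i) b)" for i
  unfolding w'_def ct_def
  by (rule multiset_eqI) (auto simp: count_mset count_list_eq_length_filter)
 have pr: "(\<Prod>b\<leftarrow>w i. g b) = (\<Prod>b\<leftarrow>w' i. g b) * g b ^ ct i" for i and g :: "'b => complex"
 proof -
  have "(\<Prod>b\<leftarrow>w i. g b) = (\<Prod>b\<in>#mset (w i). g b)" by (metis mset_map prod_mset_prod_list)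
  also have "... = (\<Prod>b\<leftarrow>w' i @ replicate (ct i) b. g b)" unfolding mw by (metis mset_map prod_mset_prod_list)
  finally show ?thesis by (simp add: prod_list_replicate)
 qed
 have w'B: "set (w' i) \<subseteq> B" if "i \<in> I" for i using insert.prems(3)[OF that] by (auto simp: w'_def)
 have bB: "b \<in> Basis" "B \<subseteq> Basis" using insert.prems by auto
 have split: "(\<Sum>i\<in>I. F i) = (\<Sum>k\<le>N. \<Sum>i | i \<in> I & ct i = k. F i)" for F :: "'i => complex"
 proof -
  have "ct ` I \<subseteq> {..N}" using N by auto
  from sum.group[OF insert.prems(2) finite_atMost this, of F] show ?thesis by simp
 qed
 have sk: "(\<Sum>i | i \<in> I & ct i = k. a i * (\<Prod>b\<leftarrow>w' i. c * cor (b \<bullet> th))) = 0" if "k \<le> N" for k th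
 proof (rule poly_vanish_real[OF assms(4) _ that])
  fix s :: real
  define th' where "th' = th + (s - th \<bullet> b) *\<^sub>R b"
  have "th' \<bullet> b = s" using bB by (simp add: th'_def inner_add_left)
  hence b1: "b \<bullet> th' = s" by (metis inner_commute)
  have b2: "b' \<bullet> th' = b' \<bullet> th" if "b' \<in> B" for b'
  proof -
   have "b' ~= b" "b' \<in> Basis" using that insert.hyps bB by auto
   thus ?thesis using bB by (simp add: th'_def inner_add_right inner_not_same_Basis)
  qed
  have p2: "(\<Prod>b\<leftarrow>w' i. c * cor (b \<bullet> th')) = (\<Prod>b\<leftarrow>w' i. c * cor (b \<bullet> th))" if "i \<in> I" for i
   using w'B[OF that] b2 by (intro arg_cong[of _ _ prod_list] map_cong) auto
  have "0 = (\<Sum>i\<in>I. a i * (\<Prod>b\<leftarrow>w i. c * cor (b \<bullet> th')))" using insert.prems(4) by simp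
  also have "... = (\<Sum>i\<in>I. (c * of_real s) ^ ct i * (a i * (\<Prod>b\<leftarrow>w' i. c * cor (b \<bullet> th))))"
   by (intro sum.cong refl) (simp add: pr p2 b1 mult_ac)
  also have "... = (\<Sum>k\<le>N. \<Sum>i | i \<in> I & ct i = k. (c * of_real s) ^ ct i * (a i * (\<Prod>b\<leftarrow>w' i. c * cor (b \<bullet> th))))"
   by (rule split)
  also have "... = (\<Sum>k\<le>N. (c * of_real s) ^ k * (\<Sum>i | i \<in> I & ct i = k. a i * (\<Prod>b\<leftarrow>w' i. c * cor (b \<bullet> th))))"
   by (intro sum.cong refl) (auto simp: sum_distrib_left)
  finally show "(\<Sum>k\<le>N. (c * of_real s) ^ k * (\<Sum>i | i \<in> I & ct i = k. a i * (\<Prod>b\<leftarrow>w' i. c * cor (b \<bullet> th)))) = 0" ..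
 qed
 have "(\<Sum>i\<in>I. a i * dd (w i) f z) = (\<Sum>i\<in>I. a i * dd (w' i) (dd (replicate (ct i) b) f) z)"
  using dd_perm[OF assms(2) insert.prems(5) assms(3) mw] by (simp add: dd_append)
 also have "... = (\<Sum>k\<le>N. \<Sum>i | i \<in> I & ct i = k. a i * dd (w' i) (dd (replicate (ct i) b) f) z)"
  by (rule split)
 also have "... = (\<Sum>k\<le>N. \<Sum>i | i \<in> I & ct i = k. a i * dd (w' i) (dd (replicate k b) f) z)"
  by (intro sum.cong refl) auto
 also have "... = (\<Sum>k\<le>N. 0)"
  by (intro sum.cong refl insert.IH bB sm_dir_deriv insert.prems(5) sk)
   (use insert.prems(2) w'B in auto)
 finally show ?case by simp
qed

text \<open>Expanding every word in the basis turns operator and symbol into the same combination of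
  basis words.\<close>

theorem symbol_zero_imp_zero:
 fixes z :: "'b::euclidean_space"
 assumes "open S" "z \<in> S" "c ~= (0::complex)" "smooth_on S f"
  and "!!th. (\<Sum>(p, ws)\<leftarrow>T. p * (\<Prod>w\<leftarrow>ws. c * cor (w \<bullet> th))) = 0"
 shows "(\<Sum>(p, ws)\<leftarrow>T. p * dd ws f z) = 0"
proof -
 let ?I = "Sigma {..<length T} (%i. bwords (length (snd (T ! i))) :: 'b list set)"
 have conv: "(\<Sum>(p, ws)\<leftarrow>T. p * F ws) = (\<Sum>i<length T. fst (T ! i) * F (snd (T ! i)))" for F :: "'b list => complex"
  by (simp add: sum_list_sum_nth case_prod_unfold lessThan_atLeast0)
 have "(\<Sum>(p, ws)\<leftarrow>T. p * dd ws f z) =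
   (\<Sum>i<length T. fst (T ! i) * (\<Sum>u\<in>bwords (length (snd (T ! i))). of_real (wcoef (snd (T ! i)) u) * dd u f z))"
  unfolding conv dd_expand[OF assms(1,4,2), symmetric] ..
 also have "... = (\<Sum>(i, u)\<in>?I. (fst (T ! i) * of_real (wcoef (snd (T ! i)) u)) * dd u f z)"
  by (subst sum.Sigma[symmetric]) (auto simp: sum_distrib_left mult_ac)
 also have "... = (\<Sum>iu\<in>?I. (fst (T ! fst iu) * of_real (wcoef (snd (T ! fst iu)) (snd iu))) * dd (snd iu) f z)"
  by (simp add: case_prod_unfold)
 also have "... = 0"
 proof (rule symbol_zero_basis[where B = Basis and S = S and c = c])
  fix th :: 'b
  have "(\<Sum>iu\<in>?I. (fst (T ! fst iu) * of_real (wcoef (snd (T ! fst iu)) (snd iu))) * (\<Prod>b\<leftarrow>snd iu. c * cor (b \<bullet> th)))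
   = (\<Sum>(i, u)\<in>?I. (fst (T ! i) * of_real (wcoef (snd (T ! i)) u)) * (\<Prod>b\<leftarrow>u. c * cor (b \<bullet> th)))"
   by (simp add: case_prod_unfold)
  also have "... = (\<Sum>i<length T. fst (T ! i) * (\<Sum>u\<in>bwords (length (snd (T ! i))).
    of_real (wcoef (snd (T ! i)) u) * (\<Prod>b\<leftarrow>u. c * cor (b \<bullet> th))))"
   by (subst sum.Sigma[symmetric]) (auto simp: sum_distrib_left mult_ac)
  also have "... = (\<Sum>(p, ws)\<leftarrow>T. p * (\<Prod>w\<leftarrow>ws. c * cor (w \<bullet> th)))"
   unfolding conv prod_list_expand[symmetric] ..
  finally show "(\<Sum>iu\<in>?I. (fst (T ! fst iu) * of_real (wcoef (snd (T ! fst iu)) (snd iu))) * (\<Prod>b\<leftarrow>snd iu. c * cor (b \<bullet> th))) = 0"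
   using assms(5) by simp
 next
  show "finite ?I" by (intro finite_SigmaI) auto
 qed (use assms in \<open>auto simp: bwords_def\<close>)
 finally show ?thesis .
qed

section \<open>Exponentials and operators that act as differential operators on germs\<close>

lemma bounded_linear_inner_complex: "bounded_linear (%z. cor (z \<bullet> th))"
 by (intro bounded_linear_compose[OF bounded_linear_of_real] bounded_linear_inner_left)

lemma sm_expc: "smooth_on UNIV (%z. exp (c * cor (z \<bullet> th)))"
 by (intro sm_exp open_UNIV sm_mult[OF open_UNIV sm_const
    sm_bounded_linear[OF open_UNIV bounded_linear_inner_complex]])

lemma dd_expc:
 "dd ws (%z. exp (c * cor (z \<bullet> th))) =
  (%z. (\<Prod>w\<leftarrow>ws. c * of_real (w \<bullet> th)) * exp (c * of_real (z \<bullet> th)))"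
proof (induction ws)
 case (Cons w ws)
 let ?P = "(\<Prod>w\<leftarrow>ws. c * of_real (w \<bullet> th))"
 have "((%z. ?P * exp (c * of_real (z \<bullet> th))) has_derivative
   (%h. ?P * (exp (c * of_real (z \<bullet> th)) * (c * of_real (h \<bullet> th))))) (at z)" for z
 proof -
  have "((%z. c * cor (z \<bullet> th)) has_derivative (%h. c * of_real (h \<bullet> th))) (at z)"
   by (intro has_derivative_mult_right bounded_linear_imp_has_derivative bounded_linear_inner_complex)
  moreover have "(exp has_derivative (%v. exp (c * of_real (z \<bullet> th)) * v)) (at (c * cor (z \<bullet> th)))"
   using DERIV_exp by (simp add: has_field_derivative_def)
  ultimately show ?thesis using has_derivative_mult_right[OF has_derivative_compose] by blast
 qed
 from fderiv_eqI[OF this] show ?case by (simp add: Cons.IH mult_ac fun_eq_iff)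
qed simp

text \<open>Agreement with \<open>diff_op T\<close> is demanded only for functions smooth near the
  point. On arbitrary functions a composite of differential operators need not be one; this form is
  closed under composition, multiplication by smooth functions and affine substitution.\<close>

definition ldo_by :: "(('b::euclidean_space => complex) \<times> 'b list) list => (('b => complex) => 'b => complex) => bool" where
 "ldo_by T A \<longleftrightarrow> (\<forall>(p, vs)\<in>set T. smooth_on UNIV p) &
   (\<forall>S f x. open S --> smooth_on S f --> x \<in> S --> A f x = diff_op T f x)"

definition ldo :: "(('b::euclidean_space => complex) => 'b => complex) => bool" where
 "ldo A \<longleftrightarrow> (\<exists>T. ldo_by T A)"

lemma ldo_byD: "ldo_by T A ==> (p, vs) \<in> set T ==> smooth_on UNIV p"
 "ldo_by T A ==> open S ==> smooth_on S f ==> x \<in> S ==> A f x = diff_op T f x"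
 unfolding ldo_by_def by blast+

lemma ldoI:
 assumes "!!p vs. (p, vs) \<in> set T ==> smooth_on UNIV p"
  "!!S f x. open S ==> smooth_on S f ==> x \<in> S ==> A f x = diff_op T f x"
 shows "ldo A"
 unfolding ldo_def ldo_by_def using assms by blast

lemma ldo_poly: "poly_diff_op A ==> ldo A"
 unfolding poly_diff_op_def ldo_def ldo_by_def using sm_poly by fast

lemma ldo_dir_deriv: "ldo (dd vs)"
 by (rule ldoI[of "[(%_. 1, vs)]"]) (auto simp: diff_op_def)

lemma ldo_id: "ldo (%f. f)"
 by (rule ldoI[of "[(%_. 1, [])]"]) (auto simp: diff_op_def)

lemma ldo_add:
 assumes "ldo A" "ldo B" shows "ldo (%f x. A f x + B f x)"
proof -
 obtain T where "ldo_by T A" using assms(1) unfolding ldo_def by blast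
 note T = ldo_byD[OF this]
 obtain T' where "ldo_by T' B" using assms(2) unfolding ldo_def by blast
 note T' = ldo_byD[OF this]
 show ?thesis using T T' by (intro ldoI[of "T @ T'"]) (auto simp: diff_op_def)
qed

lemma ldo_mult:
 assumes "smooth_on UNIV q" "ldo A" shows "ldo (%f x. q x * A f x)"
proof -
 obtain T where "ldo_by T A" using assms(2) unfolding ldo_def by blast
 note T = ldo_byD[OF this]
 have "q x * diff_op T f x = diff_op (map (%(p, vs). (%x. q x * p x, vs)) T) f x" for f x
  unfolding diff_op_def by (induction T) (auto simp: algebra_simps)
 thus ?thesis using T assms
  by (intro ldoI[of "map (%(p, vs). (%x. q x * p x, vs)) T"]) (auto intro: sm_mult)
qed

lemma ldo_sum:
 assumes "!!i. i \<in> I ==> ldo (A i)" shows "ldo (%f x. \<Sum>i\<in>I. A i f x)"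
 using assms
proof (induction I rule: infinite_finite_induct)
 case (insert i I)
 thus ?case using ldo_add[of "A i" "%f x. \<Sum>i\<in>I. A i f x"] by simp
qed (auto intro: ldoI[of "[]"] simp: diff_op_def)

lemma ldo_smooth:
 assumes "ldo A" "open S" "smooth_on S f" shows "smooth_on S (A f)"
proof -
 obtain T where "ldo_by T A" using assms(1) unfolding ldo_def by blast
 note T = ldo_byD[OF this]
 have "smooth_on S (%x. \<Sum>(p, vs)\<leftarrow>T. p x * dd vs f x)"
  unfolding case_prod_unfold using T(1) assms
  by (intro sm_sum_list sm_mult sm_dir_deriv sm_subset[of UNIV "fst _" S]) force+
 thus ?thesis
  by (rule sm_cong[OF assms(2), rotated]) (use T(2)[OF assms(2,3)] in \<open>auto simp: diff_op_def\<close>)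
qed

lemma ldo_cong:
 assumes "ldo A" "open S" "smooth_on S f" "!!y. y \<in> S ==> f y = g y" "x \<in> S"
 shows "A f x = A g x"
proof -
 obtain T where "ldo_by T A" using assms(1) unfolding ldo_def by blast
 note T = ldo_byD(2)[OF this]
 have "smooth_on S g" using sm_cong[OF assms(2,4,3)] .
 moreover have "diff_op T f x = diff_op T g x"
  unfolding diff_op_def using dd_cong[OF assms(2,4,5)] by simp
 ultimately show ?thesis using T[OF assms(2)] assms by metis
qed

lemma ldo_frechet:
 assumes "ldo A" shows "ldo (%f x. fderiv (A f) (at x) v)"
proof -
 obtain T where "ldo_by T A" using assms(1) unfolding ldo_def by blast
 note T = ldo_byD[OF this]
 let ?T' = "map (%(p, vs). (%x. fderiv p (at x) v, vs)) T @ map (%(p, vs). (p, v # vs)) T"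
 show ?thesis
 proof (rule ldoI[of ?T'])
  fix S :: "'a set" and f x assume S: "open S" "smooth_on S f" "x \<in> S"
  have p: "((%x. \<Sum>(p, vs)\<leftarrow>T. p x * dd vs f x) has_derivative
   (%h. \<Sum>(p, vs)\<leftarrow>T. p x * fderiv (dd vs f) (at x) h + fderiv p (at x) h * dd vs f x)) (at x)"
   using T(1)
  proof (induction T)
   case (Cons t T)
   obtain p vs where t: "t = (p, vs)" by force
   have "smooth_on UNIV p" using Cons.prems t by auto
   from has_derivative_mult[OF sm_hasd[OF this UNIV_I]
     sm_hasd[OF sm_dir_deriv[OF S(2)] S(3), of vs]]
   show ?case using has_derivative_add Cons t by fastforce
  qed simp
  have "fderiv (A f) (at x) v = fderiv (%x. \<Sum>(p, vs)\<leftarrow>T. p x * dd vs f x) (at x) v"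
   using fderiv_cong_open[OF S(1,3), of "A f"] T(2)[OF S(1,2)] by (simp add: diff_op_def)
  also have "... = diff_op ?T' f x"
   unfolding fderiv_eqI[OF p] diff_op_def
   by (induction T) (auto simp: algebra_simps)
  finally show "fderiv (A f) (at x) v = diff_op ?T' f x" .
 qed (use T(1) in \<open>auto intro!: sm_frechet\<close>)
qed

lemma ldo_comp:
 assumes "ldo A" "ldo B" shows "ldo (%f. A (B f))"
proof -
 obtain T where "ldo_by T A" using assms(1) unfolding ldo_def by blast
 note T = ldo_byD[OF this]
 have 1: "ldo (%f. dd vs (B f))" for vs
  by (induction vs) (auto intro: assms ldo_frechet)
 have "ldo (%f x. \<Sum>(p, vs)\<leftarrow>T. p x * dd vs (B f) x)"
  using T(1)
 proof (induction T)
  case (Cons t T)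
  obtain p vs where t: "t = (p, vs)" by force
  have "ldo (%f x. p x * dd vs (B f) x)" using Cons.prems t by (intro ldo_mult 1) auto
  moreover have "ldo (%f x. \<Sum>(p, vs)\<leftarrow>T. p x * dd vs (B f) x)"
   by (rule Cons.IH) (use Cons.prems in auto)
  ultimately show ?case using ldo_add t by fastforce
 qed (auto intro: ldoI[of "[]"] simp: diff_op_def)
 then obtain T' where "ldo_by T' (%f x. \<Sum>(p, vs)\<leftarrow>T. p x * dd vs (B f) x)" unfolding ldo_def by blast
 note T' = ldo_byD[OF this]
 show ?thesis
  by (rule ldoI[of T'], rule T'(1), assumption)
   (use T(2) T'(2) ldo_smooth[OF assms(2)] in \<open>auto simp: diff_op_def\<close>)
qed

text \<open>At the fixed point \<open>x\<close> the coefficients may be frozen; an exponential is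
  then an eigenfunction with the symbol as eigenvalue, so equal values on all exponentials mean
  equal symbols. Most operator identities below are checked in this way.\<close>

theorem ldo_eqI:
 assumes "ldo A" "ldo B" "c ~= 0" "open S" "smooth_on S f" "x \<in> S"
  and "!!th. A (%z. exp (c * cor (z \<bullet> th))) x = B (%z. exp (c * cor (z \<bullet> th))) x"
 shows "A f x = B f x"
proof -
 obtain T where "ldo_by T A" using assms(1) unfolding ldo_def by blast
 note T = ldo_byD(2)[OF this]
 obtain T' where "ldo_by T' B" using assms(2) unfolding ldo_def by blast
 note T' = ldo_byD(2)[OF this]
 let ?T = "map (%(p, vs). (p x, vs)) T @ map (%(p, vs). (- p x, vs)) T'"
 have conv: "(\<Sum>(p, ws)\<leftarrow>?T. p * F ws) = (\<Sum>(p, ws)\<leftarrow>T. p x * F ws) - (\<Sum>(p, ws)\<leftarrow>T'. p x * F ws)"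
  for F :: "'a list => complex"
  by (simp add: o_def case_prod_unfold) (simp add: uminus_sum_list_map o_def)
 have "(\<Sum>(p, ws)\<leftarrow>?T. p * dd ws f x) = 0"
 proof (rule symbol_zero_imp_zero[OF assms(4,6,3,5)])
  fix th :: 'a
  let ?e = "%z. exp (c * cor (z \<bullet> th))"
  have h1: "(\<Sum>(p, ws)\<leftarrow>?T. p * dd ws ?e x) = 0"
   using assms(7)[of th] T[OF open_UNIV sm_expc] T'[OF open_UNIV sm_expc]
   unfolding conv by (simp add: diff_op_def)
  have h2: "(\<Sum>(p, ws)\<leftarrow>L. p * dd ws ?e x) =
    (\<Sum>(p, ws)\<leftarrow>L. p * (\<Prod>w\<leftarrow>ws. c * cor (w \<bullet> th))) * ?e x" for L :: "(complex \<times> 'a list) list"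
   by (induction L) (auto simp: dd_expc algebra_simps)
  show "(\<Sum>(p, ws)\<leftarrow>?T. p * (\<Prod>w\<leftarrow>ws. c * cor (w \<bullet> th))) = 0"
   using HOL.trans[OF sym[OF h2] h1] by (simp only: mult_eq_0_iff exp_not_eq_zero simp_thms)
 qed
 thus ?thesis unfolding conv using T[OF assms(4-6)] T'[OF assms(4-6)] by (simp add: diff_op_def)
qed

section \<open>Polynomial functions\<close>

text \<open>The degree bound is uniform over all lines in all directions; the interpolation in
  \<open>poly_quotient\<close> depends on this.\<close>

lemma rpoly_line:
 assumes "rpoly p"
 shows "\<exists>d. \<forall>x v. \<exists>q. degree q \<le> d & (\<forall>t. p (x + t *\<^sub>R v) = poly q t)"
 using assms
proof induction
 case (linear f)
 then interpret bounded_linear f .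
 show ?case
  by (rule exI[of _ 1]) (auto intro!: exI[of _ "[:f _, f _:]"] simp: add scaleR)
next
 case (const c)
 show ?case by (rule exI[of _ 0]) (auto intro!: exI[of _ "[:c:]"])
next
 case (add f g)
 then obtain d e where
  "\<forall>x v. \<exists>q. degree q \<le> d & (\<forall>t. f (x + t *\<^sub>R v) = poly q t)"
  "\<forall>x v. \<exists>q. degree q \<le> e & (\<forall>t. g (x + t *\<^sub>R v) = poly q t)" by auto
 note de = this
 show ?case
 proof (rule exI[of _ "max d e"], intro allI)
  fix x v
  obtain q r where "degree q \<le> d" "\<forall>t. f (x + t *\<^sub>R v) = poly q t" "degree r \<le> e" "\<forall>t. g (x + t *\<^sub>R v) = poly r t"
   using de by meson
  thus "\<exists>q. degree q \<le> max d e & (\<forall>t. f (x + t *\<^sub>R v) + g (x + t *\<^sub>R v) = poly q t)"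
   by (intro exI[of _ "q + r"]) (auto intro!: degree_add_le)
 qed
next
 case (mult f g)
 then obtain d e where
  "\<forall>x v. \<exists>q. degree q \<le> d & (\<forall>t. f (x + t *\<^sub>R v) = poly q t)"
  "\<forall>x v. \<exists>q. degree q \<le> e & (\<forall>t. g (x + t *\<^sub>R v) = poly q t)" by auto
 note de = this
 show ?case
 proof (rule exI[of _ "d + e"], intro allI)
  fix x v
  obtain q r where "degree q \<le> d" "\<forall>t. f (x + t *\<^sub>R v) = poly q t" "degree r \<le> e" "\<forall>t. g (x + t *\<^sub>R v) = poly r t"
   using de by meson
  thus "\<exists>q. degree q \<le> d + e & (\<forall>t. f (x + t *\<^sub>R v) * g (x + t *\<^sub>R v) = poly q t)"
   by (intro exI[of _ "q * r"]) (auto intro!: order_trans[OF degree_mult_le])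
 qed
qed

lemma rpoly_lineE:
 assumes "rpoly p"
 obtains q where "!!t. p (x + t *\<^sub>R v) = poly q t"
 using rpoly_line[OF assms] by blast

text \<open>The line joining a point of \<open>U\<close> to \<open>z\<close> carries only finitely
  many zeros.\<close>

lemma rpoly_nonzero_open:
 assumes p: "rpoly p" and "p z ~= 0" and "open U" "U ~= {}"
 shows "\<exists>x\<in>U. p x ~= 0"
proof -
 obtain x0 where x0: "x0 \<in> U" using assms by auto
 obtain q where q: "!!t. p (x0 + t *\<^sub>R (z - x0)) = poly q t" using rpoly_lineE[OF p] by blast
 have "poly q 1 ~= 0" using q[of 1] assms(2) by simp
 hence "finite {t. poly q t = 0}" by (intro poly_roots_finite) auto
 moreover have "open ((%t. x0 + t *\<^sub>R (z - x0)) -` U)"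
  by (intro open_vimage assms continuous_intros)
 then obtain e where e: "e > 0" "!!t. \<bar>t\<bar> < e ==> x0 + t *\<^sub>R (z - x0) \<in> U"
  using x0 unfolding open_dist by (auto simp: dist_real_def dest!: bspec[of _ _ 0])
 moreover have "infinite {0<..<e}" using e(1) by simp
 ultimately obtain t where "t \<in> {0<..<e}" "poly q t ~= 0"
  by (metis (mono_tags, lifting) finite_subset mem_Collect_eq subsetI)
 thus ?thesis using q e(2)[of t] by (intro bexI[of _ "x0 + t *\<^sub>R (z - x0)"]) auto
qed

lemma rpoly_zeroI:
 assumes "rpoly p" "open U" "U ~= {}" "!!x. x \<in> U ==> p x = 0"
 shows "p x = 0"
 using rpoly_nonzero_open[OF assms(1) _ assms(2,3)] assms(4) by blast

lemma rpoly_eqI: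
 assumes "rpoly p" "rpoly q" "open U" "U ~= {}" "!!x. x \<in> U ==> p x = q x"
 shows "p x = q x"
 using rpoly_zeroI[OF real_polynomial_function_diff[OF assms(1,2)] assms(3,4)] assms(5) by simp

lemma pfun_inner_real:
 fixes p :: "'a::real_normed_vector => 'b::euclidean_space"
 assumes "pfun p" shows "rpoly (%x. p x \<bullet> b)"
 using assms bounded_linear_inner_left[of b] unfolding polynomial_function_def o_def by auto

lemma polynomial_eqI:
 fixes p q :: "'a::real_normed_vector => 'b::euclidean_space"
 assumes "pfun p" "pfun q" "open U" "U ~= {}" "!!x. x \<in> U ==> p x = q x"
 shows "p x = q x"
 by (rule euclidean_eqI)
  (rule rpoly_eqI[OF pfun_inner_real[OF assms(1)]
    pfun_inner_real[OF assms(2)] assms(3,4)], simp add: assms(5))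

lemma open_rpoly_nonzero:
 assumes "rpoly p" shows "open {x. p x ~= 0}"
 using continuous_on_polymonial_function[of p UNIV] assms
 by (intro open_Collect_neq continuous_intros) (auto simp: real_polynomial_function_eq)

lemma eq_on_open_if_dense:
 fixes f g :: "'a::topological_space => 'b::t2_space"
 assumes "open S" "continuous_on S f" "continuous_on S g"
  and D: "!!U. open U ==> U ~= {} ==> U \<subseteq> S ==> \<exists>x\<in>U. f x = g x"
  and "x \<in> S"
 shows "f x = g x"
proof (rule ccontr)
 assume "f x ~= g x"
 from hausdorff[OF this]
 obtain A B where AB: "open A" "open B" "f x \<in> A" "g x \<in> B" "A \<inter> B = {}" by blast
 let ?U = "(S \<inter> f -` A) \<inter> (S \<inter> g -` B)"
 have "open ?U"
  by (intro open_Int continuous_open_preimage[OF assms(2) assms(1) AB(1)]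
    continuous_open_preimage[OF assms(3) assms(1) AB(2)])
 moreover have "x \<in> ?U" using AB assms by auto
 ultimately obtain y where "y \<in> ?U" "f y = g y" using D[of ?U] by blast
 thus False using AB by auto
qed

lemma rpoly_substitute:
 assumes "rpoly p" "pfun P" "rpoly Q"
 shows "\<exists>N d. rpoly N & (\<forall>x. Q x ~= 0 --> N x = Q x ^ d * p (P x /\<^sub>R Q x))"
 using assms(1)
proof induction
 case (linear f)
 then interpret bounded_linear f .
 have "rpoly (%x. f (P x))"
  using assms(2)[unfolded polynomial_function_def, rule_format, OF linear.hyps] by (simp add: o_def)
 thus ?case by (intro exI[of _ "%x. f (P x)"] exI[of _ 1]) (auto simp: scaleR)
next
 case (const c)
 thus ?case by (intro exI[of _ "%x. c"] exI[of _ 0]) auto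
next
 case (add f g)
 then obtain N M d e where
  "rpoly N" "!!x. Q x ~= 0 ==> N x = Q x ^ d * f (P x /\<^sub>R Q x)"
  "rpoly M" "!!x. Q x ~= 0 ==> M x = Q x ^ e * g (P x /\<^sub>R Q x)" by auto
 thus ?case using assms(3)
  by (intro exI[of _ "%x. N x * Q x ^ e + M x * Q x ^ d"] exI[of _ "d + e"] conjI
    rpoly_intros(3) rpoly_intros(4) real_polynomial_function_power)
   (auto simp: algebra_simps power_add)
next
 case (mult f g)
 then obtain N M d e where
  "rpoly N" "!!x. Q x ~= 0 ==> N x = Q x ^ d * f (P x /\<^sub>R Q x)"
  "rpoly M" "!!x. Q x ~= 0 ==> M x = Q x ^ e * g (P x /\<^sub>R Q x)" by auto
 thus ?case using assms(3)
  by (intro exI[of _ "%x. N x * M x"] exI[of _ "d + e"])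
   (auto simp: algebra_simps power_add)
qed

lemma pfun_scaleR:
 assumes "rpoly f" "pfun (g :: 'a::real_normed_vector => 'b::real_normed_vector)"
 shows "pfun (%x. f x *\<^sub>R g x)"
 unfolding polynomial_function_def o_def
proof (intro allI impI)
 fix h :: "'b => real" assume h: "bounded_linear h"
 then interpret bounded_linear h .
 have "rpoly (%x. h (g x))"
  using assms(2)[unfolded polynomial_function_def, rule_format, OF h] by (simp add: o_def)
 thus "rpoly (%x. h (f x *\<^sub>R g x))" using assms(1) by (auto simp: scaleR)
qed

lemma poly_substitute:
 fixes p :: "'b::real_normed_vector => 'c::euclidean_space"
 assumes "pfun p" "pfun P" "rpoly Q"
 shows "\<exists>N d. pfun N & (\<forall>x. Q x ~= 0 --> N x = (Q x ^ d) *\<^sub>R p (P x /\<^sub>R Q x))"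
proof -
 have "\<forall>b. \<exists>N d. rpoly N & (\<forall>x. Q x ~= 0 --> N x = Q x ^ d * (p (P x /\<^sub>R Q x) \<bullet> b))"
  using rpoly_substitute[OF pfun_inner_real[OF assms(1)] assms(2,3)] by blast
 then obtain N d where Nd: "!!b. rpoly (N b)"
   "!!b x. Q x ~= 0 ==> N b x = Q x ^ d b * (p (P x /\<^sub>R Q x) \<bullet> b)" by metis
 define D where "D = (\<Sum>b\<in>Basis. d (b::'c))"
 have dD: "d b \<le> D" if "b \<in> Basis" for b unfolding D_def using that by (intro member_le_sum) auto
 have "(\<Sum>b\<in>Basis. (N b x * Q x ^ (D - d b)) *\<^sub>R b) = (Q x ^ D) *\<^sub>R p (P x /\<^sub>R Q x)" if "Q x ~= 0" for x
 proof -
  have "(\<Sum>b\<in>Basis. (N b x * Q x ^ (D - d b)) *\<^sub>R b) = (\<Sum>b\<in>Basis. (Q x ^ D * (p (P x /\<^sub>R Q x) \<bullet> b)) *\<^sub>R b)"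
  proof (rule sum.cong[OF refl])
   fix b :: 'c assume "b \<in> Basis"
   hence "Q x ^ D = Q x ^ d b * Q x ^ (D - d b)" using dD by (simp flip: power_add)
   thus "(N b x * Q x ^ (D - d b)) *\<^sub>R b = (Q x ^ D * (p (P x /\<^sub>R Q x) \<bullet> b)) *\<^sub>R b"
    using Nd(2)[OF that] by (simp add: mult_ac)
  qed
  also have "... = (Q x ^ D) *\<^sub>R (\<Sum>b\<in>Basis. (p (P x /\<^sub>R Q x) \<bullet> b) *\<^sub>R b)" by (simp add: scaleR_sum_right)
  finally show ?thesis by (simp add: euclidean_representation)
 qed
 moreover have "pfun (%x. \<Sum>b\<in>Basis. (N b x * Q x ^ (D - d b)) *\<^sub>R b)"
  using Nd(1) assms(3)
  by (intro polynomial_function_sum pfun_scaleR) auto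
 ultimately show ?thesis by blast
qed

lemma lagrange:
 fixes h :: "real poly"
 assumes "degree h \<le> d" "inj_on c {..d}"
 shows "poly h t = (\<Sum>i\<le>d. (\<Prod>j\<in>{..d} - {i}. (t - c j) / (c i - c j)) * poly h (c i))"
proof -
 define l where "l i = (\<Prod>j\<in>{..d} - {i}. [:- c j / (c i - c j), 1 / (c i - c j):])" for i
 have pl: "poly (l i) t = (\<Prod>j\<in>{..d} - {i}. (t - c j) / (c i - c j))" for i t
  unfolding l_def poly_prod by (intro prod.cong) (auto simp: diff_divide_distrib)
 define H where "H = h - (\<Sum>i\<le>d. psmult (poly h (c i)) (l i))"
 have dl: "degree (l i) \<le> d" if "i \<le> d" for i
 proof -
  have "degree (l i) \<le> (\<Sum>j\<in>{..d} - {i}. degree [:- c j / (c i - c j), 1 / (c i - c j):])"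
   unfolding l_def using degree_prod_sum_le[of "{..d} - {i}" "%j. [:- c j / (c i - c j), 1 / (c i - c j):]"]
   by (simp add: o_def)
  also have "... \<le> (\<Sum>j\<in>{..d} - {i}. 1)" by (intro sum_mono) auto
  finally show ?thesis using that by simp
 qed
 have "degree H \<le> d" unfolding H_def
  using assms(1) dl by (intro degree_diff_le degree_sum_le) (auto intro: order_trans[OF degree_smult_le])
 moreover have root: "poly H (c k) = 0" if "k \<le> d" for k
 proof -
  have "poly (l i) (c k) = (if i = k then 1 else 0)" if "i \<le> d" for i
  proof (cases "i = k")
   case True
   have "c k - c j ~= 0" if "j \<in> {..d} - {k}" for j
    using assms(2) \<open>k \<le> d\<close> that by (auto simp: inj_on_def)
   thus ?thesis using True by (auto simp: pl intro!: prod.neutral)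
  next
   case False
   hence "k \<in> {..d} - {i}" using \<open>k \<le> d\<close> by auto
   thus ?thesis using False by (auto simp: pl intro!: prod_zero)
  qed
  hence "(\<Sum>i\<le>d. poly h (c i) * poly (l i) (c k)) = (\<Sum>i\<le>d. if i = k then poly h (c k) else 0)"
   by (intro sum.cong) auto
  thus ?thesis using that by (simp add: H_def poly_sum)
 qed
 ultimately have "H = 0"
  using card_image[OF assms(2)] by (intro poly_eqI_degree[of "c ` {..d}"]) auto
 hence "poly h t = poly (\<Sum>i\<le>d. psmult (poly h (c i)) (l i)) t" by (simp add: H_def)
 thus ?thesis by (simp add: poly_sum pl mult.commute)
qed

text \<open>Along a coordinate line \<open>N / Q\<close> is a polynomial of degree at most the bound
  \<open>d\<close> for \<open>N\<close>, so its values at \<open>d + 1\<close> fixed nodes determine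
  it by Lagrange interpolation. Releasing one coordinate after another builds a polynomial on a cube
  around \<open>z\<close>, and the identity of polynomials extends from there.\<close>

theorem poly_quotient:
 fixes N Q :: "'a::euclidean_space => real"
 assumes N: "rpoly N" and Q: "rpoly Q" and z: "Q z ~= 0"
  and L: "!!x b. Q x ~= 0 ==> b \<in> Basis ==> \<exists>h. \<forall>t. N (x + t *\<^sub>R b) = poly h t * Q (x + t *\<^sub>R b)"
 shows "\<exists>f. rpoly f & (\<forall>x. N x = f x * Q x)"
proof -
 obtain d where d: "!!x v. \<exists>q. degree q \<le> d & (\<forall>t. N (x + t *\<^sub>R v) = poly q t)"
  using rpoly_line[OF N] by blast
 have "open {x. Q x ~= 0}" by (rule open_rpoly_nonzero[OF Q])
 then obtain dl0 where dl0: "dl0 > 0" "ball z dl0 \<subseteq> {x. Q x ~= 0}" using z openE by blast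
 \<comment> \<open>The cube of this half-width lies in the ball of radius \<open>dl0\<close>,
   because the norm is at most the sum of the moduli of the coordinates.\<close>
 define dl where "dl = dl0 / DIM('a)"
 have dl: "dl > 0" using dl0 by (simp add: dl_def)
 define C where "C = {x. \<forall>b\<in>Basis. \<bar>x \<bullet> b - z \<bullet> b\<bar> < dl}"
 have CQ: "Q x ~= 0" if "x \<in> C" for x
 proof -
  have "dist z x \<le> (\<Sum>b\<in>Basis. \<bar>(x - z) \<bullet> b\<bar>)" by (metis dist_commute dist_norm norm_le_l1)
  also have "... < (\<Sum>b\<in>(Basis::'a set). dl)"
   using that by (intro sum_strict_mono) (auto simp: C_def inner_diff_left)
  finally show ?thesis using dl0 by (auto simp: dl_def)
 qed
 \<comment> \<open>The \<open>d + 1\<close> nodes are spread over \<open>[0, dl)\<close>, so that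
   points obtained by moving a coordinate to a node stay in the cube.\<close>
 define c where "c i = dl * real i / (real d + 1)" for i :: nat
 have c: "\<bar>c i\<bar> < dl" if "i \<le> d" for i
 proof -
  have "real i / (real d + 1) < 1" using that by simp
  from mult_strict_left_mono[OF this dl] show ?thesis using dl by (simp add: c_def)
 qed
 have inj: "inj_on c {..d}" using dl by (auto simp: inj_on_def c_def)
 define st where "st b s x = x + (z \<bullet> b + s - x \<bullet> b) *\<^sub>R b" for b s and x :: 'a
 have st_b: "st b s x \<bullet> b' = (if b' = b then z \<bullet> b + s else x \<bullet> b')" if "b \<in> Basis" "b' \<in> Basis" for b b' s x
  using that by (auto simp: st_def inner_add_left inner_Basis)
 have stC: "st b s x \<in> C" if "b \<in> Basis" "x \<in> C" "\<bar>s\<bar> < dl" for b s x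
  using that st_b by (auto simp: C_def)
 define f0 where "f0 x = N x / Q x" for x
 have f0L: "f0 x = (\<Sum>i\<le>d. (\<Prod>j\<in>{..d} - {i}. (x \<bullet> b - z \<bullet> b - c j) / (c i - c j)) * f0 (st b (c i) x))"
  if b: "b \<in> Basis" and x: "x \<in> C" for b x
 proof -
  have s0: "st b s x = st b 0 x + s *\<^sub>R b" for s by (simp add: st_def algebra_simps)
  have Q0: "Q (st b 0 x) ~= 0" using stC[OF b x] dl CQ by simp
  obtain h where h: "\<forall>t. N (st b 0 x + t *\<^sub>R b) = poly h t * Q (st b 0 x + t *\<^sub>R b)" using L[OF Q0 b] by blast
  obtain n where n: "degree n \<le> d" "\<forall>t. N (st b 0 x + t *\<^sub>R b) = poly n t" using d by blast
  obtain q where q: "!!t. Q (st b 0 x + t *\<^sub>R b) = poly q t" using rpoly_lineE[OF Q] by blast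
  have "poly q 0 ~= 0" using q[of 0] Q0 by simp
  hence "q ~= 0" by auto
  have "poly n t = poly (h * q) t" for t using h n q by simp
  hence "n = h * q" using poly_eq_poly_eq_iff by blast
  hence dh: "degree h \<le> d" using n(1) \<open>q ~= 0\<close> by (cases "h = 0") (auto simp: degree_mult_eq)
  have f0h: "f0 (st b t x) = poly h t" if "\<bar>t\<bar> < dl" for t
   using h CQ[OF stC[OF b x that]] by (simp add: f0_def s0[of t])
  have xs: "x = st b (x \<bullet> b - z \<bullet> b) x" by (simp add: st_def)
  have "f0 x = poly h (x \<bullet> b - z \<bullet> b)" using f0h[of "x \<bullet> b - z \<bullet> b"] xs x b by (simp add: C_def)
  also have "... = (\<Sum>i\<le>d. (\<Prod>j\<in>{..d} - {i}. (x \<bullet> b - z \<bullet> b - c j) / (c i - c j)) * poly h (c i))"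
   by (rule lagrange[OF dh inj])
  also have "... = (\<Sum>i\<le>d. (\<Prod>j\<in>{..d} - {i}. (x \<bullet> b - z \<bullet> b - c j) / (c i - c j)) * f0 (st b (c i) x))"
   using c f0h by (intro sum.cong) auto
  finally show ?thesis .
 qed
 have lin: "rpoly (%x. x \<bullet> b)" for b :: 'a
  using bounded_linear_inner_left rpoly_intros(1) by blast
 \<comment> \<open>\<open>B\<close> holds the coordinates already released; the others are frozen at
   those of \<open>y\<close>.\<close>
 have main: "finite B ==> B \<subseteq> Basis ==> \<forall>y\<in>C. \<exists>f. rpoly f &
   (\<forall>x\<in>C. (\<forall>b\<in>Basis - B. x \<bullet> b = y \<bullet> b) --> f0 x = f x)" for B
 proof (induction B rule: finite_induct)
  case empty
  show ?case
  proof
   fix y assume "y \<in> C"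
   have "f0 x = f0 y" if "\<forall>b\<in>Basis - {}. x \<bullet> b = y \<bullet> b" for x
    using euclidean_eqI[of x y] that by fastforce
   thus "\<exists>f. rpoly f & (\<forall>x\<in>C. (\<forall>b\<in>Basis - {}. x \<bullet> b = y \<bullet> b) --> f0 x = f x)"
    by (intro exI[of _ "%_. f0 y"] conjI ballI impI rpoly_intros(2)) blast
  qed
 next
  case (insert b B)
  hence b: "b \<in> Basis" and IH: "\<forall>y\<in>C. \<exists>f. rpoly f &
   (\<forall>x\<in>C. (\<forall>b\<in>Basis - B. x \<bullet> b = y \<bullet> b) --> f0 x = f x)" by auto
  show ?case
  proof
   fix y assume y: "y \<in> C"
   have "\<forall>i\<in>{..d}. \<exists>f. rpoly f &
    (\<forall>x\<in>C. (\<forall>b'\<in>Basis - B. x \<bullet> b' = st b (c i) y \<bullet> b') --> f0 x = f x)"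
    using IH stC[OF b y] c by auto
   then obtain F where F: "!!i. i \<le> d ==> rpoly (F i)"
    "!!i x. i \<le> d ==> x \<in> C ==> \<forall>b'\<in>Basis - B. x \<bullet> b' = st b (c i) y \<bullet> b' ==> f0 x = F i x" by (auto dest!: bchoice)
   let ?f = "%x. \<Sum>i\<le>d. (\<Prod>j\<in>{..d} - {i}. (x \<bullet> b - z \<bullet> b - c j) / (c i - c j)) * F i (st b (c i) x)"
   have "rpoly ?f"
   proof (intro real_polynomial_function_sum rpoly_intros(4) real_polynomial_function_prod)
    fix i assume i: "i \<in> {..d}"
    have "pfun (%x. st b (c i) x)" unfolding st_def
     by (intro polynomial_function_add pfun_scaleR) (auto intro: lin)
    from real_polynomial_function_compose[OF this F(1)] i
    show "rpoly (%x. F i (st b (c i) x))" by (simp add: o_def)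
   next
    fix i j
    show "rpoly (%x. (x \<bullet> b - z \<bullet> b - c j) / (c i - c j))"
     by (intro real_polynomial_function_divide real_polynomial_function_diff lin rpoly_intros(2))
   qed auto
   moreover have "f0 x = ?f x" if x: "x \<in> C" "\<forall>b'\<in>Basis - insert b B. x \<bullet> b' = y \<bullet> b'" for x
   proof -
    have "f0 (st b (c i) x) = F i (st b (c i) x)" if "i \<le> d" for i
     using x that st_b[OF b] by (intro F(2) stC b c) auto
    thus ?thesis by (subst f0L[OF b x(1)]) simp
   qed
   ultimately show "\<exists>f. rpoly f &
     (\<forall>x\<in>C. (\<forall>b'\<in>Basis - insert b B. x \<bullet> b' = y \<bullet> b') --> f0 x = f x)" by blast
  qed
 qed
 have zC: "z \<in> C" using dl by (simp add: C_def)
 then obtain f where f: "rpoly f" "!!x. x \<in> C ==> f0 x = f x"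
  using main[OF finite_Basis order_refl] by (metis Diff_cancel empty_iff)
 have "ball z dl \<subseteq> C"
 proof
  fix x assume "x \<in> ball z dl"
  thus "x \<in> C" unfolding C_def
   by (auto simp: dist_norm norm_minus_commute inner_diff_left[symmetric] intro: le_less_trans[OF Basis_le_norm])
 qed
 have "N x = f x * Q x" for x
 proof (rule rpoly_eqI[OF N rpoly_intros(4)[OF f(1) Q] open_ball[of z dl]])
  show "ball z dl ~= {}" using dl by simp
  fix x assume "x \<in> ball z dl"
  hence "x \<in> C" using \<open>ball z dl \<subseteq> C\<close> by blast
  thus "N x = f x * Q x" using f(2)[of x] CQ[of x] by (simp add: f0_def field_simps)
 qed
 thus ?thesis using f(1) by blast
qed

lemma real_poly_eqI_all: "(!!t. poly p t = poly q t) ==> p = (q :: real poly)"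
 using poly_eq_poly_eq_iff by blast

text \<open>On a line the equation makes the square of one polynomial divide the square of another,
  and unique factorisation carries the divisibility over to the polynomials themselves. This is how
  polynomial square roots of cocycles survive composition.\<close>

lemma poly_sqrt_quotient:
 fixes N Q c :: "'a::euclidean_space => real"
 assumes N: "rpoly N" and Q: "rpoly Q" and z: "Q z ~= 0"
  and c: "rpoly c" and e: "!!x. (N x)\<^sup>2 = c x * (Q x)\<^sup>2"
 shows "\<exists>f. rpoly f & (\<forall>x. N x = f x * Q x)"
proof (rule poly_quotient[OF N Q z])
 fix x b :: 'a assume x: "Q x ~= 0"
 obtain n where n: "!!t. N (x + t *\<^sub>R b) = poly n t" using rpoly_lineE[OF N] by blast
 obtain q where q: "!!t. Q (x + t *\<^sub>R b) = poly q t" using rpoly_lineE[OF Q] by blast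
 obtain k where k: "!!t. c (x + t *\<^sub>R b) = poly k t" using rpoly_lineE[OF c] by blast
 have "poly (n ^ 2) t = poly (k * q ^ 2) t" for t
  using e[of "x + t *\<^sub>R b"] by (simp add: n q k)
 hence "n ^ 2 = k * q ^ 2" by (rule real_poly_eqI_all)
 hence "q ^ 2 dvd n ^ 2" by simp
 hence "q dvd n" by simp
 then obtain h where "n = q * h" by (elim dvdE)
 thus "\<exists>h. \<forall>t. N (x + t *\<^sub>R b) = poly h t * Q (x + t *\<^sub>R b)"
  by (intro exI[of _ h]) (simp add: n q mult.commute)
qed

section \<open>Jordan algebras: powers and minimal polynomials\<close>

locale sjordan =
 fixes J :: "'a::euclidean_space => 'a => 'a" (infixl "**" 70)
 assumes simple: "simple_unital_jordan_algebra J"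
begin

abbreviation e where "e \<equiv> junit J"

lemma bil: "bilinear J"
 using simple by (simp add: simple_unital_jordan_algebra_def jordan_algebra_def)

lemma comm: "x ** y = y ** x"
 using simple by (simp add: simple_unital_jordan_algebra_def jordan_algebra_def)

lemma jid: "(x ** x) ** (x ** y) = x ** ((x ** x) ** y)"
 using simple by (simp add: simple_unital_jordan_algebra_def jordan_algebra_def)

lemma ideal_cases: "jordan_ideal J I ==> I = {0} \<or> I = UNIV"
 using simple by (simp add: simple_unital_jordan_algebra_def)

lemma unit_left [simp]: "e ** x = x"
proof -
 obtain u where u: "!!x. u ** x = x"
  using simple by (auto simp: simple_unital_jordan_algebra_def)
 have "e = u"
  unfolding junit_def by (rule the_equality) (metis u comm)+
 thus ?thesis by (simp add: u)
qed

lemma unit_right [simp]: "x ** e = x" by (metis comm unit_left)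

lemma bdd: "bounded_bilinear J"
 using bil by (simp add: bilinear_conv_bounded_bilinear)

lemmas J_add = bilinear_ladd[OF bil] bilinear_radd[OF bil]
lemmas J_diff = bilinear_lsub[OF bil] bilinear_rsub[OF bil]
lemmas J_neg [simp] = bilinear_lneg[OF bil] bilinear_rneg[OF bil]
lemmas J_scale [simp] = bilinear_lmul[OF bil] bilinear_rmul[OF bil]
lemmas J_zero [simp] = bilinear_lzero[OF bil] bilinear_rzero[OF bil]

lemma linL: "linear (J x)" using bil by (simp add: bilinear_def)

lemma J_sum_right: "x ** (\<Sum>i\<in>I. f i) = (\<Sum>i\<in>I. x ** f i)" by (rule linear_sum[OF linL])
lemma J_sum_left: "(\<Sum>i\<in>I. f i) ** x = (\<Sum>i\<in>I. f i ** x)"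
 by (rule linear_sum) (use bil in \<open>simp add: bilinear_def\<close>)

lemma e_nonzero: "e ~= 0"
proof
 assume "e = 0"
 hence "x = 0" for x :: 'a using unit_left[of x] by (simp only: J_zero)
 moreover obtain b :: 'a where "b \<in> Basis" using nonempty_Basis by blast
 ultimately show False using nonzero_Basis by blast
qed

lemma vec_eq_inner: "(!!b::'a. x \<bullet> b = y \<bullet> b) ==> x = y"
 by (rule euclidean_eqI) auto

text \<open>The part of the Jordan identity at \<open>x + z\<close> that is odd in \<open>z\<close>,
  with the cubic terms removed by the identity at \<open>z\<close>.\<close>

lemma lin1: "2 *\<^sub>R ((x ** z) ** (x ** y)) + (x ** x) ** (z ** y) = 2 *\<^sub>R (x ** ((x ** z) ** y)) + z ** ((x ** x) ** y)"
proof (rule vec_eq_inner)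
 fix b
 have zx: "z ** x = x ** z" by (rule comm)
 note e = jid[of "x + z" y, THEN arg_cong[of _ _ "%v. v \<bullet> b"]]
  jid[of "x - z" y, THEN arg_cong[of _ _ "%v. v \<bullet> b"]] jid[of z y, THEN arg_cong[of _ _ "%v. v \<bullet> b"]]
 show "(2 *\<^sub>R ((x ** z) ** (x ** y)) + (x ** x) ** (z ** y)) \<bullet> b = (2 *\<^sub>R (x ** ((x ** z) ** y)) + z ** ((x ** x) ** y)) \<bullet> b"
  using e unfolding J_add J_diff zx inner_add_left inner_diff_left inner_scaleR_left distrib_left by linarith
qed

lemma lin2: "(x ** z) ** (w ** y) + (w ** z) ** (x ** y) + (x ** w) ** (z ** y) =
  x ** ((w ** z) ** y) + w ** ((x ** z) ** y) + z ** ((x ** w) ** y)"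
proof (rule vec_eq_inner)
 fix b
 have wx: "w ** x = x ** w" by (rule comm)
 note e = lin1[of "x + w" z y, THEN arg_cong[of _ _ "%v. v \<bullet> b"]]
  lin1[of x z y, THEN arg_cong[of _ _ "%v. v \<bullet> b"]] lin1[of w z y, THEN arg_cong[of _ _ "%v. v \<bullet> b"]]
 show "((x ** z) ** (w ** y) + (w ** z) ** (x ** y) + (x ** w) ** (z ** y)) \<bullet> b =
  (x ** ((w ** z) ** y) + w ** ((x ** z) ** y) + z ** ((x ** w) ** y)) \<bullet> b"
  using e unfolding J_add J_diff wx inner_add_left inner_diff_left inner_scaleR_left distrib_left by linarith
qed

text \<open>Two instances of \<open>lin2\<close> with the roles of \<open>z\<close> and
  \<open>u\<close> exchanged have the same left-hand side; equating the right-hand sides isolates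
  the triple product. The identity drives the recursion for powers and the derivation property of
  \<open>Dop\<close>.\<close>

lemma Lprod: "((x ** y) ** z) ** u =
  z ** ((x ** y) ** u) + x ** ((y ** z) ** u) + y ** ((x ** z) ** u) - x ** (z ** (y ** u)) - y ** (z ** (x ** u))"
proof -
 have 1: "(x ** y) ** (u ** z) + (u ** y) ** (x ** z) + (x ** u) ** (y ** z) =
  x ** ((u ** y) ** z) + u ** ((x ** y) ** z) + y ** ((x ** u) ** z)" by (rule lin2)
 have 2: "(x ** y) ** (z ** u) + (z ** y) ** (x ** u) + (x ** z) ** (y ** u) =
  x ** ((z ** y) ** u) + z ** ((x ** y) ** u) + y ** ((x ** z) ** u)" by (rule lin2)
 note 1 = 1[unfolded comm[of u z] comm[of u y], unfolded comm[of "y ** u" "x ** z"] comm[of "x ** u" "y ** z"]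
   comm[of "y ** u" z] comm[of u "(x ** y) ** z"] comm[of "x ** u" z]]
 note 2 = 2[unfolded comm[of z y]]
 show ?thesis
 proof (rule vec_eq_inner)
  fix b
  show "(((x ** y) ** z) ** u) \<bullet> b =
   (z ** ((x ** y) ** u) + x ** ((y ** z) ** u) + y ** ((x ** z) ** u) - x ** (z ** (y ** u)) - y ** (z ** (x ** u))) \<bullet> b"
   using 1[THEN arg_cong[of _ _ "%v. v \<bullet> b"]] 2[THEN arg_cong[of _ _ "%v. v \<bullet> b"]]
   unfolding inner_add_left inner_diff_left by linarith
 qed
qed

text \<open>The commutator of two multiplication operators, an inner derivation.\<close>

definition Dop :: "'a => 'a => 'a => 'a" where
 "Dop a b u = a ** (b ** u) - b ** (a ** u)"

lemma Dop_linear: "linear (Dop a b)"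
 by (rule linearI) (simp_all add: Dop_def J_add algebra_simps)

lemma Dop_derivation: "Dop a b (x ** y) = Dop a b x ** y + x ** Dop a b y"
proof (rule vec_eq_inner)
 fix c
 have 1: "((a ** x) ** b) ** y = b ** ((a ** x) ** y) + a ** ((x ** b) ** y) + x ** ((a ** b) ** y)
   - a ** (b ** (x ** y)) - x ** (b ** (a ** y))" by (rule Lprod)
 have 2: "((b ** x) ** a) ** y = a ** ((b ** x) ** y) + b ** ((x ** a) ** y) + x ** ((b ** a) ** y)
   - b ** (a ** (x ** y)) - x ** (a ** (b ** y))" by (rule Lprod)
 have cc: "x ** b = b ** x" "x ** a = a ** x" "a ** b = b ** a" "(b ** x) ** a = a ** (b ** x)"
  "(a ** x) ** b = b ** (a ** x)" by (rule comm)+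
 show "Dop a b (x ** y) \<bullet> c = (Dop a b x ** y + x ** Dop a b y) \<bullet> c"
  using 1[THEN arg_cong[of _ _ "%v. v \<bullet> c"]] 2[THEN arg_cong[of _ _ "%v. v \<bullet> c"]]
  unfolding Dop_def J_add J_diff cc inner_add_left inner_diff_left by linarith
qed

text \<open>The operator algebra generated by the multiplications by \<open>x\<close> and by
  \<open>x ** x\<close>. It is commutative because the Jordan identity lets these two commute, and
  it contains the multiplication by every power of \<open>x\<close>; power associativity is read off
  from it.\<close>

inductive_set genL :: "'a => ('a => 'a) set" for x where
 gen_id: "(%u. u) \<in> genL x"
| gen_L: "(%u. x ** u) \<in> genL x"
| gen_L2: "(%u. (x ** x) ** u) \<in> genL x"
| gen_add: "f \<in> genL x ==> g \<in> genL x ==> (%u. f u + g u) \<in> genL x"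
| gen_scale: "f \<in> genL x ==> (%u. c *\<^sub>R f u) \<in> genL x"
| gen_comp: "f \<in> genL x ==> g \<in> genL x ==> (%u. f (g u)) \<in> genL x"

lemma genL_diff:
 assumes "f \<in> genL x" "g \<in> genL x" shows "(%u. f u - g u) \<in> genL x"
 using gen_add[OF assms(1) gen_scale[OF assms(2), of "-1"]] by simp

lemma genL_linear: "f \<in> genL x ==> linear f"
proof (induction rule: genL.induct)
 case (gen_comp f g) thus ?case using linear_compose[of g f] by (simp add: o_def)
qed (auto intro: linL linear_compose_add linear_compose_scale_right linear_ident)

lemma genL_commute_gen:
 assumes "linear h" "!!u. x ** h u = h (x ** u)" "!!u. (x ** x) ** h u = h ((x ** x) ** u)" "f \<in> genL x"
 shows "f (h u) = h (f u)"
 using assms(4) by (induction arbitrary: u rule: genL.induct)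
  (simp_all add: assms linear_add[OF assms(1)] linear_scale[OF assms(1)])

lemma genL_commute:
 assumes "f \<in> genL x" "g \<in> genL x" shows "f (g u) = g (f u)"
proof (rule genL_commute_gen[OF genL_linear[OF assms(2)] _ _ assms(1)])
 show "x ** g u = g (x ** u)" for u
  using genL_commute_gen[OF linL[of x] _ _ assms(2)] jid by metis
 show "(x ** x) ** g u = g ((x ** x) ** u)" for u
  using genL_commute_gen[OF linL[of "x ** x"] _ _ assms(2)] jid by metis
qed

text \<open>Two consecutive powers are carried along because the recursion from \<open>Lprod\<close>
  reaches two steps back.\<close>

lemma genL_pow: "(%u. jpow J x k ** u) \<in> genL x & (%u. jpow J x (Suc k) ** u) \<in> genL x"
proof (induction k)
 case 0 show ?case by (auto intro: gen_id gen_L)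
next
 case (Suc k)
 let ?y = "jpow J x k"
 have m: "(%u. ?y ** u) \<in> genL x" "(%u. (x ** ?y) ** u) \<in> genL x" using Suc by auto
 have "jpow J x (Suc (Suc k)) = (x ** ?y) ** x" by (simp add: comm)
 hence "(%u. jpow J x (Suc (Suc k)) ** u) = (%u. x ** ((x ** ?y) ** u) + x ** ((x ** ?y) ** u)
   + ?y ** ((x ** x) ** u) - x ** (x ** (?y ** u)) - ?y ** (x ** (x ** u)))"
  using Lprod[of x ?y x] comm[of ?y x] by (simp add: fun_eq_iff)
 moreover have "... \<in> genL x"
  by (intro genL_diff gen_add gen_comp[OF gen_L gen_comp[OF gen_L m(1)]] gen_comp[OF m(1) gen_comp[OF gen_L gen_L]]
    gen_comp[OF gen_L m(2)] gen_comp[OF m(1) gen_L2])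
 ultimately show ?case using Suc by simp
qed

lemma jpoly_altdef: "degree p \<le> n ==> jpoly J p x = (\<Sum>i\<le>n. coeff p i *\<^sub>R jpow J x i)"
 unfolding jpoly_def by (rule sum.mono_neutral_left) (auto simp: coeff_eq_0)

lemma jpoly_0 [simp]: "jpoly J 0 x = 0" by (simp add: jpoly_def)
lemma jpoly_1 [simp]: "jpoly J 1 x = e" by (simp add: jpoly_def)

lemma jpoly_add: "jpoly J (p + q) x = jpoly J p x + jpoly J q x"
 using jpoly_altdef[of p "max (degree p) (degree q)"] jpoly_altdef[of q "max (degree p) (degree q)"]
  jpoly_altdef[of "p + q" "max (degree p) (degree q)"]
 by (simp add: degree_add_le_max scaleR_left_distrib sum.distrib)

lemma jpoly_smult: "jpoly J (psmult c p) x = c *\<^sub>R jpoly J p x"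
 using jpoly_altdef[of "psmult c p" "degree p"] by (simp add: jpoly_def scaleR_sum_right)

lemma jpoly_minus: "jpoly J (- p) x = - jpoly J p x"
 using jpoly_smult[of "-1" p] by simp

lemma jpoly_diff: "jpoly J (p - q) x = jpoly J p x - jpoly J q x"
 using jpoly_add[of p "- q"] jpoly_minus[of q] by simp

lemma jpoly_pCons: "jpoly J (pCons a p) x = a *\<^sub>R e + x ** jpoly J p x"
proof -
 have "jpoly J (pCons a p) x = (\<Sum>i\<le>Suc (degree p). coeff (pCons a p) i *\<^sub>R jpow J x i)"
  by (rule jpoly_altdef) (rule degree_pCons_le)
 also have "... = a *\<^sub>R e + (\<Sum>i\<le>degree p. coeff p i *\<^sub>R jpow J x (Suc i))"
  by (subst sum.atMost_Suc_shift) simp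
 also have "(\<Sum>i\<le>degree p. coeff p i *\<^sub>R jpow J x (Suc i)) = x ** jpoly J p x"
  by (simp add: jpoly_def J_sum_right)
 finally show ?thesis .
qed

lemma jpoly_X [simp]: "jpoly J [:0, 1:] x = x" by (simp add: jpoly_pCons)
lemma jpoly_const: "jpoly J [:c:] x = c *\<^sub>R e" by (simp add: jpoly_pCons)

lemma jpoly_genL: "(%u. jpoly J p x ** u) \<in> genL x"
proof -
 have "(%u. \<Sum>i\<le>n. coeff p i *\<^sub>R (jpow J x i ** u)) \<in> genL x" for n
 proof (induction n)
  case 0 show ?case using gen_scale[OF genL_pow[THEN conjunct1, of x 0]] by simp
 next
  case (Suc n)
  show ?case using gen_add[OF Suc gen_scale[OF genL_pow[THEN conjunct2, of x n]]] by simp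
 qed
 thus ?thesis by (simp add: jpoly_def J_sum_left)
qed

lemma jpoly_commute: "jpoly J p x ** (jpoly J q x ** u) = jpoly J q x ** (jpoly J p x ** u)"
 using genL_commute[OF jpoly_genL jpoly_genL] by simp

lemma jpoly_assoc: "(jpoly J p x ** jpoly J q x) ** jpoly J r x = jpoly J p x ** (jpoly J q x ** jpoly J r x)"
 by (metis comm jpoly_commute)

lemma jpoly_mult: "jpoly J (p * q) x = jpoly J p x ** jpoly J q x"
proof (induction p)
 case (pCons a p)
 have "jpoly J (pCons a p * q) x = a *\<^sub>R jpoly J q x + x ** (jpoly J p x ** jpoly J q x)"
  using pCons by (simp add: jpoly_add jpoly_smult jpoly_pCons)
 also have "x ** (jpoly J p x ** jpoly J q x) = (x ** jpoly J p x) ** jpoly J q x"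
  using jpoly_assoc[of "[:0, 1:]" x p q] by simp
 finally show ?case by (simp add: jpoly_pCons J_add)
qed simp

lemma jpoly_pcompose: "jpoly J (pcompose p q) x = jpoly J p (jpoly J q x)"
 by (induction p) (simp_all add: pcompose_pCons jpoly_pCons jpoly_add jpoly_mult)

lemma jpoly_monom: "jpoly J (monom c n) x = c *\<^sub>R jpow J x n"
 by (induction n) (simp_all add: monom_0 monom_Suc jpoly_pCons)

lemma jpoly_sum: "jpoly J (\<Sum>i\<in>I. p i) x = (\<Sum>i\<in>I. jpoly J (p i) x)"
 by (induction I rule: infinite_finite_induct) (simp_all add: jpoly_add)

text \<open>\<open>DIM('a) + 1\<close> powers are linearly dependent. Repeated powers are treated
  apart, since they would collapse the set whose cardinality forces dependence.\<close>

lemma exists_annihilator: "\<exists>p. p ~= 0 & degree p \<le> DIM('a) & jpoly J p x = 0"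
proof (cases "inj_on (jpow J x) {..DIM('a)}")
 case False
 then obtain i j where ij: "i < j" "j \<le> DIM('a)" "jpow J x i = jpow J x j"
  unfolding inj_on_def by (metis atMost_iff linorder_neqE_nat)
 let ?p = "monom 1 j - monom 1 i :: real poly"
 have "coeff ?p j = 1" using ij by simp
 hence "?p ~= 0" by (metis coeff_0 zero_neq_one)
 moreover have "degree ?p \<le> DIM('a)"
  using ij by (intro degree_diff_le) (auto intro: order_trans[OF degree_monom_le])
 moreover have "jpoly J ?p x = 0" using ij by (simp add: jpoly_diff jpoly_monom)
 ultimately show ?thesis by blast
next
 case True
 let ?A = "jpow J x ` {..DIM('a)}"
 have "card ?A = Suc DIM('a)" using card_image[OF True] by simp
 hence "dependent ?A" using independent_card_le by (metis dim_subset_UNIV finite_atMost finite_imageI independent_bound not_less_eq_eq order_refl)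
 then obtain u v where uv: "(\<Sum>v\<in>?A. u v *\<^sub>R v) = 0" "v \<in> ?A" "u v ~= 0"
  using dependent_finite[of ?A] by auto
 then obtain k where k: "k \<le> DIM('a)" "v = jpow J x k" by auto
 let ?p = "\<Sum>i\<le>DIM('a). monom (u (jpow J x i)) i"
 have "coeff ?p k = u v" using k by (simp add: coeff_sum)
 hence "?p ~= 0" using uv(3) by (metis coeff_0)
 moreover have "degree ?p \<le> DIM('a)"
  by (intro degree_sum_le) (auto intro: order_trans[OF degree_monom_le])
 moreover have "jpoly J ?p x = 0" using uv(1) sum.reindex[OF True, of "%v. u v *\<^sub>R v"]
  by (simp add: jpoly_sum jpoly_monom o_def)
 ultimately show ?thesis by blast
qed

lemma jminpoly_ex1: "\<exists>!p. lead_coeff p = 1 & jpoly J p x = 0 & (\<forall>q. q ~= 0 & jpoly J q x = 0 --> degree p \<le> degree q)"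
proof -
 obtain p where p: "p ~= 0" "jpoly J p x = 0" "!!q. q ~= 0 & jpoly J q x = 0 ==> degree p \<le> degree q"
  using ex_has_least_nat[of "%p. p ~= 0 & jpoly J p x = 0" _ degree] exists_annihilator[of x] by blast
 let ?p = "psmult (inverse (lead_coeff p)) p"
 have "lead_coeff ?p = 1" "jpoly J ?p x = 0" "\<forall>q. q ~= 0 & jpoly J q x = 0 --> degree ?p \<le> degree q"
  using p by (auto simp: jpoly_smult)
 note ex = this
 have uniq: "p = q" if "lead_coeff p = 1" "jpoly J p x = 0" "\<forall>q. q ~= 0 & jpoly J q x = 0 --> degree p \<le> degree q"
   "lead_coeff q = 1" "jpoly J q x = 0" "\<forall>p. p ~= 0 & jpoly J p x = 0 --> degree q \<le> degree p" for p q
 proof (rule ccontr)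
  assume "p ~= q"
  have nz: "p ~= 0" "q ~= 0" using that by auto
  hence d: "degree p = degree q" using that by (meson order_antisym)
  have "jpoly J (p - q) x = 0" using that by (simp add: jpoly_diff)
  hence "degree p \<le> degree (p - q)" using that(3) \<open>p ~= q\<close> by simp
  moreover have "degree (p - q) \<le> degree p" using d by (intro degree_diff_le) auto
  ultimately have "degree (p - q) = degree p" by simp
  hence "lead_coeff (p - q) = 0" using that d by simp
  hence "p - q = 0" using leading_coeff_0_iff by blast
  thus False using \<open>p ~= q\<close> by simp
 qed
 show ?thesis
 proof (rule ex_ex1I)
  show "\<exists>p. lead_coeff p = 1 & jpoly J p x = 0 & (\<forall>q. q ~= 0 & jpoly J q x = 0 --> degree p \<le> degree q)"
   using ex by (intro exI[of _ ?p] conjI)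
 qed (elim conjE, rule uniq)
qed

lemma jmin_props: "lead_coeff (jminpoly J x) = 1" "jpoly J (jminpoly J x) x = 0"
  "q ~= 0 ==> jpoly J q x = 0 ==> degree (jminpoly J x) \<le> degree q"
 using theI'[OF jminpoly_ex1[of x]] unfolding jminpoly_def[symmetric] by auto

lemma jminpoly_nonzero [simp]: "jminpoly J x ~= 0"
 using jmin_props(1)[of x] by auto

lemma jminpoly_degree_le: "degree (jminpoly J x) \<le> DIM('a)"
 using exists_annihilator[of x] jmin_props(3) order_trans by blast

abbreviation r where "r \<equiv> jrank J"

lemma finite_degrees: "finite (range (%x. degree (jminpoly J x)))"
 by (rule finite_subset[of _ "{..DIM('a)}"]) (auto intro: jminpoly_degree_le)

lemma degree_le_rank: "degree (jminpoly J x) \<le> r"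
 unfolding jrank_def using finite_degrees by (intro Max_ge) auto

lemma exists_regular: "\<exists>x. jregular J x"
 using Max_in[OF finite_degrees] unfolding jregular_def jrank_def by force

lemma jregular_iff: "jregular J x \<longleftrightarrow> (\<forall>q. degree q < r --> jpoly J q x = 0 --> q = 0)"
proof
 assume "jregular J x"
 thus "\<forall>q. degree q < r --> jpoly J q x = 0 --> q = 0"
  unfolding jregular_def using jmin_props(3) by (metis not_less)
next
 assume "\<forall>q. degree q < r --> jpoly J q x = 0 --> q = 0"
 thus "jregular J x" unfolding jregular_def
  by (metis degree_le_rank jminpoly_nonzero jmin_props(2) le_neq_implies_less)
qed

lemma rank_pos: "r > 0"
proof (rule ccontr)
 assume "\<not> r > 0"
 hence d: "degree (jminpoly J e) = 0" using degree_le_rank[of e] by simp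
 then obtain c where c: "jminpoly J e = [:c:]" using degree_eq_zeroE by blast
 hence "c = 1" using jmin_props(1)[of e] by simp
 thus False using jmin_props(2)[of e] c e_nonzero by (simp add: jpoly_const)
qed

lemma poly_J:
 assumes "pfun f" "pfun g"
 shows "pfun (%x. f x ** g x)"
proof -
 have "f x ** g x = (\<Sum>b\<in>Basis. \<Sum>c\<in>Basis. ((f x \<bullet> b) * (g x \<bullet> c)) *\<^sub>R (b ** c))" for x
 proof -
  have "f x ** g x = (\<Sum>b\<in>Basis. (f x \<bullet> b) *\<^sub>R b) ** (\<Sum>c\<in>Basis. (g x \<bullet> c) *\<^sub>R c)"
   by (simp only: euclidean_representation)
  also have "... = (\<Sum>b\<in>Basis. (f x \<bullet> b) *\<^sub>R (b ** (\<Sum>c\<in>Basis. (g x \<bullet> c) *\<^sub>R c)))"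
   by (simp only: J_sum_left J_scale)
  finally show ?thesis by (simp only: J_sum_right J_scale scaleR_sum_right scaleR_scaleR)
 qed
 thus ?thesis using pfun_inner_real assms
  by (auto intro!: polynomial_function_sum pfun_scaleR rpoly_intros(4))
qed

lemma poly_jpow: "pfun (%x. jpow J x n)"
 by (induction n) (auto intro: poly_J)

lemma poly_jpoly: "pfun (%x. jpoly J p x)"
 unfolding jpoly_def by (intro polynomial_function_sum polynomial_function_cmul poly_jpow) auto

end

section \<open>The generic minimal polynomial\<close>

lemma det_real_poly:
 fixes A :: "'b::real_normed_vector => real mat"
 assumes "!!x. A x \<in> carrier_mat n n" "!!i j. i < n ==> j < n ==> rpoly (%x. A x $$ (i, j))"
 shows "rpoly (%x. Determinant.det (A x))"
 unfolding det_def'[OF assms(1)]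
proof (intro real_polynomial_function_sum rpoly_intros(4) real_polynomial_function_prod
  rpoly_intros(2))
 fix p i assume "p \<in> {p. p permutes {0..<n}}" "i \<in> {0..<n}"
 thus "rpoly (%x. A x $$ (i, p i))"
  by (intro assms(2)) (auto dest: permutes_in_image[of p "{0..<n}" i])
qed (auto intro: finite_permutations)

lemma rpoly_inner:
 fixes f g :: "'b::real_normed_vector => 'c::euclidean_space"
 assumes "pfun f" "pfun g"
 shows "rpoly (%x. f x \<bullet> g x)"
 by (subst euclidean_inner)
  (intro real_polynomial_function_sum finite_Basis rpoly_intros(4) pfun_inner_real assms)

context sjordan begin

text \<open>Regularity means that the powers of \<open>x\<close> below \<open>r\<close> are linearly
  independent; their Gram determinant turns this into the non-vanishing of one polynomial.\<close>

definition gram :: "'a => real mat" where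
 "gram x = Matrix.mat r r (%(i, j). jpow J x i \<bullet> jpow J x j)"

definition gdet :: "'a => real" where "gdet x = Determinant.det (gram x)"

lemma gram_carrier [simp]: "gram x \<in> carrier_mat r r" by (simp add: gram_def)

lemma gram_entry: "i < r ==> j < r ==> gram x $$ (i, j) = jpow J x i \<bullet> jpow J x j"
 by (simp add: gram_def)

lemma gram_poly: "i < r ==> j < r ==> rpoly (%x. gram x $$ (i, j))"
 using rpoly_inner[OF poly_jpow poly_jpow, of i j]
 by (simp add: gram_entry)

lemma gdet_poly: "rpoly gdet"
 unfolding gdet_def[abs_def] by (rule det_real_poly[OF gram_carrier gram_poly])

lemma gram_mult_vec:
 assumes "v \<in> carrier_vec r" "i < r"
 shows "vec_index (gram x *\<^sub>v v) i = jpow J x i \<bullet> (\<Sum>j<r. vec_index v j *\<^sub>R jpow J x j)"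
 using assms unfolding gram_def
 by (simp add: scalar_prod_def inner_sum_right lessThan_atLeast0 mult.commute)

lemma jpoly_vec: "jpoly J (\<Sum>j<r. monom (c j) j) x = (\<Sum>j<r. c j *\<^sub>R jpow J x j)"
 by (simp add: jpoly_sum jpoly_monom)

lemma degree_vec_poly: "degree (\<Sum>j<r. monom (c j) j :: real poly) < r"
proof -
 have "degree (\<Sum>j<r. monom (c j) j :: real poly) \<le> r - 1"
  by (intro degree_sum_le) (auto intro!: order_trans[OF degree_monom_le])
 thus ?thesis using rank_pos by simp
qed

lemma coeff_vec_poly: "i < r ==> coeff (\<Sum>j<r. monom (c j) j :: real poly) i = c i"
 by (simp add: coeff_sum)

lemma gdet_regular: "gdet x ~= 0 \<longleftrightarrow> jregular J x"
proof
 assume reg: "jregular J x"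
 show "gdet x ~= 0"
 proof
  assume "gdet x = 0"
  then obtain v where v: "v \<in> carrier_vec r" "v ~= 0\<^sub>v r" "gram x *\<^sub>v v = 0\<^sub>v r"
   unfolding gdet_def det_0_iff_vec_prod_zero[OF gram_carrier] by blast
  let ?y = "\<Sum>j<r. vec_index v j *\<^sub>R jpow J x j"
  have "jpow J x i \<bullet> ?y = 0" if "i < r" for i using gram_mult_vec[OF v(1) that, of x] v(3) that by simp
  hence "?y \<bullet> ?y = 0" by (simp add: inner_sum_left)
  hence "jpoly J (\<Sum>j<r. monom (vec_index v j) j) x = 0" by (simp add: jpoly_vec)
  hence "(\<Sum>j<r. monom (vec_index v j) j) = 0" using reg degree_vec_poly unfolding jregular_iff by blast
  hence "vec_index v i = 0" if "i < r" for i using coeff_vec_poly[OF that, of "vec_index v"] by simp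
  hence "v = 0\<^sub>v r" using v(1) by (intro eq_vecI) auto
  thus False using v(2) by simp
 qed
next
 assume nz: "gdet x ~= 0"
 show "jregular J x"
  unfolding jregular_iff
 proof (intro allI impI)
  fix q :: "real poly" assume q: "degree q < r" "jpoly J q x = 0"
  let ?v = "Matrix.vec r (coeff q)"
  have qs: "(\<Sum>j<r. monom (coeff q j) j) = q"
   using q(1) by (intro poly_eqI) (auto simp: coeff_sum coeff_eq_0)
  have "(\<Sum>j<r. vec_index ?v j *\<^sub>R jpow J x j) = jpoly J q x"
   using jpoly_vec[of "coeff q" x] by (simp add: qs)
  hence "gram x *\<^sub>v ?v = 0\<^sub>v r" using gram_mult_vec[of ?v _ x] q(2) by (intro eq_vecI) (auto simp: gram_def)
  hence "?v = 0\<^sub>v r" using nz unfolding gdet_def det_0_iff_vec_prod_zero[OF gram_carrier]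
   by (metis vec_carrier)
  hence "coeff q i = 0" if "i < r" for i using that by (metis index_vec index_zero_vec(1))
  thus "q = 0" using qs by simp
 qed
qed

text \<open>The numerators of Cramer's rule for the coefficients of the minimal polynomial: pairing
  the relation between the powers of \<open>x\<close> with the powers below \<open>r\<close> gives a
  linear system with matrix \<open>gram x\<close>.\<close>

definition cnum :: "nat => 'a => real" where
 "cnum i x = (\<Sum>j<r. adj_mat (gram x) $$ (i, j) * (- (jpow J x j \<bullet> jpow J x r)))"

lemma cnum_poly: assumes "i < r" shows "rpoly (cnum i)"
proof -
 have "rpoly (%x. adj_mat (gram x) $$ (i, j))" if "j < r" for j
 proof -
  have "adj_mat (gram x) $$ (i, j) = (-1) ^ (j + i) * Determinant.det (mat_delete (gram x) j i)" for x
   using assms that by (simp add: adj_mat_def cofactor_def gram_def)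
  moreover have "rpoly (%x. Determinant.det (mat_delete (gram x) j i))"
  proof (rule det_real_poly[of _ "r - 1"])
   show "mat_delete (gram x) j i \<in> carrier_mat (r - 1) (r - 1)" for x
    by (rule mat_delete_carrier) simp
   fix k l assume kl: "k < r - 1" "l < r - 1"
   have "mat_delete (gram x) j i $$ (k, l) =
    gram x $$ (if k < j then k else Suc k, if l < i then l else Suc l)" for x
    using kl by (simp add: mat_delete_def gram_def)
   thus "rpoly (%x. mat_delete (gram x) j i $$ (k, l))"
    using kl gram_poly by auto
  qed
  ultimately show ?thesis by (auto intro: rpoly_intros)
 qed
 moreover have "rpoly (%x. - (jpow J x j \<bullet> jpow J x r))" for j
  by (intro real_polynomial_function_minus rpoly_inner poly_jpow)
 ultimately show ?thesis unfolding cnum_def[abs_def]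
  by (intro real_polynomial_function_sum rpoly_intros(4)) auto
qed

lemma regular_degree: "jregular J x ==> degree (jminpoly J x) = r" by (simp add: jregular_def)

lemma jminpoly_coeff:
 assumes "jregular J x" "i < r"
 shows "gdet x * coeff (jminpoly J x) i = cnum i x"
proof -
 let ?c = "Matrix.vec r (coeff (jminpoly J x))"
 let ?b = "Matrix.vec r (%j. - (jpow J x j \<bullet> jpow J x r))"
 have "jpoly J (jminpoly J x) x = (\<Sum>j<r. coeff (jminpoly J x) j *\<^sub>R jpow J x j) + jpow J x r"
  using jmin_props(1)[of x] regular_degree[OF assms(1)]
  by (simp add: jpoly_def flip: lessThan_Suc_atMost)
 hence s: "(\<Sum>j<r. coeff (jminpoly J x) j *\<^sub>R jpow J x j) = - jpow J x r"
  using jmin_props(2)[of x] by (simp add: eq_neg_iff_add_eq_0)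
 have "gram x *\<^sub>v ?c = ?b"
  using gram_mult_vec[of ?c _ x] s by (intro eq_vecI) (auto simp: gram_def)
 hence "adj_mat (gram x) *\<^sub>v ?b = (adj_mat (gram x) * gram x) *\<^sub>v ?c"
  using adj_mat(1)[OF gram_carrier] assoc_mult_mat_vec[of "adj_mat (gram x)" r r "gram x" r ?c] by simp
 also have "... = (gdet x \<cdot>\<^sub>m 1\<^sub>m r) *\<^sub>v ?c" by (simp add: adj_mat(3)[OF gram_carrier] gdet_def)
 also have "... = gdet x \<cdot>\<^sub>v ?c"
 proof (rule eq_vecI)
  fix i assume "i < dim_vec (gdet x \<cdot>\<^sub>v ?c)"
  hence i: "i < r" by simp
  have "vec_index ((gdet x \<cdot>\<^sub>m 1\<^sub>m r) *\<^sub>v ?c) i = gdet x * coeff (jminpoly J x) i"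
   using i unfolding scalar_prod_def by (auto intro!: sum.cong)
  also have "... = vec_index (gdet x \<cdot>\<^sub>v ?c) i" using i by simp
  finally show "vec_index ((gdet x \<cdot>\<^sub>m 1\<^sub>m r) *\<^sub>v ?c) i = vec_index (gdet x \<cdot>\<^sub>v ?c) i" .
 qed simp
 finally have "vec_index (adj_mat (gram x) *\<^sub>v ?b) i = gdet x * coeff (jminpoly J x) i" using assms(2) by simp
 moreover have "vec_index (adj_mat (gram x) *\<^sub>v ?b) i = cnum i x"
  using assms(2) adj_mat(1)[OF gram_carrier, of x]
  by (simp add: scalar_prod_def cnum_def lessThan_atLeast0)
 ultimately show ?thesis by simp
qed

text \<open>Evaluates polynomials at the multiplication operator of \<open>y\<close> rather than at
  \<open>y\<close>. Operators compose associatively, as the adjugate argument below requires, and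
  \<open>act_unit\<close> leads back to \<open>jpoly\<close>.\<close>

definition act :: "real poly => 'a => 'a => 'a" where
 "act p y u = (\<Sum>i\<le>degree p. coeff p i *\<^sub>R (J y ^^ i) u)"

lemma act_altdef: "degree p \<le> n ==> act p y u = (\<Sum>i\<le>n. coeff p i *\<^sub>R (J y ^^ i) u)"
 unfolding act_def by (rule sum.mono_neutral_left) (auto simp: coeff_eq_0)

lemma act_0 [simp]: "act 0 y u = 0" by (simp add: act_def)

lemma act_add: "act (p + q) y u = act p y u + act q y u"
 using act_altdef[of p "max (degree p) (degree q)"] act_altdef[of q "max (degree p) (degree q)"]
  act_altdef[of "p + q" "max (degree p) (degree q)"]
 by (simp add: degree_add_le_max scaleR_left_distrib sum.distrib)

lemma act_smult: "act (psmult c p) y u = c *\<^sub>R act p y u"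
 using act_altdef[of "psmult c p" "degree p"] by (simp add: act_def scaleR_sum_right)

lemma act_pCons: "act (pCons a p) y u = a *\<^sub>R u + y ** act p y u"
proof -
 have "act (pCons a p) y u = (\<Sum>i\<le>Suc (degree p). coeff (pCons a p) i *\<^sub>R (J y ^^ i) u)"
  by (rule act_altdef) (rule degree_pCons_le)
 also have "... = a *\<^sub>R u + (\<Sum>i\<le>degree p. coeff p i *\<^sub>R (J y ^^ Suc i) u)"
  by (subst sum.atMost_Suc_shift) simp
 also have "(\<Sum>i\<le>degree p. coeff p i *\<^sub>R (J y ^^ Suc i) u) = y ** act p y u"
  by (simp add: act_def J_sum_right)
 finally show ?thesis .
qed

lemma act_mult: "act (p * q) y u = act p y (act q y u)"
 by (induction p) (simp_all add: act_pCons act_add act_smult)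

lemma act_sum: "act (\<Sum>i\<in>I. p i) y u = (\<Sum>i\<in>I. act (p i) y u)"
 by (induction I rule: infinite_finite_induct) (simp_all add: act_add)

lemma act_linear: "linear (act p y)"
proof (induction p)
 case (pCons a p)
 have "act (pCons a p) y = (%u. a *\<^sub>R u + y ** act p y u)" by (simp add: act_pCons fun_eq_iff)
 thus ?case using linear_compose[OF pCons(2) linL] unfolding o_def
  by (auto intro!: linear_compose_add linear_compose_scale_right linear_ident)
qed (simp add: linear_zero[unfolded] module_hom_zero linearI)

lemma act_unit: "act p y e = jpoly J p y"
 by (induction p) (simp_all add: act_pCons jpoly_pCons)

definition bs :: "'a list" where "bs = (SOME l. set l = Basis & distinct l)"

lemma bs: "set bs = Basis" "distinct bs" "length bs = DIM('a)"
proof -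
 have "\<exists>l. set l = (Basis :: 'a set) & distinct l" using finite_distinct_list[OF finite_Basis] by blast
 from someI_ex[OF this] show "set bs = Basis" "distinct bs" unfolding bs_def by auto
 thus "length bs = DIM('a)" by (metis distinct_card)
qed

lemma sum_bs: "(\<Sum>b\<in>Basis. f b) = (\<Sum>i<DIM('a). f (bs ! i))"
proof -
 have "bij_betw (nth bs) {..<DIM('a)} Basis" using bij_betw_nth[of bs "{..<DIM('a)}" Basis] bs by simp
 from sum.reindex_bij_betw[OF this, of f] show ?thesis by simp
qed

definition Lmat :: "'a => real mat" where
 "Lmat y = Matrix.mat DIM('a) DIM('a) (%(i, j). (y ** bs ! j) \<bullet> bs ! i)"

text \<open>The adjugate proof: the characteristic matrix, acting through \<open>act\<close>, sends
  the tuple of basis vectors to zero, and multiplication by its adjugate leaves the characteristic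
  polynomial acting on each of them. Applying this to the unit returns to the algebra.\<close>

lemma cayley_hamilton_L: "jpoly J (char_poly (Lmat y)) y = 0"
proof -
 let ?n = "DIM('a)" and ?A = "Lmat y"
 define C where "C = char_poly_matrix ?A"
 have A: "?A \<in> carrier_mat ?n ?n" by (simp add: Lmat_def)
 hence C: "C \<in> carrier_mat ?n ?n" unfolding C_def by simp
 have Cij: "C $$ (i, j) = (if i = j then [:0, 1:] else 0) + [:- (?A $$ (i, j)):]" if "i < ?n" "j < ?n" for i j
  using that A unfolding C_def char_poly_matrix_def by auto
 have rel: "(\<Sum>i<?n. act (C $$ (i, j)) y (bs ! i)) = 0" if j: "j < ?n" for j
 proof -
  have "(\<Sum>i<?n. act (C $$ (i, j)) y (bs ! i)) = (\<Sum>i<?n. (if i = j then y ** bs ! i else 0) - ?A $$ (i, j) *\<^sub>R bs ! i)"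
   using j by (intro sum.cong refl) (auto simp: Cij act_add act_pCons)
  also have "... = y ** bs ! j - (\<Sum>i<?n. ((y ** bs ! j) \<bullet> bs ! i) *\<^sub>R bs ! i)"
   using j by (simp add: sum_subtractf Lmat_def)
  also have "(\<Sum>i<?n. ((y ** bs ! j) \<bullet> bs ! i) *\<^sub>R bs ! i) = y ** bs ! j"
   using sum_bs[of "%b. ((y ** bs ! j) \<bullet> b) *\<^sub>R b"] by (simp add: euclidean_representation)
  finally show ?thesis by simp
 qed
 define B where "B = adj_mat C"
 have B: "B \<in> carrier_mat ?n ?n" "C * B = Determinant.det C \<cdot>\<^sub>m 1\<^sub>m ?n"
  using adj_mat[OF C] by (auto simp: B_def)
 have CB: "(\<Sum>j<?n. C $$ (i, j) * B $$ (j, k)) = (if i = k then char_poly ?A else 0)" if "i < ?n" "k < ?n" for i k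
 proof -
  have "(C * B) $$ (i, k) = (\<Sum>j<?n. C $$ (i, j) * B $$ (j, k))"
   using that C B(1) by (simp add: scalar_prod_def lessThan_atLeast0)
  thus ?thesis using that unfolding B(2) by (cases "i = k") (auto simp: char_poly_def C_def)
 qed
 have kill: "act (char_poly ?A) y (bs ! k) = 0" if k: "k < ?n" for k
 proof -
  have "act (char_poly ?A) y (bs ! k) = (\<Sum>i<?n. act (if i = k then char_poly ?A else 0) y (bs ! i))"
   using k by (simp add: if_distrib[of "%p. act p y _"] cong: if_cong)
  also have "... = (\<Sum>i<?n. \<Sum>j<?n. act (B $$ (j, k)) y (act (C $$ (i, j)) y (bs ! i)))"
  proof (rule sum.cong[OF refl])
   fix i assume "i \<in> {..<?n}"
   hence "act (if i = k then char_poly ?A else 0) y (bs ! i) = act (\<Sum>j<?n. C $$ (i, j) * B $$ (j, k)) y (bs ! i)"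
    using CB[of i k] k by simp
   also have "... = (\<Sum>j<?n. act (B $$ (j, k) * C $$ (i, j)) y (bs ! i))"
    by (simp only: act_sum mult.commute)
   finally show "act (if i = k then char_poly ?A else 0) y (bs ! i) =
    (\<Sum>j<?n. act (B $$ (j, k)) y (act (C $$ (i, j)) y (bs ! i)))" by (simp add: act_mult)
  qed
  also have "... = (\<Sum>j<?n. act (B $$ (j, k)) y (\<Sum>i<?n. act (C $$ (i, j)) y (bs ! i)))"
   by (subst sum.swap) (simp add: linear_sum[OF act_linear])
  also have "... = 0" using rel by (simp add: linear_0[OF act_linear])
  finally show ?thesis .
 qed
 have "act (char_poly ?A) y b = 0" if "b \<in> Basis" for b
  using kill that bs by (metis in_set_conv_nth)
 hence "act (char_poly ?A) y e = 0"
  using linear_eq_on_span[OF act_linear linear_zero, of Basis] by auto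
 thus ?thesis by (simp add: act_unit)
qed

text \<open>Gauss's lemma over the polynomials in the line parameter. The minimal polynomial scaled
  by \<open>gdet\<close> divides a scalar multiple of the characteristic polynomial of the
  multiplication operator. The latter is monic, hence primitive, so the primitive part of the
  divisor has a unit as leading coefficient, and \<open>gdet\<close> divides the content.\<close>

lemma gdet_dvd_line:
 assumes x: "gdet x ~= 0" and i0: "i0 < r"
 shows "\<exists>h. \<forall>t. cnum i0 (x + t *\<^sub>R b) = poly h t * gdet (x + t *\<^sub>R b)"
proof -
 let ?n = "DIM('a)"
 define w where "w t = x + t *\<^sub>R b" for t
 obtain qp where qp: "!!t. gdet (w t) = poly qp t"
  unfolding w_def using rpoly_lineE[OF gdet_poly] by blast
 have "\<forall>i\<in>{..<r}. \<exists>q. \<forall>t. cnum i (w t) = poly q t"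
  unfolding w_def by (metis cnum_poly lessThan_iff rpoly_lineE)
 then obtain np where np: "!!i t. i < r ==> cnum i (w t) = poly (np i) t" by (metis lessThan_iff)
 have "poly qp 0 ~= 0" using qp[of 0] x by (simp add: w_def)
 hence qp0: "qp ~= 0" by auto
 \<comment> \<open>Along the line this is \<open>gdet\<close> times the minimal polynomial, written
   without division so that its coefficients are polynomial in the parameter.\<close>
 define Mb where "Mb = monom qp r + (\<Sum>i<r. monom (np i) i)"
 have cMb: "coeff Mb i = (if i = r then qp else if i < r then np i else 0)" for i
  by (auto simp: Mb_def coeff_sum)
 have dMb: "degree Mb = r"
  by (rule antisym[OF degree_le le_degree]) (auto simp: cMb qp0)
 have Mb0: "Mb ~= 0" using cMb[of r] qp0 by auto
 define M where "M = Matrix.mat ?n ?n (%(i, j). [:(x ** bs ! j) \<bullet> bs ! i, (b ** bs ! j) \<bullet> bs ! i:])"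
 have M: "M \<in> carrier_mat ?n ?n" by (simp add: M_def)
 let ?\<chi> = "char_poly M"
 have \<chi>: "degree ?\<chi> = ?n" "lead_coeff ?\<chi> = 1" using degree_monic_char_poly[OF M] by auto
 have ev\<chi>: "jpoly J (map_poly (%p. poly p t) ?\<chi>) (w t) = 0" for t
 proof -
  have "map_mat (%p. poly p t) M = Lmat (w t)"
   by (rule eq_matI) (auto simp: M_def Lmat_def w_def J_add inner_add_left)
  thus ?thesis using cayley_hamilton_L[of "w t"] poly_hom.char_poly_hom[OF M, of t] by simp
 qed
 have evMb: "map_poly (%p. poly p t) Mb = psmult (poly qp t) (jminpoly J (w t))" if "poly qp t ~= 0" for t
 proof (rule poly_eqI)
  fix i
  have reg: "jregular J (w t)" using that qp gdet_regular by metis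
  have "poly (coeff Mb i) t = poly qp t * coeff (jminpoly J (w t)) i"
  proof (cases i r rule: linorder_cases)
   case less thus ?thesis using jminpoly_coeff[OF reg less] np[OF less, of t] qp[of t] by (simp add: cMb)
  next
   case equal
   have "coeff (jminpoly J (w t)) r = 1" using jmin_props(1)[of "w t"] regular_degree[OF reg] by simp
   thus ?thesis using equal by (simp add: cMb)
  next
   case greater thus ?thesis using regular_degree[OF reg] by (simp add: cMb coeff_eq_0)
  qed
  thus "coeff (map_poly (%p. poly p t) Mb) i = coeff (psmult (poly qp t) (jminpoly J (w t))) i"
   by (simp add: coeff_map_poly)
 qed
 obtain K R where KR: "pseudo_divmod ?\<chi> Mb = (K, R)" by fastforce
 define c where "c = lead_coeff Mb ^ (Suc (degree ?\<chi>) - degree Mb)"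
 have c0: "c ~= 0" using Mb0 by (simp add: c_def)
 have eq: "psmult c ?\<chi> = Mb * K + R" and dR: "R = 0 \<or> degree R < r"
  using pseudo_divmod[OF Mb0 KR] by (auto simp: c_def dMb)
 \<comment> \<open>At a regular parameter value the remainder annihilates \<open>w t\<close> and has
   degree below \<open>r\<close>, hence vanishes; all but finitely many values are regular.\<close>
 have "coeff R i = 0" for i
 proof (rule ccontr)
  assume ci: "coeff R i ~= 0"
  have "poly (coeff R i) t = 0" if t: "poly qp t ~= 0" for t
  proof -
   interpret h: map_poly_comm_ring_hom "%p. poly p t" ..
   have "[:c:] * ?\<chi> = Mb * K + R" using eq by simp
   hence "R = [:c:] * ?\<chi> - Mb * K" by simp
   hence "map_poly (%p. poly p t) R = map_poly (%p. poly p t) [:c:] * map_poly (%p. poly p t) ?\<chi> -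
     map_poly (%p. poly p t) Mb * map_poly (%p. poly p t) K"
    by (simp only: h.hom_minus h.hom_mult)
   hence "jpoly J (map_poly (%p. poly p t) R) (w t) = 0"
    by (simp add: jpoly_diff jpoly_mult ev\<chi> evMb[OF t] jpoly_smult jmin_props)
   moreover have "degree (map_poly (%p. poly p t) R) < r"
    using dR rank_pos degree_map_poly_le[of "%p. poly p t" R] by (auto intro: le_less_trans)
   moreover have "jregular J (w t)" using t qp gdet_regular by metis
   ultimately have "map_poly (%p. poly p t) R = 0" unfolding jregular_iff by blast
   hence "coeff (map_poly (%p. poly p t) R) i = 0" by simp
   thus ?thesis by (simp add: coeff_map_poly)
  qed
  hence "UNIV \<subseteq> {t. poly qp t = 0} \<union> {t. poly (coeff R i) t = 0}" by auto
  moreover have "finite ({t. poly qp t = 0} \<union> {t. poly (coeff R i) t = 0})"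
   using qp0 ci by (simp add: poly_roots_finite)
  ultimately show False using finite_subset infinite_UNIV_char_0 by blast
 qed
 hence "R = 0" by (intro poly_eqI) simp
 hence eq: "psmult c ?\<chi> = Mb * K" using eq by simp
 have "content ?\<chi> = 1"
 proof -
  have "is_unit (content ?\<chi>)" using content_dvd_coeff[of ?\<chi> "degree ?\<chi>"] \<chi>(2) by simp
  thus ?thesis by (simp only: is_unit_content_iff)
 qed
 hence pp: "primitive_part ?\<chi> = ?\<chi>" by (metis content_times_primitive_part smult_1_left)
 have "psmult (unit_factor c) ?\<chi> = primitive_part Mb * primitive_part K"
  using arg_cong[OF eq, of primitive_part] by (simp add: primitive_part_mult primitive_part_smult pp)
 from arg_cong[OF this, of lead_coeff]
 have "unit_factor c = lead_coeff (primitive_part Mb) * lead_coeff (primitive_part K)"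
  by (simp only: lead_coeff_mult lead_coeff_smult \<chi>(2) mult_1_right)
 moreover have "is_unit (unit_factor c)" using c0 by (rule unit_factor_is_unit)
 ultimately have u: "is_unit (lead_coeff (primitive_part Mb))" by (metis dvd_mult_left)
 have "Mb = psmult (content Mb) (primitive_part Mb)" by (simp add: content_times_primitive_part)
 from arg_cong[OF this, of lead_coeff] have "qp = content Mb * lead_coeff (primitive_part Mb)"
  using cMb[of r] dMb by (simp only: lead_coeff_smult if_True simp_thms)
 hence "qp dvd content Mb" using u by (metis dvd_mult_unit_iff dvd_refl mult_unit_dvd_iff)
 moreover have "content Mb dvd np i0" using content_dvd_coeff[of Mb i0] i0 by (simp add: cMb)
 ultimately have "qp dvd np i0" by (rule dvd_trans)
 then obtain h where "np i0 = qp * h" by (elim dvdE)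
 thus ?thesis using np[OF i0] qp unfolding w_def by (intro exI[of _ h]) (simp add: mult.commute)
qed

lemma regular_dense: "open U ==> U ~= {} ==> \<exists>x\<in>U. jregular J x"
 using exists_regular gdet_regular rpoly_nonzero_open[OF gdet_poly] by metis

text \<open>For \<open>j > 0\<close> the candidate is the quotient of Cramer's numerator by
  \<open>gdet\<close>; uniqueness follows from agreement on the nonempty open set of regular
  elements.\<close>

lemma gen_coeff_ex1:
 assumes "j \<le> r"
 shows "\<exists>!a. rpoly a & (\<forall>x. jregular J x --> a x = (-1) ^ j * coeff (jminpoly J x) (r - j))"
proof (rule ex_ex1I)
 show "\<exists>a. rpoly a & (\<forall>x. jregular J x --> a x = (-1) ^ j * coeff (jminpoly J x) (r - j))"
 proof (cases "j = 0")
  case True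
  have "1 = (-1) ^ j * coeff (jminpoly J x) (r - j)" if "jregular J x" for x
   using jmin_props(1)[of x] regular_degree[OF that] True by simp
  thus ?thesis by (intro exI[of _ "%_. 1"] conjI rpoly_intros(2)) auto
 next
  case False
  hence i: "r - j < r" using rank_pos by simp
  obtain z where z: "gdet z ~= 0" using exists_regular gdet_regular by blast
  obtain f where f: "rpoly f" "!!x. cnum (r - j) x = f x * gdet x"
   using poly_quotient[OF cnum_poly[OF i] gdet_poly z] gdet_dvd_line i by metis
  have "f x = coeff (jminpoly J x) (r - j)" if "jregular J x" for x
   using jminpoly_coeff[OF that i] f(2)[of x] gdet_regular[of x] that by simp
  thus ?thesis using f(1) by (intro exI[of _ "%x. (-1) ^ j * f x"] conjI rpoly_intros(2,4)) auto
 qed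
next
 fix a b
 assume a: "rpoly a & (\<forall>x. jregular J x --> a x = (-1) ^ j * coeff (jminpoly J x) (r - j))"
  and b: "rpoly b & (\<forall>x. jregular J x --> b x = (-1) ^ j * coeff (jminpoly J x) (r - j))"
 obtain z where z: "gdet z ~= 0" using exists_regular gdet_regular by blast
 have "a x = b x" for x
 proof (rule rpoly_eqI[of a b "{x. gdet x ~= 0}"])
  show "open {x. gdet x ~= 0}" by (rule open_rpoly_nonzero[OF gdet_poly])
  show "{x. gdet x ~= 0} ~= {}" using z by blast
  show "a y = b y" if "y \<in> {x. gdet x ~= 0}" for y using a b gdet_regular that by simp
 qed (use a b in blast)+
 thus "a = b" by blast
qed

abbreviation A where "A \<equiv> gen_coeff J"

lemma A_props:
 assumes "j \<le> r"
 shows "rpoly (A j) & (\<forall>x. jregular J x --> A j x = (-1) ^ j * coeff (jminpoly J x) (r - j))"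
 unfolding gen_coeff_def by (rule theI'[OF gen_coeff_ex1[OF assms]])

lemma A_poly: "j \<le> r ==> rpoly (A j)"
 using A_props[of j] by simp

lemma A_regular: "j \<le> r ==> jregular J x ==> A j x = (-1) ^ j * coeff (jminpoly J x) (r - j)"
 using A_props[of j] by simp

end

section \<open>Determinant and trace\<close>

lemma cont_rp: "rpoly p ==> continuous_on S p"
 by (rule continuous_on_polymonial_function) (simp add: real_polynomial_function_eq)

abbreviation cpoly :: "real poly => complex poly" where "cpoly \<equiv> map_poly cor"

lemma coeff_cpoly [simp]: "coeff (cpoly p) i = of_real (coeff p i)" by (simp add: coeff_map_poly)

lemma cpoly_0 [simp]: "cpoly 0 = 0" by (intro poly_eqI) simp
lemma cpoly_1 [simp]: "cpoly 1 = 1" by (intro poly_eqI) simp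
lemma cpoly_add: "cpoly (p + q) = cpoly p + cpoly q" by (intro poly_eqI) simp
lemma cpoly_pCons: "cpoly (pCons a p) = pCons (of_real a) (cpoly p)"
 by (intro poly_eqI) (auto simp: coeff_pCons split: nat.split)
lemma cpoly_mult: "cpoly (p * q) = cpoly p * cpoly q" by (intro poly_eqI) (simp add: coeff_mult)
lemma degree_cpoly: "degree (cpoly p) = degree p" by (rule degree_map_poly) simp

lemma poly_cpoly_real: "poly (cpoly p) (of_real t) = of_real (poly p t)"
 by (induction p) (simp_all add: cpoly_pCons)

lemma Re_poly_mult: "map_poly Re (cpoly a * K) = a * map_poly Re K"
 by (intro poly_eqI) (simp add: coeff_mult coeff_map_poly)
lemma Im_poly_mult: "map_poly Im (cpoly a * K) = a * map_poly Im K"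
 by (intro poly_eqI) (simp add: coeff_mult coeff_map_poly)

lemma Re_poly_pcompose: "map_poly Re (pcompose C (cpoly q)) = pcompose (map_poly Re C) q"
proof (induction C)
 case (pCons c C)
 have "map_poly Re (pcompose (pCons c C) (cpoly q)) = map_poly Re ([:c:] + cpoly q * pcompose C (cpoly q))"
  by (simp add: pcompose_pCons)
 also have "... = [:Re c:] + map_poly Re (cpoly q * pcompose C (cpoly q))"
  by (intro poly_eqI) (auto simp: coeff_map_poly coeff_pCons split: nat.split)
 also have "... = [:Re c:] + q * pcompose (map_poly Re C) q" by (simp add: Re_poly_mult pCons)
 also have "[:Re c:] + q * pcompose (map_poly Re C) q = pcompose (pCons (Re c) (map_poly Re C)) q"
  by (simp add: pcompose_pCons)
 also have "pCons (Re c) (map_poly Re C) = map_poly Re (pCons c C)"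
  by (intro poly_eqI) (auto simp: coeff_map_poly coeff_pCons split: nat.split)
 finally show ?case .
qed simp

lemma Im_poly_pcompose: "map_poly Im (pcompose C (cpoly q)) = pcompose (map_poly Im C) q"
proof (induction C)
 case (pCons c C)
 have "map_poly Im (pcompose (pCons c C) (cpoly q)) = map_poly Im ([:c:] + cpoly q * pcompose C (cpoly q))"
  by (simp add: pcompose_pCons)
 also have "... = [:Im c:] + map_poly Im (cpoly q * pcompose C (cpoly q))"
  by (intro poly_eqI) (auto simp: coeff_map_poly coeff_pCons split: nat.split)
 also have "... = [:Im c:] + q * pcompose (map_poly Im C) q" by (simp add: Im_poly_mult pCons)
 also have "[:Im c:] + q * pcompose (map_poly Im C) q = pcompose (pCons (Im c) (map_poly Im C)) q"
  by (simp add: pcompose_pCons)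
 also have "pCons (Im c) (map_poly Im C) = map_poly Im (pCons c C)"
  by (intro poly_eqI) (auto simp: coeff_map_poly coeff_pCons split: nat.split)
 finally show ?case .
qed simp

lemma degree_prod_linear: "degree (\<Prod>l\<leftarrow>ls. [:- l, 1:] :: complex poly) = length ls &
  lead_coeff (\<Prod>l\<leftarrow>ls. [:- l, 1:] :: complex poly) = 1"
proof (induction ls)
 case (Cons l ls)
 have nz: "(\<Prod>l\<leftarrow>ls. [:- l, 1:] :: complex poly) ~= 0" using Cons by auto
 have "degree ([:- l, 1:] * (root_poly ls)) = Suc (length ls)"
  using degree_mult_eq[OF _ nz, of "[:- l, 1:]"] Cons by simp
 moreover have "lead_coeff ([:- l, 1:] * (root_poly ls)) = 1"
  by (simp only: lead_coeff_mult conjunct2[OF Cons.IH]) simp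
 ultimately show ?case by simp
qed simp

lemma poly_prod_linear: "poly (\<Prod>l\<leftarrow>ls. [:- f l, 1:]) z = (\<Prod>l\<leftarrow>ls. z - f l)" for z :: complex
 by (induction ls) (simp_all add: algebra_simps)

context sjordan begin

abbreviation jd where "jd \<equiv> jdet J"
abbreviation tr where "tr \<equiv> jtr J"
abbreviation tau where "tau \<equiv> jtau J"

lemma jd_A: "jd = A r" by (simp add: jdet_def)
lemma tr_A: "tr = A 1" by (simp add: jtr_def)

lemma jd_poly: "rpoly jd" unfolding jd_A by (rule A_poly) simp

text \<open>The generic minimal polynomial at a complex argument. Being built from the polynomials
  \<open>A j\<close>, it makes sense for all \<open>y\<close> and is continuous in \<open>y\<close>,
  so that identities extend from regular elements.\<close>

definition gp :: "'a => complex => complex" where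
 "gp y z = (\<Sum>j\<le>r. of_real ((-1) ^ j * A j y) * z ^ (r - j))"

lemma gp_regular:
 assumes "jregular J y" shows "gp y z = poly (cpoly (jminpoly J y)) z"
proof -
 have "poly (cpoly (jminpoly J y)) z = (\<Sum>i\<le>r. of_real (coeff (jminpoly J y) i) * z ^ i)"
  by (simp add: poly_altdef degree_cpoly regular_degree[OF assms])
 also have "... = (\<Sum>j\<le>r. of_real (coeff (jminpoly J y) (r - j)) * z ^ (r - j))"
  by (rule sum.reindex_bij_witness[of _ "%j. r - j" "%j. r - j"]) auto
 also have "... = gp y z"
  unfolding gp_def by (intro sum.cong refl) (simp add: A_regular[OF _ assms] flip: power_mult_distrib mult.assoc)
 finally show ?thesis by simp
qed

lemma exists_roots: "\<exists>ls. length ls = degree (jminpoly J x) & cpoly (jminpoly J x) = (root_poly ls)"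
proof -
 have nz: "cpoly (jminpoly J x) ~= 0"
  using jmin_props(1)[of x] by (metis coeff_0 coeff_cpoly of_real_1 zero_neq_one)
 obtain R where R: "size R = degree (cpoly (jminpoly J x))"
  "cpoly (jminpoly J x) = psmult (lead_coeff (cpoly (jminpoly J x))) (\<Prod>l\<in>#R. [:- l, 1:])"
  using alg_closed_imp_factorization[OF nz] by blast
 have "lead_coeff (cpoly (jminpoly J x)) = 1" using jmin_props(1)[of x] by (simp add: degree_cpoly)
 hence R2: "cpoly (jminpoly J x) = (\<Prod>l\<in>#R. [:- l, 1:])" using R(2) by simp
 obtain ls where ls: "mset ls = R" using ex_mset by blast
 have "(\<Prod>l\<in>#R. [:- l, 1:]) = (root_poly ls)"
  unfolding ls[symmetric] by (metis mset_map prod_mset_prod_list)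
 moreover have "length ls = degree (jminpoly J x)"
  using R(1) degree_cpoly[of "jminpoly J x"] unfolding ls[symmetric] size_mset by (rule HOL.trans)
 ultimately show ?thesis using R2 by (intro exI[of _ ls] conjI) (simp_all only:)
qed

definition eigs :: "'a => complex list" where
 "eigs x = (SOME ls. length ls = degree (jminpoly J x) & cpoly (jminpoly J x) = (root_poly ls))"

lemma eigs: "length (eigs x) = degree (jminpoly J x)" "cpoly (jminpoly J x) = (\<Prod>l\<leftarrow>eigs x. [:- l, 1:])"
 using someI_ex[OF exists_roots[of x]] unfolding eigs_def by auto

text \<open>Spectral mapping. The polynomial \<open>C\<close> with the values of \<open>q\<close> at
  the roots as its roots becomes divisible by the minimal polynomial of \<open>x\<close> once
  \<open>q\<close> is substituted, so it annihilates \<open>jpoly J q x\<close>; being monic of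
  degree \<open>r\<close>, it is the minimal polynomial of that regular element. Real and imaginary
  parts are separated because \<open>jpoly\<close> takes real coefficients.\<close>

lemma gp_jpoly_regular:
 assumes x: "jregular J x" and y: "jregular J (jpoly J q x)"
 shows "gp (jpoly J q x) z = (\<Prod>l\<leftarrow>eigs x. z - poly (cpoly q) l)"
proof -
 let ?y = "jpoly J q x" and ?q = "cpoly q"
 define C where "C = (\<Prod>l\<leftarrow>eigs x. [:- poly ?q l, 1:])"
 have C': "C = (\<Prod>l\<leftarrow>map (poly ?q) (eigs x). [:- l, 1:])" by (simp add: C_def o_def)
 have Cdeg: "degree C = r" "lead_coeff C = 1"
  unfolding C' using degree_prod_linear[of "map (poly ?q) (eigs x)"] eigs(1)[of x] regular_degree[OF x]
  by auto
 have "cpoly (jminpoly J x) dvd pcompose C ?q"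
  unfolding eigs(2) C_def
 proof (induction "eigs x")
  case Nil thus ?case by simp
 next
  case (Cons l ls)
  have "(root_poly ls) dvd pcompose (\<Prod>l\<leftarrow>ls. [:- poly ?q l, 1:]) ?q" for ls
  proof (induction ls)
   case (Cons l ls)
   have "[:- l, 1:] dvd pcompose [:- poly ?q l, 1:] ?q"
    by (simp add: pcompose_pCons flip: poly_eq_0_iff_dvd)
   from mult_dvd_mono[OF this Cons] show ?case by (simp only: list.map prod_list.Cons pcompose_mult)
  qed simp
  thus ?case .
 qed
 then obtain K where K: "pcompose C ?q = cpoly (jminpoly J x) * K" by (elim dvdE)
 have "jpoly J (map_poly Re C) ?y = jpoly J (pcompose (map_poly Re C) q) x" by (simp add: jpoly_pcompose)
 also have "pcompose (map_poly Re C) q = jminpoly J x * map_poly Re K"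
  using Re_poly_pcompose[of C q] K Re_poly_mult by simp
 finally have ReC: "jpoly J (map_poly Re C) ?y = 0" by (simp add: jpoly_mult jmin_props)
 have "jpoly J (map_poly Im C) ?y = jpoly J (pcompose (map_poly Im C) q) x" by (simp add: jpoly_pcompose)
 also have "pcompose (map_poly Im C) q = jminpoly J x * map_poly Im K"
  using Im_poly_pcompose[of C q] K Im_poly_mult by simp
 finally have ImC: "jpoly J (map_poly Im C) ?y = 0" by (simp add: jpoly_mult jmin_props)
 have lt: "degree P < r" if "degree P \<le> r" "coeff P r = 0" for P :: "real poly"
  using that rank_pos by (metis coeff_0_degree_minus_1 degree_0 le_degree le_neq_implies_less leading_coeff_0_iff)
 have "map_poly Im C = 0"
 proof -
  have "degree (map_poly Im C) < r"
   using Cdeg degree_map_poly_le[of Im C] by (intro lt) (auto simp: coeff_map_poly)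
  thus ?thesis using y ImC unfolding jregular_iff by blast
 qed
 moreover have "map_poly Re C - jminpoly J ?y = 0"
 proof -
  have "coeff (jminpoly J ?y) r = 1" using jmin_props(1)[of ?y] regular_degree[OF y] by simp
  hence "degree (map_poly Re C - jminpoly J ?y) < r"
   using Cdeg degree_map_poly_le[of Re C] regular_degree[OF y]
   by (intro lt degree_diff_le) (auto simp: coeff_map_poly)
  moreover have "jpoly J (map_poly Re C - jminpoly J ?y) ?y = 0"
   by (simp add: jpoly_diff ReC jmin_props)
  ultimately show ?thesis using y unfolding jregular_iff by blast
 qed
 ultimately have "C = cpoly (jminpoly J ?y)"
 proof -
  assume 1: "map_poly Im C = 0" and 2: "map_poly Re C - jminpoly J ?y = 0"
  have "Im (coeff C i) = 0" for i using arg_cong[OF 1, of "%p. coeff p i"] by (simp add: coeff_map_poly)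
  moreover have "Re (coeff C i) = coeff (jminpoly J ?y) i" for i
   using arg_cong[OF 2, of "%p. coeff p i"] by (simp add: coeff_map_poly)
  ultimately show ?thesis by (intro poly_eqI complex_eqI) auto
 qed
 thus ?thesis using gp_regular[OF y] poly_prod_linear[of "poly ?q" "eigs x" z] by (simp add: C_def)
qed

text \<open>The segment from \<open>x\<close> to \<open>jpoly J p x\<close> consists of polynomials
  in \<open>x\<close> and starts at a regular element, so all but finitely many points on its line
  are regular; continuity then reaches the endpoint.\<close>

lemma gp_jpoly:
 assumes x: "jregular J x"
 shows "gp (jpoly J p x) z = (\<Prod>l\<leftarrow>eigs x. z - poly (cpoly p) l)"
proof -
 define q where "q s = [:0, 1:] + psmult s (p - [:0, 1:])" for s :: real
 define y where "y s = x + s *\<^sub>R (jpoly J p x - x)" for s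
 have y: "y s = jpoly J (q s) x" for s by (simp add: y_def q_def jpoly_add jpoly_smult jpoly_diff)
 have pq: "poly (cpoly (q s)) l = l + of_real s * (poly (cpoly p) l - l)" for s l
 proof -
  have "cpoly (q s) = [:0, 1:] + psmult (of_real s) (cpoly p - [:0, 1:])"
   by (intro poly_eqI) (auto simp: q_def coeff_pCons split: nat.split)
  thus ?thesis by simp
 qed
 obtain g where g: "!!s. gdet (y s) = poly g s" using rpoly_lineE[OF gdet_poly] unfolding y_def by blast
 have "gdet (y 0) ~= 0" using x by (simp add: y_def gdet_regular)
 hence "poly g 0 ~= 0" using g by simp
 hence fin: "finite {s. poly g s = 0}" by (intro poly_roots_finite) auto
 have "continuous_on UNIV (%s. gp (y s) z)"
 proof -
  have "continuous_on UNIV (%s. A j (y s))" if "j \<le> r" for j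
   by (rule continuous_on_compose2[OF cont_rp[OF A_poly[OF that], of UNIV]])
    (auto simp: y_def intro!: continuous_intros)
  thus ?thesis unfolding gp_def by (intro continuous_intros) auto
 qed
 moreover have "continuous_on UNIV (%s. \<Prod>l\<leftarrow>eigs x. z - (l + of_real s * (poly (cpoly p) l - l)))"
 proof -
  have "continuous_on UNIV (%s. \<Prod>l\<leftarrow>ls. z - (l + of_real s * (poly (cpoly p) l - l)))" for ls
   by (induction ls) (auto intro!: continuous_intros)
  thus ?thesis .
 qed
 ultimately have "gp (y 1) z = (\<Prod>l\<leftarrow>eigs x. z - (l + of_real 1 * (poly (cpoly p) l - l)))"
 proof (rule eq_on_open_if_dense[OF open_UNIV])
  fix U :: "real set" assume "open U" "U ~= {}"
  hence "infinite U" using finite_imp_not_open by blast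
  then obtain s where s: "s \<in> U" "poly g s ~= 0"
   using fin by (metis (mono_tags, lifting) finite_subset mem_Collect_eq subsetI)
  hence "jregular J (y s)" using g gdet_regular by metis
  hence "gp (y s) z = (\<Prod>l\<leftarrow>eigs x. z - (l + of_real s * (poly (cpoly p) l - l)))"
   using gp_jpoly_regular[OF x, of "q s" z] y[of s] pq by simp
  thus "\<exists>s\<in>U. gp (y s) z = (\<Prod>l\<leftarrow>eigs x. z - (l + of_real s * (poly (cpoly p) l - l)))" using s by blast
 qed simp
 thus ?thesis by (simp add: y_def)
qed

lemma jd_jpoly: assumes "jregular J x" shows "cor (jd (jpoly J p x)) = (\<Prod>l\<leftarrow>eigs x. poly (cpoly p) l)"
proof -
 have "gp y 0 = (-1) ^ r * of_real (jd y)" for y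
 proof -
  have "gp y 0 = (\<Sum>j\<le>r. if j = r then of_real ((-1) ^ r * A r y) else 0)"
   unfolding gp_def by (intro sum.cong refl) (auto simp: zero_power)
  thus ?thesis by (simp add: jd_A)
 qed
 moreover have "(\<Prod>l\<leftarrow>ls. 0 - poly (cpoly p) l) = (-1) ^ length ls * (\<Prod>l\<leftarrow>ls. poly (cpoly p) l)" for ls
  by (induction ls) auto
 ultimately have "(-1) ^ r * cor (jd (jpoly J p x)) = (-1) ^ r * (\<Prod>l\<leftarrow>eigs x. poly (cpoly p) l)"
  using gp_jpoly[OF assms, of p 0] eigs(1)[of x] regular_degree[OF assms] by simp
 thus ?thesis by simp
qed

lemma regular_extend:
 fixes f g :: "'a => 'b::t2_space"
 assumes "continuous_on UNIV f" "continuous_on UNIV g" "!!x. jregular J x ==> f x = g x"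
 shows "f x = g x"
 by (rule eq_on_open_if_dense[OF open_UNIV assms(1,2)]) (use regular_dense assms(3) in blast)+

lemma cont_jpoly: "continuous_on UNIV (%x. jpoly J p x)"
 by (rule continuous_on_polymonial_function) (rule poly_jpoly)

lemma jd_mult_jpoly: "jd (jpoly J p x ** jpoly J q x) = jd (jpoly J p x) * jd (jpoly J q x)"
proof (rule regular_extend[where f = "%x. jd (jpoly J p x ** jpoly J q x)" and g = "%x. jd (jpoly J p x) * jd (jpoly J q x)"])
 show "continuous_on UNIV (%x. jd (jpoly J p x ** jpoly J q x))"
  unfolding jpoly_mult[symmetric]
  by (rule continuous_on_compose2[OF cont_rp[OF jd_poly] cont_jpoly]) auto
 show "continuous_on UNIV (%x. jd (jpoly J p x) * jd (jpoly J q x))"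
  by (intro continuous_intros continuous_on_compose2[OF cont_rp[OF jd_poly] cont_jpoly]) auto
 fix x assume x: "jregular J x"
 have "(\<Prod>l\<leftarrow>ls. poly (cpoly (p * q)) l) = (\<Prod>l\<leftarrow>ls. poly (cpoly p) l) * (\<Prod>l\<leftarrow>ls. poly (cpoly q) l)" for ls
  by (induction ls) (simp_all add: cpoly_mult)
 hence "cor (jd (jpoly J (p * q) x)) = cor (jd (jpoly J p x) * jd (jpoly J q x))"
  using jd_jpoly[OF x] by simp
 thus "jd (jpoly J p x ** jpoly J q x) = jd (jpoly J p x) * jd (jpoly J q x)"
  by (simp only: jpoly_mult of_real_eq_iff)
qed

lemma jd_scale: "jd (c *\<^sub>R e) = c ^ r"
proof -
 obtain x where x: "jregular J x" using exists_regular by blast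
 have "(\<Prod>l\<leftarrow>ls. poly (cpoly [:c:]) l) = cor c ^ length ls" for ls :: "complex list"
  by (induction ls) (simp_all add: cpoly_pCons)
 hence "cor (jd (c *\<^sub>R e)) = cor c ^ r"
  using jd_jpoly[OF x, of "[:c:]"] eigs(1)[of x] regular_degree[OF x] by (simp add: jpoly_const)
 thus ?thesis by (metis of_real_eq_iff of_real_power)
qed

lemma jd_e [simp]: "jd e = 1" using jd_scale[of 1] by simp

lemma A_0 [simp]: "A 0 x = 1"
proof (rule regular_extend[where f = "A 0" and g = "%_. 1"])
 show "continuous_on UNIV (A 0)" by (intro cont_rp A_poly) simp
 fix x assume x: "jregular J x"
 show "A 0 x = 1" using A_regular[OF _ x, of 0] jmin_props(1)[of x] regular_degree[OF x] by simp
qed simp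

text \<open>For \<open>t \<noteq> 0\<close> the product of \<open>1 + t * l\<close> over the roots
  \<open>l\<close> is \<open>(- t)^r\<close> times the generic minimal polynomial at
  \<open>- 1 / t\<close>.\<close>

lemma jd_e_plus: "jd (e + t *\<^sub>R x) = (\<Sum>j\<le>r. A j x * t ^ j)"
proof (cases "t = 0")
 case True thus ?thesis by (simp add: power_0_left if_distrib[of "%c. _ * c"] cong: if_cong)
next
 case False
 show ?thesis
 proof (rule regular_extend[where f = "%x. jd (e + t *\<^sub>R x)" and g = "%x. \<Sum>j\<le>r. A j x * t ^ j"])
  show "continuous_on UNIV (%x. jd (e + t *\<^sub>R x))"
   by (rule continuous_on_compose2[OF cont_rp[OF jd_poly, of UNIV]]) (auto intro!: continuous_intros)
  show "continuous_on UNIV (%x. \<Sum>j\<le>r. A j x * t ^ j)"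
   by (intro continuous_intros cont_rp A_poly) auto
  fix x assume x: "jregular J x"
  have xX: "e + t *\<^sub>R x = jpoly J [:1, t:] x" by (simp add: jpoly_pCons)
  have "(\<Prod>l\<leftarrow>ls. poly (cpoly [:1, t:]) l) = (- of_real t) ^ length ls * (\<Prod>l\<leftarrow>ls. - 1 / of_real t - l)" for ls
   using False by (induction ls) (auto simp: cpoly_pCons field_simps)
  hence "cor (jd (e + t *\<^sub>R x)) = (- of_real t) ^ r * gp x (- 1 / of_real t)"
   using jd_jpoly[OF x, of "[:1, t:]"] gp_jpoly[OF x, of "[:0, 1:]" "- 1 / of_real t"] eigs(1)[of x] regular_degree[OF x]
   unfolding xX by (simp add: cpoly_pCons)
  also have "... = (\<Sum>j\<le>r. of_real (A j x * t ^ j))"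
   unfolding gp_def sum_distrib_left
  proof (rule sum.cong[OF refl])
   fix j assume "j \<in> {..r}"
   hence "(- cor t) ^ r = (- of_real t) ^ j * (- of_real t) ^ (r - j)" by (simp flip: power_add)
   moreover have "(- cor t) ^ (r - j) * (- 1 / of_real t) ^ (r - j) = 1"
    using False by (simp flip: power_mult_distrib)
   moreover have "(- cor t) ^ j * (-1) ^ j = of_real t ^ j"
    by (simp flip: power_mult_distrib)
   ultimately show "(- cor t) ^ r * (of_real ((- 1) ^ j * A j x) * (- 1 / of_real t) ^ (r - j)) = of_real (A j x * t ^ j)"
    by (simp add: mult_ac)
  qed
  finally show "jd (e + t *\<^sub>R x) = (\<Sum>j\<le>r. A j x * t ^ j)"
   by (metis (no_types, lifting) of_real_eq_iff of_real_sum sum.cong)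
 qed
qed

lemma cayley_hamilton: "(\<Sum>j\<le>r. ((-1) ^ j * A j x) *\<^sub>R jpow J x (r - j)) = 0"
proof (rule regular_extend[where f = "%x. \<Sum>j\<le>r. ((-1) ^ j * A j x) *\<^sub>R jpow J x (r - j)" and g = "%_. 0"])
 show "continuous_on UNIV (%x. \<Sum>j\<le>r. ((-1) ^ j * A j x) *\<^sub>R jpow J x (r - j))"
  by (intro continuous_intros cont_rp A_poly continuous_on_polymonial_function poly_jpow) auto
 fix x assume x: "jregular J x"
 have "(\<Sum>j\<le>r. ((-1) ^ j * A j x) *\<^sub>R jpow J x (r - j)) = (\<Sum>j\<le>r. coeff (jminpoly J x) (r - j) *\<^sub>R jpow J x (r - j))"
  by (intro sum.cong refl) (simp add: A_regular[OF _ x] flip: power_mult_distrib mult.assoc)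
 also have "... = (\<Sum>i\<le>r. coeff (jminpoly J x) i *\<^sub>R jpow J x i)"
  by (rule sum.reindex_bij_witness[of _ "%j. r - j" "%j. r - j"]) auto
 also have "... = jpoly J (jminpoly J x) x" by (simp add: jpoly_def regular_degree[OF x])
 finally show "(\<Sum>j\<le>r. ((-1) ^ j * A j x) *\<^sub>R jpow J x (r - j)) = 0" by (simp add: jmin_props)
qed simp

lemma A_hasd: "j \<le> r ==> (A j has_derivative fderiv (A j) (at x)) (at x)"
 using differentiable_at_real_polynomial_function[OF A_poly] frechet_derivative_works by blast

lemma jd_hasd: "(jd has_derivative fderiv jd (at x)) (at x)"
 unfolding jd_A by (rule A_hasd) simp

lemma line_deriv:
 assumes "(f has_derivative D) (at x)"
 shows "((%t. f (x + t *\<^sub>R h)) has_vector_derivative D h) (at 0)"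
proof -
 have 1: "((%t. x + t *\<^sub>R h) has_derivative (%t. t *\<^sub>R h)) (at 0)" by (auto intro!: derivative_eq_intros)
 have "((%t. f (x + t *\<^sub>R h)) has_derivative (%t. D (t *\<^sub>R h))) (at 0)"
  using has_derivative_compose[OF 1, of f D] assms by simp
 thus ?thesis unfolding has_vector_derivative_def
  using linear_scale[OF has_derivative_linear[OF assms]] by simp
qed

lemma jd_deriv_e: "fderiv jd (at e) x = tr x"
proof -
 have "((%t. jd (e + t *\<^sub>R x)) has_real_derivative fderiv jd (at e) x) (at 0)"
  using line_deriv[OF jd_hasd] by (simp add: has_real_derivative_iff_has_vector_derivative)
 moreover have "((%t. jd (e + t *\<^sub>R x)) has_real_derivative tr x) (at 0)"
 proof -
  have "((%t. \<Sum>j\<le>r. A j x * t ^ j) has_real_derivative (\<Sum>j\<le>r. A j x * (of_nat j * 0 ^ (j - 1)))) (at 0)"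
   by (auto intro!: derivative_eq_intros simp: mult_ac)
  moreover have "(\<Sum>j\<le>r. A j x * (of_nat j * 0 ^ (j - 1))) = (\<Sum>j\<le>r. if j = 1 then A 1 x else 0)"
  proof (intro sum.cong refl)
   fix j show "A j x * (of_nat j * 0 ^ (j - 1)) = (if j = 1 then A 1 x else 0)"
    by (cases "j = 0 \<or> j = 1") auto
  qed
  ultimately show ?thesis using rank_pos unfolding jd_e_plus tr_A by simp
 qed
 ultimately show ?thesis by (rule DERIV_unique)
qed

lemma tr_linear: "linear tr"
proof -
 have "tr = fderiv jd (at e)" using jd_deriv_e by (simp add: fun_eq_iff)
 thus ?thesis using has_derivative_linear[OF jd_hasd, of e] by simp
qed

lemma tr_e: "tr e = real r"
proof -
 have "((%t. jd (e + t *\<^sub>R e)) has_real_derivative tr e) (at 0)"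
  using line_deriv[OF jd_hasd, of e e] jd_deriv_e[of e]
  by (simp add: has_real_derivative_iff_has_vector_derivative)
 moreover have "jd (e + t *\<^sub>R e) = (1 + t) ^ r" for t
  using jd_scale[of "1 + t"] by (simp add: scaleR_left_distrib)
 moreover have "((%t::real. (1 + t) ^ r) has_real_derivative real r) (at 0)"
  by (auto intro!: derivative_eq_intros)
 ultimately show ?thesis using DERIV_unique by simp
qed

lemma J_has_vector_deriv:
 assumes "(f has_vector_derivative f') (at t)" "(g has_vector_derivative g') (at t)"
 shows "((%t. f t ** g t) has_vector_derivative (f t ** g' + f' ** g t)) (at t)"
 using bounded_bilinear.has_vector_derivative[OF bdd assms] .

text \<open>The Cayley-Hamilton relation is differentiated at a regular \<open>x\<close> along
  \<open>Dop a b x\<close>. The terms that differentiate the powers form the derivation applied to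
  the relation, hence vanish; the differentiated coefficients then give a relation of degree below
  \<open>r\<close>, so all of them are zero, in particular that of the trace.\<close>

lemma tr_derivation: "tr (Dop a b x) = 0"
proof (rule regular_extend[where f = "%x. tr (Dop a b x)" and g = "%_. 0"])
 let ?D = "Dop a b"
 have "linear (%x. tr (?D x))" using linear_compose[OF Dop_linear tr_linear] by (simp add: o_def)
 thus "continuous_on UNIV (%x. tr (?D x))" by (rule linear_continuous_on[OF linear_conv_bounded_linear[THEN iffD1]])
 fix x assume x: "jregular J x"
 let ?h = "?D x"
 have De: "?D e = 0" by (simp add: Dop_def comm)
 have pw: "((%t. jpow J (x + t *\<^sub>R ?h) k) has_vector_derivative ?D (jpow J x k)) (at 0)" for k
 proof (induction k)
  case 0 show ?case by (simp add: De)
 next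
  case (Suc k)
  have "((%t. x + t *\<^sub>R ?h) has_vector_derivative ?h) (at 0)"
   by (auto intro!: derivative_eq_intros)
  from J_has_vector_deriv[OF this Suc] show ?case by (simp add: Dop_derivation add.commute)
 qed
 define A' where "A' j = fderiv (A j) (at x) ?h" for j
 have Ad: "((%t. A j (x + t *\<^sub>R ?h)) has_real_derivative A' j) (at 0)" if "j \<le> r" for j
  using line_deriv[OF A_hasd[OF that]]
  by (simp add: A'_def has_real_derivative_iff_has_vector_derivative)
 have "((%t. \<Sum>j\<le>r. ((-1) ^ j * A j (x + t *\<^sub>R ?h)) *\<^sub>R jpow J (x + t *\<^sub>R ?h) (r - j)) has_vector_derivative
  (\<Sum>j\<le>r. ((-1) ^ j * A j (x + 0 *\<^sub>R ?h)) *\<^sub>R ?D (jpow J x (r - j)) + ((-1) ^ j * A' j) *\<^sub>R jpow J (x + 0 *\<^sub>R ?h) (r - j))) (at 0)"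
  by (intro has_vector_derivative_sum has_vector_derivative_scaleR pw DERIV_cmult Ad) auto
 hence "((%t::real. 0 :: 'a) has_vector_derivative
  (\<Sum>j\<le>r. ((-1) ^ j * A j x) *\<^sub>R ?D (jpow J x (r - j)) + ((-1) ^ j * A' j) *\<^sub>R jpow J x (r - j))) (at 0)"
  unfolding cayley_hamilton by simp
 hence "(\<Sum>j\<le>r. ((-1) ^ j * A j x) *\<^sub>R ?D (jpow J x (r - j)) + ((-1) ^ j * A' j) *\<^sub>R jpow J x (r - j)) = 0"
  using vector_derivative_unique_at has_vector_derivative_const by blast
 moreover have "(\<Sum>j\<le>r. ((-1) ^ j * A j x) *\<^sub>R ?D (jpow J x (r - j))) = ?D (\<Sum>j\<le>r. ((-1) ^ j * A j x) *\<^sub>R jpow J x (r - j))"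
  by (simp add: linear_sum[OF Dop_linear] linear_scale[OF Dop_linear])
 ultimately have s: "(\<Sum>j\<le>r. ((-1) ^ j * A' j) *\<^sub>R jpow J x (r - j)) = 0"
  unfolding cayley_hamilton by (simp add: sum.distrib linear_0[OF Dop_linear])
 have "A' 0 = 0"
 proof -
  have "A 0 = (%_. 1)" by (simp add: fun_eq_iff)
  thus ?thesis by (simp add: A'_def)
 qed
 define q where "q = (\<Sum>j\<le>r. monom ((-1) ^ j * A' j) (r - j))"
 have "jpoly J q x = 0" using s by (simp add: q_def jpoly_sum jpoly_monom)
 moreover have "degree q < r"
 proof -
  have "degree (monom ((-1) ^ j * A' j) (r - j)) \<le> r - 1" if "j \<le> r" for j
   using \<open>A' 0 = 0\<close> by (cases "j = 0") (auto intro: order_trans[OF degree_monom_le])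
  hence "degree q \<le> r - 1" unfolding q_def by (intro degree_sum_le) auto
  thus ?thesis using rank_pos by simp
 qed
 ultimately have "q = 0" using x unfolding jregular_iff by blast
 hence "coeff q (r - 1) = 0" by simp
 moreover have "coeff q (r - 1) = (\<Sum>j\<le>r. if j = 1 then - A' 1 else 0)"
  unfolding q_def coeff_sum using rank_pos by (intro sum.cong refl) auto
 ultimately have "A' 1 = 0" using rank_pos by simp
 moreover have "A' 1 = tr ?h"
 proof -
  have "(tr has_derivative tr) (at x)"
   using bounded_linear_imp_has_derivative tr_linear linear_conv_bounded_linear by blast
  hence "fderiv tr (at x) ?h = tr ?h" by (rule fderiv_eqI)
  thus ?thesis by (simp add: A'_def tr_A)
 qed
 ultimately show "tr ?h = 0" by simp
qed simp

lemma tau_def: "tau x y = tr (x ** y)" by (simp add: jtau_def)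

lemma tau_sym: "tau x y = tau y x" by (simp add: tau_def comm)

text \<open>The defect of associativity is the trace of an inner derivation.\<close>

lemma tau_assoc: "tau (x ** y) z = tau x (y ** z)"
proof -
 have "tr (x ** (z ** y)) = tr (z ** (x ** y))"
  using tr_derivation[of x z y] by (simp add: Dop_def linear_diff[OF tr_linear])
 thus ?thesis by (simp add: tau_def comm)
qed

lemma tau_e [simp]: "tau e x = tr x" "tau x e = tr x" by (simp_all add: tau_def)

lemma tau_linear: "linear (tau x)" "linear (%x. tau x y)"
 using linear_compose[OF linL tr_linear, of x] linear_compose[OF linL tr_linear, of y]
 by (simp_all add: tau_def[abs_def] o_def comm[of _ y])

lemmas tau_add = linear_add[OF tau_linear(1)] linear_add[OF tau_linear(2)]
lemmas tau_scale = linear_scale[OF tau_linear(1)] linear_scale[OF tau_linear(2)]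
lemmas tau_diff = linear_diff[OF tau_linear(1)] linear_diff[OF tau_linear(2)]
lemmas tau_sum = linear_sum[OF tau_linear(1)] linear_sum[OF tau_linear(2)]
lemmas tau_zero [simp] = linear_0[OF tau_linear(1)] linear_0[OF tau_linear(2)]
lemmas tau_neg = linear_neg[OF tau_linear(1)] linear_neg[OF tau_linear(2)]

text \<open>The radical of \<open>tau\<close> is an ideal, and it misses the unit because
  \<open>tau e e\<close> is the rank.\<close>

lemma tau_nondegenerate: assumes "!!y. tau x y = 0" shows "x = 0"
proof -
 let ?I = "{x. \<forall>y. tau x y = 0}"
 have "jordan_ideal J ?I" unfolding jordan_ideal_def
 proof
  show "subspace ?I" unfolding subspace_def by (simp add: tau_add tau_scale)
  show "\<forall>x\<in>?I. \<forall>y. y ** x \<in> ?I"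
  proof (intro ballI allI CollectI)
   fix x y z assume "x \<in> ?I"
   thus "tau (y ** x) z = 0" using tau_assoc[of x y z] by (simp add: comm[of y x])
  qed
 qed
 moreover have "e \<notin> ?I"
 proof
  assume "e \<in> ?I"
  hence "tau e e = 0" by blast
  thus False using tr_e rank_pos by simp
 qed
 ultimately have "?I = {0}" using ideal_cases by blast
 thus ?thesis using assms by blast
qed

lemma tau_eqI: "(!!z. tau x z = tau y z) ==> x = y"
 using tau_nondegenerate[of "x - y"] by (simp add: tau_diff)

definition Sg :: "'a => 'a" where "Sg y = (\<Sum>b\<in>Basis. tau b y *\<^sub>R b)"

lemma tau_inner: "tau x y = x \<bullet> Sg y"
proof -
 have "tau x y = tau (\<Sum>b\<in>Basis. (x \<bullet> b) *\<^sub>R b) y" by (simp only: euclidean_representation)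
 also have "... = x \<bullet> Sg y" by (simp add: tau_sum tau_scale Sg_def inner_sum_right mult.commute)
 finally show ?thesis .
qed

lemma Sg_linear: "linear Sg"
 by (rule linearI) (simp_all add: Sg_def tau_add tau_scale scaleR_left_distrib sum.distrib scaleR_sum_right)

lemma Sg_bij: "bij Sg"
proof -
 have "Sg x = 0 ==> x = 0" for x
  by (rule tau_nondegenerate) (metis inner_zero_right tau_inner tau_sym)
 hence "inj Sg" by (simp add: linear_injective_0[OF Sg_linear])
 thus ?thesis using linear_injective_imp_surjective[OF Sg_linear] by (simp add: bij_def)
qed

text \<open>The vectors \<open>dl b\<close> form the \<open>tau\<close>-dual of the standard basis;
  through them sums over \<open>Basis\<close> express quantities that depend on \<open>tau\<close>
  only.\<close>

definition dl :: "'a => 'a" where "dl = inv_into UNIV Sg"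

lemma tau_dl: "tau x (dl y) = x \<bullet> y"
 by (simp add: tau_inner dl_def surj_f_inv_f[OF bij_is_surj[OF Sg_bij]])

end

section \<open>Traces of multiplication operators\<close>

definition Trc :: "('a::euclidean_space => 'a) => real" where
 "Trc f = (\<Sum>b\<in>Basis. f b \<bullet> b)"

lemma Trc_neg: "Trc (%x. - f x) = - Trc f"
 by (simp add: Trc_def sum_negf)

lemma Trc_diff: "Trc (%x. f x - g x) = Trc f - Trc g"
 by (simp add: Trc_def inner_diff_left sum_subtractf)

lemma Trc_comp_commute:
 fixes f g :: "'a::euclidean_space => 'a"
 assumes "linear f" "linear g" shows "Trc (%x. f (g x)) = Trc (%x. g (f x))"
proof -
 have *: "Trc (%x. f (g x)) = (\<Sum>b\<in>Basis. \<Sum>c\<in>Basis. (g b \<bullet> c) * (f c \<bullet> b))" if "linear f" for f g :: "'a => 'a"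
 proof -
  have "f (g b) = (\<Sum>c\<in>Basis. (g b \<bullet> c) *\<^sub>R f c)" for b
   using linear_sum[OF that, of "%c. (g b \<bullet> c) *\<^sub>R c" Basis] linear_scale[OF that]
   by (simp add: euclidean_representation)
  thus ?thesis by (simp add: Trc_def inner_sum_left)
 qed
 show ?thesis unfolding *[OF assms(1)] *[OF assms(2)] by (subst sum.swap) (simp add: mult.commute)
qed

lemma Trc_adjoint:
 fixes f :: "'a::euclidean_space => 'a"
 assumes "linear f" shows "Trc (adjoint f) = Trc f"
 unfolding Trc_def using adjoint_clauses[OF assms] by (simp add: inner_commute)

text \<open>A complex structure is skew for the averaged inner product defined by \<open>M\<close>,
  the identity plus the adjoint of \<open>T\<close> composed with \<open>T\<close>. So the adjoint
  is conjugate to \<open>- T\<close>, and equality of the traces of \<open>T\<close> and its adjoint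
  forces zero.\<close>

lemma Trc_square_neg:
 fixes T :: "'a::euclidean_space => 'a"
 assumes T: "linear T" and sq: "!!x. T (T x) = - x"
 shows "Trc T = 0"
proof -
 let ?S = "adjoint T"
 have S: "linear ?S" by (rule adjoint_linear[OF T])
 have ST: "x \<bullet> ?S y = T x \<bullet> y" for x y by (rule adjoint_works[OF T])
 define M where "M x = x + ?S (T x)" for x
 have M: "linear M" unfolding M_def using T S
  by (intro linear_compose_add linear_ident linear_compose[of T ?S, unfolded o_def])
 have "M x = 0 ==> x = 0" for x
 proof -
  assume "M x = 0"
  hence "x \<bullet> x + T x \<bullet> T x = 0" using ST[of x "T x"] by (metis M_def inner_add_right inner_zero_right)
  thus "x = 0" by (metis add_nonneg_eq_0_iff inner_eq_zero_iff inner_ge_zero)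
 qed
 hence injM: "inj M" by (simp add: linear_injective_0[OF M])
 hence surM: "surj M" using linear_injective_imp_surjective[OF M] by simp
 obtain N where N: "linear N" "!!x. N (M x) = x"
  using linear_injective_left_inverse[OF M injM] by (auto simp: fun_eq_iff)
 have MN: "M (N x) = x" for x by (metis N(2) surM surjD)
 have SS: "?S (?S x) = - x" for x
 proof (rule euclidean_eqI)
  fix b :: 'a
  have "b \<bullet> ?S (?S x) = T (T b) \<bullet> x" by (simp add: ST)
  thus "?S (?S x) \<bullet> b = - x \<bullet> b" by (simp add: sq inner_commute)
 qed
 have "?S (M x) = - M (T x)" for x
  by (simp add: M_def linear_add[OF S] linear_neg[OF S] SS sq linear_diff[OF S])
 hence "?S x = - M (T (N x))" for x using MN by metis
 hence "?S = (%x. - M (T (N x)))" by (rule ext)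
 hence "Trc ?S = - Trc (%x. M (T (N x)))" by (simp add: Trc_neg)
 also have "Trc (%x. M (T (N x))) = Trc (%x. T (N (M x)))"
  using Trc_comp_commute[OF M linear_compose[OF N(1) T]] by (simp add: o_def)
 finally show ?thesis using Trc_adjoint[OF T] by (simp add: N(2))
qed

lemma imaginary_roots_coeff:
 assumes "!!z. z \<in> set ls ==> z = \<i> \<or> z = - \<i>"
 shows "\<exists>u::real. coeff (root_poly ls) 1 = \<i> * of_real u * coeff (root_poly ls) 0"
 using assms
proof (induction ls)
 case Nil show ?case by (auto intro: exI[of _ 0])
next
 case (Cons z ls)
 then obtain u :: real where u: "coeff (root_poly ls) 1 = \<i> * of_real u * coeff (root_poly ls) 0" by auto
 let ?P = "\<Prod>l\<leftarrow>ls. [:- l, 1:]"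
 have 0: "coeff (root_poly (z # ls)) 0 = - z * coeff ?P 0" by simp
 have 1: "coeff (root_poly (z # ls)) 1 = coeff ?P 0 - z * coeff ?P 1" by simp
 from Cons.prems have "z = \<i> \<or> z = - \<i>" by simp
 thus ?case
 proof
  assume z: "z = \<i>"
  have "coeff (root_poly (z # ls)) 1 = \<i> * of_real (u + 1) * coeff (root_poly (z # ls)) 0"
   using u by (simp add: 0 1[unfolded One_nat_def] z algebra_simps)
  thus ?thesis by blast
 next
  assume z: "z = - \<i>"
  have "coeff (root_poly (z # ls)) 1 = \<i> * of_real (u - 1) * coeff (root_poly (z # ls)) 0"
   using u by (simp add: 0 1[unfolded One_nat_def] z algebra_simps)
  thus ?thesis by blast
 qed
qed

context sjordan begin

lemma TrL_Dop: "Trc (J (Dop a b z)) = 0"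
proof -
 have "J (Dop a b z) = (%x. Dop a b (z ** x) - z ** Dop a b x)"
  by (simp add: fun_eq_iff Dop_derivation)
 thus ?thesis using Trc_comp_commute[OF Dop_linear linL] by (simp add: Trc_diff)
qed

lemma TrL_linear: "linear (%z. Trc (J z))"
 by (rule linearI) (simp_all add: Trc_def J_add inner_add_left sum.distrib sum_distrib_left)

lemma functional_rep: assumes "linear f" shows "\<exists>c. \<forall>x. f x = tau x c"
proof (intro exI allI)
 fix x
 have "f x = (\<Sum>b\<in>Basis. (x \<bullet> b) * f b)"
  using linear_sum[OF assms, of "%b. (x \<bullet> b) *\<^sub>R b" Basis] linear_scale[OF assms]
  by (simp add: euclidean_representation)
 thus "f x = tau x (\<Sum>b\<in>Basis. f b *\<^sub>R dl b)" by (simp add: tau_sum tau_scale tau_dl mult.commute)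
qed

text \<open>The polynomial \<open>P t = jd (e + t j)\<close> satisfies
  \<open>P t * P (- t) = (1 + t^2)^r\<close>, so its complex roots are among \<open>\<i>\<close> and
  \<open>- \<i>\<close>. Its linear coefficient is then a purely imaginary multiple of the constant
  one, which is \<open>1\<close>; but it is the real number \<open>tr j\<close>.\<close>

lemma trace_zero_of_square: assumes "j ** j = - e" shows "tr j = 0"
proof -
 define P where "P = (\<Sum>i\<le>r. monom (A i j) i)"
 have P: "poly P t = jd (e + t *\<^sub>R j)" for t by (simp add: P_def poly_sum poly_monom jd_e_plus)
 have c: "coeff P 0 = 1" "coeff P 1 = tr j" using rank_pos by (simp_all add: P_def coeff_sum tr_A)
 have PP: "poly (P * pcompose P [:0, -1:]) t = poly ([:1, 0, 1:] ^ r) t" for t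
 proof -
  have "(e + t *\<^sub>R j) ** (e + (- t) *\<^sub>R j) = (1 + t * t) *\<^sub>R e"
   by (simp add: J_add J_diff assms algebra_simps)
  moreover have "e + s *\<^sub>R j = jpoly J [:1, s:] j" for s by (simp add: jpoly_pCons)
  ultimately have "jd (e + t *\<^sub>R j) * jd (e + (- t) *\<^sub>R j) = (1 + t * t) ^ r"
   using jd_mult_jpoly[of "[:1, t:]" j "[:1, - t:]"] jd_scale by metis
  thus ?thesis by (simp add: poly_pcompose P)
 qed
 hence "P * pcompose P [:0, -1:] = [:1, 0, 1:] ^ r" using poly_eq_poly_eq_iff by blast
 hence "cpoly P * cpoly (pcompose P [:0, -1:]) = cpoly ([:1, 0, 1:] ^ r)" by (metis cpoly_mult)
 moreover have "cpoly ([:1, 0, 1:] ^ r) = [:1, 0, 1:] ^ r"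
 proof -
  have "cpoly (p ^ n) = cpoly p ^ n" for p n by (induction n) (simp_all add: cpoly_mult)
  thus ?thesis by (simp add: cpoly_pCons)
 qed
 ultimately have root: "z = \<i> \<or> z = - \<i>" if "poly (cpoly P) z = 0" for z
 proof -
  assume "cpoly P * cpoly (pcompose P [:0, -1:]) = cpoly ([:1, 0, 1:] ^ r)"
   "cpoly ([:1, 0, 1:] ^ r) = [:1, 0, 1:] ^ r"
  hence "poly ([:1, 0, 1:] ^ r) z = 0" using that by (metis mult_zero_left poly_mult)
  hence "1 + z * z = 0" by (simp add: poly_power)
  hence "(z - \<i>) * (z + \<i>) = 0" by (simp add: algebra_simps)
  thus ?thesis by (simp add: eq_neg_iff_add_eq_0)
 qed
 have nz: "cpoly P ~= 0" using c(1) by (metis coeff_0 coeff_cpoly of_real_1 zero_neq_one)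
 obtain R where R: "cpoly P = psmult (lead_coeff (cpoly P)) (\<Prod>l\<in>#R. [:- l, 1:])"
  using alg_closed_imp_factorization[OF nz] by blast
 obtain ls where ls: "mset ls = R" using ex_mset by blast
 have R': "(\<Prod>l\<in>#R. [:- l, 1:]) = (root_poly ls)"
  unfolding ls[symmetric] by (metis mset_map prod_mset_prod_list)
 have "z = \<i> \<or> z = - \<i>" if "z \<in> set ls" for z
 proof (rule root)
  have "poly (root_poly ls) z = (\<Prod>l\<leftarrow>ls. z - l)" using poly_prod_linear[of "%l. l"] by simp
  also have "... = 0" using that by (simp add: prod_list_zero_iff)
  finally show "poly (cpoly P) z = 0" by (subst R) (simp add: R')
 qed
 then obtain u :: real where "coeff (root_poly ls) 1 = \<i> * of_real u * coeff (root_poly ls) 0"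
  using imaginary_roots_coeff by blast
 hence "coeff (cpoly P) 1 = \<i> * of_real u * coeff (cpoly P) 0"
  using arg_cong[OF R, of "%p. coeff p 0"] arg_cong[OF R, of "%p. coeff p 1"] R' by simp
 hence "cor (tr j) = \<i> * of_real u" using c by simp
 thus ?thesis by (metis Re_complex_of_real Re_i_times Im_complex_of_real neg_0_equal_iff_equal)
qed

text \<open>The trace form is represented by an element \<open>c\<close>, which is central because
  the trace kills \<open>Dop\<close>. By simplicity the polynomials in \<open>c\<close> have no zero
  divisors, so a root of the minimal polynomial of \<open>c\<close> gives either a scalar or a
  central \<open>j\<close> with \<open>j ** j = - e\<close>. In the second case \<open>tr j\<close>
  and the trace of multiplication by \<open>j\<close> both vanish, which contradicts the nonzero
  imaginary part of the root. So \<open>c\<close> is a multiple of the unit, and evaluation at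
  \<open>e\<close> fixes the factor.\<close>

theorem TrL: "Trc (J z) = (DIM('a) / r) * tr z"
proof -
 obtain c where c: "!!z. Trc (J z) = tau z c" using functional_rep[OF TrL_linear] by blast
 have TrLs: "Trc (J (x ** (z ** y))) = Trc (J (z ** (x ** y)))" for x y z
  using TrL_Dop[of x z y] linear_diff[OF TrL_linear, of "x ** (z ** y)" "z ** (x ** y)"] by (simp add: Dop_def)
 have central: "(c ** x) ** y = c ** (x ** y)" for x y
 proof (rule tau_eqI)
  fix z
  have "tau ((c ** x) ** y) z = tau c (x ** (y ** z))" by (simp add: tau_assoc)
  also have "... = Trc (J (x ** (z ** y)))" by (simp add: c tau_sym[of c] comm[of y z])
  also have "... = Trc (J (z ** (x ** y)))" by (rule TrLs)
  also have "... = tau (c ** (x ** y)) z" by (simp add: c tau_sym[of _ c] tau_assoc comm[of z])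
  finally show "tau ((c ** x) ** y) z = tau (c ** (x ** y)) z" .
 qed
 have cJ: "jpoly J q c ** (x ** u) = x ** (jpoly J q c ** u)" for q x u
 proof -
  have 1: "c ** (x ** u) = x ** (c ** u)" for u
   using central[of u x] by (simp add: comm[of x])
  have 2: "(c ** c) ** (x ** u) = x ** ((c ** c) ** u)" for u
   by (simp add: central 1)
  show ?thesis using genL_commute_gen[OF linL 1 2 jpoly_genL] .
 qed
 have ideal: "jordan_ideal J {u. jpoly J q c ** u = 0}" for q
  unfolding jordan_ideal_def subspace_def by (auto simp: J_add cJ)
 have ker: "jpoly J q c = 0" if "u ~= 0" "jpoly J q c ** u = 0" for q u
 proof -
  have "{u. jpoly J q c ** u = 0} = UNIV" using ideal_cases[OF ideal[of q]] that by blast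
  hence "jpoly J q c ** e = 0" by blast
  thus ?thesis by simp
 qed
 let ?m = "jminpoly J c"
 have factor: "jpoly J q c = 0" if qm: "q dvd ?m" and dq: "degree q > 0" for q
 proof -
  obtain k where k: "?m = q * k" using qm unfolding dvd_def by blast
  have "k ~= 0" "q ~= 0" using k jminpoly_nonzero[of c] by auto
  hence "degree k < degree ?m" using dq k by (simp add: degree_mult_eq)
  hence "jpoly J k c ~= 0" using jmin_props(3)[OF \<open>k ~= 0\<close>] by force
  moreover have "jpoly J q c ** jpoly J k c = 0"
   using jmin_props(2)[of c] k by (simp flip: jpoly_mult)
  ultimately show ?thesis by (rule ker)
 qed
 have dm: "degree ?m > 0"
 proof (rule ccontr)
  assume "\<not> degree ?m > 0"
  then obtain a where a: "?m = [:a:]" using degree_eq_zeroE by blast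
  thus False using jmin_props(1)[of c] jmin_props(2)[of c] e_nonzero by (simp add: jpoly_const)
 qed
 have "degree (cpoly ?m) > 0" using dm by (simp add: degree_cpoly)
 then obtain l where l: "poly (cpoly ?m) l = 0"
  using fundamental_theorem_of_algebra constant_degree by (metis less_irrefl)
 have "\<exists>a. c = a *\<^sub>R e"
 proof (cases "Im l = 0")
  case True
  hence "l = of_real (Re l)" by (simp add: complex_eq_iff)
  hence "poly ?m (Re l) = 0" using l by (metis of_real_eq_0_iff poly_cpoly_real)
  hence "[:- Re l, 1:] dvd ?m" by (simp add: poly_eq_0_iff_dvd)
  from factor[OF this] have "c = Re l *\<^sub>R e" by (simp add: jpoly_pCons)
  thus ?thesis by blast
 next
  case False
  define q where "q = [:(Re l)\<^sup>2 + (Im l)\<^sup>2, - 2 * Re l, 1:]"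
  have ql: "poly (cpoly q) l = 0"
   by (simp add: q_def cpoly_pCons complex_eq_iff power2_eq_square algebra_simps)
  have qdvd: "q dvd ?m"
  proof -
   define R where "R = ?m mod q"
   have "q ~= 0" by (simp add: q_def)
   hence "R = 0 \<or> degree R < degree q" unfolding R_def by (rule degree_mod_less)
   hence "degree R \<le> 1" by (auto simp: q_def)
   hence "R = [:coeff R 0, coeff R 1:]"
    by (intro poly_eqI) (auto simp: coeff_pCons coeff_eq_0 split: nat.split)
   then obtain u v where uv: "R = [:u, v:]" by blast
   have "?m = ?m div q * q + R" unfolding R_def by (rule div_mult_mod_eq[symmetric])
   hence "poly (cpoly ?m) l = poly (cpoly R) l" using ql by (metis add_0 cpoly_add cpoly_mult mult_zero_right poly_add poly_mult)
   hence "of_real u + l * of_real v = 0" using l by (simp add: uv cpoly_pCons)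
   hence "u + Re l * v = 0 & v = 0" using False by (auto simp: complex_eq_iff)
   hence "v = 0 & u = 0" by auto
   hence "R = 0" by (simp add: uv)
   thus ?thesis unfolding R_def by (rule mod_0_imp_dvd)
  qed
  have q0: "jpoly J q c = 0" by (rule factor[OF qdvd]) (simp add: q_def)
  define b where "b = Im l"
  have b: "b ~= 0" using False by (simp add: b_def)
  define j where "j = inverse b *\<^sub>R (c - Re l *\<^sub>R e)"
  have cj: "c = Re l *\<^sub>R e + b *\<^sub>R j" using b by (simp add: j_def)
  have cc: "c ** c = (2 * Re l) *\<^sub>R c - ((Re l)\<^sup>2 + b\<^sup>2) *\<^sub>R e"
  proof -
   have "c ** c - (2 * Re l) *\<^sub>R c + ((Re l)\<^sup>2 + b\<^sup>2) *\<^sub>R e = 0"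
    using q0 by (simp add: q_def b_def jpoly_pCons J_add J_diff algebra_simps)
   from arg_cong[OF this, of "%w. w + ((2 * Re l) *\<^sub>R c - ((Re l)\<^sup>2 + b\<^sup>2) *\<^sub>R e)"]
   show ?thesis by simp
  qed
  have "(c - Re l *\<^sub>R e) ** (c - Re l *\<^sub>R e) = - (b\<^sup>2) *\<^sub>R e"
   by (rule vec_eq_inner) (simp add: J_diff cc inner_diff_left inner_add_left algebra_simps power2_eq_square)
  moreover have "inverse b * (inverse b * (b * b)) = 1" using b by (simp add: field_simps)
  ultimately have jj: "j ** j = - e" by (simp add: j_def power2_eq_square)
  have jcent: "(j ** x) ** y = j ** (x ** y)" for x y
   by (simp add: j_def J_diff central)
  have "j ** (j ** x) = - x" for x using jcent[of j x] jj by simp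
  hence "Trc (J j) = 0" by (rule Trc_square_neg[OF linL])
  hence "tau j c = 0" by (simp add: c)
  \<comment> \<open>Here \<open>c\<close> is replaced by
    \<open>Re l *\<^sub>R e + b *\<^sub>R j\<close>, where \<open>tr j = 0\<close> and
    \<open>tau j j = - r\<close>.\<close>
  hence "b * real r = 0" using trace_zero_of_square[OF jj]
   by (subst (asm) cj) (simp add: tau_add tau_scale tau_def[of j j] jj linear_neg[OF tr_linear] tr_e)
  thus ?thesis using b rank_pos by simp
 qed
 then obtain a where a: "c = a *\<^sub>R e" by blast
 have T: "Trc (J z) = a * tr z" for z by (simp add: c a tau_scale)
 have "J e = (%x. x)" by (simp add: fun_eq_iff)
 hence "Trc (J e) = DIM('a)" by (simp add: Trc_def)
 hence "a * r = DIM('a)" using T[of e] tr_e by simp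
 thus ?thesis using T[of z] rank_pos by (simp add: field_simps)
qed

end

section \<open>Inverses and the quadratic representation\<close>

lemma rpoly_frechet:
 assumes "rpoly p"
 shows "rpoly (%x. fderiv p (at x) h)"
 using assms
proof induction
 case (linear f)
 hence "fderiv f (at x) h = f h" for x
  by (intro fderiv_eqI bounded_linear_imp_has_derivative)
 thus ?case by (simp add: rpoly_intros)
next
 case (const c)
 show ?case by (simp add: rpoly_intros)
next
 case (add f g)
 have d: "(f has_derivative fderiv f (at x)) (at x)" "(g has_derivative fderiv g (at x)) (at x)" for x
  using differentiable_at_real_polynomial_function add.hyps frechet_derivative_works by blast+
 have "fderiv (%x. f x + g x) (at x) h = fderiv f (at x) h + fderiv g (at x) h" for x
  using fderiv_eqI[OF has_derivative_add[OF d]] .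
 thus ?case using add.IH by (simp add: rpoly_intros)
next
 case (mult f g)
 have d: "(f has_derivative fderiv f (at x)) (at x)" "(g has_derivative fderiv g (at x)) (at x)" for x
  using differentiable_at_real_polynomial_function mult.hyps frechet_derivative_works by blast+
 have "fderiv (%x. f x * g x) (at x) h = f x * fderiv g (at x) h + fderiv f (at x) h * g x" for x
  using fderiv_eqI[OF has_derivative_mult[OF d]] .
 thus ?case using mult by (simp add: rpoly_intros)
qed

context sjordan begin

definition adjp :: "'a => real poly" where "adjp x = (\<Sum>i<r. monom ((-1) ^ i * A (r - 1 - i) x) i)"

text \<open>The adjugate, read off from the Cayley-Hamilton relation: the constant term is the
  determinant up to sign, and the rest has a factor \<open>x\<close>, whose cofactor this is up to
  sign.\<close>

definition adj :: "'a => 'a" where "adj x = (\<Sum>i<r. ((-1) ^ i * A (r - 1 - i) x) *\<^sub>R jpow J x i)"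

lemma adj_jpoly: "adj x = jpoly J (adjp x) x"
 by (simp add: adj_def adjp_def jpoly_sum jpoly_monom)

lemma adj_poly: "pfun adj"
 unfolding adj_def[abs_def]
 by (intro polynomial_function_sum pfun_scaleR poly_jpow rpoly_intros(2,4) A_poly) auto

lemma adj_mult: "x ** adj x = jd x *\<^sub>R e"
proof -
 obtain m where m: "r = Suc m" using rank_pos gr0_implies_Suc by blast
 have "(\<Sum>j\<le>r. ((-1) ^ j * A j x) *\<^sub>R jpow J x (r - j)) = 0" by (rule cayley_hamilton)
 hence "(\<Sum>j<r. ((-1) ^ j * A j x) *\<^sub>R jpow J x (r - j)) + ((-1) ^ r * jd x) *\<^sub>R e = 0"
  by (simp add: jd_A flip: lessThan_Suc_atMost)
 moreover have "(\<Sum>j<r. ((-1) ^ j * A j x) *\<^sub>R jpow J x (r - j)) =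
  (\<Sum>i<r. ((-1) ^ (r - 1 - i) * A (r - 1 - i) x) *\<^sub>R jpow J x (Suc i))"
  unfolding m by (rule sum.reindex_bij_witness[of _ "%i. m - i" "%i. m - i"]) (auto simp: Suc_diff_le)
 moreover have "(\<Sum>i<r. ((-1) ^ (r - 1 - i) * A (r - 1 - i) x) *\<^sub>R jpow J x (Suc i)) = (-1) ^ m *\<^sub>R (x ** adj x)"
  unfolding adj_def J_sum_right scaleR_sum_right
 proof (rule sum.cong[OF refl])
  fix i assume "i \<in> {..<r}"
  hence "(-1) ^ m = (-1::real) ^ (m - i) * (-1) ^ i" using m by (simp flip: power_add)
  moreover have "(-1::real) ^ i * (-1) ^ i = 1" by (simp flip: power_mult_distrib)
  ultimately have "(-1::real) ^ (r - 1 - i) = (-1) ^ m * (-1) ^ i" using m by (simp add: mult.assoc)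
  thus "((-1) ^ (r - 1 - i) * A (r - 1 - i) x) *\<^sub>R jpow J x (Suc i) =
    (-1) ^ m *\<^sub>R (x ** ((-1) ^ i * A (r - 1 - i) x) *\<^sub>R jpow J x i)" by simp
 qed
 ultimately have "(-1::real) ^ m *\<^sub>R (x ** adj x) + ((-1) ^ r * jd x) *\<^sub>R e = 0" by simp
 hence "(-1::real) ^ m *\<^sub>R (x ** adj x - jd x *\<^sub>R e) = 0" by (simp add: m algebra_simps)
 thus ?thesis by simp
qed

lemma jinv_rel_unique: "jinv_rel J x y ==> jinv_rel J x z ==> y = z"
proof -
 assume "jinv_rel J x y" "jinv_rel J x z"
 then obtain p q where pq: "y = jpoly J p x" "x ** y = e" "z = jpoly J q x" "x ** z = e"
  by (auto simp: jinv_rel_def)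
 have "y = y ** (x ** z)" using pq by simp
 also have "... = (y ** x) ** z" using jpoly_assoc[of p x "[:0, 1:]" q] pq by simp
 finally show "y = z" using pq by (simp add: comm)
qed

lemma jinv_rel_adj: "jd x ~= 0 ==> jinv_rel J x (inverse (jd x) *\<^sub>R adj x)"
 unfolding jinv_rel_def
proof (intro conjI exI)
 show "inverse (jd x) *\<^sub>R adj x = jpoly J (psmult (inverse (jd x)) (adjp x)) x"
  by (simp add: adj_jpoly jpoly_smult)
 show "jd x ~= 0 ==> x ** (inverse (jd x) *\<^sub>R adj x) = e" by (simp add: adj_mult)
qed

lemma invertibles_iff: "x \<in> invertibles J \<longleftrightarrow> jd x ~= 0"
proof
 assume "x \<in> invertibles J"
 then obtain p where p: "x ** jpoly J p x = e" by (auto simp: invertibles_def jinv_rel_def)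
 have "jd x * jd (jpoly J p x) = 1" using jd_mult_jpoly[of "[:0, 1:]" x p] p by simp
 thus "jd x ~= 0" by auto
qed (use jinv_rel_adj in \<open>auto simp: invertibles_def\<close>)

lemma jinv_eq: "jd x ~= 0 ==> jinv J x = inverse (jd x) *\<^sub>R adj x"
 unfolding jinv_def using jinv_rel_adj jinv_rel_unique by blast

lemma jinv_jpoly: "jd x ~= 0 ==> jinv J x = jpoly J (psmult (inverse (jd x)) (adjp x)) x"
 by (simp add: jinv_eq adj_jpoly jpoly_smult)

lemma jinv_right [simp]: "jd x ~= 0 ==> x ** jinv J x = e"
 by (simp add: jinv_eq adj_mult)

lemma jinv_left [simp]: "jd x ~= 0 ==> jinv J x ** x = e" by (simp add: comm)

lemma jinv_commute: "jd x ~= 0 ==> x ** (jinv J x ** u) = jinv J x ** (x ** u)"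
 using jpoly_commute[of "[:0, 1:]" x] by (simp add: jinv_jpoly)

lemma jinv_sq: "jd x ~= 0 ==> (x ** x) ** jinv J x = x"
 using jpoly_assoc[of "[:0, 1:]" x "[:0, 1:]" "psmult (inverse (jd x)) (adjp x)"] jinv_right[of x]
 by (simp add: jinv_jpoly)

lemma jinv_sq': "jd x ~= 0 ==> x ** (jinv J x ** jinv J x) = jinv J x"
 using jinv_commute[of x "jinv J x"] by simp

lemma jd_jinv: "jd x ~= 0 ==> jd (jinv J x) = inverse (jd x)"
proof -
 assume x: "jd x ~= 0"
 have "jd x * jd (jinv J x) = 1"
  using jd_mult_jpoly[of "[:0, 1:]" x "psmult (inverse (jd x)) (adjp x)"] jinv_right[OF x] jinv_jpoly[OF x] by simp
 thus ?thesis by (metis inverse_unique)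
qed

lemma jinv_jinv: assumes "jd x ~= 0" shows "jinv J (jinv J x) = x"
proof -
 let ?v = "jinv J x"
 have v: "jd ?v ~= 0" using assms by (simp add: jd_jinv)
 have v': "?v = jpoly J (psmult (inverse (jd x)) (adjp x)) x" by (rule jinv_jpoly[OF assms])
 have w': "jinv J ?v = jpoly J (pcompose (psmult (inverse (jd ?v)) (adjp ?v)) (psmult (inverse (jd x)) (adjp x))) x"
  using jinv_jpoly[OF v] v' by (simp only: jpoly_pcompose)
 have "x = x ** (?v ** jinv J ?v)" using v by simp
 also have "... = (x ** ?v) ** jinv J ?v"
  using jpoly_assoc[of "[:0, 1:]" x "psmult (inverse (jd x)) (adjp x)"
    "pcompose (psmult (inverse (jd ?v)) (adjp ?v)) (psmult (inverse (jd x)) (adjp x))"]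
  by (simp only: v'[symmetric] w'[symmetric] jpoly_X)
 finally show ?thesis using assms by simp
qed

lemma open_invertibles: "open {x. jd x ~= 0}" by (rule open_rpoly_nonzero[OF jd_poly])

definition dinv :: "'a => 'a => 'a" where "dinv x = fderiv (jinv J) (at x)"

lemma smap_jinv: "smooth_map {x. jd x ~= 0} (jinv J)"
proof -
 have "smooth_map {x. jd x ~= 0} (%x. inverse (jd x) *\<^sub>R adj x)"
  unfolding smooth_map_def
 proof
  fix b
  have "smooth_on {x. jd x ~= 0} (%x. inverse (cor (jd x)) * cor (adj x \<bullet> b))"
   by (intro sm_mult sm_inverse open_invertibles sm_real_poly jd_poly
     pfun_inner_real adj_poly) auto
  thus "smooth_on {x. jd x ~= 0} (%x. cor ((inverse (jd x) *\<^sub>R adj x) \<bullet> b))" by simp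
 qed
 thus ?thesis by (rule smap_cong[OF open_invertibles, rotated]) (simp add: jinv_eq)
qed

lemma dinv: "jd x ~= 0 ==> (jinv J has_derivative dinv x) (at x)"
 unfolding dinv_def by (rule smap_hasd[OF smap_jinv]) simp

lemma dinv_linear: "jd x ~= 0 ==> linear (dinv x)"
 using dinv has_derivative_linear by blast

text \<open>The quadratic representation in polarised form. On the diagonal it inverts minus the
  differential of the Jordan inverse.\<close>

definition Pb :: "'a => 'a => 'a => 'a" where
 "Pb x y u = x ** (y ** u) + y ** (x ** u) - (x ** y) ** u"

abbreviation P where "P x \<equiv> Pb x x"

lemma P_def: "P x u = 2 *\<^sub>R (x ** (x ** u)) - (x ** x) ** u"
 by (simp add: Pb_def scaleR_2)

lemma Pb_linear: "linear (Pb x y)" "linear (%x. Pb x y u)" "linear (%y. Pb x y u)"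
 by (rule linearI; simp add: Pb_def J_add algebra_simps)+

text \<open>Two linear equations for \<open>y\<close> already determine \<open>P x y\<close>. The
  differential of the inverse satisfies them by differentiation of the two relations for inverses,
  and the derivations \<open>Dop\<close> satisfy them by the product rule.\<close>

lemma P_inverse_eq:
 assumes "jd x ~= 0" "h ** jinv J x + x ** y = 0" "2 *\<^sub>R ((x ** h) ** jinv J x) + (x ** x) ** y = h"
 shows "P x y = - h"
proof -
 have xy: "x ** y = - (jinv J x ** h)" using assms(2) by (simp add: comm eq_neg_iff_add_eq_0 add.commute)
 have "(x ** x) ** y = h - 2 *\<^sub>R (jinv J x ** (x ** h))" using assms(3) by (simp add: comm[of "jinv J x"] algebra_simps)
 thus ?thesis unfolding P_def xy by (simp add: jinv_commute[OF assms(1)])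
qed

lemma has_deriv_const_on_open:
 assumes "(f has_derivative D) (at x)" "open S" "x \<in> S" "!!y. y \<in> S ==> f y = c"
 shows "D h = 0"
proof -
 have "fderiv f (at x) h = D h" by (rule fderiv_eqI[OF assms(1)])
 moreover have "fderiv f (at x) = fderiv (%_. c) (at x)"
  by (rule fderiv_cong_open[OF assms(2,3)]) (rule assms(4))
 ultimately show ?thesis by simp
qed

lemma J_hasd:
 assumes "(f has_derivative f') (at x)" "(g has_derivative g') (at x)"
 shows "((%x. f x ** g x) has_derivative (%h. f x ** g' h + f' h ** g x)) (at x)"
 using bounded_bilinear.FDERIV[OF bdd assms] .

lemma dinv_relations:
 assumes "jd x ~= 0"
 shows "h ** jinv J x + x ** dinv x h = 0"
  "2 *\<^sub>R ((x ** h) ** jinv J x) + (x ** x) ** dinv x h = h"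
proof -
 have S: "x \<in> {x. jd x ~= 0}" using assms by simp
 have "x ** dinv x h + h ** jinv J x = 0"
  by (rule has_deriv_const_on_open[OF J_hasd[OF has_derivative_ident dinv[OF assms]] open_invertibles S, of e]) simp
 thus "h ** jinv J x + x ** dinv x h = 0" by (simp add: add.commute)
 have "(x ** x) ** dinv x h + (x ** h + h ** x) ** jinv J x - h = 0"
  by (rule has_deriv_const_on_open[OF has_derivative_diff[OF J_hasd[OF J_hasd[OF has_derivative_ident has_derivative_ident]
     dinv[OF assms]] has_derivative_ident] open_invertibles S, of 0]) (simp add: jinv_sq)
 thus "2 *\<^sub>R ((x ** h) ** jinv J x) + (x ** x) ** dinv x h = h"
  by (simp add: comm[of h] J_add scaleR_2 algebra_simps)
qed

lemma P_dinv: "jd x ~= 0 ==> P x (dinv x h) = - h"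
 by (rule P_inverse_eq[OF _ dinv_relations])

lemma P_bij: assumes "jd x ~= 0" shows "bij (P x)"
proof -
 have "surj (P x)" by (rule surjI[of _ "%h. dinv x (- h)"]) (simp add: P_dinv[OF assms])
 thus ?thesis using linear_surjective_imp_injective[OF Pb_linear(1)] by (simp add: bij_def)
qed

lemma P_inj: "jd x ~= 0 ==> P x u = P x v ==> u = v"
 using P_bij bij_is_inj injD by metis

lemma P_jinv: "jd x ~= 0 ==> P x (jinv J x) = x"
 by (simp add: P_def jinv_sq scaleR_2)

lemma P_jinv_sq: assumes "jd x ~= 0" shows "P x (jinv J x ** jinv J x) = e"
proof -
 have "(x ** x) ** (jinv J x ** jinv J x) = e"
 proof -
  have "(x ** x) ** (jinv J x ** jinv J x) = jinv J x ** ((x ** x) ** jinv J x)"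
   using jpoly_commute[of "[:0, 1:] * [:0, 1:]" x "psmult (inverse (jd x)) (adjp x)" "jinv J x"]
   by (simp only: jpoly_mult jpoly_X jinv_jpoly[OF assms, symmetric])
  thus ?thesis by (simp add: jinv_sq[OF assms] assms)
 qed
 thus ?thesis using assms by (simp add: P_def jinv_sq' scaleR_2)
qed

lemma dinv_self: assumes "jd x ~= 0" shows "dinv x x = - jinv J x"
 by (rule P_inj[OF assms]) (simp add: P_dinv[OF assms] linear_neg[OF Pb_linear(1)] P_jinv[OF assms])

lemma dinv_e: assumes "jd x ~= 0" shows "dinv x e = - (jinv J x ** jinv J x)"
 by (rule P_inj[OF assms]) (simp add: P_dinv[OF assms] linear_neg[OF Pb_linear(1)] P_jinv_sq[OF assms])

lemma tau_Pb: "tau (Pb x y u) v = tau u (Pb x y v)"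
proof -
 have "tau (a ** (b ** u)) v = tau u (b ** (a ** v))" for a b
  by (metis comm tau_assoc)
 moreover have "tau (a ** u) v = tau u (a ** v)" for a by (metis comm tau_assoc)
 ultimately show ?thesis by (simp add: Pb_def tau_add tau_diff)
qed

lemma tau_dinv: assumes "jd x ~= 0" shows "tau (P x u) (dinv x h) = - tau u h"
 by (simp add: tau_Pb P_dinv[OF assms] tau_neg)

lemma jd_deriv_alg:
 "fderiv jd (at u) (u ** jpoly J q u) = jd u * tr (jpoly J q u)"
proof -
 let ?a = "jpoly J q u"
 have "((%t. jd (u + t *\<^sub>R (u ** ?a))) has_real_derivative fderiv jd (at u) (u ** ?a)) (at 0)"
  using line_deriv[OF jd_hasd] by (simp add: has_real_derivative_iff_has_vector_derivative)
 moreover have "jd (u + t *\<^sub>R (u ** ?a)) = jd u * jd (e + t *\<^sub>R ?a)" for t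
  using jd_mult_jpoly[of "[:0, 1:]" u "1 + psmult t q"] by (simp add: jpoly_add jpoly_smult J_add)
 moreover have "((%t. jd u * jd (e + t *\<^sub>R ?a)) has_real_derivative jd u * tr ?a) (at 0)"
  using line_deriv[OF jd_hasd, of e ?a]
  by (intro DERIV_cmult) (simp add: has_real_derivative_iff_has_vector_derivative jd_deriv_e)
 ultimately show ?thesis using DERIV_unique by simp
qed

lemma has_real_derivI: "(f has_derivative (%h. h * c)) (at t) ==> (f has_real_derivative c) (at t)"
 by (simp add: has_field_derivative_def mult_commute_abs)

lemma jd_deriv_radial:
 assumes "jd (e + t *\<^sub>R y) ~= 0"
 shows "fderiv jd (at (e + t *\<^sub>R y)) y = jd (e + t *\<^sub>R y) * tr (y ** jinv J (e + t *\<^sub>R y))"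
proof (cases "t = 0")
 case True
 have "jinv J e = e" using jinv_right[of e] by simp
 thus ?thesis using True by (simp add: jd_deriv_e)
next
 case False
 let ?u = "e + t *\<^sub>R y" and ?v = "jinv J (e + t *\<^sub>R y)"
 have y: "y = inverse t *\<^sub>R (?u - e)" using False by simp
 have vy: "?v ** y = inverse t *\<^sub>R (e - ?v)"
  using arg_cong[OF y, of "J ?v"] by (simp only: J_scale J_diff jinv_left[OF assms] unit_right)
 define q where "q = psmult (inverse t) (1 - psmult (inverse (jd ?u)) (adjp ?u))"
 have q: "jpoly J q ?u = ?v ** y"
  unfolding vy q_def jpoly_smult jpoly_diff jpoly_1 by (simp only: jinv_jpoly[OF assms] jpoly_smult)
 have uvy: "?u ** (?v ** y) = y" unfolding vy by (simp add: J_diff assms False)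
 show ?thesis using jd_deriv_alg[of ?u q] unfolding q uvy by (simp add: comm)
qed

text \<open>The mixed second derivative of \<open>jd (e + s x)\<close> in \<open>s\<close> and in
  \<open>x\<close>, computed in both orders: the derivative in \<open>s\<close> is already known, so
  differentiating it in \<open>x\<close> yields the \<open>s\<close>-derivative of the still unknown
  gradient.\<close>

lemma radial_mixed:
 assumes u: "jd (e + t *\<^sub>R x) ~= 0"
 defines "v \<equiv> jinv J (e + t *\<^sub>R x)"
 shows "((%s. s * fderiv jd (at (e + s *\<^sub>R x)) h) has_real_derivative
  t * fderiv jd (at (e + t *\<^sub>R x)) h * tr (x ** v) + jd (e + t *\<^sub>R x) * tau (v ** v) h) (at t)"
proof -
 let ?u = "e + t *\<^sub>R x"
 define \<Phi> :: "real \<times> 'a => complex" where "\<Phi> p = of_real (jd (e + fst p *\<^sub>R snd p))" for p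
 have "pfun (%p :: real \<times> 'a. e + fst p *\<^sub>R snd p)"
  by (intro polynomial_function_add polynomial_function_const pfun_scaleR
   rpoly_intros(1) polynomial_function_bounded_linear bounded_linear_fst bounded_linear_snd)
 from real_polynomial_function_compose[OF this jd_poly]
 have sm: "smooth_on UNIV \<Phi>" unfolding \<Phi>_def[abs_def] by (intro sm_real_poly) (simp add: o_def)
 have D\<Phi>: "fderiv \<Phi> (at p) w = of_real (fderiv jd (at (e + fst p *\<^sub>R snd p)) (fst w *\<^sub>R snd p + fst p *\<^sub>R snd w))" for p w
 proof (rule fderiv_eqI)
  have "((%p :: real \<times> 'a. e + fst p *\<^sub>R snd p) has_derivative (%w. fst w *\<^sub>R snd p + fst p *\<^sub>R snd w)) (at p)"
   by (auto intro!: derivative_eq_intros)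
  from bounded_linear.has_derivative[OF bounded_linear_of_real has_derivative_compose[OF this jd_hasd]]
  show "(\<Phi> has_derivative (%w. cor (fderiv jd (at (e + fst p *\<^sub>R snd p)) (fst w *\<^sub>R snd p + fst p *\<^sub>R snd w)))) (at p)"
   unfolding \<Phi>_def[abs_def] .
 qed
 have lin: "linear (fderiv jd (at y))" for y using has_derivative_linear[OF jd_hasd] .
 define c where "c = dd [(1, 0), (0, h)] \<Phi> (t, x)"
 have W: "dd [(0, h)] \<Phi> = (%p. of_real (fst p * fderiv jd (at (e + fst p *\<^sub>R snd p)) h))"
  by (simp add: fun_eq_iff D\<Phi> linear_scale[OF lin])
 have V: "dd [(1, 0)] \<Phi> = (%p. of_real (fderiv jd (at (e + fst p *\<^sub>R snd p)) (snd p)))"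
  by (simp add: fun_eq_iff D\<Phi>)
 let ?W = "dd [(0, h)] \<Phi>" and ?V = "dd [(1, 0)] \<Phi>"
 have dW: "(?W has_derivative fderiv ?W (at (t, x))) (at (t, x))"
  by (rule sm_hasd[OF sm_dir_deriv[OF sm]]) simp
 have dV: "(?V has_derivative fderiv ?V (at (t, x))) (at (t, x))"
  by (rule sm_hasd[OF sm_dir_deriv[OF sm]]) simp
 have cW: "fderiv ?W (at (t, x)) (1, 0) = c" by (simp add: c_def)
 have cV: "fderiv ?V (at (t, x)) (0, h) = c"
  unfolding c_def by (subst dd_swap[OF open_UNIV sm UNIV_I]) simp
 have "((%s. (s, x)) has_derivative (%s. (s, 0))) (at t)" by (auto intro!: derivative_eq_intros)
 from bounded_linear.has_derivative[OF bounded_linear_Re has_derivative_compose[OF this dW]]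
 have 1: "((%s. Re (?W (s, x))) has_derivative (%s. Re (fderiv ?W (at (t, x)) (s, 0)))) (at t)" .
 have "fderiv ?W (at (t, x)) (s, 0) = s *\<^sub>R c" for s
  using linear_scale[OF has_derivative_linear[OF dW], of s "(1, 0)"] cW by simp
 hence d1: "((%s. s * fderiv jd (at (e + s *\<^sub>R x)) h) has_real_derivative Re c) (at t)"
  using 1 unfolding W by (simp add: has_field_derivative_def mult.commute[of _ "Re c"])
 have "((%y. (t, y)) has_derivative (%y. (0, y))) (at x)" by (auto intro!: derivative_eq_intros)
 from bounded_linear.has_derivative[OF bounded_linear_Re has_derivative_compose[OF this dV]]
 have 2: "((%y. Re (?V (t, y))) has_derivative (%y. Re (fderiv ?V (at (t, x)) (0, y)))) (at x)" .
 let ?T = "{y. jd (e + t *\<^sub>R y) ~= 0}"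
 have "continuous_on UNIV (%y. e + t *\<^sub>R y)" by (intro continuous_intros)
 from open_vimage[OF open_invertibles this] have oT: "open ?T" by (simp add: vimage_def)
 have eqV: "Re (?V (t, y)) = jd (e + t *\<^sub>R y) * tr (y ** jinv J (e + t *\<^sub>R y))" if "y \<in> ?T" for y
  using jd_deriv_radial[of t y] that unfolding V by simp
 have inner: "((%y. e + t *\<^sub>R y) has_derivative (%y. t *\<^sub>R y)) (at x)" by (auto intro!: derivative_eq_intros)
 have dtr: "(tr has_derivative tr) (at y)" for y
  using bounded_linear_imp_has_derivative tr_linear linear_conv_bounded_linear by blast
 have "((%y. jd (e + t *\<^sub>R y) * tr (y ** jinv J (e + t *\<^sub>R y))) has_derivative
   (%k. jd ?u * tr (x ** dinv ?u (t *\<^sub>R k) + k ** jinv J ?u) + fderiv jd (at ?u) (t *\<^sub>R k) * tr (x ** jinv J ?u))) (at x)"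
  by (rule has_derivative_mult[OF has_derivative_compose[OF inner jd_hasd]
    has_derivative_compose[OF J_hasd[OF has_derivative_ident has_derivative_compose[OF inner dinv[OF u]]] dtr]])
 hence 3: "((%y. Re (?V (t, y))) has_derivative
   (%k. jd ?u * tr (x ** dinv ?u (t *\<^sub>R k) + k ** jinv J ?u) + fderiv jd (at ?u) (t *\<^sub>R k) * tr (x ** jinv J ?u))) (at x)"
  by (rule has_derivative_transform_within_open[OF _ oT]) (use u eqV in auto)
 have "Re c = jd ?u * tr (x ** dinv ?u (t *\<^sub>R h) + h ** v) + fderiv jd (at ?u) (t *\<^sub>R h) * tr (x ** v)"
  using has_derivative_unique[OF 2 3, THEN fun_cong, of h] cV by (simp add: v_def)
 moreover have "tr (x ** dinv ?u (t *\<^sub>R h) + h ** v) = tau (v ** v) h"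
 proof -
  have "tr (x ** dinv ?u (t *\<^sub>R h)) = tau (t *\<^sub>R x) (dinv ?u h)"
   by (simp add: linear_scale[OF dinv_linear[OF u]] linear_scale[OF tr_linear] tau_def)
  also have "... = tau ?u (dinv ?u h) - tau e (dinv ?u h)" by (simp add: tau_add tau_diff flip: tau_e)
  also have "tau ?u (dinv ?u h) = - tau v h"
   using tau_dinv[OF u, of v h] P_jinv[OF u] by (simp add: v_def)
  also have "tau e (dinv ?u h) = - tau (v ** v) h"
   using tau_dinv[OF u, of "v ** v" h] P_jinv_sq[OF u] by (simp add: v_def)
  finally show ?thesis by (simp add: linear_add[OF tr_linear] tau_def comm)
 qed
 ultimately have "Re c = t * fderiv jd (at ?u) h * tr (x ** v) + jd ?u * tau (v ** v) h"
  by (simp add: linear_scale[OF lin])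
 thus ?thesis using d1 by simp
qed

text \<open>The difference of the two sides at \<open>e + t x\<close>, multiplied by
  \<open>t\<close>, solves the same first-order linear equation as \<open>jd (e + t x)\<close>; so
  their quotient is constant, and it starts at zero.\<close>

lemma jd_deriv_near_e:
 assumes seg: "!!t. 0 \<le> t ==> t \<le> 1 ==> jd (e + t *\<^sub>R x) ~= 0"
 shows "fderiv jd (at (e + x)) h = jd (e + x) * tau (jinv J (e + x)) h"
proof -
 define u where "u t = e + t *\<^sub>R x" for t
 define v where "v t = jinv J (u t)" for t
 define w where "w t = fderiv jd (at (u t)) h" for t
 define W where "W t = t * w t - t * (jd (u t) * tau (v t) h)" for t
 have du: "(u has_derivative (%s. s *\<^sub>R x)) (at t)" for t
  unfolding u_def by (auto intro!: derivative_eq_intros)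
 have djd: "((%t. jd (u t)) has_real_derivative jd (u t) * tr (x ** v t)) (at t)" if "0 \<le> t" "t \<le> 1" for t
 proof -
  have "fderiv jd (at (u t)) (s *\<^sub>R x) = s * (jd (u t) * tr (x ** v t))" for s
   using jd_deriv_radial[OF seg[OF that]] linear_scale[OF has_derivative_linear[OF jd_hasd]]
   by (simp add: u_def v_def)
  thus ?thesis using has_derivative_compose[OF du[of t] jd_hasd] by (intro has_real_derivI) simp
 qed
 have dv: "((%t. tau (v t) h) has_real_derivative tau (dinv (u t) x) h) (at t)" if "0 \<le> t" "t \<le> 1" for t
 proof -
  have nz: "jd (u t) ~= 0" using seg[OF that] by (simp add: u_def)
  have "((%y. tau y h) has_derivative (%y. tau y h)) (at y)" for y
   using bounded_linear_imp_has_derivative tau_linear(2) linear_conv_bounded_linear by blast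
  from has_derivative_compose[OF has_derivative_compose[OF du dinv[OF nz]] this]
  show ?thesis by (simp add: has_field_derivative_def v_def linear_scale[OF dinv_linear[OF nz]] tau_scale mult.commute[of _ "tau _ h"])
 qed
 have dW: "(W has_real_derivative W t * tr (x ** v t)) (at t)" if t: "0 \<le> t" "t \<le> 1" for t
 proof -
  have nz: "jd (u t) ~= 0" using seg[OF t] by (simp add: u_def)
  have a: "((%t. t * w t) has_real_derivative t * w t * tr (x ** v t) + jd (u t) * tau (v t ** v t) h) (at t)"
   using radial_mixed[OF seg[OF t], of h] by (simp add: w_def u_def v_def)
  have b: "((%t. t * (jd (u t) * tau (v t) h)) has_real_derivative
    1 * (jd (u t) * tau (v t) h) + (jd (u t) * tr (x ** v t) * tau (v t) h + tau (dinv (u t) x) h * jd (u t)) * t) (at t)"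
   by (intro DERIV_mult DERIV_ident djd dv t)
  have "t * tau (dinv (u t) x) h = tau (dinv (u t) (u t - e)) h"
   by (simp add: u_def linear_scale[OF dinv_linear[OF nz[unfolded u_def]]] tau_scale)
  also have "... = tau (v t ** v t) h - tau (v t) h"
   by (simp add: linear_diff[OF dinv_linear[OF nz]] dinv_self[OF nz] dinv_e[OF nz] v_def tau_diff tau_neg tau_add)
  finally have c: "t * tau (dinv (u t) x) h = tau (v t ** v t) h - tau (v t) h" .
  have "t * w t * tr (x ** v t) + jd (u t) * tau (v t ** v t) h -
    (1 * (jd (u t) * tau (v t) h) + (jd (u t) * tr (x ** v t) * tau (v t) h + tau (dinv (u t) x) h * jd (u t)) * t)
   = t * w t * tr (x ** v t) + jd (u t) * tau (v t ** v t) h -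
    (jd (u t) * tau (v t) h + t * (jd (u t) * tr (x ** v t) * tau (v t) h) + jd (u t) * (t * tau (dinv (u t) x) h))"
   by (simp add: algebra_simps)
  also have "... = W t * tr (x ** v t)" unfolding c by (simp add: W_def algebra_simps)
  finally show ?thesis using DERIV_diff[OF a b] by (simp add: W_def[abs_def])
 qed
 have dQ: "((%t. W t / jd (u t)) has_real_derivative 0) (at t)" if t: "0 \<le> t" "t \<le> 1" for t
 proof -
  have nz: "jd (u t) ~= 0" using seg[OF t] by (simp add: u_def)
  show ?thesis using DERIV_divide[OF dW[OF t] djd[OF t] nz] by (simp add: mult_ac)
 qed
 have "W 1 / jd (u 1) = W 0 / jd (u 0)"
 proof (rule DERIV_isconst_end[of 0 1 "%t. W t / jd (u t)"])
  show "continuous_on {0..1} (%t. W t / jd (u t))"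
   by (intro continuous_at_imp_continuous_on ballI DERIV_isCont[OF dQ]) auto
 qed (use dQ in auto)
 hence "W 1 = 0" using seg[of 1] by (simp add: W_def u_def)
 thus ?thesis by (simp add: W_def w_def u_def v_def)
qed

text \<open>Near the unit the segment to \<open>e\<close> avoids the zeros of the determinant. Both
  sides are polynomial in \<open>u\<close>, so the identity extends from a ball.\<close>

theorem jd_deriv: "fderiv jd (at u) h = tau (adj u) h"
proof -
 have "open {u. jd u > 0}"
  using cont_rp[OF jd_poly, of UNIV] by (intro open_Collect_less continuous_on_const) auto
 moreover have "e \<in> {u. jd u > 0}" by simp
 ultimately obtain dl where dl: "dl > 0" "ball e dl \<subseteq> {u. jd u > 0}" using openE by blast
 have "rpoly (%u. tau (adj u) h)"
  unfolding tau_inner by (rule pfun_inner_real[OF adj_poly])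
 thus ?thesis
 proof (rule rpoly_eqI[OF rpoly_frechet[OF jd_poly] _ open_ball[of e dl]])
  show "ball e dl ~= {}" using dl by simp
  fix u assume u: "u \<in> ball e dl"
  have "jd (e + t *\<^sub>R (u - e)) ~= 0" if "0 \<le> t" "t \<le> 1" for t
  proof -
   have "(1 - t) *\<^sub>R e + t *\<^sub>R u \<in> ball e dl"
    using convex_ball[of e dl] u dl(1) that by (auto simp: convex_alt)
   moreover have "(1 - t) *\<^sub>R e + t *\<^sub>R u = e + t *\<^sub>R (u - e)" by (simp add: algebra_simps)
   ultimately show ?thesis using dl(2) by auto
  qed
  from jd_deriv_near_e[OF this, of h]
  have "fderiv jd (at u) h = jd u * tau (jinv J u) h" by simp
  moreover have "jd u ~= 0" using u dl(2) by auto
  ultimately show "fderiv jd (at u) h = tau (adj u) h"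
   by (simp add: jinv_eq tau_scale)
 qed
qed

lemma jd_hasd': "(jd has_derivative tau (adj u)) (at u)"
 using jd_hasd[of u] jd_deriv[of u] by (metis ext)

lemma jd_deriv_mult: "tau (adj u) (a ** u) = jd u * tr a"
proof -
 have "tau (adj u) (a ** u) = tau (u ** adj u) a" by (metis comm tau_assoc)
 thus ?thesis by (simp add: adj_mult tau_scale)
qed

text \<open>Serves to differentiate \<open>P\<close> along a curve whose velocity is
  \<open>x ** a\<close> with \<open>a\<close> a polynomial in \<open>x\<close>.\<close>

lemma Pb_alg: "Pb x (x ** jpoly J q x) u = jpoly J q x ** P x u"
proof -
 let ?a = "jpoly J q x"
 have xa: "x ** (?a ** w) = ?a ** (x ** w)" for w using jpoly_commute[of "[:0, 1:]" x q] by simp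
 have 1: "(x ** ?a) ** (x ** w) = x ** ((x ** ?a) ** w)" for w
  using jpoly_commute[of "[:0, 1:] * q" x "[:0, 1:]"] unfolding jpoly_mult by simp
 have 2: "x ** (x ** ?a) = (x ** x) ** ?a" using jpoly_assoc[of "[:0, 1:]" x "[:0, 1:]" q] by simp
 have 3: "((x ** x) ** ?a) ** u = ?a ** ((x ** x) ** u) + x ** ((x ** ?a) ** u) + x ** ((x ** ?a) ** u)
   - x ** (?a ** (x ** u)) - x ** (?a ** (x ** u))" by (rule Lprod)
 show ?thesis unfolding Pb_def 1 2 3 J_add J_diff xa[of "x ** u"]
  by (rule vec_eq_inner) (simp add: inner_add_left inner_diff_left)
qed

lemma P_poly: "pfun (%x. P x z)"
 unfolding Pb_def by (intro polynomial_function_diff polynomial_function_add poly_J polynomial_function_const polynomial_function_id)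

text \<open>Along \<open>xs s = e + s k\<close> the vector \<open>P (xs s) z\<close> moves by
  \<open>2 a\<close> times itself, where \<open>a\<close> is the quotient of \<open>k\<close> by
  \<open>xs s\<close>. So its determinant has logarithmic rate \<open>2 tr a\<close>, as has the
  square of \<open>jd (xs s)\<close>. The quotient is constant for small \<open>s\<close>, and the
  resulting polynomial identity in \<open>s\<close> reaches \<open>s = 1\<close>.\<close>

theorem jd_P: "jd (P x z) = (jd x)\<^sup>2 * jd z"
proof -
 define k where "k = x - e"
 define xs where "xs s = e + s *\<^sub>R k" for s
 have rp1: "rpoly (%x. jd (P x z))"
  using real_polynomial_function_compose[OF P_poly jd_poly] by (simp add: o_def)
 have rp2: "rpoly (%x. (jd x)\<^sup>2 * jd z)" using jd_poly by auto
 obtain f where f: "!!s. jd (P (xs s) z) = poly f s" unfolding xs_def using rpoly_lineE[OF rp1] by blast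
 obtain g where g: "!!s. (jd (xs s))\<^sup>2 * jd z = poly g s" unfolding xs_def using rpoly_lineE[OF rp2] by blast
 have "open {s. jd (xs s) > 0}"
 proof -
  have "continuous_on UNIV xs" unfolding xs_def by (intro continuous_intros)
  from continuous_on_compose2[OF cont_rp[OF jd_poly, of UNIV] this] show ?thesis
   by (intro open_Collect_less continuous_on_const) auto
 qed
 moreover have "0 \<in> {s. jd (xs s) > 0}" by (simp add: xs_def)
 ultimately obtain dl where dl: "dl > 0" "ball 0 dl \<subseteq> {s. jd (xs s) > 0}" using openE by blast
 have pos: "jd (xs s) > 0" if "0 \<le> s" "s < dl" for s using dl(2) that by (auto simp: subset_iff)
 have dxs: "(xs has_derivative (%h. h *\<^sub>R k)) (at s)" for s
  unfolding xs_def by (auto intro!: derivative_eq_intros)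
 have dQ: "((%s. jd (P (xs s) z) / (jd (xs s))\<^sup>2) has_real_derivative 0) (at s)" if s: "0 < s" "s < dl" for s
 proof -
  let ?u = "xs s"
  have nz: "jd ?u ~= 0" using pos[of s] s by simp
  define q where "q = psmult (inverse (jd ?u)) (adjp ?u) * [:- inverse s, inverse s:]"
  define a where "a = jpoly J q ?u"
  have kk: "jpoly J [:- inverse s, inverse s:] ?u = k"
   using s by (simp add: jpoly_pCons xs_def algebra_simps)
  have a: "a = jinv J ?u ** k" unfolding a_def q_def jpoly_mult kk jinv_jpoly[OF nz] ..
  have ua: "?u ** a = k"
  proof -
   have "?u ** (jinv J ?u ** k) = (?u ** jinv J ?u) ** k"
    using jpoly_assoc[of "[:0, 1:]" ?u "psmult (inverse (jd ?u)) (adjp ?u)" "[:- inverse s, inverse s:]"]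
    unfolding kk jinv_jpoly[OF nz, symmetric] by simp
   thus ?thesis using nz by (simp add: a)
  qed
  have "((%s. P (xs s) z) has_derivative (%h. h *\<^sub>R (2 *\<^sub>R (a ** P ?u z)))) (at s)"
  proof -
   have c: "((%s. z) has_derivative (%h. 0)) (at s)" by simp
   have 1: "((%s. xs s ** (xs s ** z) + xs s ** (xs s ** z) - (xs s ** xs s) ** z) has_derivative
    (%h. (?u ** (?u ** 0 + (h *\<^sub>R k) ** z) + (h *\<^sub>R k) ** (?u ** z)) + (?u ** (?u ** 0 + (h *\<^sub>R k) ** z) + (h *\<^sub>R k) ** (?u ** z))
     - ((?u ** ?u) ** 0 + (?u ** (h *\<^sub>R k) + (h *\<^sub>R k) ** ?u) ** z))) (at s)"
    by (intro has_derivative_diff has_derivative_add J_hasd dxs c)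
   have 2: "(?u ** (?u ** 0 + (h *\<^sub>R k) ** z) + (h *\<^sub>R k) ** (?u ** z)) + (?u ** (?u ** 0 + (h *\<^sub>R k) ** z) + (h *\<^sub>R k) ** (?u ** z))
     - ((?u ** ?u) ** 0 + (?u ** (h *\<^sub>R k) + (h *\<^sub>R k) ** ?u) ** z) = h *\<^sub>R (2 *\<^sub>R Pb ?u k z)" for h
    by (rule vec_eq_inner) (simp add: Pb_def comm[of k ?u] J_add inner_add_left inner_diff_left algebra_simps)
   have 3: "Pb ?u k z = a ** P ?u z" using Pb_alg[of ?u q z] ua unfolding a_def by simp
   show ?thesis using 1 unfolding 2 3 by (simp add: Pb_def)
  qed
  from has_derivative_compose[OF this jd_hasd']
  have d1: "((%s. jd (P (xs s) z)) has_real_derivative 2 * tr a * jd (P ?u z)) (at s)"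
   by (intro has_real_derivI) (simp add: tau_scale jd_deriv_mult mult_ac)
  have "tau (adj ?u) k = jd ?u * tr a" using jd_deriv_mult[of ?u a] ua by (simp add: comm)
  hence d2: "((%s. jd (xs s)) has_real_derivative jd ?u * tr a) (at s)"
   using has_derivative_compose[OF dxs[of s] jd_hasd']
   by (intro has_real_derivI) (simp add: tau_scale)
  have "((%s. (jd (xs s))\<^sup>2) has_real_derivative 2 * tr a * (jd ?u)\<^sup>2) (at s)"
   using DERIV_power[OF d2, of 2] by (simp add: power2_eq_square mult_ac)
  from DERIV_divide[OF d1 this] nz show ?thesis by (simp add: mult_ac)
 qed
 have "poly f s = poly g s" if s: "0 < s" "s < dl" for s
 proof -
  have "jd (P (xs s) z) / (jd (xs s))\<^sup>2 = jd (P (xs 0) z) / (jd (xs 0))\<^sup>2"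
  proof (rule DERIV_isconst_end[of 0 s "%s. jd (P (xs s) z) / (jd (xs s))\<^sup>2"])
   have "continuous_on {0..s} xs" unfolding xs_def by (intro continuous_intros)
   hence "continuous_on {0..s} (%s. jd (P (xs s) z))" "continuous_on {0..s} (%s. jd (xs s))"
    using continuous_on_compose2[OF cont_rp[OF rp1, of UNIV]] continuous_on_compose2[OF cont_rp[OF jd_poly, of UNIV]] by auto
   moreover have "jd (xs t) ~= 0" if "t \<in> {0..s}" for t using pos[of t] that s by auto
   ultimately show "continuous_on {0..s} (%s. jd (P (xs s) z) / (jd (xs s))\<^sup>2)"
    by (intro continuous_intros) auto
  qed (use s dQ in auto)
  also have "... = jd z" by (simp add: xs_def P_def scaleR_2)
  finally show ?thesis using pos[of s] s f[of s] g[of s] by (simp add: field_simps)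
 qed
 hence "{0<..<dl} \<subseteq> {s. poly (f - g) s = 0}" by auto
 moreover have "infinite {0<..<dl}" using dl(1) by simp
 ultimately have "f - g = 0" using poly_roots_finite finite_subset by blast
 hence "jd (P (xs 1) z) = (jd (xs 1))\<^sup>2 * jd z" using f[of 1] g[of 1] by simp
 thus ?thesis by (simp add: xs_def k_def)
qed

section \<open>The structure group\<close>

lemma inv_extend:
 fixes f g :: "'a => 'b::t2_space"
 assumes "continuous_on UNIV f" "continuous_on UNIV g" "!!x. jd x ~= 0 ==> f x = g x"
 shows "f x = g x"
proof (rule eq_on_open_if_dense[OF open_UNIV assms(1,2)])
 fix U :: "'a set" assume "open U" "U ~= {}"
 then obtain x where "x \<in> U" "jd x ~= 0" using rpoly_nonzero_open[OF jd_poly, of e] by auto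
 thus "\<exists>x\<in>U. f x = g x" using assms(3) by blast
qed simp

lemma cont_linear: "linear (g :: 'a => 'b::euclidean_space) ==> continuous_on S g"
 by (rule linear_continuous_on) (simp add: linear_conv_bounded_linear)

lemma jd_semi_invariant:
 assumes "linear g" "\<forall>x\<in>invertibles J. jd (g x) = c * jd x"
 shows "jd (g x) = c * jd x"
proof (rule inv_extend[where f = "%x. jd (g x)" and g = "%x. c * jd x"])
 show "continuous_on UNIV (%x. jd (g x))"
  by (rule continuous_on_compose2[OF cont_rp[OF jd_poly, of UNIV] cont_linear[OF assms(1)]]) simp
 show "continuous_on UNIV (%x. c * jd x)" by (intro continuous_intros cont_rp jd_poly)
qed (use assms(2) invertibles_iff in auto)

lemma str_char_eq:
 assumes "c ~= 0" "!!x. jd (g x) = c * jd x"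
 shows "str_char J g = c"
 unfolding str_char_def
proof (rule the_equality)
 show "c ~= 0 & (\<forall>x\<in>invertibles J. jd (g x) = c * jd x)" using assms by auto
 fix d assume "d ~= 0 & (\<forall>x\<in>invertibles J. jd (g x) = d * jd x)"
 moreover have "e \<in> invertibles J" by (simp add: invertibles_iff)
 ultimately have "jd (g e) = d" by (metis jd_e mult_1_right)
 thus "d = c" using assms(2)[of e] by simp
qed

lemma str_groupI:
 assumes "linear g" "bij g" "c ~= 0" "!!x. jd (g x) = c * jd x"
 shows "g \<in> str_group J"
 using assms unfolding str_group_def by auto

lemma strp_I:
 assumes "linear g" "bij g" "c > 0" "!!x. jd (g x) = c * jd x"
 shows "g \<in> str_group_pos J" "str_char J g = c"
 using str_groupI[OF assms(1,2) _ assms(4)] str_char_eq[OF _ assms(4)] assms(3)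
 by (auto simp: str_group_pos_def)

lemma strp_D:
 assumes "g \<in> str_group_pos J"
 shows "linear g" "bij g" "str_char J g > 0" "jd (g x) = str_char J g * jd x"
proof -
 obtain c where g: "linear g" "bij g" "c ~= 0" "\<forall>x\<in>invertibles J. jd (g x) = c * jd x"
  using assms unfolding str_group_pos_def str_group_def by blast
 have c: "jd (g x) = c * jd x" for x by (rule jd_semi_invariant[OF g(1,4)])
 show "linear g" "bij g" by fact+
 show "str_char J g > 0" using assms by (simp add: str_group_pos_def)
 show "jd (g x) = str_char J g * jd x" unfolding str_char_eq[OF g(3) c] by (rule c)
qed

text \<open>The adjoint of \<open>g\<close> with respect to \<open>tau\<close>.\<close>

definition tadj :: "('a => 'a) => 'a => 'a" where
 "tadj g y = (\<Sum>b\<in>Basis. tau (g b) y *\<^sub>R dl b)"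

lemma tau_tadj: assumes "linear g" shows "tau x (tadj g y) = tau (g x) y"
proof -
 have "g x = (\<Sum>b\<in>Basis. (x \<bullet> b) *\<^sub>R g b)"
  using linear_sum[OF assms, of "%b. (x \<bullet> b) *\<^sub>R b" Basis] linear_scale[OF assms]
  by (simp add: euclidean_representation)
 thus ?thesis by (simp add: tadj_def tau_sum tau_scale tau_dl mult.commute)
qed

lemma tadj_linear: "linear (tadj g)"
 by (rule linearI) (simp_all add: tadj_def tau_add tau_scale scaleR_left_distrib sum.distrib scaleR_sum_right)

context
 fixes g and c :: real
 assumes g: "linear g" "bij g" and c: "c ~= 0" and gc: "!!x. jd (g x) = c * jd x"
begin

lemma tadj_inj: "inj (tadj g)"
proof -
 have "tadj g y = 0 ==> y = 0" for y
 proof (rule tau_nondegenerate)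
  fix z assume "tadj g y = 0"
  hence "tau (g (inv_into UNIV g z)) y = 0" by (metis tau_tadj[OF g(1)] tau_zero(1))
  thus "tau y z = 0" using g(2) by (simp add: bij_is_surj surj_f_inv_f tau_sym)
 qed
 thus ?thesis by (simp add: linear_injective_0[OF tadj_linear])
qed

lemma tadj_adj: "tadj g (adj (g x)) = c *\<^sub>R adj x"
proof (rule tau_eqI)
 fix h
 have "((%x. jd (g x)) has_derivative (%h. tau (adj (g x)) (g h))) (at x)"
  by (rule has_derivative_compose[OF bounded_linear_imp_has_derivative jd_hasd'])
   (use g(1) linear_conv_bounded_linear in blast)
 moreover have "((%x. jd (g x)) has_derivative (%h. c * tau (adj x) h)) (at x)"
  unfolding gc by (rule has_derivative_mult_right[OF jd_hasd'])
 ultimately have "tau (adj (g x)) (g h) = c * tau (adj x) h"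
  using has_derivative_unique by (metis (no_types, lifting))
 thus "tau (tadj g (adj (g x))) h = tau (c *\<^sub>R adj x) h"
  by (simp add: tau_sym[of "tadj g _"] tau_tadj[OF g(1)] tau_sym[of "g h"] tau_scale)
qed

lemma tadj_jinv: assumes "jd x ~= 0" shows "tadj g (jinv J (g x)) = jinv J x"
proof -
 have "jd (g x) ~= 0" using assms c gc by simp
 thus ?thesis using assms c by (simp add: jinv_eq linear_scale[OF tadj_linear] tadj_adj gc)
qed

lemma tadj_dinv: assumes "jd x ~= 0" shows "tadj g (dinv (g x) (g h)) = dinv x h"
proof -
 have nz: "jd (g x) ~= 0" using assms c gc by simp
 have l: "(tadj g has_derivative tadj g) (at y)" for y
  using bounded_linear_imp_has_derivative tadj_linear linear_conv_bounded_linear by blast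
 have l': "(g has_derivative g) (at y)" for y
  using bounded_linear_imp_has_derivative g(1) linear_conv_bounded_linear by blast
 have "((%x. tadj g (jinv J (g x)) - jinv J x) has_derivative (%h. tadj g (dinv (g x) (g h)) - dinv x h)) (at x)"
  by (rule has_derivative_diff[OF has_derivative_compose[OF has_derivative_compose[OF l' dinv[OF nz]] l] dinv[OF assms]])
 from has_deriv_const_on_open[OF this open_invertibles, of 0 h] assms
 show ?thesis by (simp add: tadj_jinv)
qed

text \<open>Differentiating \<open>jd (g x) = c * jd x\<close> gives \<open>tadj_jinv\<close>;
  differentiating that relates the differentials of the inverse at \<open>x\<close> and at
  \<open>g x\<close>, whose inverses are, up to sign, the quadratic representations.\<close>

lemma P_str: "P (g x) w = g (P x (tadj g w))"
proof (rule inv_extend[where f = "%x. P (g x) w" and g = "%x. g (P x (tadj g w))"])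
 have pg: "pfun g"
  using polynomial_function_bounded_linear g(1) linear_conv_bounded_linear by blast
 show "continuous_on UNIV (%x. P (g x) w)"
  by (rule continuous_on_compose2[OF continuous_on_polymonial_function[OF P_poly, of UNIV] cont_linear[OF g(1)]]) simp
 show "continuous_on UNIV (%x. g (P x (tadj g w)))"
  by (rule continuous_on_compose2[OF cont_linear[OF g(1), of UNIV] continuous_on_polymonial_function[OF P_poly]]) simp
 fix x assume x: "jd x ~= 0"
 have nz: "jd (g x) ~= 0" using x c gc by simp
 obtain h where h: "g h = - P (g x) w" using g(2) by (metis bij_pointE)
 have "P (g x) (dinv (g x) (g h)) = P (g x) w" using P_dinv[OF nz, of "g h"] h by simp
 hence "dinv (g x) (g h) = w" by (rule P_inj[OF nz])
 hence "tadj g w = dinv x h" using tadj_dinv[OF x, of h] by simp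
 hence "g (P x (tadj g w)) = - g h" by (simp add: P_dinv[OF x] linear_neg[OF g(1)])
 thus "P (g x) w = g (P x (tadj g w))" using h by simp
qed

lemma Pb_polar: "Pb x y u = (1 / 2) *\<^sub>R (P (x + y) u - P x u - P y u)"
proof -
 have "P (x + y) u - P x u - P y u = 2 *\<^sub>R Pb x y u"
  by (rule vec_eq_inner) (simp add: Pb_def comm[of y x] J_add inner_add_left inner_diff_left)
 thus ?thesis by simp
qed

lemma Pb_str: "Pb (g x) (g y) w = g (Pb x y (tadj g w))"
proof -
 have "Pb (g x) (g y) w = (1 / 2) *\<^sub>R (P (g (x + y)) w - P (g x) w - P (g y) w)"
  by (subst Pb_polar) (simp only: linear_add[OF g(1)])
 also have "... = g ((1 / 2) *\<^sub>R (P (x + y) (tadj g w) - P x (tadj g w) - P y (tadj g w)))"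
  by (simp only: P_str linear_diff[OF g(1)] linear_scale[OF g(1)])
 also have "... = g (Pb x y (tadj g w))" by (simp only: Pb_polar[of x y, symmetric])
 finally show ?thesis .
qed

lemma jd_tadj: "jd (tadj g z) = c * jd z"
proof (rule inv_extend[where f = "%z. jd (tadj g z)" and g = "%z. c * jd z"])
 show "continuous_on UNIV (%x. jd (tadj g x))"
  by (rule continuous_on_compose2[OF cont_rp[OF jd_poly, of UNIV] cont_linear[OF tadj_linear]]) simp
 show "continuous_on UNIV (%x. c * jd x)" by (intro continuous_intros cont_rp jd_poly)
 fix z assume z: "jd z ~= 0"
 define x where "x = inv_into UNIV g (jinv J z)"
 have gx: "g x = jinv J z" unfolding x_def using g(2) by (simp add: bij_is_surj surj_f_inv_f)
 have "c * jd x = inverse (jd z)" using gc[of x] gx jd_jinv[OF z] by simp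
 hence "inverse c * (c * jd x) = inverse c * inverse (jd z)" by simp
 hence jx: "jd x = inverse c * inverse (jd z)" using c by (simp add: mult.assoc[symmetric] del: mult_cancel_left inverse_mult_distrib)
 hence x0: "jd x ~= 0" using c z by simp
 have "tadj g z = jinv J x" using tadj_jinv[OF x0] gx jinv_jinv[OF z] by simp
 thus "jd (tadj g z) = c * jd z" using jd_jinv[OF x0] jx by simp
qed

end

lemma P_str_group:
 assumes "jd x ~= 0" shows "P x \<in> str_group_pos J" "str_char J (P x) = (jd x)\<^sup>2"
 using strp_I[OF Pb_linear(1) P_bij[OF assms], of "(jd x)\<^sup>2"] jd_P assms by auto

lemma J_via_P: assumes "jd x ~= 0" shows "x ** u = jinv J x ** P x u" "x ** u = P x (jinv J x ** u)"
proof -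
 have "Pb x (x ** jinv J x) u = jinv J x ** P x u"
  using Pb_alg[of x "psmult (inverse (jd x)) (adjp x)" u] by (simp add: jinv_jpoly[OF assms])
 moreover have "Pb x e u = x ** u" by (simp add: Pb_def)
 ultimately show 1: "x ** u = jinv J x ** P x u" using assms by simp
 have "(x ** x) ** (jinv J x ** u) = jinv J x ** ((x ** x) ** u)"
  using jpoly_commute[of "[:0, 1:] * [:0, 1:]" x "psmult (inverse (jd x)) (adjp x)" u]
  by (simp only: jpoly_mult jpoly_X jinv_jpoly[OF assms, symmetric])
 hence "P x (jinv J x ** u) = jinv J x ** P x u"
  by (simp add: P_def J_diff jinv_commute[OF assms])
 thus "x ** u = P x (jinv J x ** u)" using 1 by simp
qed

text \<open>The composite is multiplication by \<open>- jinv J x\<close>, so \<open>TrL\<close>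
  applies. In the Bessel operator this trace decides which exponent removes the zero-order
  term.\<close>

lemma Trc_L_dinv:
 assumes "jd x ~= 0" shows "Trc (%h. x ** dinv x h) = - (DIM('a) / r) * tr (jinv J x)"
proof -
 have "(%h. x ** dinv x h) = (%h. - (jinv J x ** h))"
  by (simp add: J_via_P(1)[OF assms] P_dinv[OF assms])
 thus ?thesis using TrL[of "jinv J x"] by (simp add: Trc_neg)
qed

lemma tau_dual_trace':
 assumes "linear f" shows "(\<Sum>b\<in>Basis. tau (f (dl b)) b) = Trc f"
proof -
 have sy: "dl b \<bullet> c = dl c \<bullet> b" for b c by (metis tau_dl tau_sym)
 have "f (dl b) = (\<Sum>c\<in>Basis. (dl b \<bullet> c) *\<^sub>R f c)" for b
  using linear_sum[OF assms, of "%c. (dl b \<bullet> c) *\<^sub>R c" Basis] linear_scale[OF assms]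
  by (simp add: euclidean_representation)
 hence "(\<Sum>b\<in>Basis. tau (f (dl b)) b) = (\<Sum>b\<in>Basis. \<Sum>c\<in>Basis. (dl c \<bullet> b) * tau (f c) b)"
  by (simp add: tau_sum tau_scale sy)
 also have "... = (\<Sum>c\<in>Basis. tau (f c) (\<Sum>b\<in>Basis. (dl c \<bullet> b) *\<^sub>R b))"
  by (subst sum.swap) (simp add: tau_sum tau_scale)
 also have "... = (\<Sum>c\<in>Basis. tau (f c) (dl c))" by (simp only: euclidean_representation)
 finally show ?thesis by (simp add: Trc_def tau_dl)
qed

text \<open>Polynomial fields of degree at most two, of the kinds that occur in the conformal Lie
  algebra. Stability under pull-back by translations, structure maps and the inversion gives every
  composite polynomial fields with prescribed image, and this remains true at points where only the
  composite is defined.\<close>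

inductive_set qf :: "('a => 'a) set" where
 qf_const: "(%x. v) \<in> qf"
| qf_lin: "(%x. Pb x v w) \<in> qf"
| qf_quad: "(%x. P x w) \<in> qf"
| qf_add: "X \<in> qf ==> Y \<in> qf ==> (%x. X x + Y x) \<in> qf"

lemma Pb_poly:
 "pfun f ==> pfun g ==> pfun (%x. Pb (f x) (g x) w)"
 unfolding Pb_def by (intro polynomial_function_diff polynomial_function_add poly_J polynomial_function_const)

lemma qf_poly: "X \<in> qf ==> pfun X"
proof (induction rule: qf.induct)
 case qf_lin show ?case by (intro Pb_poly polynomial_function_id polynomial_function_const)
next
 case qf_quad show ?case by (intro Pb_poly polynomial_function_id)
next
 case (qf_add X Y) thus ?case by (intro polynomial_function_add)
qed simp

lemma qf_pullback:
 assumes lin: "!!x. x \<in> S ==> linear (D x)"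
  and 1: "!!v. \<exists>Y\<in>qf. \<forall>x\<in>S. D x (Y x) = v"
  and 2: "!!v w. \<exists>Y\<in>qf. \<forall>x\<in>S. D x (Y x) = Pb (f x) v w"
  and 3: "!!w. \<exists>Y\<in>qf. \<forall>x\<in>S. D x (Y x) = P (f x) w"
  and "X \<in> qf"
 shows "\<exists>Y\<in>qf. \<forall>x\<in>S. D x (Y x) = X (f x)"
 using \<open>X \<in> qf\<close>
proof induction
 case (qf_add X Y)
 then obtain X' Y' where "X' \<in> qf" "Y' \<in> qf" "\<forall>x\<in>S. D x (X' x) = X (f x)" "\<forall>x\<in>S. D x (Y' x) = Y (f x)" by blast
 thus ?case by (intro bexI[of _ "%x. X' x + Y' x"] qf.qf_add ballI) (auto simp: linear_add[OF lin])
qed (use 1 2 3 in simp_all)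

lemma P_add: "P (x + v) w = P x w + (Pb x v w + Pb x v w) + P v w"
 by (rule vec_eq_inner) (simp add: Pb_def comm[of v x] J_add inner_add_left inner_diff_left)

lemma qf_translation:
 assumes "X \<in> qf" shows "\<exists>Y\<in>qf. \<forall>x\<in>S. Y x = X (x + v)"
proof (rule qf_pullback[where D = "%x u. u" and f = "%x. x + v", OF _ _ _ _ assms])
 show "linear (%u::'a. u)" by (rule linear_ident)
 show "\<exists>Y\<in>qf. \<forall>x\<in>S. Y x = w" for w by (intro bexI[OF _ qf_const]) auto
 show "\<exists>Y\<in>qf. \<forall>x\<in>S. Y x = Pb (x + v) u w" for u w
  by (intro bexI[OF _ qf_add[OF qf_lin[of u w] qf_const[of "Pb v u w"]]]) (simp add: linear_add[OF Pb_linear(2)])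
 show "\<exists>Y\<in>qf. \<forall>x\<in>S. Y x = P (x + v) w" for w
  by (intro bexI[OF _ qf_add[OF qf_add[OF qf_quad[of w] qf_add[OF qf_lin[of v w] qf_lin[of v w]]] qf_const[of "P v w"]]])
   (rule ballI, rule P_add[symmetric])
qed

lemma qf_linear:
 assumes g: "g \<in> str_group_pos J" and "X \<in> qf" shows "\<exists>Y\<in>qf. \<forall>x\<in>S. g (Y x) = X (g x)"
proof (rule qf_pullback[where D = "%x u. g u" and f = g, OF _ _ _ _ assms(2)])
 note gD = strp_D[OF g]
 have gi: "g (inv_into UNIV g y) = y" for y using gD(2) by (simp add: bij_is_surj surj_f_inv_f)
 show "linear (%u. g u)" by (simp add: gD(1))
 show "\<exists>Y\<in>qf. \<forall>x\<in>S. g (Y x) = v" for v by (intro bexI[OF _ qf_const[of "inv_into UNIV g v"]]) (simp add: gi)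
 have c: "str_char J g ~= 0" using gD(3) by simp
 show "\<exists>Y\<in>qf. \<forall>x\<in>S. g (Y x) = Pb (g x) v w" for v w
  by (intro bexI[OF _ qf_lin[of "inv_into UNIV g v" "tadj g w"]])
   (simp add: Pb_str[OF gD(1,2) c gD(4), symmetric] gi)
 show "\<exists>Y\<in>qf. \<forall>x\<in>S. g (Y x) = P (g x) w" for w
  by (intro bexI[OF _ qf_quad[of "tadj g w"]]) (simp add: Pb_str[OF gD(1,2) c gD(4), symmetric])
qed

lemma P_P_jinv: assumes "jd x ~= 0" shows "P x (P (jinv J x) h) = h"
proof -
 let ?v = "jinv J x"
 have v: "jd ?v ~= 0" using assms by (simp add: jd_jinv)
 have S: "x \<in> {x. jd x ~= 0}" using assms by simp
 have "dinv ?v (dinv x h) - h = 0"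
  by (rule has_deriv_const_on_open[OF has_derivative_diff[OF has_derivative_compose[OF dinv[OF assms] dinv[OF v]]
   has_derivative_ident] open_invertibles S, of 0]) (simp add: jinv_jinv)
 hence "P ?v h = - dinv x h" using P_dinv[OF v, of "dinv x h"] by simp
 thus ?thesis by (simp add: linear_neg[OF Pb_linear(1)] P_dinv[OF assms])
qed

lemma P_Dop: assumes "jd x ~= 0" shows "P x (Dop a b (jinv J x)) = - Dop a b x"
proof (rule P_inverse_eq[OF assms])
 let ?D = "Dop a b" and ?v = "jinv J x"
 have "?D e = 0" by (simp add: Dop_def comm)
 thus "?D x ** ?v + x ** ?D ?v = 0" using Dop_derivation[of a b x ?v] assms by simp
 show "2 *\<^sub>R ((x ** ?D x) ** ?v) + (x ** x) ** ?D ?v = ?D x"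
  using Dop_derivation[of a b "x ** x" ?v] jinv_sq[OF assms] Dop_derivation[of a b x x]
  by (simp add: comm[of "?D x"] J_add scaleR_2)
qed

text \<open>\<open>Pb\<close> at the inverse splits into a multiplication and a derivation;
  \<open>J_via_P\<close> and \<open>P_Dop\<close> carry these two through \<open>P x\<close>, and
  the arguments come out exchanged.\<close>

lemma P_Pb_jinv: assumes "jd x ~= 0" shows "P x (Pb (jinv J x) a w) = Pb x w a"
proof -
 let ?v = "jinv J x"
 have "Pb ?v a w = ?v ** (a ** w) + Dop a w ?v"
  by (simp add: Pb_def Dop_def comm[of w ?v] comm[of w "?v ** a"] comm[of a ?v])
 hence "P x (Pb ?v a w) = x ** (a ** w) - Dop a w x"
  by (simp add: linear_add[OF Pb_linear(1)] J_via_P(2)[OF assms, symmetric] P_Dop[OF assms])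
 also have "... = Pb x w a"
  by (simp add: Pb_def Dop_def comm[of w x] comm[of a w] comm[of a x] comm[of a "x ** w"])
 finally show ?thesis .
qed

text \<open>Pull-back by the inversion replaces \<open>X\<close> by \<open>P x\<close> applied to
  \<open>X (- jinv J x)\<close>: constant and quadratic fields change places, and the fields
  \<open>Pb x v w\<close> keep their type.\<close>

lemma qf_inversion:
 assumes "X \<in> qf"
 shows "\<exists>Y\<in>qf. \<forall>x\<in>{x. jd x ~= 0}. - dinv x (Y x) = X (- jinv J x)"
proof (rule qf_pullback[where D = "%x u. - dinv x u" and f = "%x. - jinv J x", OF _ _ _ _ assms])
 have key: "- dinv x u = z" if "jd x ~= 0" "P x z = u" for x u z
  by (rule P_inj[OF that(1)]) (simp add: linear_neg[OF Pb_linear(1)] P_dinv[OF that(1)] that(2))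
 show "linear (%u. - dinv x u)" if "x \<in> {x. jd x ~= 0}" for x
  using that by (intro linear_compose_neg dinv_linear) simp
 show "\<exists>Y\<in>qf. \<forall>x\<in>{x. jd x ~= 0}. - dinv x (Y x) = v" for v
  by (intro bexI[OF _ qf_quad[of v]] ballI key) auto
 show "\<exists>Y\<in>qf. \<forall>x\<in>{x. jd x ~= 0}. - dinv x (Y x) = Pb (- jinv J x) v w" for v w
  by (intro bexI[OF _ qf_lin[of w "- v"]] ballI key)
   (auto simp: linear_neg[OF Pb_linear(1)] linear_neg[OF Pb_linear(2)] P_Pb_jinv)
 show "\<exists>Y\<in>qf. \<forall>x\<in>{x. jd x ~= 0}. - dinv x (Y x) = P (- jinv J x) w" for w
  by (intro bexI[OF _ qf_const[of w]] ballI key)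
   (auto simp: linear_neg[OF Pb_linear(2)] linear_neg[OF Pb_linear(3)] P_P_jinv)
qed

end

section \<open>Operators in two groups of variables\<close>

lemma dd_sum_list:
 assumes "open S" "x \<in> S" "!!p ws. (p, ws) \<in> set T ==> smooth_on S (g ws)"
 shows "dd vs (%x. \<Sum>(p, ws)\<leftarrow>T. p * g ws x) x = (\<Sum>(p, ws)\<leftarrow>T. p * dd vs (g ws) x)"
 using assms(3)
proof (induction T)
 case (Cons t T)
 obtain p ws where t: "t = (p, ws)" by force
 have 1: "smooth_on S (%x. p * g ws x)" using Cons.prems t by (intro sm_mult assms(1)) auto
 have 2: "smooth_on S (%x. \<Sum>(p, ws)\<leftarrow>T. p * g ws x)"
  unfolding case_prod_unfold using Cons.prems t by (intro sm_sum_list sm_mult assms(1)) force+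
 have 3: "smooth_on S (g ws)" using Cons.prems t by auto
 have IH: "dd vs (%x. \<Sum>(p, ws)\<leftarrow>T. p * g ws x) x = (\<Sum>(p, ws)\<leftarrow>T. p * dd vs (g ws) x)"
  by (rule Cons.IH) (use Cons.prems in auto)
 show ?case using IH dd_add[OF assms(1) 1 2 assms(2), of vs]
   dd_cmult[OF assms(1) 3 assms(2), of vs p] t by simp
qed (simp add: dd_zero)

lemma slice_right:
 fixes H :: "'c::real_normed_vector \<times> 'b::real_normed_vector => complex"
 assumes "open S" "smooth_on S H"
 shows "open {z. (th, z) \<in> S}" "smooth_on {z. (th, z) \<in> S} (%z. H (th, z))"
  "(th, z) \<in> S ==> dd vs (%z. H (th, z)) z = dd (map (%v. (0, v)) vs) H (th, z)"
proof -
 have bl: "bounded_linear (%v::'b. (0::'c, v))" by (intro bounded_linear_Pair bounded_linear_zero bounded_linear_ident)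
 have "continuous_on UNIV (%z::'b. (th, z))" by (intro continuous_intros)
 from open_vimage[OF assms(1) this] show "open {z. (th, z) \<in> S}" by (simp add: vimage_def)
 show "smooth_on {z. (th, z) \<in> S} (%z. H (th, z))"
  using sm_affine[OF assms bl, of "(th, 0)"] by simp
 show "(th, z) \<in> S ==> dd vs (%z. H (th, z)) z = dd (map (%v. (0, v)) vs) H (th, z)"
  using dd_affine[OF assms bl, of "(th, 0)" z vs] by simp
qed

lemma slice_left:
 fixes H :: "'c::real_normed_vector \<times> 'b::real_normed_vector => complex"
 assumes "open S" "smooth_on S H"
 shows "open {th. (th, z) \<in> S}" "smooth_on {th. (th, z) \<in> S} (%th. H (th, z))"
  "(th, z) \<in> S ==> dd vs (%th. H (th, z)) th = dd (map (%v. (v, 0)) vs) H (th, z)"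
proof -
 have bl: "bounded_linear (%v::'c. (v, 0::'b))" by (intro bounded_linear_Pair bounded_linear_zero bounded_linear_ident)
 have "continuous_on UNIV (%th::'c. (th, z))" by (intro continuous_intros)
 from open_vimage[OF assms(1) this] show "open {th. (th, z) \<in> S}" by (simp add: vimage_def)
 show "smooth_on {th. (th, z) \<in> S} (%th. H (th, z))"
  using sm_affine[OF assms bl, of "(0, z)"] by simp
 show "(th, z) \<in> S ==> dd vs (%th. H (th, z)) th = dd (map (%v. (v, 0)) vs) H (th, z)"
  using dd_affine[OF assms bl, of "(0, z)" th vs] by simp
qed

lemma ldo_right:
 fixes H :: "'c::real_normed_vector \<times> 'b::euclidean_space => complex"
 assumes H: "open S" "smooth_on S H" and A: "ldo_by T A" and z: "(th, z) \<in> S"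
 shows "A (%z. H (th, z)) z = (\<Sum>(p, vs)\<leftarrow>T. p z * dd (map (%v. (0, v)) vs) H (th, z))"
proof -
 have "A (%z. H (th, z)) z = diff_op T (%z. H (th, z)) z"
  by (rule ldo_byD(2)[OF A slice_right(1,2)[OF H]]) (use z in simp)
 thus ?thesis by (simp add: diff_op_def slice_right(3)[OF H z])
qed

text \<open>Derivatives in the two groups of variables commute, and the coefficients of either
  operator are constants for the other.\<close>

theorem ldo_commute:
 fixes H :: "'c::euclidean_space \<times> 'b::euclidean_space => complex"
 assumes H: "open S" "smooth_on S H" and A: "ldo A" and B: "ldo B" and S: "(th, z) \<in> S"
 shows "A (%z. B (%th. H (th, z)) th) z = B (%th. A (%z. H (th, z)) z) th"
proof -
 obtain T where TA: "ldo_by T A" using A unfolding ldo_def by blast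
 note T = ldo_byD(2)[OF TA]
 obtain T' where "ldo_by T' B" using B unfolding ldo_def by blast
 note T' = ldo_byD(2)[OF this]
 let ?L = "map (%v::'c. (v, 0::'b))" and ?R = "map (%v::'b. (0::'c, v))"
 let ?U = "{z. (th, z) \<in> S}" and ?V = "{th. (th, z) \<in> S}"
 have B1: "B (%th. H (th, z')) th = (\<Sum>(q, ws)\<leftarrow>map (%(q, ws). (q th, ws)) T'. q * dd (?L ws) H (th, z'))" if "z' \<in> ?U" for z'
 proof -
  have "B (%th. H (th, z')) th = diff_op T' (%th. H (th, z')) th"
   by (rule T'[OF slice_left(1,2)[OF H]]) (use that in simp)
  thus ?thesis using that by (simp add: diff_op_def slice_left(3)[OF H] o_def case_prod_unfold)
 qed
 have A1: "A (%z. H (th', z)) z = (\<Sum>(p, vs)\<leftarrow>map (%(p, vs). (p z, vs)) T. p * dd (?R vs) H (th', z))" if "th' \<in> ?V" for th'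
  using ldo_right[OF H TA, of th' z] that by (simp add: o_def case_prod_unfold)
 have sm: "smooth_on S (dd ws H)" for ws by (rule sm_dir_deriv[OF H(2)])
 let ?K = "%z'. \<Sum>(q, ws)\<leftarrow>map (%(q, ws). (q th, ws)) T'. q * dd (?L ws) H (th, z')"
 let ?M = "%th'. \<Sum>(p, vs)\<leftarrow>map (%(p, vs). (p z, vs)) T. p * dd (?R vs) H (th', z)"
 have smK: "smooth_on ?U ?K"
  unfolding case_prod_unfold
  by (intro sm_sum_list sm_mult sm_const slice_right(1)[OF H] slice_right(2)[OF H(1) sm])
 have smM: "smooth_on ?V ?M"
  unfolding case_prod_unfold
  by (intro sm_sum_list sm_mult sm_const slice_left(1)[OF H] slice_left(2)[OF H(1) sm])
 have zU: "z \<in> ?U" and tV: "th \<in> ?V" using S by auto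
 have "A (%z. B (%th. H (th, z)) th) z = A ?K z"
  by (rule ldo_cong[OF A slice_right(1)[OF H] smK _ zU, symmetric]) (rule B1[symmetric])
 also have "... = (\<Sum>(p, vs)\<leftarrow>T. p z * dd vs ?K z)"
  using T[OF slice_right(1)[OF H] smK zU] by (simp add: diff_op_def)
 also have "... = (\<Sum>(p, vs)\<leftarrow>T. p z * (\<Sum>(q, ws)\<leftarrow>map (%(q, ws). (q th, ws)) T'. q * dd (?R vs @ ?L ws) H (th, z)))"
  by (subst dd_sum_list[OF slice_right(1)[OF H] zU, of _ "%ws z'. dd (?L ws) H (th, z')"])
   (use slice_right(2)[OF H(1) sm] slice_right(3)[OF H(1) sm S] in \<open>auto simp: dd_append\<close>)
 also have "... = (\<Sum>(p, vs)\<leftarrow>T. \<Sum>(q, ws)\<leftarrow>T'. p z * (q th * dd (?L ws @ ?R vs) H (th, z)))"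
 proof -
  have "dd (?R vs @ ?L ws) H (th, z) = dd (?L ws @ ?R vs) H (th, z)" for vs ws
   by (rule dd_perm[OF H S]) simp
  thus ?thesis by (simp add: o_def case_prod_unfold flip: sum_list_const_mult)
 qed
 also have "... = (\<Sum>(q, ws)\<leftarrow>T'. \<Sum>(p, vs)\<leftarrow>T. p z * (q th * dd (?L ws @ ?R vs) H (th, z)))"
 proof (induction T)
  case Nil show ?case by (simp add: case_prod_unfold)
 next
  case (Cons t T) thus ?case by (simp add: case_prod_unfold sum_list_addf)
 qed
 also have "... = (\<Sum>(q, ws)\<leftarrow>T'. q th * (\<Sum>(p, vs)\<leftarrow>map (%(p, vs). (p z, vs)) T. p * dd (?L ws @ ?R vs) H (th, z)))"
  by (simp add: o_def case_prod_unfold mult_ac flip: sum_list_const_mult)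
 also have "... = (\<Sum>(q, ws)\<leftarrow>T'. q th * dd ws ?M th)"
  by (subst dd_sum_list[OF slice_left(1)[OF H] tV, of _ "%vs th'. dd (?R vs) H (th', z)"])
   (use slice_left(2)[OF H(1) sm] slice_left(3)[OF H(1) sm S] in \<open>auto simp: dd_append\<close>)
 also have "... = B ?M th"
  using T'[OF slice_left(1)[OF H] smM tV] by (simp add: diff_op_def)
 also have "... = B (%th. A (%z. H (th, z)) z) th"
  by (rule ldo_cong[OF B slice_left(1)[OF H] smM _ tV]) (rule A1[symmetric])
 finally show ?thesis .
qed

lemma ldo_param_smooth:
 fixes H :: "'c::euclidean_space \<times> 'b::euclidean_space => complex"
 assumes H: "open S" "smooth_on S H" and A: "ldo A"
 shows "smooth_on S (%(th, z). A (%z. H (th, z)) z)"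
proof -
 obtain T where T: "ldo_by T A" using A unfolding ldo_def by blast
 have "smooth_on S (%w. \<Sum>(p, vs)\<leftarrow>T. p (snd w) * dd (map (%v. (0, v)) vs) H w)"
  unfolding case_prod_unfold
 proof (intro sm_sum_list sm_mult H(1) sm_dir_deriv[OF H(2)])
  fix t assume "t \<in> set T"
  hence "smooth_on UNIV (fst t)" using ldo_byD(1)[OF T, of "fst t" "snd t"] by simp
  from sm_affine[OF open_UNIV this bounded_linear_snd, of 0]
  show "smooth_on S (%w. fst t (snd w))" by (intro sm_subset[of UNIV _ S]) auto
 qed
 thus ?thesis by (rule sm_cong[OF H(1), rotated]) (use ldo_right[OF H T] in auto)
qed

lemma ldo_linear_comb:
 assumes "ldo A" "open S" "!!i. i \<in> I ==> smooth_on S (f i)" "x \<in> S"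
 shows "A (%x. \<Sum>i\<in>I. c i * f i x) x = (\<Sum>i\<in>I. c i * A (f i) x)"
proof -
 obtain T where "ldo_by T A" using assms(1) unfolding ldo_def by blast
 note T = ldo_byD(2)[OF this]
 have sm: "smooth_on S (%x. \<Sum>i\<in>I. c i * f i x)"
  by (intro sm_sum sm_mult sm_const assms)
 have d: "dd vs (%x. \<Sum>i\<in>I. c i * f i x) x = (\<Sum>i\<in>I. c i * dd vs (f i) x)" for vs
  by (subst dd_sum[OF assms(2) _ assms(4)])
   (auto intro!: sm_mult sm_const sum.cong dd_cmult[OF assms(2) _ assms(4)] assms(2,3))
 have "A (%x. \<Sum>i\<in>I. c i * f i x) x = (\<Sum>(p, vs)\<leftarrow>T. p x * (\<Sum>i\<in>I. c i * dd vs (f i) x))"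
  using T[OF assms(2) sm assms(4)] by (simp add: diff_op_def d)
 also have "... = (\<Sum>i\<in>I. c i * (\<Sum>(p, vs)\<leftarrow>T. p x * dd vs (f i) x))"
  by (induction T) (auto simp: sum_distrib_left sum.distrib algebra_simps)
 also have "... = (\<Sum>i\<in>I. c i * A (f i) x)"
  using T[OF assms(2,3,4)] by (intro sum.cong refl) (simp add: diff_op_def)
 finally show ?thesis .
qed

lemma ldo_cmult:
 assumes "ldo A" "open S" "smooth_on S f" "x \<in> S"
 shows "A (%x. c * f x) x = c * A f x"
 using ldo_linear_comb[OF assms(1,2), of "{()}" "%_. f" x "%_. c"] assms by simp

lemma ldo_affine:
 fixes A :: "('b::euclidean_space => complex) => 'b => complex" and L K :: "'b => 'b"
 assumes A: "ldo A" and L: "linear L" "linear K" "!!x. L (K x) = x"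
 shows "ldo (%f z. A (%y. f (a + L y)) (K (z - a)))"
proof -
 obtain T where "ldo_by T A" using A unfolding ldo_def by blast
 note T1 = ldo_byD(1)[OF this] and T = ldo_byD(2)[OF this]
 have blL: "bounded_linear L" and blK: "bounded_linear K" using L by (simp_all add: linear_conv_bounded_linear)
 let ?T = "map (%(p, vs). (%z. p (K (z - a)), map L vs)) T"
 show ?thesis
 proof (rule ldoI[of ?T])
  fix p vs assume "(p, vs) \<in> set ?T"
  then obtain q where q: "smooth_on UNIV q" "p = (%z. q (K (z - a)))" using T1 by auto
  have "p = (%z. q (- K a + K z))" using q(2) by (simp add: linear_diff[OF L(2)])
  thus "smooth_on UNIV p" using sm_affine[OF open_UNIV q(1) blK, of "- K a"] by simp
 next
  fix S :: "'b set" and f z assume S: "open S" "smooth_on S f" "z \<in> S"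
  let ?U = "{y. a + L y \<in> S}"
  have "continuous_on UNIV (%y. a + L y)" by (intro continuous_intros linear_continuous_on blL)
  from open_vimage[OF S(1) this] have U: "open ?U" by (simp add: vimage_def)
  have z: "a + L (K (z - a)) = z" by (simp add: L(3))
  have "A (%y. f (a + L y)) (K (z - a)) = diff_op T (%y. f (a + L y)) (K (z - a))"
   by (rule T[OF U sm_affine[OF S(1,2) blL]]) (simp add: z S(3))
  also have "... = (\<Sum>(p, vs)\<leftarrow>T. p (K (z - a)) * dd (map L vs) f z)"
   using dd_affine[OF S(1,2) blL, of a "K (z - a)"] z S(3) by (simp add: diff_op_def)
  also have "... = diff_op ?T f z" by (simp add: diff_op_def o_def case_prod_unfold)
  finally show "A (%y. f (a + L y)) (K (z - a)) = diff_op ?T f z" .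
 qed
qed

lemma dd_product2:
 assumes "open S" "smooth_on S f" "smooth_on S g" "x \<in> S"
 shows "dd [u] (%x. f x * g x) x = f x * dd [u] g x + dd [u] f x * g x"
  "dd [u, v] (%x. f x * g x) x = f x * dd [u, v] g x + dd [u] f x * dd [v] g x
   + dd [v] f x * dd [u] g x + dd [u, v] f x * g x"
proof -
 have 1: "dd [u] (%x. f x * g x) x = f x * dd [u] g x + dd [u] f x * g x"
  if "smooth_on S f" "smooth_on S g" "x \<in> S" for u f g x
  using fderiv_eqI[OF has_derivative_mult[OF sm_hasd[OF that(1,3)] sm_hasd[OF that(2,3)]]]
  by simp
 show "dd [u] (%x. f x * g x) x = f x * dd [u] g x + dd [u] f x * g x" by (rule 1[OF assms(2-4)])
 have "dd [u, v] (%x. f x * g x) x = dd [u] (dd [v] (%x. f x * g x)) x" by simp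
 also have "... = dd [u] (%x. f x * dd [v] g x + dd [v] f x * g x) x"
  by (rule dd_cong[OF assms(1) _ assms(4)]) (rule 1[OF assms(2,3)])
 also have "... = dd [u] (%x. f x * dd [v] g x) x + dd [u] (%x. dd [v] f x * g x) x"
  by (intro dd_add[OF assms(1) _ _ assms(4)] sm_mult sm_dir_deriv assms)
 finally show "dd [u, v] (%x. f x * g x) x = f x * dd [u, v] g x + dd [u] f x * dd [v] g x
   + dd [v] f x * dd [u] g x + dd [u, v] f x * g x"
  using 1[OF assms(2) sm_dir_deriv[OF assms(3), of "[v]"] assms(4), of u]
   1[OF sm_dir_deriv[OF assms(2), of "[v]"] assms(3,4), of u] by simp
qed

section \<open>Bessel operators\<close>

context sjordan begin

definition tau2 :: "'a \<times> 'a => 'a \<times> 'a => real" where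
 "tau2 z th = tau (fst z) (fst th) + tau (snd z) (snd th)"

definition S2 :: "'a \<times> 'a => 'a \<times> 'a" where "S2 th = (Sg (fst th), Sg (snd th))"

lemma tau2_inner: "tau2 z th = z \<bullet> S2 th"
 by (simp add: tau2_def S2_def inner_prod_def tau_inner)

lemma tau2_sym: "tau2 z th = tau2 th z" by (simp add: tau2_def tau_sym)

lemma S2_surj: "\<exists>th. S2 th = y"
proof -
 obtain a b where "Sg a = fst y" "Sg b = snd y" using bij_is_surj[OF Sg_bij] by (metis surjD)
 thus ?thesis by (intro exI[of _ "(a, b)"]) (simp add: S2_def)
qed

lemma S2_linear: "linear S2"
 by (rule linearI) (simp_all add: S2_def linear_add[OF Sg_linear] linear_scale[OF Sg_linear])

lemma tau2_linear: "linear (%z. tau2 z th)"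
 unfolding tau2_inner by (rule linearI) (simp_all add: inner_add_left)

definition E :: "complex => 'a \<times> 'a => 'a \<times> 'a => complex" where
 "E c th z = exp (c * of_real (tau2 z th))"

lemma E_sym: "E c th z = E c z th" by (simp add: E_def tau2_sym)

lemma E_nonzero [simp]: "E c th z ~= 0" by (simp add: E_def)

lemma E_inner: "E c th = (%z. exp (c * of_real (z \<bullet> S2 th)))"
 by (simp add: E_def[abs_def] tau2_inner)

lemma E_smooth: "smooth_on S (E c th)"
 unfolding E_inner by (rule sm_subset[OF sm_expc]) simp

lemma E_dir_deriv: "dd ws (E c th) z = (\<Prod>w\<leftarrow>ws. c * of_real (tau2 w th)) * E c th z"
 unfolding E_inner dd_expc tau2_inner ..

lemma ldo_eqI_E:
 assumes "ldo U" "ldo W" "c ~= 0" "open S" "smooth_on S f" "x \<in> S" "!!th. U (E c th) x = W (E c th) x"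
 shows "U f x = W f x"
proof (rule ldo_eqI[OF assms(1-6)])
 fix th obtain th' where "S2 th' = th" using S2_surj by blast
 thus "U (%z. exp (c * of_real (z \<bullet> th))) x = W (%z. exp (c * of_real (z \<bullet> th))) x"
  using assms(7)[of th'] by (simp add: E_inner)
qed

lemma poly_linear: "linear (f :: 'c::euclidean_space => 'd::euclidean_space) ==> pfun f"
 by (simp add: linear_conv_bounded_linear polynomial_function_bounded_linear)

lemma lin_fst_snd: "linear (fst :: 'c::real_vector \<times> 'd::real_vector => _)" "linear (snd :: 'c \<times> 'd => _)"
 by (rule linearI; simp)+

lemma E_joint: "smooth_on UNIV (%(th, z). E c th z)"
proof -
 have "rpoly (%w::('a \<times> 'a) \<times> ('a \<times> 'a). snd w \<bullet> S2 (fst w))"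
  by (intro rpoly_inner poly_linear lin_fst_snd linear_compose[OF lin_fst_snd(1) S2_linear, unfolded o_def])
 from sm_exp[OF open_UNIV sm_mult[OF open_UNIV sm_const sm_real_poly[OF this]]]
 show ?thesis by (simp add: E_inner case_prod_unfold)
qed

lemma E_commute:
 assumes "ldo U" "ldo W"
 shows "U (%z. W (%th. E c th z) th) z = W (%th. U (E c th) z) th"
 using ldo_commute[OF open_UNIV E_joint assms, of th z c] by simp

text \<open>The component along the unit of the vector-valued Bessel operator, in one of the two
  variables: \<open>ka\<close> embeds the algebra as that variable and \<open>\<pi>\<close> reads it
  off.\<close>

definition Bes :: "('a => 'a \<times> 'a) => ('a \<times> 'a => 'a) => complex => ('a \<times> 'a => complex) => 'a \<times> 'a => complex" where
 "Bes ka \<pi> k h z = (\<Sum>a\<in>Basis. \<Sum>b\<in>Basis. of_real (tau (a ** b) (\<pi> z)) * dd [ka (dl a), ka (dl b)] h z)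
   + k * dd [ka e] h z"

abbreviation inl :: "'a => 'a \<times> 'a" where "inl x \<equiv> (x, 0)"
abbreviation inr :: "'a => 'a \<times> 'a" where "inr x \<equiv> (0, x)"

definition BB :: "complex => complex => ('a \<times> 'a => complex) => 'a \<times> 'a => complex" where
 "BB k k' h z = Bes inl fst k h z + Bes inr snd k' h z"

definition sq :: "'a \<times> 'a => 'a \<times> 'a" where "sq z = (fst z ** fst z, snd z ** snd z)"

definition tr2 :: "complex => complex => 'a \<times> 'a => complex" where
 "tr2 l m z = l * of_real (tr (fst z)) + m * of_real (tr (snd z))"

text \<open>The infinitesimal action of the field \<open>v ** v\<close> on both factors with weights
  \<open>l\<close> and \<open>m\<close>; it is the generator of the flow used further below.\<close>

definition dpi :: "complex => complex => ('a \<times> 'a => complex) => 'a \<times> 'a => complex" where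
 "dpi l m f z = (\<Sum>b\<in>Basis. of_real (sq z \<bullet> b) * dd [b] f z) + tr2 l m z * f z"

lemma smooth_of_real_linear: "linear f ==> smooth_on S (%x::'c::euclidean_space. cor (f x))"
 by (rule sm_real_poly) (simp add: real_polynomial_function_eq poly_linear)

lemma ldo_Bes:
 assumes "linear \<pi>" shows "ldo (Bes ka \<pi> k)"
proof -
 have "ldo (%h z. (\<Sum>a\<in>Basis. \<Sum>b\<in>Basis. of_real (tau (a ** b) (\<pi> z)) * dd [ka (dl a), ka (dl b)] h z)
   + k * dd [ka e] h z)"
  by (intro ldo_add ldo_sum ldo_mult ldo_dir_deriv sm_const smooth_of_real_linear
    linear_compose[OF assms tau_linear(1), unfolded o_def])
 thus ?thesis by (simp add: Bes_def[abs_def])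
qed

lemma ldo_BB: "ldo (BB k k')"
 unfolding BB_def[abs_def] by (intro ldo_add ldo_Bes lin_fst_snd)

lemma sq_poly: "pfun sq"
proof -
 have "pfun (%z::'a\<times>'a. inl (fst z ** fst z) + inr (snd z ** snd z))"
  by (intro polynomial_function_add polynomial_function_compose[OF poly_J poly_linear, unfolded o_def]
    poly_linear lin_fst_snd) (rule linearI; simp)+
 thus ?thesis by (simp add: sq_def[abs_def])
qed

lemma tr2_smooth: "smooth_on UNIV (tr2 l m)"
 unfolding tr2_def[abs_def]
 by (intro sm_add sm_mult sm_const smooth_of_real_linear open_UNIV
   linear_compose[OF lin_fst_snd(1) tr_linear, unfolded o_def] linear_compose[OF lin_fst_snd(2) tr_linear, unfolded o_def])

lemma ldo_dpi: "ldo (dpi l m)"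
proof -
 have "ldo (%f z. (\<Sum>b\<in>Basis. of_real (sq z \<bullet> b) * dd [b] f z) + tr2 l m z * f z)"
  by (intro ldo_add ldo_sum ldo_mult ldo_dir_deriv tr2_smooth ldo_id sm_real_poly
    pfun_inner_real[OF sq_poly])
 thus ?thesis by (simp add: dpi_def[abs_def])
qed

lemma deriv_expand:
 assumes "smooth_on S f" "z \<in> S"
 shows "(\<Sum>b\<in>Basis. of_real (v \<bullet> b) * dd [b] f z) = fderiv f (at z) v"
proof -
 have l: "linear (fderiv f (at z))" by (rule sm_linear_deriv[OF assms])
 have "fderiv f (at z) (\<Sum>b\<in>Basis. (v \<bullet> b) *\<^sub>R b) = (\<Sum>b\<in>Basis. (v \<bullet> b) *\<^sub>R fderiv f (at z) b)"
  by (simp add: linear_sum[OF l] linear_scale[OF l])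
 thus ?thesis by (simp add: euclidean_representation scaleR_conv_of_real)
qed

lemma dpi_frechet:
 assumes "smooth_on S f" "z \<in> S"
 shows "dpi l m f z = fderiv f (at z) (sq z) + tr2 l m z * f z"
 unfolding dpi_def deriv_expand[OF assms] ..

lemma dpi_E: "dpi l m (E c th) z = (c * of_real (tau2 (sq z) th) + tr2 l m z) * E c th z"
proof -
 have "fderiv (E c th) (at z) (sq z) = c * of_real (tau2 (sq z) th) * E c th z"
  using E_dir_deriv[of "[sq z]" c th z] by simp
 thus ?thesis by (simp add: dpi_frechet[OF E_smooth[of UNIV]] algebra_simps)
qed

lemma tau_dl': "tau (dl a) y = y \<bullet> a" using tau_dl[of y a] by (simp add: tau_sym)

lemma tau_double_sum: "(\<Sum>a\<in>Basis. \<Sum>b\<in>Basis. tau (a ** b) x * ((u \<bullet> a) * (v \<bullet> b))) = tau (u ** v) x"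
proof -
 have "tau ((\<Sum>a\<in>Basis. (u \<bullet> a) *\<^sub>R a) ** (\<Sum>b\<in>Basis. (v \<bullet> b) *\<^sub>R b)) x =
  (\<Sum>b\<in>Basis. \<Sum>a\<in>Basis. (v \<bullet> b) * ((u \<bullet> a) * tau (a ** b) x))"
  by (simp add: J_sum_left J_sum_right tau_sum tau_scale sum_distrib_left del: euclidean_representation_sum_fun)
 thus ?thesis by (subst sum.swap) (simp add: euclidean_representation mult_ac)
qed

lemma Bes_E:
 assumes "!!v. tau2 (ka v) th = tau v (\<pi> th)"
 shows "Bes ka \<pi> k (E c th) z = (c\<^sup>2 * of_real (tau (\<pi> th ** \<pi> th) (\<pi> z)) + c * k * of_real (tr (\<pi> th))) * E c th z"
proof -
 have "Bes ka \<pi> k (E c th) z = c\<^sup>2 * of_real (\<Sum>a\<in>Basis. \<Sum>b\<in>Basis. tau (a ** b) (\<pi> z) * ((\<pi> th \<bullet> a) * (\<pi> th \<bullet> b))) * E c th z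
   + c * k * of_real (tr (\<pi> th)) * E c th z"
  unfolding Bes_def E_dir_deriv
  by (simp add: assms tau_dl' sum_distrib_left sum_distrib_right power2_eq_square mult_ac)
 from this[unfolded tau_double_sum] show ?thesis by (simp add: algebra_simps)
qed

lemma BB_E: "BB k k' (E c th) z = (c\<^sup>2 * of_real (tau2 (sq th) z) + c * tr2 k k' th) * E c th z"
proof -
 have 1: "tau2 (inl v) th = tau v (fst th)" "tau2 (inr v) th = tau v (snd th)" for v by (simp_all add: tau2_def)
 show ?thesis unfolding BB_def Bes_E[of inl th fst, OF 1(1)] Bes_E[of inr th snd, OF 1(2)]
  by (simp add: tau2_def sq_def tr2_def algebra_simps)
qed

text \<open>The exponential kernel exchanges multiplications and derivatives, so the action in
  \<open>z\<close> becomes a Bessel operator in \<open>th\<close> with the same parameters.\<close>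

lemma dpi_E_BB: "BB l m (E c z) th = c * dpi l m (E c th) z"
 unfolding BB_E dpi_E by (simp add: E_sym[of c z th] power2_eq_square algebra_simps)

abbreviation Dd :: "'a \<times> 'a => real" where "Dd th \<equiv> jd (fst th - snd th)"

lemma linear_minus_pair: "linear (%th::'a \<times> 'a. fst th - snd th)" by (rule linearI) (simp_all add: algebra_simps)

lemma Dd_hasd:
 "(Dd has_derivative (%h. tau (adj (fst th - snd th)) (fst h - snd h))) (at th)"
 using has_derivative_compose[OF bounded_linear_imp_has_derivative[OF linear_minus_pair[unfolded linear_conv_bounded_linear]] jd_hasd']
 by simp

lemma Dd_smooth: "smooth_on S (%th. cor (Dd th))"
proof (rule sm_real_poly)
 show "rpoly Dd"
  using real_polynomial_function_compose[OF poly_linear[OF linear_minus_pair] jd_poly] by (simp add: o_def)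
qed

lemma frechet_of_real:
 assumes "(f has_derivative f') (at x)"
 shows "fderiv (%x. cor (f x)) (at x) h = of_real (f' h)"
 by (rule fderiv_eqI) (rule has_derivative_of_real[OF assms])

text \<open>The factor \<open>tr (u + v)\<close> comes from \<open>u\<^sup>2 - v\<^sup>2 = (u + v) (u - v)\<close>.\<close>

lemma dpi_Dd:
 assumes "smooth_on UNIV f"
 shows "dpi k k' (%th. of_real (Dd th) * f th) th = of_real (Dd th) * dpi (k + 1) (k' + 1) f th"
proof -
 have sm: "smooth_on UNIV (%th. of_real (Dd th) * f th)" by (rule sm_mult[OF open_UNIV Dd_smooth assms])
 have a: "fst (sq th) - snd (sq th) = (fst th + snd th) ** (fst th - snd th)"
  by (simp add: sq_def J_add J_diff comm)
 have "fderiv (%th. cor (Dd th)) (at th) (sq th) = of_real (Dd th * tr (fst th + snd th))"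
  unfolding frechet_of_real[OF Dd_hasd] a jd_deriv_mult ..
 moreover have "fderiv (%th. of_real (Dd th) * f th) (at th) (sq th) = of_real (Dd th) * fderiv f (at th) (sq th)
   + fderiv (%th. cor (Dd th)) (at th) (sq th) * f th"
  using dd_product2(1)[OF open_UNIV Dd_smooth assms, of th "sq th"] by simp
 ultimately show ?thesis
  unfolding dpi_frechet[OF sm UNIV_I] dpi_frechet[OF assms UNIV_I]
  by (simp add: tr2_def linear_add[OF tr_linear] algebra_simps)
qed

definition qp :: "complex => int => 'a => complex" where "qp s ep x = sgn_powr (jd x) s ep"

lemma sgn_powr_shift: "t ~= 0 ==> ep \<in> {1, -1} ==> sgn_powr t (s - 1) (- ep) * of_real t = sgn_powr t s ep"
 by (auto simp: sgn_powr_def powr_diff sgn_if abs_if)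

lemma qp_hasd:
 assumes "jd x ~= 0" "ep \<in> {1, -1}"
 shows "(qp s ep has_derivative (%h. s * qp s ep x * of_real (tau (jinv J x) h))) (at x)"
proof -
 have "tau (adj x) h = jd x * tau (jinv J x) h" for h by (simp add: jinv_eq[OF assms(1)] tau_scale assms(1))
 hence "s * sgn_powr (jd x) (s - 1) (- ep) * of_real (tau (adj x) h) = s * qp s ep x * of_real (tau (jinv J x) h)" for h
  by (simp add: qp_def mult_ac flip: sgn_powr_shift[OF assms, of s])
 hence "(%h. s * sgn_powr (jd x) (s - 1) (- ep) * of_real (tau (adj x) h)) = (%h. s * qp s ep x * of_real (tau (jinv J x) h))" by (rule ext)
 with sgn_powr_compose_hasd[OF jd_hasd' assms, of s] show ?thesis by (simp only: qp_def[abs_def])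
qed

lemma qp_smooth: "ep \<in> {1, -1} ==> smooth_on {x. jd x ~= 0} (qp s ep)"
 unfolding qp_def[abs_def]
 by (rule sm_sgn_powr[OF open_invertibles sm_real_poly[OF jd_poly]]) auto

lemma qp_nonzero: "jd x ~= 0 ==> qp s ep x ~= 0" by (simp add: qp_def sgn_powr_def sgn_if)

lemma tau_expand': "(\<Sum>b\<in>Basis. tau x b *\<^sub>R dl b) = x"
proof (rule tau_eqI)
 fix y
 have "tau x (\<Sum>b\<in>Basis. (y \<bullet> b) *\<^sub>R b) = (\<Sum>b\<in>Basis. (y \<bullet> b) * tau x b)" by (simp add: tau_sum tau_scale del: euclidean_representation_sum_fun)
 thus "tau (\<Sum>b\<in>Basis. tau x b *\<^sub>R dl b) y = tau x y"
  by (simp add: tau_sum tau_scale tau_dl' euclidean_representation mult.commute)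
qed

lemma open_vimage_linear: "open S ==> linear (\<pi> :: 'c::euclidean_space => 'd::euclidean_space) ==> open {z. \<pi> z \<in> S}"
 using open_vimage[of S \<pi>] by (simp add: vimage_def linear_continuous_on linear_conv_bounded_linear)

lemma sm_linear_compose:
 assumes "open S" "smooth_on S f" "linear (\<pi> :: 'c::euclidean_space => 'd::euclidean_space)"
 shows "smooth_on {z. \<pi> z \<in> S} (%z. f (\<pi> z))"
 using sm_affine[OF assms(1,2), of \<pi> 0] assms(3) by (simp add: linear_conv_bounded_linear)

text \<open>Conjugation by a power of the determinant shifts the parameter of the Bessel operator.\<close>

lemma Bes_qp:
 assumes \<pi>: "linear \<pi>" "!!v. \<pi> (ka v) = v" and ka: "linear ka"
  and S: "open S" "smooth_on S h" "z \<in> S" and inv: "!!z. z \<in> S ==> jd (\<pi> z) ~= 0" and ep: "ep \<in> {1, -1}"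
  and s: "s = of_real (DIM('a) / r) - k"
 shows "Bes ka \<pi> k (%z. qp s ep (\<pi> z) * h z) z = qp s ep (\<pi> z) * Bes ka \<pi> (k + 2 * s) h z"
proof -
 let ?Q = "%z. qp s ep (\<pi> z)" and ?j = "jinv J (\<pi> z)" and ?x = "\<pi> z"
 have smQ: "smooth_on S ?Q"
  by (rule sm_subset[OF sm_linear_compose[OF open_invertibles qp_smooth[OF ep] \<pi>(1)]]) (use inv in auto)
 have dQ: "(?Q has_derivative (%h. s * ?Q y * of_real (tau (jinv J (\<pi> y)) (\<pi> h)))) (at y)" if "y \<in> S" for y
  by (rule has_derivative_compose[OF bounded_linear_imp_has_derivative[OF \<pi>(1)[unfolded linear_conv_bounded_linear]] qp_hasd[OF inv[OF that] ep]])
 have d1: "dd [ka v] ?Q y = s * ?Q y * of_real (tau (jinv J (\<pi> y)) v)" if "y \<in> S" for y v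
  using fderiv_eqI[OF dQ[OF that], of "ka v"] by (simp add: \<pi>(2))
 have jz: "jd ?x ~= 0" by (rule inv[OF S(3)])
 have dj: "((%y. cor (tau (jinv J (\<pi> y)) v)) has_derivative (%h. of_real (tau (dinv ?x (\<pi> h)) v))) (at z)" for v
 proof -
  have "((%y. jinv J (\<pi> y)) has_derivative (%h. dinv ?x (\<pi> h))) (at z)"
   by (rule has_derivative_compose[OF bounded_linear_imp_has_derivative[OF \<pi>(1)[unfolded linear_conv_bounded_linear]] dinv[OF jz]])
  from bounded_linear.has_derivative[OF tau_linear(2)[unfolded linear_conv_bounded_linear] this]
  show ?thesis by (rule has_derivative_of_real)
 qed
 have d2: "dd [ka u, ka v] ?Q z = ?Q z * (s\<^sup>2 * of_real (tau ?j u * tau ?j v) + s * of_real (tau (dinv ?x u) v))" for u v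
 proof -
  have "dd [ka u, ka v] ?Q z = dd [ka u] (dd [ka v] ?Q) z" by simp
  also have "... = dd [ka u] (%y. s * ?Q y * of_real (tau (jinv J (\<pi> y)) v)) z"
   by (rule dd_cong[OF S(1) d1 S(3)])
  also have "... = s * ?Q z * of_real (tau (dinv ?x (\<pi> (ka u))) v) + s * (s * ?Q z * of_real (tau ?j (\<pi> (ka u)))) * of_real (tau ?j v)"
   using fderiv_eqI[OF has_derivative_mult[OF has_derivative_mult[OF has_derivative_const[of s] dQ[OF S(3)]] dj[of v]], of "ka u"] by simp
  finally show ?thesis by (simp add: \<pi>(2) power2_eq_square algebra_simps)
 qed
 have e1: "(\<Sum>a\<in>Basis. tau (a ** b) ?x * (?j \<bullet> a)) = tau e b" for b
 proof -
  have "(\<Sum>a\<in>Basis. tau (a ** b) ?x * (?j \<bullet> a)) = tau ((\<Sum>a\<in>Basis. (?j \<bullet> a) *\<^sub>R a) ** b) ?x"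
   by (simp add: J_sum_left tau_sum tau_scale mult.commute del: euclidean_representation_sum_fun)
  also have "... = tau (b ** ?j) ?x" by (simp add: euclidean_representation comm)
  also have "... = tau b e" by (simp add: tau_assoc jz)
  finally show ?thesis by simp
 qed
 have lin: "linear (fderiv h (at z))" by (rule sm_linear_deriv[OF S(2,3)])
 have e2: "(\<Sum>a\<in>Basis. \<Sum>b\<in>Basis. of_real (tau (a ** b) ?x) * (of_real (?j \<bullet> a) * dd [ka (dl b)] h z)) = dd [ka e] h z"
 proof -
  have "(\<Sum>a\<in>Basis. \<Sum>b\<in>Basis. of_real (tau (a ** b) ?x) * (of_real (?j \<bullet> a) * dd [ka (dl b)] h z)) =
   (\<Sum>b\<in>Basis. of_real (\<Sum>a\<in>Basis. tau (a ** b) ?x * (?j \<bullet> a)) * dd [ka (dl b)] h z)"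
   by (subst sum.swap) (simp add: sum_distrib_left sum_distrib_right mult_ac)
  also have "... = (\<Sum>b\<in>Basis. tau e b *\<^sub>R fderiv h (at z) (ka (dl b)))"
   by (simp add: e1 scaleR_conv_of_real del: tau_e)
  also have "... = fderiv h (at z) (ka (\<Sum>b\<in>Basis. tau e b *\<^sub>R dl b))"
   by (simp add: linear_sum[OF lin] linear_scale[OF lin] linear_sum[OF ka] linear_scale[OF ka] del: tau_e)
  finally show ?thesis by (simp add: tau_expand' del: tau_e)
 qed
 have e3: "(\<Sum>a\<in>Basis. \<Sum>b\<in>Basis. of_real (tau (a ** b) ?x) * (of_real (?j \<bullet> b) * dd [ka (dl a)] h z)) = dd [ka e] h z"
  unfolding e2[symmetric] by (subst sum.swap) (simp add: comm)
 have e4: "(\<Sum>a\<in>Basis. \<Sum>b\<in>Basis. tau (a ** b) ?x * ((?j \<bullet> a) * (?j \<bullet> b))) = tr ?j"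
  unfolding tau_double_sum using jz by (simp add: tau_assoc)
 have l: "linear (%h. ?x ** dinv ?x h)" using linear_compose[OF dinv_linear[OF jz] linL] by (simp add: o_def)
 have e5: "(\<Sum>a\<in>Basis. \<Sum>b\<in>Basis. tau (a ** b) ?x * (dinv ?x (dl a) \<bullet> b)) = - (DIM('a) / r) * tr ?j"
 proof -
  have "(\<Sum>b\<in>Basis. tau (a ** b) ?x * (dinv ?x (dl a) \<bullet> b)) = tau (?x ** dinv ?x (dl a)) a" for a
  proof -
   have "(\<Sum>b\<in>Basis. tau (a ** b) ?x * (dinv ?x (dl a) \<bullet> b)) = tau (a ** (\<Sum>b\<in>Basis. (dinv ?x (dl a) \<bullet> b) *\<^sub>R b)) ?x"
    by (simp add: J_sum_right tau_sum tau_scale mult.commute del: euclidean_representation_sum_fun)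
   also have "... = tau a (dinv ?x (dl a) ** ?x)" by (simp add: euclidean_representation tau_assoc)
   finally show ?thesis by (simp add: comm tau_sym)
  qed
  thus ?thesis using tau_dual_trace'[OF l] Trc_L_dinv[OF jz] by simp
 qed
 have "Bes ka \<pi> k (%z. ?Q z * h z) z =
  (\<Sum>a\<in>Basis. \<Sum>b\<in>Basis. of_real (tau (a ** b) ?x) * (?Q z * dd [ka (dl a), ka (dl b)] h z
   + ?Q z * s * of_real (?j \<bullet> a) * dd [ka (dl b)] h z + ?Q z * s * of_real (?j \<bullet> b) * dd [ka (dl a)] h z
   + ?Q z * (s\<^sup>2 * of_real ((?j \<bullet> a) * (?j \<bullet> b)) + s * of_real (dinv ?x (dl a) \<bullet> b)) * h z))
  + k * (?Q z * dd [ka e] h z + s * ?Q z * of_real (tr ?j) * h z)"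
  unfolding Bes_def dd_product2[OF S(1) smQ S(2,3)] d1[OF S(3)] d2 by (simp add: tau_dl mult_ac)
 also have "... = ?Q z * (\<Sum>a\<in>Basis. \<Sum>b\<in>Basis. of_real (tau (a ** b) ?x) * dd [ka (dl a), ka (dl b)] h z)
  + ?Q z * s * (\<Sum>a\<in>Basis. \<Sum>b\<in>Basis. of_real (tau (a ** b) ?x) * (of_real (?j \<bullet> a) * dd [ka (dl b)] h z))
  + ?Q z * s * (\<Sum>a\<in>Basis. \<Sum>b\<in>Basis. of_real (tau (a ** b) ?x) * (of_real (?j \<bullet> b) * dd [ka (dl a)] h z))
  + ?Q z * s\<^sup>2 * of_real (\<Sum>a\<in>Basis. \<Sum>b\<in>Basis. tau (a ** b) ?x * ((?j \<bullet> a) * (?j \<bullet> b))) * h z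
  + ?Q z * s * of_real (\<Sum>a\<in>Basis. \<Sum>b\<in>Basis. tau (a ** b) ?x * (dinv ?x (dl a) \<bullet> b)) * h z
  + k * (?Q z * dd [ka e] h z + s * ?Q z * of_real (tr ?j) * h z)"
  by (simp only: distrib_left distrib_right sum.distrib sum_distrib_left sum_distrib_right of_real_sum of_real_mult)
   (simp only: mult_ac add_ac)
 \<comment> \<open>The two mixed sums raise the parameter by \<open>2 * s\<close>; all zero-order
   terms collect in the last bracket, which the choice of \<open>s\<close> makes zero.\<close>
 also have "... = ?Q z * Bes ka \<pi> (k + 2 * s) h z + ?Q z * h z * s * of_real (tr ?j) * (s - of_real (DIM('a) / r) + k)"
  unfolding e2 e3 e4 e5 Bes_def by (simp add: power2_eq_square algebra_simps)
 finally show ?thesis by (simp add: s)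
qed

section \<open>The source operators\<close>

text \<open>The operator conjugated by the affine map is again a differential operator on germs, so
  covariance need only be checked on exponentials.\<close>

lemma ldo_affine_cov:
 fixes L :: "'a \<times> 'a => 'a \<times> 'a"
 assumes U: "ldo U" and L: "linear L" "bij L" and c: "c ~= 0"
  and cov: "!!th x. U (%y. E c th (a + L y)) x = k * U (E c th) (a + L x)"
  and S: "open S" "smooth_on S f" "a + L x \<in> S"
 shows "U (%y. f (a + L y)) x = k * U f (a + L x)"
proof -
 let ?K = "inv_into UNIV L"
 have K: "linear ?K" "!!x. L (?K x) = x" "!!x. ?K (L x) = x"
  using inj_linear_imp_inv_linear[OF L(1) bij_is_inj[OF L(2)]] bij_is_surj[OF L(2)] bij_is_inj[OF L(2)]
  by (simp_all add: surj_f_inv_f)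
 have 1: "ldo (%f z. U (%y. f (a + L y)) (?K (z - a)))" by (rule ldo_affine[OF U L(1) K(1,2)])
 have 2: "ldo (%f z. k * U f z)" by (rule ldo_mult[OF sm_const U])
 have "U (%y. f (a + L y)) (?K (a + L x - a)) = k * U f (a + L x)"
  by (rule ldo_eqI_E[OF 1 2 c S]) (simp add: K(3) cov)
 thus ?thesis by (simp add: K(3))
qed

text \<open>Along the direction \<open>w\<close> the function solves a linear equation; multiplied
  by \<open>exp (- s c)\<close> it is constant.\<close>

lemma eigen_translate:
 fixes G :: "'c::real_normed_vector => complex"
 assumes G: "smooth_on UNIV G" and d: "!!z. dd [w] G z = c * G z"
 shows "G (z + w) = exp c * G z"
proof -
 have "((%s. G (z + s *\<^sub>R w) * exp (- (of_real s * c))) has_vector_derivative 0) (at s)" for s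
 proof -
  have l: "linear (fderiv G (at (z + s *\<^sub>R w)))" by (rule sm_linear_deriv[OF G UNIV_I])
  have "((%s. z + s *\<^sub>R w) has_derivative (%h. h *\<^sub>R w)) (at s)" by (auto intro!: derivative_eq_intros)
  from has_derivative_compose[OF this sm_hasd[OF G UNIV_I]]
  have 1: "((%s. G (z + s *\<^sub>R w)) has_vector_derivative c * G (z + s *\<^sub>R w)) (at s)"
   using d by (simp add: has_vector_derivative_def linear_scale[OF l])
  have "((%s::real. - (of_real s * c)) has_derivative (%h. - (of_real h * c))) (at s)"
   by (auto intro!: derivative_eq_intros)
  from has_derivative_compose[OF this DERIV_exp[unfolded has_field_derivative_def]]
  have 2: "((%s. exp (- (of_real s * c))) has_vector_derivative (- c * exp (- (of_real s * c)))) (at s)"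
   by (simp add: has_vector_derivative_def scaleR_conv_of_real mult_ac)
  show ?thesis using has_vector_derivative_mult[OF 1 2] by (simp add: mult_ac)
 qed
 then obtain k where "!!s. G (z + s *\<^sub>R w) * exp (- (of_real s * c)) = k"
  using has_vector_derivative_zero_constant[of UNIV "%s. G (z + s *\<^sub>R w) * exp (- (of_real s * c))"] by auto
 from this[of 0] this[of 1] show ?thesis by (simp add: exp_minus field_simps)
qed

definition inv2 :: "('a \<times> 'a) set" where "inv2 = {z. jd (fst z) ~= 0 & jd (snd z) ~= 0}"

lemma jd2_poly: "rpoly (%z. jd (fst z) * jd (snd z))"
 using real_polynomial_function_compose[OF poly_linear[OF lin_fst_snd(1)] jd_poly]
  real_polynomial_function_compose[OF poly_linear[OF lin_fst_snd(2)] jd_poly]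
 by (intro rpoly_intros(4)) (simp_all add: o_def)

lemma inv2_alt: "inv2 = {z. jd (fst z) * jd (snd z) ~= 0}" by (auto simp: inv2_def)

lemma open_inv2: "open inv2" unfolding inv2_alt by (rule open_rpoly_nonzero[OF jd2_poly])

lemma inv2_extend:
 assumes "continuous_on UNIV f" "continuous_on UNIV (g :: 'a \<times> 'a => complex)" "!!z. z \<in> inv2 ==> f z = g z"
 shows "f z = g z"
proof (rule eq_on_open_if_dense[OF open_UNIV assms(1,2) _ UNIV_I])
 fix U :: "('a \<times> 'a) set" assume "open U" "U ~= {}"
 from rpoly_nonzero_open[OF jd2_poly _ this, of "(e, e)"] show "\<exists>x\<in>U. f x = g x"
  using assms(3) by (auto simp: inv2_alt)
qed

definition QQ :: "complex => int => complex => int => 'a \<times> 'a => complex" where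
 "QQ s ep t et z = qp s ep (fst z) * qp t et (snd z)"

lemma QQ_nonzero: "z \<in> inv2 ==> QQ s ep t et z ~= 0" by (simp add: QQ_def inv2_def qp_nonzero)

lemma qp_fst_smooth: "ep \<in> {1, -1} ==> smooth_on inv2 (%z. qp s ep (fst z))"
  and qp_snd_smooth: "ep \<in> {1, -1} ==> smooth_on inv2 (%z. qp s ep (snd z))"
 by (auto intro!: sm_subset[OF sm_linear_compose[OF open_invertibles qp_smooth lin_fst_snd(1)]]
   sm_subset[OF sm_linear_compose[OF open_invertibles qp_smooth lin_fst_snd(2)]] simp: inv2_def)

lemma QQ_smooth: "ep \<in> {1, -1} ==> et \<in> {1, -1} ==> smooth_on inv2 (QQ s ep t et)"
 unfolding QQ_def[abs_def] by (intro sm_mult open_inv2 qp_fst_smooth qp_snd_smooth)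

lemma Bes_const:
 assumes S: "open S" "smooth_on S g" "smooth_on S h" "z \<in> S" and g: "!!y v. y \<in> S ==> dd [ka v] g y = 0"
 shows "Bes ka \<pi> k (%z. g z * h z) z = g z * Bes ka \<pi> k h z"
proof -
 have "dd [ka u, ka v] g z = 0" for u v
  using dd_cong[OF S(1), of "dd [ka v] g" "%_. 0" z "[ka u]"] g S(4) by (simp add: dd_zero)
 thus ?thesis unfolding Bes_def dd_product2[OF S] g[OF S(4)]
  by (simp add: sum_distrib_left algebra_simps)
qed

lemma dd_linear_kernel:
 assumes "open S" "smooth_on S f" "linear (\<pi> :: 'c::euclidean_space => 'd::euclidean_space)" "\<pi> y \<in> S" "\<pi> v = 0"
 shows "dd [v] (%z. f (\<pi> z)) y = 0"
 using dd_affine[OF assms(1,2), of \<pi> 0 y "[v]"] assms(3-5) linear_0[OF sm_linear_deriv[OF assms(2,4)]]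
 by (simp add: linear_conv_bounded_linear)

definition \<rho> :: complex where "\<rho> = of_real (DIM('a) / r)"

text \<open>For the Bessel operator in one variable the power of the other determinant is a
  constant, so the one-variable rule applies twice.\<close>

lemma BB_QQ:
 assumes h: "smooth_on inv2 h" "z \<in> inv2" and ep: "ep \<in> {1, -1}" "et \<in> {1, -1}"
  and s: "s = \<rho> - k" "t = \<rho> - k'"
 shows "BB k k' (%z. QQ s ep t et z * h z) z = QQ s ep t et z * BB (k + 2 * s) (k' + 2 * t) h z"
proof -
 note sm = qp_fst_smooth[OF ep(1), of s] qp_snd_smooth[OF ep(2), of t]
 have li: "linear inl" "linear inr" by (rule linearI; simp)+
 have 0: "dd [inl v] (%z. qp t et (snd z)) y = 0" "dd [inr v] (%z. qp s ep (fst z)) y = 0" if "y \<in> inv2" for v y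
  using that by (intro dd_linear_kernel[OF open_invertibles qp_smooth] ep lin_fst_snd; simp add: inv2_def)+
 have "Bes inl fst k (%z. qp s ep (fst z) * (qp t et (snd z) * h z)) z
  = qp s ep (fst z) * Bes inl fst (k + 2 * s) (%z. qp t et (snd z) * h z) z"
  by (rule Bes_qp[OF lin_fst_snd(1) _ li(1) open_inv2 sm_mult[OF open_inv2 sm(2) h(1)] h(2) _ ep(1) s(1)[unfolded \<rho>_def]])
   (simp_all add: inv2_def)
 also have "... = qp s ep (fst z) * (qp t et (snd z) * Bes inl fst (k + 2 * s) h z)"
  using Bes_const[OF open_inv2 sm(2) h, where ka = inl] 0(1) by simp
 finally have 1: "Bes inl fst k (%z. QQ s ep t et z * h z) z = QQ s ep t et z * Bes inl fst (k + 2 * s) h z"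
  by (simp add: QQ_def mult.assoc)
 have "Bes inr snd k' (%z. qp t et (snd z) * (qp s ep (fst z) * h z)) z
  = qp t et (snd z) * Bes inr snd (k' + 2 * t) (%z. qp s ep (fst z) * h z) z"
  by (rule Bes_qp[OF lin_fst_snd(2) _ li(2) open_inv2 sm_mult[OF open_inv2 sm(1) h(1)] h(2) _ ep(2) s(2)[unfolded \<rho>_def]])
   (simp_all add: inv2_def)
 also have "... = qp t et (snd z) * (qp s ep (fst z) * Bes inr snd (k' + 2 * t) h z)"
  using Bes_const[OF open_inv2 sm(1) h, where ka = inr] 0(2) by simp
 finally have 2: "Bes inr snd k' (%z. QQ s ep t et z * h z) z = QQ s ep t et z * Bes inr snd (k' + 2 * t) h z"
  by (simp add: QQ_def mult_ac)
 show ?thesis unfolding BB_def 1 2 by (simp add: distrib_left)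
qed

lemma Dd_str:
 assumes "g \<in> str_group_pos J" shows "Dd (g a, g b) = str_char J g * Dd (a, b)"
 using strp_D(4)[OF assms, of "a - b"] by (simp add: linear_diff[OF strp_D(1)[OF assms]])

definition map2 :: "('a => 'a) => 'a \<times> 'a => 'a \<times> 'a" where "map2 g z = (g (fst z), g (snd z))"

lemma map2_linear: "linear g ==> linear (map2 g)"
 by (rule linearI) (simp_all add: map2_def linear_add linear_scale)

lemma map2_bij: "bij g ==> bij (map2 g)"
 by (rule o_bij[of "map2 (inv_into UNIV g)"])
  (simp_all add: fun_eq_iff map2_def bij_is_inj bij_is_surj surj_f_inv_f)

lemma tau2_tadj: "linear g ==> tau2 z (map2 (tadj g) th) = tau2 (map2 g z) th"
 by (simp add: tau2_def map2_def tau_tadj)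

lemma linear_inj_bij: "linear (g :: 'a => 'a) ==> inj g ==> bij g"
 by (simp add: bij_def linear_injective_imp_surjective)

lemma sgn_powr_scale: "c > 0 ==> sgn_powr (c * t) s ep = of_real c powr s * sgn_powr t s ep"
 by (simp add: sgn_powr_def abs_mult sgn_mult powr_times_real)

end

locale source_ops = sjordan J for J :: "'a::euclidean_space => 'a => 'a" (infixl "**" 70) +
 fixes \<Delta> :: "('a \<times> 'a => complex) => 'a \<times> 'a => complex"
  and D F :: "complex => complex => ('a \<times> 'a => complex) => 'a \<times> 'a => complex"
 assumes Delta: "is_det_diff_op J \<Delta>" and Dsrc: "!!s t. is_source_D J \<Delta> s t (D s t)"
  and Fsrc: "!!l m. is_source_F J D l m (F l m)"
begin

lemma ldo_Delta: "ldo \<Delta>"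
proof (rule ldo_poly)
 obtain T where "\<forall>(p, vs)\<in>set T. \<exists>c. p = (%_. c)" "\<Delta> = diff_op T"
  using Delta unfolding is_det_diff_op_def const_diff_op_def by (elim conjE exE) (rule that)
 thus "poly_diff_op \<Delta>" unfolding poly_diff_op_def by (intro exI[of _ T]) auto
qed

lemma ldo_D: "ldo (D s t)" using Dsrc ldo_poly unfolding is_source_D_def by blast
lemma ldo_F: "ldo (F l m)" using Fsrc ldo_poly unfolding is_source_F_def by blast

lemma Delta_E: "\<Delta> (E 1 th) z = of_real (Dd th) * E 1 th z"
 using Delta unfolding is_det_diff_op_def
 by (auto simp: E_def[abs_def] tau2_def case_prod_unfold dest!: spec[of _ "fst th"] spec[of _ "snd th"])

lemma D_eq:
 assumes "smooth_on inv2 f" "z \<in> inv2"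
 shows "\<Delta> (%z. QQ s 1 t 1 z * f z) z = QQ (s - 1) (-1) (t - 1) (-1) z * D s t f z"
proof -
 have i: "invertibles J \<times> invertibles J = inv2" by (auto simp: inv2_def invertibles_iff)
 have "\<forall>f. smooth_on inv2 f --> (\<forall>\<xi>\<in>invertibles J. \<forall>\<zeta>\<in>invertibles J.
      \<Delta> (%(\<xi>, \<zeta>). sgn_powr (jdet J \<xi>) s 1 * sgn_powr (jdet J \<zeta>) t 1 * f (\<xi>, \<zeta>)) (\<xi>, \<zeta>) =
      sgn_powr (jdet J \<xi>) (s - 1) (- 1) * sgn_powr (jdet J \<zeta>) (t - 1) (- 1) * D s t f (\<xi>, \<zeta>))"
  using Dsrc[of s t] unfolding is_source_D_def i by blast
 from this[rule_format, OF assms(1), of "fst z" "snd z"] show ?thesis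
  using assms(2) by (simp add: QQ_def qp_def case_prod_unfold inv2_def invertibles_iff)
qed

abbreviation D0 where "D0 l m \<equiv> D (l - \<rho> + 1) (m - \<rho> + 1)"

lemma F_E: "F l m (E \<i> th) z = D0 l m (E \<i> z) th"
proof -
 have "F l m (%(x, y). exp (\<i> * of_real (tau x (fst th) + tau y (snd th)))) (fst z, snd z) =
  D0 l m (%(\<xi>, \<zeta>). exp (\<i> * of_real (tau (fst z) \<xi> + tau (snd z) \<zeta>))) (fst th, snd th)"
  using conjunct2[OF Fsrc[of l m, unfolded is_source_F_def Let_def], rule_format, of "fst th" "snd th" "fst z" "snd z"]
  by (simp add: \<rho>_def)
 thus ?thesis by (simp add: E_def[abs_def] tau2_def case_prod_unfold tau_sym)
qed

lemma E_fun_sym: "(%z. E c z th) = E c th" by (rule ext) (rule E_sym)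

text \<open>On exponentials \<open>\<Delta>\<close> multiplies by \<open>Dd\<close> and the Bessel
  operator becomes \<open>dpi\<close> in the dual variable, where multiplication by
  \<open>Dd\<close> raises both weights by one.\<close>

lemma Delta_BB:
 assumes "open S" "smooth_on S f" "z \<in> S"
 shows "\<Delta> (BB k k' f) z = BB (k + 1) (k' + 1) (\<Delta> f) z"
proof (rule ldo_eqI_E[OF ldo_comp[OF ldo_Delta ldo_BB] ldo_comp[OF ldo_BB ldo_Delta] _ assms, of 1])
 fix th
 have 1: "BB k k' (E 1 th) = (%z. dpi k k' (%th. E 1 th z) th)" for k k'
  by (rule ext) (simp add: dpi_E_BB E_fun_sym)
 have "\<Delta> (BB k k' (E 1 th)) z = dpi k k' (%th. \<Delta> (E 1 th) z) th"
  unfolding 1 by (rule E_commute[OF ldo_Delta ldo_dpi])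
 also have "... = dpi k k' (%th. of_real (Dd th) * E 1 z th) th" by (simp add: Delta_E E_sym[of 1 _ z])
 also have "... = of_real (Dd th) * BB (k + 1) (k' + 1) (E 1 th) z"
  by (simp add: dpi_Dd[OF E_smooth] 1 E_fun_sym)
 also have "... = BB (k + 1) (k' + 1) (%z. of_real (Dd th) * E 1 th z) z"
  by (rule ldo_cmult[OF ldo_BB open_UNIV E_smooth UNIV_I, symmetric])
 also have "(%z. of_real (Dd th) * E 1 th z) = \<Delta> (E 1 th)" by (rule ext) (simp add: Delta_E)
 finally show "\<Delta> (BB k k' (E 1 th)) z = BB (k + 1) (k' + 1) (\<Delta> (E 1 th)) z" .
qed simp

text \<open>\<open>D0 l m\<close> is \<open>\<Delta>\<close> conjugated by powers of the
  determinants. \<open>BB_QQ\<close> moves the Bessel operator through the inner and outer powers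
  and \<open>Delta_BB\<close> moves it through \<open>\<Delta>\<close>; density of
  \<open>inv2\<close> frees the result from invertibility.\<close>

lemma D_BB:
 assumes "smooth_on UNIV h"
 shows "D0 l m (BB (l + 1) (m + 1) h) z = BB l m (D0 l m h) z"
proof (rule inv2_extend)
 show "continuous_on UNIV (D0 l m (BB (l + 1) (m + 1) h))" "continuous_on UNIV (BB l m (D0 l m h))"
  by (intro sm_continuous ldo_smooth[OF ldo_D open_UNIV] ldo_smooth[OF ldo_BB open_UNIV] assms)+
next
 fix z assume z: "z \<in> inv2"
 \<comment> \<open>The values for which the exponents are \<open>\<rho> - ?k\<close> and
   \<open>\<rho> - ?k'\<close>, as conjugation requires. The first parameter then runs from
   \<open>l + 1\<close> to \<open>?k\<close>, through \<open>\<Delta>\<close> to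
   \<open>?k + 1\<close>, and on to \<open>l\<close>.\<close>
 let ?k = "2 * \<rho> - 1 - l" and ?k' = "2 * \<rho> - 1 - m" and ?s = "l - \<rho> + 1" and ?t = "m - \<rho> + 1"
 have h: "smooth_on inv2 h" by (rule sm_subset[OF assms]) simp
 note smQ = QQ_smooth[of 1 1 ?s ?t, simplified] and smQ' = QQ_smooth[of "-1" "-1" "?s - 1" "?t - 1", simplified]
 have st: "?s = \<rho> - ?k" "?t = \<rho> - ?k'" "?s - 1 = \<rho> - (?k + 1)" "?t - 1 = \<rho> - (?k' + 1)" by simp_all
 have k: "?k + 2 * ?s = l + 1" "?k' + 2 * ?t = m + 1" "?k + 1 + 2 * (?s - 1) = l" "?k' + 1 + 2 * (?t - 1) = m" by simp_all
 note smD = ldo_smooth[OF ldo_D open_inv2]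
 have sm1: "smooth_on inv2 (%z. QQ ?s 1 ?t 1 z * h z)" by (rule sm_mult[OF open_inv2 smQ h])
 have "QQ (?s - 1) (-1) (?t - 1) (-1) z * D0 l m (BB (l + 1) (m + 1) h) z
  = \<Delta> (%z. QQ ?s 1 ?t 1 z * BB (l + 1) (m + 1) h z) z"
  by (rule D_eq[OF ldo_smooth[OF ldo_BB open_inv2 h] z, symmetric])
 also have "... = \<Delta> (BB ?k ?k' (%z. QQ ?s 1 ?t 1 z * h z)) z"
 proof (rule ldo_cong[OF ldo_Delta open_inv2 sm_mult[OF open_inv2 smQ ldo_smooth[OF ldo_BB open_inv2 h]] _ z])
  fix y assume "y \<in> inv2"
  from BB_QQ[OF h this _ _ st(1,2), of 1 1] show "QQ ?s 1 ?t 1 y * BB (l + 1) (m + 1) h y = BB ?k ?k' (%z. QQ ?s 1 ?t 1 z * h z) y"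
   unfolding k by simp
 qed
 also have "... = BB (?k + 1) (?k' + 1) (\<Delta> (%z. QQ ?s 1 ?t 1 z * h z)) z"
  by (rule Delta_BB[OF open_inv2 sm1 z])
 also have "... = BB (?k + 1) (?k' + 1) (%z. QQ (?s - 1) (-1) (?t - 1) (-1) z * D0 l m h z) z"
  by (rule ldo_cong[OF ldo_BB open_inv2 ldo_smooth[OF ldo_Delta open_inv2 sm1] _ z]) (rule D_eq[OF h])
 also have "... = QQ (?s - 1) (-1) (?t - 1) (-1) z * BB l m (D0 l m h) z"
  using BB_QQ[OF smD[OF h, of ?s ?t] z _ _ st(3,4), of "-1" "-1"] unfolding k by simp
 finally show "D0 l m (BB (l + 1) (m + 1) h) z = BB l m (D0 l m h) z"
  using QQ_nonzero[OF z] by simp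
qed

text \<open>\<open>F\<close> on exponentials is \<open>D\<close> in the dual variable, so this is
  \<open>D_BB\<close> read through the kernel; the factor \<open>- \<i>\<close> inverts the
  \<open>c = \<i>\<close> of \<open>dpi_E_BB\<close>.\<close>

lemma F_dpi_E: "F l m (dpi l m (E \<i> th)) z = dpi (l + 1) (m + 1) (F l m (E \<i> th)) z"
proof -
 have 1: "dpi l m (E \<i> th) = (%z. - \<i> * BB l m (%th. E \<i> th z) th)" for l m th
  by (rule ext) (simp add: E_fun_sym dpi_E_BB)
 have sm: "smooth_on UNIV (%z. BB l m (%th. E \<i> th z) th)"
  by (simp add: E_fun_sym dpi_E_BB sm_mult[OF open_UNIV] ldo_smooth[OF ldo_dpi open_UNIV E_smooth])
 have "F l m (dpi l m (E \<i> th)) z = - \<i> * F l m (%z. BB l m (%th. E \<i> th z) th) z"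
  unfolding 1 by (rule ldo_cmult[OF ldo_F open_UNIV sm UNIV_I])
 also have "... = - \<i> * BB l m (%th. F l m (E \<i> th) z) th" by (simp add: E_commute[OF ldo_F ldo_BB])
 also have "... = - \<i> * D0 l m (BB (l + 1) (m + 1) (E \<i> z)) th" by (simp add: F_E D_BB[OF E_smooth])
 also have "... = D0 l m (%th. - \<i> * BB (l + 1) (m + 1) (E \<i> z) th) th"
  by (rule ldo_cmult[OF ldo_D open_UNIV ldo_smooth[OF ldo_BB open_UNIV E_smooth] UNIV_I, symmetric])
 also have "... = D0 l m (%th. dpi (l + 1) (m + 1) (%z. E \<i> z th) z) th"
  by (simp add: dpi_E_BB E_fun_sym)
 also have "... = dpi (l + 1) (m + 1) (%z. D0 l m (E \<i> z) th) z" by (rule E_commute[OF ldo_D ldo_dpi])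
 also have "(%z. D0 l m (E \<i> z) th) = F l m (E \<i> th)" by (simp add: F_E[abs_def] fun_eq_iff F_E)
 finally show ?thesis .
qed

lemma F_dpi:
 assumes "open S" "smooth_on S f" "z \<in> S"
 shows "F l m (dpi l m f) z = dpi (l + 1) (m + 1) (F l m f) z"
 by (rule ldo_eqI_E[OF ldo_comp[OF ldo_F ldo_dpi] ldo_comp[OF ldo_dpi ldo_F] _ assms, of \<i>]) (simp_all add: F_dpi_E)

text \<open>Multiplication by this linear form is dual to the derivative along the diagonal, which
  annihilates \<open>Dd\<close>.\<close>

lemma Delta_ell:
 assumes "open S" "smooth_on S f" "z \<in> S"
 shows "\<Delta> (%z. of_real (tau2 (v, v) z) * f z) z = of_real (tau2 (v, v) z) * \<Delta> f z"
proof -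
 have sl: "smooth_on UNIV (%z. cor (tau2 (v, v) z))"
  by (rule smooth_of_real_linear) (simp add: tau2_sym[of "(v, v)"] tau2_linear)
 have dd: "dd [(v, v)] (E 1 z) th = of_real (tau2 (v, v) z) * E 1 th z" for th z
  by (simp add: E_dir_deriv E_sym[of 1 th z] del: dir_deriv.simps)
 show ?thesis
 proof (rule ldo_eqI_E[OF ldo_comp[OF ldo_Delta ldo_mult[OF sl ldo_id]] ldo_mult[OF sl ldo_Delta] _ assms, of 1])
  fix th
  have "\<Delta> (%z. of_real (tau2 (v, v) z) * E 1 th z) z = \<Delta> (%z. dd [(v, v)] (%th. E 1 th z) th) z"
   unfolding E_fun_sym dd ..
  also have "... = dd [(v, v)] (%th. \<Delta> (E 1 th) z) th" by (rule E_commute[OF ldo_Delta ldo_dir_deriv])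
  also have "... = dd [(v, v)] (%th. of_real (Dd th) * E 1 z th) th" by (simp only: Delta_E E_sym[of 1 _ z])
  also have "... = of_real (Dd th) * dd [(v, v)] (E 1 z) th"
   using frechet_of_real[OF Dd_hasd, of th "(v, v)"]
   by (simp add: dd_product2(1)[OF open_UNIV Dd_smooth E_smooth UNIV_I] del: dir_deriv.simps) simp
  finally show "\<Delta> (%z. of_real (tau2 (v, v) z) * E 1 th z) z = of_real (tau2 (v, v) z) * \<Delta> (E 1 th) z"
   by (simp add: Delta_E dd del: dir_deriv.simps)
 qed simp
qed

lemma D_ell:
 assumes "smooth_on UNIV f"
 shows "D s t (%z. of_real (tau2 (v, v) z) * f z) z = of_real (tau2 (v, v) z) * D s t f z"
proof (rule inv2_extend)
 have sl: "smooth_on UNIV (%z. cor (tau2 (v, v) z))"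
  by (rule smooth_of_real_linear) (simp add: tau2_sym[of "(v, v)"] tau2_linear)
 show "continuous_on UNIV (D s t (%z. of_real (tau2 (v, v) z) * f z))"
  "continuous_on UNIV (%z. of_real (tau2 (v, v) z) * D s t f z)"
  by (intro sm_continuous ldo_smooth[OF ldo_D open_UNIV] sm_mult sl assms open_UNIV)+
 fix z assume z: "z \<in> inv2"
 have f: "smooth_on inv2 f" "smooth_on inv2 (%z. of_real (tau2 (v, v) z) * f z)"
  by (rule sm_subset[OF _ subset_UNIV], intro sm_mult sl assms open_UNIV)+
 have "\<Delta> (%z. of_real (tau2 (v, v) z) * (QQ s 1 t 1 z * f z)) z = of_real (tau2 (v, v) z) * \<Delta> (%z. QQ s 1 t 1 z * f z) z"
  by (rule Delta_ell[OF open_inv2 sm_mult[OF open_inv2 QQ_smooth f(1)] z]) simp_all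
 moreover have "(%z. of_real (tau2 (v, v) z) * (QQ s 1 t 1 z * f z)) = (%z. QQ s 1 t 1 z * (of_real (tau2 (v, v) z) * f z))"
  by (simp add: fun_eq_iff)
 ultimately show "D s t (%z. of_real (tau2 (v, v) z) * f z) z = of_real (tau2 (v, v) z) * D s t f z"
  using D_eq[OF f(1) z, of s t] D_eq[OF f(2) z, of s t] QQ_nonzero[OF z] by simp
qed

text \<open>In the dual variable a derivative along the diagonal is a multiplication inside
  \<open>D\<close>, and \<open>D_ell\<close> pulls it out. So the function is an eigenfunction of
  that derivative, and translation multiplies it by a scalar.\<close>

lemma F_translate_E: "F l m (E \<i> th) (z + (v, v)) = exp (\<i> * of_real (tau2 (v, v) th)) * F l m (E \<i> th) z"
proof (rule eigen_translate[OF ldo_smooth[OF ldo_F open_UNIV E_smooth]])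
 fix z
 have dd: "dd [(v, v)] (E \<i> th) z = \<i> * (of_real (tau2 (v, v) th) * E \<i> z th)" for th z
  by (simp add: E_dir_deriv E_sym[of _ th z] del: dir_deriv.simps)
 have sl: "smooth_on UNIV (%z. of_real (tau2 (v, v) z) * E \<i> th z)" for th
  by (rule sm_mult[OF open_UNIV _ E_smooth], rule smooth_of_real_linear) (simp add: tau2_sym[of "(v, v)"] tau2_linear)
 have "dd [(v, v)] (F l m (E \<i> th)) z = dd [(v, v)] (%z. D0 l m (E \<i> z) th) z"
  by (simp only: F_E[abs_def] F_E)
 also have "... = D0 l m (%th. dd [(v, v)] (%z. E \<i> z th) z) th"
  by (rule E_commute[OF ldo_D ldo_dir_deriv, symmetric])
 also have "... = D0 l m (%th. \<i> * (of_real (tau2 (v, v) th) * E \<i> z th)) th" by (simp only: E_fun_sym dd)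
 also have "... = \<i> * of_real (tau2 (v, v) th) * F l m (E \<i> th) z"
  by (simp add: ldo_cmult[OF ldo_D open_UNIV sl UNIV_I] D_ell[OF E_smooth] F_E)
 finally show "dd [(v, v)] (F l m (E \<i> th)) z = \<i> * of_real (tau2 (v, v) th) * F l m (E \<i> th) z" .
qed

lemma E_add: "E c th (a + b) = E c th a * E c th b"
 by (simp add: E_def linear_add[OF tau2_linear] distrib_left exp_add)

lemma F_translate:
 assumes "open S" "smooth_on S f" "(v, v) + z \<in> S"
 shows "F l m (%y. f ((v, v) + y)) z = F l m f ((v, v) + z)"
proof -
 have l: "linear (%y::'a\<times>'a. y)" "bij (%y::'a\<times>'a. y)" by (simp_all add: linear_ident bij_id[unfolded id_def])
 have "F l m (%y. f ((v, v) + y)) z = 1 * F l m f ((v, v) + z)"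
 proof (rule ldo_affine_cov[OF ldo_F l _ _ assms, of \<i>])
  fix th x
  have "F l m (%y. E \<i> th ((v, v) + y)) x = E \<i> th (v, v) * F l m (E \<i> th) x"
   unfolding E_add by (rule ldo_cmult[OF ldo_F open_UNIV E_smooth UNIV_I])
  thus "F l m (%y. E \<i> th ((v, v) + y)) x = 1 * F l m (E \<i> th) ((v, v) + x)"
   using F_translate_E[of l m th x v] by (simp add: add.commute E_def)
 qed simp
 thus ?thesis by simp
qed

section \<open>Covariance of the source operators under the positive structure group\<close>

context
 fixes g assumes g: "g \<in> str_group_pos J"
begin

lemmas gD = strp_D[OF g]

abbreviation "cg \<equiv> str_char J g"
abbreviation "T \<equiv> map2 (tadj g)"

lemma tadj_bij: "bij (tadj g)"
 using tadj_inj[OF gD(1,2) _ gD(4)] gD(3) linear_inj_bij[OF tadj_linear] by simp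

lemma jd_tadj': "jd (tadj g z) = cg * jd z"
 using jd_tadj[OF gD(1,2) _ gD(4)] gD(3) by simp

lemma T_linear: "linear T" by (rule map2_linear[OF tadj_linear])

lemma T_inv2: "T z \<in> inv2 \<longleftrightarrow> z \<in> inv2" using gD(3) by (simp add: inv2_def map2_def jd_tadj')

lemma E_T: "E c th (T y) = E c (map2 g th) y"
 by (simp add: E_def tau2_sym[of _ th] tau2_tadj[OF gD(1)] tau2_sym[of _ y])

lemma Delta_str:
 assumes "open S" "smooth_on S f" "T z \<in> S"
 shows "\<Delta> (%y. f (T y)) z = of_real cg * \<Delta> f (T z)"
proof -
 have "\<Delta> (%y. f (0 + T y)) z = of_real cg * \<Delta> f (0 + T z)"
 proof (rule ldo_affine_cov[OF ldo_Delta T_linear map2_bij[OF tadj_bij] _ _ assms(1,2), of 1])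
  fix th x
  have "Dd (map2 g th) = cg * Dd th" using Dd_str[OF g, of "fst th" "snd th"] by (simp add: map2_def)
  thus "\<Delta> (%y. E 1 th (0 + T y)) x = of_real cg * \<Delta> (E 1 th) (0 + T x)"
   by (simp add: E_T Delta_E)
 qed (simp_all add: assms)
 thus ?thesis by simp
qed

text \<open>\<open>\<Delta>\<close> contributes one factor \<open>str_char J g\<close>, while
  lowering both powers of the determinant by one costs its square, since \<open>tadj g\<close>
  scales the determinant as \<open>g\<close> does.\<close>

lemma D_str:
 assumes "smooth_on UNIV h"
 shows "D s t (%y. h (T y)) z = inverse (of_real cg) * D s t h (T z)"
proof (rule inv2_extend[where g = "%z. inverse (of_real cg) * D s t h (T z)" and z = z])
 have hT: "smooth_on UNIV (%y. h (T y))"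
  using sm_linear_compose[OF open_UNIV assms T_linear] by simp
 have hD: "smooth_on UNIV (%y. D s t h (T y))"
  using sm_linear_compose[OF open_UNIV ldo_smooth[OF ldo_D open_UNIV assms] T_linear] by simp
 show "continuous_on UNIV (D s t (%y. h (T y)))" "continuous_on UNIV (%z. inverse (of_real cg) * D s t h (T z))"
  by (intro sm_continuous ldo_smooth[OF ldo_D open_UNIV] hT hD sm_mult open_UNIV sm_const)+
 fix z assume z: "z \<in> inv2"
 have h: "smooth_on inv2 h" "smooth_on inv2 (%y. h (T y))"
  using sm_subset[OF assms subset_UNIV] sm_subset[OF hT subset_UNIV] by simp_all
 define C where "C = cor cg powr s * of_real cg powr t"
 have C: "QQ s 1 t 1 (T y) = C * QQ s 1 t 1 y" for y
  by (simp add: QQ_def qp_def map2_def jd_tadj' sgn_powr_scale[OF gD(3)] C_def)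
 have C': "QQ (s - 1) (-1) (t - 1) (-1) (T y) = C / of_real (cg\<^sup>2) * QQ (s - 1) (-1) (t - 1) (-1) y" for y
  using gD(3) by (simp add: QQ_def qp_def map2_def jd_tadj' sgn_powr_scale[OF gD(3)] C_def powr_diff power2_eq_square)
 have C0: "C ~= 0" using gD(3) by (simp add: C_def)
 have smQ: "smooth_on inv2 (%z. QQ s 1 t 1 z * h z)" by (rule sm_mult[OF open_inv2 QQ_smooth h(1)]) simp_all
 have "C * (QQ (s - 1) (-1) (t - 1) (-1) z * D s t (%y. h (T y)) z) = C * \<Delta> (%y. QQ s 1 t 1 y * h (T y)) z"
  by (simp add: D_eq[OF h(2) z])
 also have "... = \<Delta> (%y. C * (QQ s 1 t 1 y * h (T y))) z"
  by (rule ldo_cmult[OF ldo_Delta open_inv2 sm_mult[OF open_inv2 QQ_smooth h(2)] z, symmetric]) simp_all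
 also have "... = \<Delta> (%y. (%z. QQ s 1 t 1 z * h z) (T y)) z" by (simp add: C mult.assoc)
 also have "... = of_real cg * \<Delta> (%z. QQ s 1 t 1 z * h z) (T z)"
  by (rule Delta_str[OF open_inv2 smQ]) (simp add: T_inv2 z)
 also have "... = of_real cg * (C / of_real (cg\<^sup>2) * QQ (s - 1) (-1) (t - 1) (-1) z * D s t h (T z))"
  using D_eq[OF h(1), of "T z" s t] z by (simp add: T_inv2 C')
 finally show "D s t (%y. h (T y)) z = inverse (of_real cg) * D s t h (T z)"
  using C0 QQ_nonzero[OF z, of "s - 1" "-1" "t - 1" "-1"] gD(3) by (simp add: field_simps power2_eq_square)
qed

lemma F_str:
 assumes "open S" "smooth_on S f" "map2 g z \<in> S"
 shows "F l m (%y. f (map2 g y)) z = of_real cg * F l m f (map2 g z)"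
proof -
 have EG: "E c th (map2 g y) = E c (T th) y" for c th y by (simp add: E_def tau2_tadj[OF gD(1)])
 have "F l m (%y. f (0 + map2 g y)) z = of_real cg * F l m f (0 + map2 g z)"
 proof (rule ldo_affine_cov[OF ldo_F map2_linear[OF gD(1)] map2_bij[OF gD(2)] _ _ assms(1,2), of \<i>])
  fix th x
  have "F l m (E \<i> th) (map2 g x) = D0 l m (%th. E \<i> x (T th)) th"
   by (simp add: F_E E_T)
  thus "F l m (%y. E \<i> th (0 + map2 g y)) x = of_real cg * F l m (E \<i> th) (0 + map2 g x)"
   using gD(3) by (simp add: EG F_E D_str[OF E_smooth])
 qed (simp_all add: assms)
 thus ?thesis by simp
qed

end

lemma ldo_iter: "ldo (iter_F F l m k)"
proof (induction k)
 case 0 show ?case using ldo_id by (simp add: id_def)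
next
 case (Suc k) show ?case using ldo_comp[OF ldo_F Suc] by (simp add: o_def)
qed

lemma iter_dpi:
 assumes "open S" "smooth_on S f"
 shows "z \<in> S ==> iter_F F l m k (dpi l m f) z = dpi (l + of_nat k) (m + of_nat k) (iter_F F l m k f) z"
proof (induction k arbitrary: z)
 case (Suc k)
 note sm = ldo_smooth[OF ldo_iter assms]
 have "iter_F F l m (Suc k) (dpi l m f) z = F (l + of_nat k) (m + of_nat k) (iter_F F l m k (dpi l m f)) z" by simp
 also have "... = F (l + of_nat k) (m + of_nat k) (dpi (l + of_nat k) (m + of_nat k) (iter_F F l m k f)) z"
  by (rule ldo_cong[OF ldo_F assms(1) ldo_smooth[OF ldo_iter assms(1) ldo_smooth[OF ldo_dpi assms]] Suc.IH Suc.prems])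
 also have "... = dpi (l + of_nat k + 1) (m + of_nat k + 1) (F (l + of_nat k) (m + of_nat k) (iter_F F l m k f)) z"
  by (rule F_dpi[OF assms(1) sm Suc.prems])
 finally show ?case by (simp add: add_ac)
qed simp

lemma iter_translate:
 assumes "open S" "smooth_on S f"
 shows "(v, v) + z \<in> S ==> iter_F F l m k (%y. f ((v, v) + y)) z = iter_F F l m k f ((v, v) + z)"
proof (induction k arbitrary: z)
 case (Suc k)
 let ?S = "{y. (v, v) + y \<in> S}"
 have S: "open ?S" using open_vimage[OF assms(1), of "%y. (v, v) + y"] by (simp add: vimage_def continuous_intros)
 have smf: "smooth_on ?S (%y. f ((v, v) + y))" by (rule sm_affine[OF assms, of "%y. y"]) simp
 have "iter_F F l m (Suc k) (%y. f ((v, v) + y)) z = F (l + of_nat k) (m + of_nat k) (iter_F F l m k (%y. f ((v, v) + y))) z" by simp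
 also have "... = F (l + of_nat k) (m + of_nat k) (%z. iter_F F l m k f ((v, v) + z)) z"
  by (rule ldo_cong[OF ldo_F S ldo_smooth[OF ldo_iter S smf]]) (use Suc in auto)
 also have "... = F (l + of_nat k) (m + of_nat k) (iter_F F l m k f) ((v, v) + z)"
  by (rule F_translate[OF assms(1) ldo_smooth[OF ldo_iter assms] Suc.prems])
 finally show ?case by simp
qed simp

lemma iter_str:
 assumes g: "g \<in> str_group_pos J" and "open S" "smooth_on S f"
 shows "map2 g z \<in> S ==> iter_F F l m k (%y. f (map2 g y)) z = of_real (str_char J g) ^ k * iter_F F l m k f (map2 g z)"
proof (induction k arbitrary: z)
 case (Suc k)
 note gl = map2_linear[OF strp_D(1)[OF g]]
 let ?S = "{y. map2 g y \<in> S}" and ?c = "cor (str_char J g)"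
 have S: "open ?S" by (rule open_vimage_linear[OF assms(2) gl])
 have smf: "smooth_on ?S (%y. f (map2 g y))" by (rule sm_linear_compose[OF assms(2,3) gl])
 have smg: "smooth_on ?S (%y. iter_F F l m k f (map2 g y))"
  by (rule sm_linear_compose[OF assms(2) ldo_smooth[OF ldo_iter assms(2,3)] gl])
 have "iter_F F l m (Suc k) (%y. f (map2 g y)) z = F (l + of_nat k) (m + of_nat k) (iter_F F l m k (%y. f (map2 g y))) z" by simp
 also have "... = F (l + of_nat k) (m + of_nat k) (%z. ?c ^ k * iter_F F l m k f (map2 g z)) z"
  by (rule ldo_cong[OF ldo_F S ldo_smooth[OF ldo_iter S smf]]) (use Suc in auto)
 also have "... = ?c ^ k * F (l + of_nat k) (m + of_nat k) (%z. iter_F F l m k f (map2 g z)) z"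
  by (rule ldo_cmult[OF ldo_F S smg]) (use Suc in auto)
 also have "... = ?c ^ k * (?c * F (l + of_nat k) (m + of_nat k) (iter_F F l m k f) (map2 g z))"
  by (simp add: F_str[OF g assms(2) ldo_smooth[OF ldo_iter assms(2,3)] Suc.prems])
 finally show ?case by simp
qed simp

end

section \<open>Rational transformations\<close>

text \<open>A fraction for \<open>g\<close> that may have a smaller domain than \<open>g\<close>
  itself; by \<open>rat_map_local\<close> every point of the domain has one valid there.\<close>

definition represents :: "('a::euclidean_space \<rightharpoonup> 'a) => ('a => 'a) => ('a => real) => bool" where
 "represents g P Q \<longleftrightarrow> pfun P & rpoly Q &
   (\<forall>z. Q z ~= 0 --> g z = Some (P z /\<^sub>R Q z))"

abbreviation "fraction_value P Q x y \<equiv> (\<exists>P' Q'. pfun P' & rpoly Q' &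
 (\<forall>z. Q z *\<^sub>R P' z = Q' z *\<^sub>R P z) & Q' x ~= 0 & y = P' x /\<^sub>R Q' x)"

lemma two_nonzero:
 assumes "rpoly p" "rpoly q" "p a ~= 0" "q b ~= 0" "open U" "U ~= {}"
 shows "\<exists>x\<in>U. p x ~= 0 & q x ~= 0"
proof -
 obtain x where "x \<in> U" "p x ~= 0" using rpoly_nonzero_open[OF assms(1,3,5,6)] by blast
 hence "U \<inter> {x. p x ~= 0} ~= {}" by auto
 from rpoly_nonzero_open[OF assms(2,4) open_Int[OF assms(5) open_rpoly_nonzero[OF assms(1)]] this]
 show ?thesis by auto
qed

lemma rat_mapE:
 assumes "rational_map g"
 obtains P Q z where "pfun P" "rpoly Q" "Q z ~= 0" "represents g P Q"
  "!!x y. g x = Some y \<longleftrightarrow> fraction_value P Q x y"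
proof -
 obtain P Q z where PQ: "pfun P" "rpoly Q" "Q z ~= 0"
  "!!x y. g x = Some y \<longleftrightarrow> fraction_value P Q x y"
  using assms unfolding rational_map_def by (elim exE conjE) (rule that, assumption+, simp)
 have "g x = Some (P x /\<^sub>R Q x)" if "Q x ~= 0" for x
  unfolding PQ(4) using that PQ(1,2) by (intro exI[of _ P] exI[of _ Q]) simp
 hence "represents g P Q" using PQ(1,2) by (simp add: represents_def)
 from that[OF PQ(1-3) this PQ(4)] show ?thesis .
qed

lemma rat_map_local:
 assumes "rational_map g" "g x = Some y"
 shows "\<exists>P Q. represents g P Q & Q x ~= 0"
proof -
 obtain P Q where iff: "!!x y. g x = Some y \<longleftrightarrow> fraction_value P Q x y"
  using rat_mapE[OF assms(1)] by metis
 obtain P' Q' where 1: "pfun P'" "rpoly Q'"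
  "\<forall>z. Q z *\<^sub>R P' z = Q' z *\<^sub>R P z" "Q' x ~= 0" using assms(2) unfolding iff by blast
 have "g z = Some (P' z /\<^sub>R Q' z)" if "Q' z ~= 0" for z
  unfolding iff using that 1 by (intro exI[of _ P'] exI[of _ Q']) simp
 thus ?thesis using 1 by (auto simp: represents_def)
qed

lemma rat_dom_open: assumes "rational_map g" shows "open (dom g)"
proof (rule openI)
 fix x assume "x \<in> dom g"
 then obtain P Q where PQ: "represents g P Q" "Q x ~= 0" using rat_map_local[OF assms] by blast
 have "open {z. Q z ~= 0}" using PQ(1) by (intro open_rpoly_nonzero) (simp add: represents_def)
 then obtain d where "d > 0" "ball x d \<subseteq> {z. Q z ~= 0}" using PQ(2) openE by blast
 thus "\<exists>d>0. ball x d \<subseteq> dom g" using PQ(1) by (intro exI[of _ d]) (auto simp: represents_def)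
qed

lemma rat_dom_dense:
 assumes "rational_map g" "open U" "U ~= {}" shows "\<exists>x\<in>U. x \<in> dom g"
proof -
 obtain P Q z where PQ: "rpoly Q" "Q z ~= 0" "represents g P Q" by (rule rat_mapE[OF assms(1)])
 from rpoly_nonzero_open[OF PQ(1,2) assms(2,3)] PQ(3) show ?thesis by (auto simp: represents_def)
qed

text \<open>Equality of fractions is transitive: the cross-multiplied equations combine where
  \<open>Q\<close> does not vanish, and polynomials that agree there agree everywhere.\<close>

lemma fraction_transfer:
 fixes P P1 P' :: "'a::euclidean_space => 'a"
 assumes "pfun P'" "rpoly Q'" "pfun P1" "rpoly Q1"
  "rpoly Q" "Q a ~= 0" "!!z. Q1 z *\<^sub>R P z = Q z *\<^sub>R P1 z" "!!z. Q z *\<^sub>R P' z = Q' z *\<^sub>R P z"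
 shows "Q1 z *\<^sub>R P' z = Q' z *\<^sub>R P1 z"
proof (rule polynomial_eqI[of "%z. Q1 z *\<^sub>R P' z" "%z. Q' z *\<^sub>R P1 z" "{z. Q z ~= 0}" z])
 fix x assume "x \<in> {z. Q z ~= 0}"
 hence x: "Q x ~= 0" by simp
 have "Q x *\<^sub>R (Q1 x *\<^sub>R P' x) = Q1 x *\<^sub>R (Q x *\<^sub>R P' x)" by (rule scaleR_left_commute)
 also have "... = Q1 x *\<^sub>R (Q' x *\<^sub>R P x)" by (simp only: assms(8))
 also have "... = Q' x *\<^sub>R (Q1 x *\<^sub>R P x)" by (rule scaleR_left_commute)
 also have "... = Q' x *\<^sub>R (Q x *\<^sub>R P1 x)" by (simp only: assms(7))
 also have "... = Q x *\<^sub>R (Q' x *\<^sub>R P1 x)" by (rule scaleR_left_commute)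
 finally show "Q1 x *\<^sub>R P' x = Q' x *\<^sub>R P1 x" by (rule scaleR_left_imp_eq[OF x])
qed (use assms in \<open>auto intro: pfun_scaleR open_rpoly_nonzero\<close>)

text \<open>Agreement on an open set makes the two defining fractions equivalent, and equivalent
  fractions have the same maximal extension; so the domains coincide as well.\<close>

lemma rat_map_eqI:
 assumes g: "rational_map g" and h: "rational_map h" and U: "open U" "U ~= {}"
  and eq: "!!x. x \<in> U ==> x \<in> dom g ==> x \<in> dom h ==> g x = h x"
 shows "g = h"
proof -
 obtain P Q a where P: "pfun P" "rpoly Q" "Q a ~= 0" "represents g P Q"
  "!!x y. g x = Some y \<longleftrightarrow> fraction_value P Q x y" by (rule rat_mapE[OF g], rule that, assumption+)
 obtain P1 Q1 b where P1: "pfun P1" "rpoly Q1" "Q1 b ~= 0" "represents h P1 Q1"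
  "!!x y. h x = Some y \<longleftrightarrow> fraction_value P1 Q1 x y" by (rule rat_mapE[OF h], rule that, assumption+)
 let ?W = "U \<inter> ({z. Q z ~= 0} \<inter> {z. Q1 z ~= 0})"
 have W: "open ?W" using U by (intro open_Int open_rpoly_nonzero P P1)
 have W0: "?W ~= {}" using two_nonzero[OF P(2) P1(2) P(3) P1(3) U] by auto
 have cross: "Q1 z *\<^sub>R P z = Q z *\<^sub>R P1 z" for z
 proof (rule polynomial_eqI[OF pfun_scaleR[OF P1(2) P(1)] pfun_scaleR[OF P(2) P1(1)] W W0])
  fix x assume x: "x \<in> ?W"
  hence "g x = Some (P x /\<^sub>R Q x)" "h x = Some (P1 x /\<^sub>R Q1 x)" using P(4) P1(4) by (auto simp: represents_def)
  hence "P x /\<^sub>R Q x = P1 x /\<^sub>R Q1 x" using eq[of x] x by auto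
  moreover have "P x = Q x *\<^sub>R (P x /\<^sub>R Q x)" "P1 x = Q1 x *\<^sub>R (P1 x /\<^sub>R Q1 x)" using x by simp_all
  ultimately show "Q1 x *\<^sub>R P x = Q x *\<^sub>R P1 x" by (metis scaleR_left_commute)
 qed
 have "g x = Some y \<longleftrightarrow> h x = Some y" for x y
  unfolding P(5) P1(5)
 proof (intro iffI; elim exE conjE)
  fix P' Q' assume 1: "pfun P'" "rpoly Q'" "Q' x ~= 0" "y = P' x /\<^sub>R Q' x"
  {
   assume "\<forall>z. Q z *\<^sub>R P' z = Q' z *\<^sub>R P z"
   hence "Q1 z *\<^sub>R P' z = Q' z *\<^sub>R P1 z" for z
    by (intro fraction_transfer[OF 1(1,2) P1(1,2) P(2,3) cross]) simp
   thus "fraction_value P1 Q1 x y"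
    using 1 by (intro exI[of _ P'] exI[of _ Q']) simp
  next
   assume "\<forall>z. Q1 z *\<^sub>R P' z = Q' z *\<^sub>R P1 z"
   hence "Q z *\<^sub>R P' z = Q' z *\<^sub>R P z" for z
    by (intro fraction_transfer[OF 1(1,2) P(1,2) P1(2,3) cross[symmetric]]) simp
   thus "fraction_value P Q x y"
    using 1 by (intro exI[of _ P'] exI[of _ Q']) simp
  }
 qed
 thus "g = h" by (metis (no_types) ext option.exhaust)
qed

lemma rat_map_of_fraction:
 fixes P :: "'a::euclidean_space => 'a"
 assumes P: "pfun P" and Q: "rpoly Q" "Q a ~= 0"
 shows "\<exists>g. rational_map g & represents g P Q"
proof -
 define R where "R x y \<longleftrightarrow> fraction_value P Q x y" for x y
 have uniq: "y = y'" if R1: "R x y" and R2: "R x y'" for x y y'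
 proof -
  obtain P1 Q1 where 1: "pfun P1" "rpoly Q1" "\<forall>z. Q z *\<^sub>R P1 z = Q1 z *\<^sub>R P z" "Q1 x ~= 0" "y = P1 x /\<^sub>R Q1 x"
   using R1 unfolding R_def by (elim exE conjE) (rule that)
  obtain P2 Q2 where 2: "pfun P2" "rpoly Q2" "\<forall>z. Q z *\<^sub>R P2 z = Q2 z *\<^sub>R P z" "Q2 x ~= 0" "y' = P2 x /\<^sub>R Q2 x"
   using R2 unfolding R_def by (elim exE conjE) (rule that)
  have "Q1 x *\<^sub>R P2 x = Q2 x *\<^sub>R P1 x" by (rule fraction_transfer[of P2 Q2 P1 Q1 Q a P x]) (use 1 2 P Q in auto)
  hence "inverse (Q1 x) *\<^sub>R inverse (Q2 x) *\<^sub>R (Q1 x *\<^sub>R P2 x) = inverse (Q1 x) *\<^sub>R inverse (Q2 x) *\<^sub>R (Q2 x *\<^sub>R P1 x)" by simp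
  hence "inverse (Q2 x) *\<^sub>R inverse (Q1 x) *\<^sub>R (Q1 x *\<^sub>R P2 x) = inverse (Q1 x) *\<^sub>R inverse (Q2 x) *\<^sub>R (Q2 x *\<^sub>R P1 x)"
   by (subst scaleR_left_commute)
  thus ?thesis using 1(4,5) 2(4,5) by simp
 qed
 define g where "g x = (if \<exists>y. R x y then Some (THE y. R x y) else None)" for x
 have g: "g x = Some y \<longleftrightarrow> R x y" for x y
 proof (cases "\<exists>y. R x y")
  case True
  then obtain y' where y': "R x y'" by blast
  have "(THE y. R x y) = y'" by (rule the_equality[of "R x", OF y']) (rule uniq[OF _ y'])
  thus ?thesis using y' uniq[OF y', of y] by (auto simp: g_def)
 qed (simp add: g_def)
 have "rational_map g" unfolding rational_map_def
  by (intro exI[of _ P] exI[of _ Q] conjI P Q(1) exI[of _ a] Q(2) allI) (simp add: g R_def)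
 moreover have "represents g P Q"
 proof -
  have "R z (P z /\<^sub>R Q z)" if "Q z ~= 0" for z
   unfolding R_def using that P Q by (intro exI[of _ P] exI[of _ Q]) simp
  thus ?thesis using P Q by (simp add: represents_def g)
 qed
 ultimately show ?thesis by blast
qed

lemma rpoly_mult_power:
 "rpoly f ==> rpoly g ==> rpoly (%x. f x ^ n * g x)"
 by (intro rpoly_intros(4) real_polynomial_function_power)

text \<open>Substitution and clearing of denominators give a fraction for the composite.
  \<open>R\<close> marks an open set around the prescribed point; two such sets always meet, which
  is how the map \<open>k\<close> is later seen not to depend on the point.\<close>

lemma composite_local:
 assumes g: "rational_map g" and h: "rational_map h" and x: "h x = Some y" "g y = Some z"
 shows "\<exists>k R. rational_map k & rpoly R & R x ~= 0 &
  (\<forall>w. R w ~= 0 --> (\<exists>u v. h w = Some u & g u = Some v & k w = Some v))"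
proof -
 obtain P1 Q1 where 1: "represents g P1 Q1" "Q1 y ~= 0" using rat_map_local[OF g x(2)] by blast
 obtain P2 Q2 where 2: "represents h P2 Q2" "Q2 x ~= 0" using rat_map_local[OF h x(1)] by blast
 have p: "pfun P1" "rpoly Q1" "pfun P2" "rpoly Q2"
  using 1 2 by (auto simp: represents_def)
 obtain N1 d1 where N1: "rpoly N1" "!!x. Q2 x ~= 0 ==> N1 x = Q2 x ^ d1 * Q1 (P2 x /\<^sub>R Q2 x)"
  using rpoly_substitute[OF p(2,3,4)] by blast
 obtain N2 d2 where N2: "pfun N2" "!!x. Q2 x ~= 0 ==> N2 x = (Q2 x ^ d2) *\<^sub>R P1 (P2 x /\<^sub>R Q2 x)"
  using poly_substitute[OF p(1,3,4)] by blast
 let ?P = "%x. (Q2 x ^ d1) *\<^sub>R N2 x" and ?Q = "%x. Q2 x ^ d2 * N1 x"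
 have pP: "pfun ?P" by (intro pfun_scaleR real_polynomial_function_power p N2)
 have pQ: "rpoly ?Q" by (intro rpoly_mult_power p N1)
 have y: "y = P2 x /\<^sub>R Q2 x" using x(1) 2 by (simp add: represents_def)
 have Qx: "?Q x ~= 0" using 1(2) 2(2) by (simp add: N1(2) y)
 obtain k where k: "rational_map k" "represents k ?P ?Q"
  using rat_map_of_fraction[OF pP pQ Qx] by blast
 have R: "rpoly (%x. Q2 x ^ 1 * ?Q x)" by (rule rpoly_mult_power[OF p(4) pQ])
 show ?thesis
 proof (intro exI[of _ k] exI[of _ "%x. Q2 x ^ 1 * ?Q x"] conjI k(1) R allI impI)
  show "Q2 x ^ 1 * ?Q x ~= 0" using Qx 2(2) by simp
  fix w assume "Q2 w ^ 1 * ?Q w ~= 0"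
  hence w: "Q2 w ~= 0" "?Q w ~= 0" by auto
  let ?u = "P2 w /\<^sub>R Q2 w" and ?v = "P1 (P2 w /\<^sub>R Q2 w) /\<^sub>R Q1 (P2 w /\<^sub>R Q2 w)"
  have Q1: "Q1 ?u ~= 0" using w by (auto simp: N1(2)[OF w(1)])
  have "k w = Some (?P w /\<^sub>R ?Q w)" using k(2) w(2) by (simp add: represents_def)
  also have "?P w /\<^sub>R ?Q w = ?v" using w(1) Q1 by (simp add: N1(2)[OF w(1)] N2(2)[OF w(1)] field_simps)
  finally show "\<exists>u v. h w = Some u & g u = Some v & k w = Some v"
   using 1(1) 2(1) w(1) Q1 by (intro exI[of _ ?u] exI[of _ ?v]) (auto simp: represents_def)
 qed
qed

lemma rat_comp_rational:
 assumes g: "rational_map g" and h: "rational_map h" and x0: "h x0 = Some y0" "g y0 = Some z0"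
 shows "rational_map (rat_comp g h)" "h x = Some y ==> g y = Some z ==> rat_comp g h x = Some z"
proof -
 obtain k R where k: "rational_map k" "rpoly R" "R x0 ~= 0"
  "!!w. R w ~= 0 ==> \<exists>u v. h w = Some u & g u = Some v & k w = Some v"
  using composite_local[OF g h x0] by blast
 let ?C = "%k. rational_map k & (\<forall>x y z. h x = Some y & g y = Some z --> k x = Some z)"
 have "k x = Some z" if x: "h x = Some y" "g y = Some z" for x y z
 proof -
  obtain k' R' where k': "rational_map k'" "rpoly R'" "R' x ~= 0"
   "!!w. R' w ~= 0 ==> \<exists>u v. h w = Some u & g u = Some v & k' w = Some v"
   using composite_local[OF g h x] by blast
  have "k = k'"
  proof (rule rat_map_eqI[OF k(1) k'(1)])
   show "open ({x. R x ~= 0} \<inter> {x. R' x ~= 0})" by (intro open_Int open_rpoly_nonzero k k')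
   show "{x. R x ~= 0} \<inter> {x. R' x ~= 0} ~= {}" using two_nonzero[OF k(2) k'(2) k(3) k'(3), of UNIV] by auto
   show "k w = k' w" if "w \<in> {x. R x ~= 0} \<inter> {x. R' x ~= 0}" for w
    using k(4)[of w] k'(4)[of w] that by auto
  qed
  thus ?thesis using k'(4)[OF k'(3)] x by auto
 qed
 hence C: "?C k" using k(1) by blast
 have "k' = k" if "?C k'" for k'
 proof (rule rat_map_eqI[OF _ k(1) open_rpoly_nonzero[OF k(2)]])
  show "rational_map k'" "{x. R x ~= 0} ~= {}" using that k(3) by auto
  show "k' w = k w" if "w \<in> {x. R x ~= 0}" for w using k(4)[of w] that \<open>?C k'\<close> by auto
 qed
 hence "?C (rat_comp g h)" unfolding rat_comp_def by (rule theI[of ?C, OF C])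
 thus "rational_map (rat_comp g h)" "h x = Some y ==> g y = Some z ==> rat_comp g h x = Some z" by auto
qed

lemma rat_poly: assumes "pfun P" shows "rational_map (%x. Some (P x))"
proof -
 obtain g where g: "rational_map g" "represents g P (%_. 1)"
  using rat_map_of_fraction[OF assms, of "%_. 1"] by (auto simp: rpoly_intros(2))
 hence "g = (%x. Some (P x))" by (auto simp: represents_def)
 thus ?thesis using g by simp
qed

lemma rat_smooth_map:
 assumes g: "rational_map g" shows "smooth_map (dom g) (%x. the (g x))"
 unfolding smooth_map_def
proof (intro allI sm_local)
 fix b x assume "x \<in> dom g"
 then obtain P Q where PQ: "represents g P Q" "Q x ~= 0" using rat_map_local[OF g] by blast
 have p: "pfun P" "rpoly Q" using PQ by (auto simp: represents_def)
 let ?T = "{z. Q z ~= 0}"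
 have T: "open ?T" by (rule open_rpoly_nonzero[OF p(2)])
 have "smooth_on ?T (%z. inverse (cor (Q z)) * of_real (P z \<bullet> b))"
  by (intro sm_mult sm_inverse T sm_real_poly p pfun_inner_real) auto
 hence "smooth_on ?T (%x. cor (the (g x) \<bullet> b))"
  by (rule sm_cong[OF T, rotated]) (use PQ(1) in \<open>auto simp: represents_def\<close>)
 thus "\<exists>T. x \<in> T & smooth_on T (%x. cor (the (g x) \<bullet> b))" using PQ(2) by (intro exI[of _ ?T]) simp
qed

section \<open>The conformal group\<close>

lemma rat_SomeI: "rational_map Some"
 using rat_poly[OF polynomial_function_id] by (simp add: id_def eta_contract_eq)

lemma rat_comp_eqI:
 assumes g: "rational_map g" and h: "rational_map h" and k: "rational_map k" and U: "open U" "U ~= {}"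
  and eq: "!!x. x \<in> U ==> \<exists>y z. h x = Some y & g y = Some z & k x = Some z"
 shows "rat_comp g h = k"
proof -
 obtain x0 y0 z0 where 0: "h x0 = Some y0" "g y0 = Some z0" using U(2) eq by blast
 note rc = rat_comp_rational[OF g h 0]
 show ?thesis
 proof (rule rat_map_eqI[OF rc(1) k U])
  fix x assume "x \<in> U"
  then obtain y z where 1: "h x = Some y" "g y = Some z" "k x = Some z" using eq by blast
  show "rat_comp g h x = k x" using rc(2)[OF 1(1,2)] 1(3) by simp
 qed
qed

definition dense_in :: "'b::topological_space set => bool" where
 "dense_in V \<longleftrightarrow> (\<forall>U. open U --> U ~= {} --> (\<exists>x\<in>U. x \<in> V))"

lemma dense_dom: "rational_map g ==> dense_in (dom g)"
 using rat_dom_dense by (auto simp: dense_in_def)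

lemma dense_in_Int:
 fixes V :: "'b::topological_space set"
 assumes "dense_in V" "dense_in W" "open V" shows "dense_in (V \<inter> W)"
 unfolding dense_in_def
proof (intro allI impI)
 fix U :: "'b set" assume U: "open U" "U ~= {}"
 then obtain x where "x \<in> U \<inter> V" using assms(1) by (auto simp: dense_in_def)
 thus "\<exists>x\<in>U. x \<in> V \<inter> W" using assms(2) open_Int[OF U(1) assms(3)] by (auto simp: dense_in_def)
qed

lemma eq_on_dense:
 fixes f g :: "'b::topological_space => 'c::t2_space"
 assumes "open S" "continuous_on S f" "continuous_on S g" "dense_in W" "!!x. x \<in> S ==> x \<in> W ==> f x = g x" "x \<in> S"
 shows "f x = g x"
 by (rule eq_on_open_if_dense[OF assms(1-3) _ assms(6)]) (use assms(4,5) in \<open>unfold dense_in_def, blast\<close>)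

lemma poly_eq_dense:
 assumes "rpoly p" "rpoly q" "dense_in W" "!!x. x \<in> W ==> p x = q x"
 shows "p x = (q x :: real)"
 by (rule eq_on_dense[OF open_UNIV cont_rp[OF assms(1)] cont_rp[OF assms(2)] assms(3)]) (use assms(4) in auto)

lemma dense_poly_nonzero:
 fixes p :: "'b::euclidean_space => real"
 assumes "rpoly p" "p z ~= 0" shows "dense_in {x. p x ~= 0}"
 using rpoly_nonzero_open[OF assms] by (auto simp: dense_in_def)

context sjordan begin

lemma str_pos_comp:
 assumes "g \<in> str_group_pos J" "h \<in> str_group_pos J"
 shows "(%x. g (h x)) \<in> str_group_pos J" "str_char J (%x. g (h x)) = str_char J g * str_char J h"
proof -
 note G = strp_D[OF assms(1)] and H = strp_D[OF assms(2)]
 have 1: "linear (%x. g (h x))" "bij (%x. g (h x))"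
  using linear_compose[OF H(1) G(1)] bij_comp[OF H(2) G(2)] by (simp_all add: o_def)
 have "jd (g (h x)) = (str_char J g * str_char J h) * jd x" for x using G(4) H(4) by simp
 from strp_I[OF 1 _ this] G(3) H(3)
 show "(%x. g (h x)) \<in> str_group_pos J" "str_char J (%x. g (h x)) = str_char J g * str_char J h" by auto
qed

lemma str_pos_inv:
 assumes "g \<in> str_group_pos J"
 shows "inv_into UNIV g \<in> str_group_pos J" "str_char J (inv_into UNIV g) = inverse (str_char J g)"
proof -
 note G = strp_D[OF assms]
 have s: "g (inv_into UNIV g x) = x" for x using bij_is_surj[OF G(2)] by (rule surj_f_inv_f)
 have "jd (inv_into UNIV g x) = inverse (str_char J g) * jd x" for x
  using G(4)[of "inv_into UNIV g x"] G(3) by (simp add: s field_simps)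
 from strp_I[OF inj_linear_imp_inv_linear[OF G(1) bij_is_inj[OF G(2)]] bij_imp_bij_inv[OF G(2)] _ this] G(3)
 show "inv_into UNIV g \<in> str_group_pos J" "str_char J (inv_into UNIV g) = inverse (str_char J g)" by auto
qed

definition dg :: "('a \<rightharpoonup> 'a) => 'a => 'a => 'a" where
 "dg g x = fderiv (%z. the (g z)) (at x)"

lemma cocycle_dg: "cocycle_c J g x = inverse (str_char J (dg g x))" by (simp add: cocycle_c_def dg_def)

text \<open>The properties that pass to composites. The last clause survives at points where a
  composite is defined but its factors are not: a polynomial field mapped to any given constant
  makes the differential surjective there and exhibits the cocycle as a determinant.\<close>

definition conf :: "('a \<rightharpoonup> 'a) => bool" where
 "conf g \<longleftrightarrow> rational_map g & (\<forall>x\<in>dom g. dg g x \<in> str_group_pos J) &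
   (\<forall>X\<in>qf. \<exists>Y\<in>qf. \<forall>x\<in>dom g. dg g x (Y x) = X (the (g x)))"

lemma conf_str: "conf g ==> x \<in> dom g ==> dg g x \<in> str_group_pos J" by (simp add: conf_def)

lemma dg_hasd:
 assumes "rational_map g" "x \<in> dom g" shows "((%z. the (g z)) has_derivative dg g x) (at x)"
 unfolding dg_def by (rule smap_hasd[OF rat_smooth_map[OF assms(1)] assms(2)])

lemma dgI: "((%z. the (g z)) has_derivative D) (at x) ==> dg g x = D"
 unfolding dg_def by (rule frechet_derivative_at[symmetric])

lemma dg_continuous:
 assumes g: "rational_map g" and Y: "pfun Y" shows "continuous_on (dom g) (%x. dg g x (Y x))"
proof -
 have "continuous_on (dom g) (%x. \<Sum>b\<in>Basis. (Y x \<bullet> b) *\<^sub>R dg g x b)"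
  unfolding dg_def
  by (intro continuous_on_sum continuous_on_scaleR cont_rp pfun_inner_real[OF Y]
    smap_continuous smap_frechet rat_dom_open rat_smooth_map g)
 moreover have "(\<Sum>b\<in>Basis. (Y x \<bullet> b) *\<^sub>R dg g x b) = dg g x (Y x)" if "x \<in> dom g" for x
 proof -
  note l = has_derivative_linear[OF dg_hasd[OF g that]]
  have "dg g x (\<Sum>b\<in>Basis. (Y x \<bullet> b) *\<^sub>R b) = (\<Sum>b\<in>Basis. (Y x \<bullet> b) *\<^sub>R dg g x b)"
   by (simp add: linear_sum[OF l] linear_scale[OF l])
  thus ?thesis by (simp add: euclidean_representation)
 qed
 ultimately show ?thesis by (simp cong: continuous_on_cong)
qed

lemma conf_linear: assumes "g \<in> str_group_pos J" shows "conf (linear_tr g)" "dg (linear_tr g) x = g"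
proof -
 note G = strp_D[OF assms]
 show d: "dg (linear_tr g) x = g" for x
  by (rule dgI) (use G(1) in \<open>simp add: linear_tr_def linear_imp_has_derivative\<close>)
 have "\<exists>Y\<in>qf. \<forall>x\<in>UNIV. g (Y x) = X (g x)" if "X \<in> qf" for X by (rule qf_linear[OF assms that])
 thus "conf (linear_tr g)" using assms rat_poly[OF poly_linear[OF G(1)]]
  by (simp add: conf_def d) (simp add: linear_tr_def)
qed

lemma str_id: "(%h. h) \<in> str_group_pos J" "str_char J (%h. h) = 1"
 using strp_I[of "%h. h" 1] by (simp_all add: linear_ident bij_id[unfolded id_def])

lemma conf_translation: "conf (translation_tr v)" "dg (translation_tr v) x = (%h. h)"
proof -
 show d: "dg (translation_tr v) x = (%h. h)" for x
  by (rule dgI) (auto simp: translation_tr_def intro!: derivative_eq_intros)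
 have "\<exists>Y\<in>qf. \<forall>x\<in>UNIV. Y x = X (x + v)" if "X \<in> qf" for X by (rule qf_translation[OF that])
 moreover have "rational_map (translation_tr v)" unfolding translation_tr_def
  by (rule rat_poly) (intro polynomial_function_add polynomial_function_const polynomial_function_id[unfolded id_def])
 ultimately show "conf (translation_tr v)" using str_id by (simp add: conf_def d) (simp add: translation_tr_def)
qed

lemma jd_neg: "jd (- x) = (-1) ^ r * jd x"
proof -
 have "jd (jpoly J [:-1:] x ** jpoly J [:0, 1:] x) = jd (jpoly J [:-1:] x) * jd (jpoly J [:0, 1:] x)" by (rule jd_mult_jpoly)
 thus ?thesis using jd_scale[of "-1"] by (simp add: jpoly_const)
qed

lemma conf_inversion_dg: assumes "jd x ~= 0"
 shows "dg (inversion_tr J) x = (%h. - dinv x h)" "dg (inversion_tr J) x \<in> str_group_pos J"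
  "str_char J (dg (inversion_tr J) x) = inverse ((jd x)\<^sup>2)"
proof -
 show d: "dg (inversion_tr J) x = (%h. - dinv x h)"
 proof (rule dgI)
  show "((%z. the (inversion_tr J z)) has_derivative (%h. - dinv x h)) (at x)"
   by (rule has_derivative_transform_within_open[OF has_derivative_minus[OF dinv[OF assms]] open_invertibles])
    (simp_all add: assms inversion_tr_def invertibles_iff)
 qed
 have i: "P x (- dinv x h) = h" for h using P_dinv[OF assms, of h] linear_neg[OF Pb_linear(1), of x x "dinv x h"] by simp
 have "- dinv x = inv_into UNIV (P x)"
 proof
  fix h show "(- dinv x) h = inv_into UNIV (P x) h"
   using i[of h] bij_is_inj[OF P_bij[OF assms]] by (simp add: inv_f_eq)
 qed
 hence "(%h. - dinv x h) = inv_into UNIV (P x)" by (simp add: fun_Compl_def)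
 with str_pos_inv[OF P_str_group(1)[OF assms]] P_str_group(2)[OF assms] d
 show "dg (inversion_tr J) x \<in> str_group_pos J" "str_char J (dg (inversion_tr J) x) = inverse ((jd x)\<^sup>2)" by auto
qed

text \<open>No equivalent fraction extends the inversion further: where one is defined,
  \<open>jd\<close> of its value times \<open>jd x\<close> equals \<open>(-1)^r\<close> by
  continuity, so \<open>x\<close> is invertible.\<close>

lemma rat_inversion: "rational_map (inversion_tr J)"
proof -
 have pa: "pfun (%x. - adj x)" by (intro polynomial_function_minus adj_poly)
 have inv_of: "jd x ~= 0" if "pfun P'" "rpoly Q'"
   "!!z. jd z *\<^sub>R P' z = Q' z *\<^sub>R (- adj z)" "Q' x ~= 0" for P' Q' x
 proof -
  have ev: "P' y /\<^sub>R Q' y = - jinv J y" if "Q' y ~= 0" "jd y ~= 0" for y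
  proof -
   have "P' y = inverse (jd y) *\<^sub>R (jd y *\<^sub>R P' y)" using that by simp
   also have "... = Q' y *\<^sub>R (- (inverse (jd y) *\<^sub>R adj y))" by (simp add: \<open>!!z. jd z *\<^sub>R P' z = _\<close>)
   finally show ?thesis using that by (simp add: jinv_eq)
  qed
  have "jd (P' x /\<^sub>R Q' x) * jd x = (-1) ^ r"
  proof (rule eq_on_dense[where f = "%x. jd (P' x /\<^sub>R Q' x) * jd x" and x = x, OF open_rpoly_nonzero[OF that(2)] _ continuous_on_const dense_poly_nonzero[OF jd_poly, of e]])
   have c: "continuous_on {x. Q' x ~= 0} (%x. P' x /\<^sub>R Q' x)"
    by (intro continuous_on_scaleR continuous_on_inverse cont_rp that continuous_on_polymonial_function) auto
   show "continuous_on {x. Q' x ~= 0} (%x. jd (P' x /\<^sub>R Q' x) * jd x)"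
    by (intro continuous_on_mult cont_rp[OF jd_poly] continuous_on_compose2[OF cont_rp[OF jd_poly, of UNIV] c]) simp
   show "jd (P' y /\<^sub>R Q' y) * jd y = (-1) ^ r" if "y \<in> {x. Q' x ~= 0}" "y \<in> {x. jd x ~= 0}" for y
    using that by (simp add: ev jd_neg jd_jinv)
  qed (use that in auto)
  thus ?thesis by auto
 qed
 have iff: "inversion_tr J x = Some y \<longleftrightarrow> fraction_value (%z. - adj z) jd x y" for x y
 proof (rule iffI)
  assume "inversion_tr J x = Some y"
  hence "jd x ~= 0" "y = - adj x /\<^sub>R jd x" by (auto simp: inversion_tr_def invertibles_iff jinv_eq split: if_splits)
  thus "fraction_value (%z. - adj z) jd x y"
   using pa jd_poly by (intro exI[of _ "%x. - adj x"] exI[of _ jd]) simp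
 next
  assume "fraction_value (%z. - adj z) jd x y"
  then obtain P' Q' where 1: "pfun P'" "rpoly Q'" "\<forall>z. jd z *\<^sub>R P' z = Q' z *\<^sub>R - adj z" "Q' x ~= 0" "y = P' x /\<^sub>R Q' x"
   by (elim exE conjE) (rule that)
  have jx: "jd x ~= 0" by (rule inv_of[OF 1(1,2) _ 1(4)]) (use 1(3) in simp)
  have "P' x = inverse (jd x) *\<^sub>R (jd x *\<^sub>R P' x)" using jx by simp
  also have "... = Q' x *\<^sub>R (- (inverse (jd x) *\<^sub>R adj x))" using 1(3) by simp
  finally show "inversion_tr J x = Some y" using 1(4,5) jx by (simp add: inversion_tr_def invertibles_iff jinv_eq)
 qed
 show ?thesis unfolding rational_map_def
  by (rule exI[of _ "%x. - adj x"], rule exI[of _ jd])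
   (intro conjI allI pa jd_poly iff exI[of _ e], simp)
qed

lemma conf_inversion: "conf (inversion_tr J)"
proof -
 have dom: "dom (inversion_tr J) = {x. jd x ~= 0}" by (auto simp: inversion_tr_def invertibles_iff split: if_splits)
 show ?thesis unfolding conf_def dom
 proof (intro conjI rat_inversion ballI)
  fix X assume "X \<in> qf"
  from qf_inversion[OF this] obtain Y where "Y \<in> qf" "\<forall>x\<in>{x. jd x ~= 0}. - dinv x (Y x) = X (- jinv J x)" by blast
  thus "\<exists>Y\<in>qf. \<forall>x\<in>{x. jd x ~= 0}. dg (inversion_tr J) x (Y x) = X (the (inversion_tr J x))"
   by (intro bexI[of _ Y] ballI) (simp_all add: conf_inversion_dg(1), simp add: inversion_tr_def invertibles_iff)
 qed (simp add: conf_inversion_dg(2))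
qed

lemma conf_open_map:
 assumes g: "conf g" and U: "open U" "U \<subseteq> dom g" "x \<in> U"
 shows "the (g x) \<in> interior ((%z. the (g z)) ` U)"
proof -
 have r: "rational_map g" and s: "dg g x \<in> str_group_pos J" using g U by (auto simp: conf_def)
 note S = strp_D[OF s]
 show ?thesis
 proof (rule sussmann_open_mapping[OF rat_dom_open[OF r] smap_continuous[OF rat_smooth_map[OF r]] _ dg_hasd[OF r]])
  show "bounded_linear (inv_into UNIV (dg g x))"
   using inj_linear_imp_inv_linear[OF S(1) bij_is_inj[OF S(2)]] by (simp add: linear_conv_bounded_linear)
  show "dg g x \<circ> inv_into UNIV (dg g x) = id" using bij_is_surj[OF S(2)] by (simp add: surj_iff[symmetric])
  show "x \<in> interior U" using U interior_open by blast
 qed (use U in auto)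
qed

text \<open>The differential is invertible, so images of nonempty open sets have interior points and
  therefore meet every dense set.\<close>

lemma conf_generic:
 assumes h: "conf h" and V: "dense_in V"
 shows "dense_in {x \<in> dom h. the (h x) \<in> V}"
 unfolding dense_in_def
proof (intro allI impI)
 fix U :: "'a set" assume U: "open U" "U ~= {}"
 have r: "rational_map h" using h by (simp add: conf_def)
 let ?U = "U \<inter> dom h"
 have oU: "open ?U" using U(1) rat_dom_open[OF r] by (rule open_Int)
 obtain x where "x \<in> ?U" using rat_dom_dense[OF r U] by blast
 hence "interior ((%z. the (h z)) ` ?U) ~= {}" using conf_open_map[OF h oU, of x] by auto
 then obtain y where "y \<in> interior ((%z. the (h z)) ` ?U)" "y \<in> V"
  using V open_interior by (auto simp: dense_in_def)
 hence "y \<in> (%z. the (h z)) ` ?U" "y \<in> V" using interior_subset by auto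
 thus "\<exists>x\<in>U. x \<in> {x \<in> dom h. the (h x) \<in> V}" by auto
qed

text \<open>The points where the pointwise composite exists; the domain of
  \<open>rat_comp g h\<close> may be larger.\<close>

definition cdom :: "('a \<rightharpoonup> 'a) => ('a \<rightharpoonup> 'a) => 'a set" where
 "cdom g h = {x \<in> dom h. the (h x) \<in> dom g}"

lemma conf_rational: "conf g ==> rational_map g" by (simp add: conf_def)

lemma cdom_open: "rational_map g ==> rational_map h ==> open (cdom g h)"
 unfolding cdom_def
 using continuous_open_preimage[OF smap_continuous[OF rat_smooth_map] rat_dom_open rat_dom_open, of h g]
 by (simp add: vimage_def Int_def)

lemma cdom_dense: "conf h ==> rational_map g ==> dense_in (cdom g h)"
 unfolding cdom_def by (intro conf_generic dense_dom)

lemma dense_nonempty: "dense_in V ==> \<exists>x. x \<in> V"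
 unfolding dense_in_def using open_UNIV by blast

lemma conf_comp_val:
 assumes "conf g" "conf h"
 shows "rational_map (rat_comp g h)"
  "x \<in> cdom g h ==> rat_comp g h x = g (the (h x))" "x \<in> cdom g h ==> x \<in> dom (rat_comp g h)"
proof -
 note r = assms[THEN conf_rational]
 obtain x0 y0 z0 where 0: "h x0 = Some y0" "g y0 = Some z0"
  using dense_nonempty[OF cdom_dense[OF assms(2) r(1)]] by (auto simp: cdom_def)
 note rc = rat_comp_rational[OF r 0]
 show "rational_map (rat_comp g h)" by (rule rc(1))
 show "x \<in> cdom g h ==> rat_comp g h x = g (the (h x))" "x \<in> cdom g h ==> x \<in> dom (rat_comp g h)"
  using rc(2)[of x] by (auto simp: cdom_def)
qed

lemma conf_comp_dg:
 assumes "conf g" "conf h" "x \<in> cdom g h"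
 shows "dg (rat_comp g h) x = (%v. dg g (the (h x)) (dg h x v))"
proof (rule dgI)
 note r = assms(1,2)[THEN conf_rational]
 have "((%z. the (g (the (h z)))) has_derivative (%v. dg g (the (h x)) (dg h x v))) (at x)"
  using assms(3) by (intro has_derivative_compose[OF dg_hasd[OF r(2)] dg_hasd[OF r(1)]]) (auto simp: cdom_def)
 thus "((%z. the (rat_comp g h z)) has_derivative (%v. dg g (the (h x)) (dg h x v))) (at x)"
  by (rule has_derivative_transform_within_open[OF _ cdom_open[OF r] assms(3)]) (simp add: conf_comp_val(2)[OF assms(1,2)])
qed

lemma conf_comp_cocycle:
 assumes "conf g" "conf h" "x \<in> cdom g h"
 shows "cocycle_c J (rat_comp g h) x = cocycle_c J g (the (h x)) * cocycle_c J h x"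
proof -
 have "x \<in> dom h" "the (h x) \<in> dom g" using assms(3) by (auto simp: cdom_def)
 from str_pos_comp(2)[OF conf_str[OF assms(1) this(2)] conf_str[OF assms(2) this(1)]]
 show ?thesis by (simp add: cocycle_dg conf_comp_dg[OF assms])
qed

text \<open>On \<open>cdom g h\<close> everything follows from the chain rule. Elsewhere the
  identities extend by continuity, but nondegeneracy does not; it comes from pulling back constant
  fields, which makes the differential surjective.\<close>

lemma conf_comp: assumes g: "conf g" and h: "conf h" shows "conf (rat_comp g h)"
proof -
 let ?k = "rat_comp g h"
 note r = conf_rational[OF g] conf_rational[OF h] and k = conf_comp_val(1)[OF g h]
 note W = cdom_open[OF r] cdom_dense[OF h r(1)]
 have X: "\<exists>Y\<in>qf. \<forall>x\<in>dom ?k. dg ?k x (Y x) = X (the (?k x))" if Xq: "X \<in> qf" for X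
 proof -
  obtain Z where Z: "Z \<in> qf" "!!x. x \<in> dom g ==> dg g x (Z x) = X (the (g x))" using g Xq by (auto simp: conf_def)
  obtain Y where Y: "Y \<in> qf" "!!x. x \<in> dom h ==> dg h x (Y x) = Z (the (h x))" using h Z(1) by (auto simp: conf_def)
  have "dg ?k x (Y x) = X (the (?k x))" if "x \<in> dom ?k" for x
  proof (rule eq_on_dense[where g = "%x. X (the (?k x))", OF rat_dom_open[OF k] dg_continuous[OF k qf_poly[OF Y(1)]] _ W(2) _ that])
   show "continuous_on (dom ?k) (%x. X (the (?k x)))"
    by (rule continuous_on_compose2[OF continuous_on_polymonial_function[OF qf_poly[OF Xq], of UNIV]
       smap_continuous[OF rat_smooth_map[OF k]]]) simp
   show "dg ?k x (Y x) = X (the (?k x))" if "x \<in> dom ?k" "x \<in> cdom g h" for x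
    using that(2) Y(2)[of x] Z(2)[of "the (h x)"] by (auto simp: conf_comp_dg[OF g h] conf_comp_val(2)[OF g h] cdom_def)
  qed
  thus ?thesis using Y(1) by blast
 qed
 have "dg ?k x \<in> str_group_pos J" if x: "x \<in> dom ?k" for x
 proof -
  have l: "linear (dg ?k x)" by (rule has_derivative_linear[OF dg_hasd[OF k x]])
  have "\<exists>y. v = dg ?k x y" for v
  proof -
   obtain Y where "\<forall>x\<in>dom ?k. dg ?k x (Y x) = v" using X[OF qf_const[of v]] by blast
   hence "v = dg ?k x (Y x)" using x by simp
   thus ?thesis by (rule exI)
  qed
  hence "surj (dg ?k x)" by (simp add: surj_def)
  hence b: "bij (dg ?k x)" using l by (simp add: bij_def linear_surjective_imp_injective)
  have cj: "continuous_on (dom ?k) (%x. jd (dg ?k x v))" for v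
   by (rule continuous_on_compose2[OF cont_rp[OF jd_poly, of UNIV] dg_continuous[OF k polynomial_function_const]]) simp
  have on_W: "dg ?k y \<in> str_group_pos J" if "y \<in> cdom g h" for y
   unfolding conf_comp_dg[OF g h that]
   by (rule str_pos_comp(1)[OF conf_str[OF g] conf_str[OF h]]) (use that in \<open>auto simp: cdom_def\<close>)
  have jd: "jd (dg ?k x v) = jd (dg ?k x e) * jd v" for v
  proof (rule eq_on_dense[OF rat_dom_open[OF k] cj continuous_on_mult[OF cj continuous_on_const] W(2) _ x])
   show "jd (dg ?k y v) = jd (dg ?k y e) * jd v" if "y \<in> cdom g h" for y
    using strp_D(4)[OF on_W[OF that]] by simp
  qed
  \<comment> \<open>The sign condition is phrased as an equation of continuous functions, so that it
    passes from the dense set to \<open>x\<close>; bijectivity then excludes zero.\<close>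
  have "\<bar>jd (dg ?k x e)\<bar> = jd (dg ?k x e)"
  proof (rule eq_on_dense[OF rat_dom_open[OF k] continuous_on_rabs[OF cj] cj W(2) _ x])
   show "\<bar>jd (dg ?k y e)\<bar> = jd (dg ?k y e)" if "y \<in> cdom g h" for y
    using strp_D(3,4)[OF on_W[OF that]] by simp
  qed
  moreover have "jd (dg ?k x e) ~= 0"
  proof
   assume "jd (dg ?k x e) = 0"
   moreover obtain v where "dg ?k x v = e" using bij_is_surj[OF b] by (metis surjD)
   ultimately show False using jd[of v] by simp
  qed
  ultimately have "jd (dg ?k x e) > 0" by linarith
  from strp_I(1)[OF l b this jd] show ?thesis .
 qed
 thus ?thesis using k X by (simp add: conf_def)
qed

lemma co_group_conf: "g \<in> co_group J ==> conf g"
 by (induction rule: co_group.induct) (simp_all add: conf_linear conf_translation conf_inversion conf_comp)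

text \<open>A field \<open>Y\<close> sent to the constant \<open>e\<close> satisfies
  \<open>str_char J (dg g x) * jd (Y x) = 1\<close>, so the cocycle is the polynomial
  \<open>jd (Y x)\<close>.\<close>

lemma conf_cocycle:
 assumes "conf g"
 shows "\<exists>C. rpoly C & (\<forall>x\<in>dom g. cocycle_c J g x = C x & C x > 0)"
proof -
 obtain Y where Y: "Y \<in> qf" "!!x. x \<in> dom g ==> dg g x (Y x) = e" using assms qf_const[of e] by (auto simp: conf_def)
 have "cocycle_c J g x = jd (Y x) & jd (Y x) > 0" if "x \<in> dom g" for x
 proof -
  have s: "dg g x \<in> str_group_pos J" using assms that by (simp add: conf_def)
  have "str_char J (dg g x) * jd (Y x) = 1" using strp_D(4)[OF s, of "Y x"] Y(2)[OF that] by simp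
  thus ?thesis using strp_D(3)[OF s] unfolding cocycle_dg
   by (metis inverse_unique inverse_positive_iff_positive)
 qed
 moreover have "rpoly (%x. jd (Y x))"
  using real_polynomial_function_compose[OF qf_poly[OF Y(1)] jd_poly] by (simp add: o_def)
 ultimately show ?thesis by blast
qed

lemma rat_comp_assoc:
 assumes "conf a" "conf b" "conf c"
 shows "rat_comp (rat_comp a b) c = rat_comp a (rat_comp b c)"
proof -
 note R = assms[THEN conf_rational]
 note ab = conf_comp_val[OF assms(1,2)] and bc = conf_comp_val[OF assms(2,3)]
 let ?U = "cdom b c \<inter> {x \<in> dom c. the (c x) \<in> cdom a b}"
 have cont: "continuous_on (dom c) (%x. the (c x))" by (rule smap_continuous[OF rat_smooth_map[OF R(3)]])
 have "open {x \<in> dom c. the (c x) \<in> cdom a b}"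
  using continuous_open_preimage[OF cont rat_dom_open[OF R(3)] cdom_open[OF R(1,2)]] by (simp add: vimage_def Int_def)
 hence U: "open ?U" by (intro open_Int cdom_open R)
 have "dense_in ?U" by (intro dense_in_Int cdom_dense cdom_open R assms conf_generic)
 hence "?U ~= {}" using dense_nonempty by blast
 show ?thesis
 proof (rule rat_comp_eqI[OF ab(1) R(3) conf_comp_val(1)[OF assms(1) conf_comp[OF assms(2,3)]] U \<open>?U ~= {}\<close>])
  fix x assume x: "x \<in> ?U"
  obtain y z w where 1: "c x = Some y" "b y = Some z" "a z = Some w" using x by (auto simp: cdom_def)
  have 2: "rat_comp a b y = Some w" using ab(2)[of y] x 1 by auto
  have "rat_comp b c x = Some z" using bc(2)[of x] x 1 by auto
  hence "rat_comp a (rat_comp b c) x = Some w"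
   using conf_comp_val(2)[OF assms(1) conf_comp[OF assms(2,3)], of x] 1 by (auto simp: cdom_def)
  with 1 2 show "\<exists>y z. c x = Some y & rat_comp a b y = Some z & rat_comp a (rat_comp b c) x = Some z" by auto
 qed
qed

lemma rat_comp_Some:
 assumes "rational_map g" shows "rat_comp Some g = g" "rat_comp g Some = g"
proof -
 have "dom g ~= {}" using dense_nonempty[OF dense_dom[OF assms]] by auto
 note U = rat_dom_open[OF assms] this
 show "rat_comp Some g = g" "rat_comp g Some = g"
  by (rule rat_comp_eqI[OF rat_SomeI assms assms U], auto)
   (rule rat_comp_eqI[OF assms rat_SomeI assms U], auto)
qed

text \<open>Each generator has its inverse among the generators, and composites are inverted in
  reverse order.\<close>

lemma co_group_inverse:
 "g \<in> co_group J ==> \<exists>g'\<in>co_group J. rat_comp g' g = Some & rat_comp g g' = Some"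
proof (induction rule: co_group.induct)
 case (str g)
 note G = strp_D[OF str]
 let ?g = "inv_into UNIV g"
 have i: "g (?g x) = x" "?g (g x) = x" for x
  using bij_is_surj[OF G(2)] bij_is_inj[OF G(2)] by (simp_all add: surj_f_inv_f)
 have "linear_tr ?g \<in> co_group J" by (rule co_group.str[OF str_pos_inv(1)[OF str]])
 moreover have "rational_map (linear_tr g)" "rational_map (linear_tr ?g)"
  using conf_linear(1)[OF str] conf_linear(1)[OF str_pos_inv(1)[OF str]] by (simp_all add: conf_def)
 ultimately show ?case
  by (intro bexI[of _ "linear_tr ?g"] conjI rat_comp_eqI[OF _ _ rat_SomeI open_UNIV]) (simp_all add: linear_tr_def i)
next
 case (trans v)
 show ?case
  using conf_translation(1)[of v] conf_translation(1)[of "- v"]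
  by (intro bexI[of _ "translation_tr (- v)"] conjI rat_comp_eqI[OF _ _ rat_SomeI open_UNIV] co_group.trans)
   (simp_all add: conf_def translation_tr_def)
next
 case inversion
 have "e \<in> {x. jd x ~= 0}" by simp
 hence "{x. jd x ~= 0} ~= {}" by blast
 moreover have ii: "jd (- jinv J x) ~= 0" "- jinv J (- jinv J x) = x" if jx: "jd x ~= 0" for x
 proof -
  show n: "jd (- jinv J x) ~= 0" using jx by (simp add: jd_neg jd_jinv)
  have "jinv_rel J (- jinv J x) (- x)"
  proof -
   obtain p where p: "jinv J (jinv J x) = jpoly J p (jinv J x)"
    using jinv_jpoly[of "jinv J x"] jx jd_jinv[OF jx] by auto
   have "jpoly J (- pcompose p [:0, -1:]) (- jinv J x) = - x"
    unfolding jpoly_minus jpoly_pcompose by (simp add: jpoly_pCons p[symmetric] jinv_jinv[OF jx])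
   thus ?thesis using jx unfolding jinv_rel_def by (intro conjI exI[of _ "- pcompose p [:0, -1:]"]) simp_all
  qed
  hence "jinv J (- jinv J x) = - x"
   by (subst jinv_def, intro the_equality jinv_rel_unique)
  thus "- jinv J (- jinv J x) = x" by simp
 qed
 ultimately have "rat_comp (inversion_tr J) (inversion_tr J) = Some"
  by (intro rat_comp_eqI[OF rat_inversion rat_inversion rat_SomeI open_invertibles])
   (auto simp: inversion_tr_def invertibles_iff)
 thus ?case by (intro bexI[of _ "inversion_tr J"] co_group.inversion) simp
next
 case (comp g h)
 then obtain g' h' where g': "g' \<in> co_group J" "rat_comp g' g = Some" "rat_comp g g' = Some"
  and h': "h' \<in> co_group J" "rat_comp h' h = Some" "rat_comp h h' = Some" by blast
 note c = co_group_conf[OF comp.hyps(1)] co_group_conf[OF comp.hyps(2)] co_group_conf[OF g'(1)] co_group_conf[OF h'(1)]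
 note c' = conf_comp[OF c(1,2)] conf_comp[OF c(4,3)]
 have "rat_comp (rat_comp h' g') (rat_comp g h) = rat_comp h' (rat_comp (rat_comp g' g) h)"
  by (simp only: rat_comp_assoc[OF c(4,3) c'(1)] rat_comp_assoc[OF c(3,1,2)])
 moreover have "rat_comp (rat_comp g h) (rat_comp h' g') = rat_comp g (rat_comp (rat_comp h h') g')"
  by (simp only: rat_comp_assoc[OF c(1,2) c'(2)] rat_comp_assoc[OF c(2,4,3)])
 ultimately show ?case using g' h' c
  by (intro bexI[OF _ co_group.comp[OF h'(1) g'(1)]]) (simp add: rat_comp_Some conf_rational)
qed

section \<open>The group of conformal maps with a polynomial square root of the cocycle\<close>

abbreviation GC :: "'a gelem set" where "GC \<equiv> G_carrier J"

lemma GC_D: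
 assumes "a \<in> GC"
 shows "fst a \<in> co_group J" "conf (fst a)" "rational_map (fst a)" "rpoly (snd a)"
  "x \<in> dom (fst a) ==> (snd a x)\<^sup>2 = cocycle_c J (fst a) x" "x \<in> dom (fst a) ==> snd a x ~= 0"
proof -
 show 1: "fst a \<in> co_group J" "rpoly (snd a)"
  "!!x. x \<in> dom (fst a) ==> (snd a x)\<^sup>2 = cocycle_c J (fst a) x"
  using assms by (auto simp: G_carrier_def)
 show c: "conf (fst a)" by (rule co_group_conf[OF 1(1)])
 thus "rational_map (fst a)" by (rule conf_rational)
 show "snd a x ~= 0" if "x \<in> dom (fst a)"
  using conf_cocycle[OF c] 1(3)[OF that] that by force
qed

text \<open>The square condition is an identity between polynomials, so it may be verified on a
  dense set.\<close>

lemma GC_I: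
 assumes "fst a \<in> co_group J" "rpoly (snd a)" "dense_in W"
  "!!x. x \<in> W ==> x \<in> dom (fst a) ==> (snd a x)\<^sup>2 = cocycle_c J (fst a) x"
 shows "a \<in> GC"
proof -
 have c: "conf (fst a)" by (rule co_group_conf[OF assms(1)])
 obtain C where C: "rpoly C" "!!x. x \<in> dom (fst a) ==> cocycle_c J (fst a) x = C x"
  using conf_cocycle[OF c] by blast
 have "(snd a x)\<^sup>2 = C x" for x
 proof (rule poly_eq_dense[OF real_polynomial_function_power[OF assms(2)] C(1)])
  show "dense_in (dom (fst a) \<inter> W)"
   by (intro dense_in_Int dense_dom conf_rational c assms(3) rat_dom_open)
 qed (use assms(4) C(2) in auto)
 thus ?thesis using assms(1,2) C(2) by (cases a) (auto simp: G_carrier_def)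
qed

lemma G_eqI:
 assumes "a \<in> GC" "b \<in> GC" "fst a = fst b" "dense_in W" "!!x. x \<in> W ==> snd a x = snd b x"
 shows "a = b"
proof (rule prod_eqI[OF assms(3)])
 show "snd a = snd b"
  by (rule ext) (rule poly_eq_dense[OF GC_D(4)[OF assms(1)] GC_D(4)[OF assms(2)] assms(4,5)])
qed

lemma compose_power:
 assumes h: "rational_map h" and p: "rpoly p"
 obtains N Q d z where "rpoly N" "rpoly Q" "Q z ~= 0"
  "!!x. Q x ~= 0 ==> x \<in> dom h & N x = Q x ^ d * p (the (h x))"
proof -
 obtain P Q z where PQ: "pfun P" "rpoly Q" "Q z ~= 0" "represents h P Q"
  by (rule rat_mapE[OF h], rule that, assumption+)
 obtain N d where N: "rpoly N" "!!x. Q x ~= 0 ==> N x = Q x ^ d * p (P x /\<^sub>R Q x)"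
  using rpoly_substitute[OF p PQ(1,2)] by blast
 show thesis
 proof (rule that[OF N(1) PQ(2,3)])
  show "x \<in> dom h & N x = Q x ^ d * p (the (h x))" if "Q x ~= 0" for x
   using PQ(4) N(2)[OF that] that by (auto simp: represents_def)
 qed
qed

lemma compose_continuous:
 assumes h: "rational_map h" and p: "rpoly p" and "S \<subseteq> dom h"
 shows "continuous_on S (%x. p (the (h x)))"
 by (rule continuous_on_subset[OF continuous_on_compose2[OF cont_rp[OF p, of UNIV] smap_continuous[OF rat_smooth_map[OF h]]] assms(3)]) simp

text \<open>The cocycle product of the two roots is a fraction whose square is the polynomial
  cocycle of the composite; by \<open>poly_sqrt_quotient\<close> it is polynomial itself.\<close>

lemma G_mult_ex:
 assumes a: "a \<in> GC" and b: "b \<in> GC"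
 shows "\<exists>r. rpoly r & (\<forall>x\<in>cdom (fst a) (fst b). r x = snd a (the (fst b x)) * snd b x)"
proof -
 note A = GC_D[OF a] and B = GC_D[OF b]
 obtain N Q d z where N: "rpoly N" "rpoly Q" "Q z ~= 0"
  "!!x. Q x ~= 0 ==> x \<in> dom (fst b) & N x = Q x ^ d * snd a (the (fst b x))"
  by (rule compose_power[OF B(3) A(4)], rule that, assumption+)
 let ?W = "cdom (fst a) (fst b)"
 obtain C where C: "rpoly C" "!!x. x \<in> dom (rat_comp (fst a) (fst b)) ==> cocycle_c J (rat_comp (fst a) (fst b)) x = C x"
  using conf_cocycle[OF conf_comp[OF A(2) B(2)]] by blast
 have sq: "(N x * snd b x)\<^sup>2 = C x * (Q x ^ d)\<^sup>2" for x
 proof (rule poly_eq_dense[of "%x. (N x * snd b x)\<^sup>2" "%x. C x * (Q x ^ d)\<^sup>2" "?W \<inter> {x. Q x ~= 0}"])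
  show "dense_in (?W \<inter> {x. Q x ~= 0})"
   by (intro dense_in_Int cdom_dense cdom_open A(3) B(2,3) dense_poly_nonzero[OF N(2,3)])
  fix x assume "x \<in> ?W \<inter> {x. Q x ~= 0}"
  hence x: "x \<in> ?W" "Q x ~= 0" "x \<in> dom (fst b)" "the (fst b x) \<in> dom (fst a)" by (auto simp: cdom_def)
  have "(snd a (the (fst b x)) * snd b x)\<^sup>2 = C x"
   using C(2)[OF conf_comp_val(3)[OF A(2) B(2) x(1)]] conf_comp_cocycle[OF A(2) B(2) x(1)] A(5)[OF x(4)] B(5)[OF x(3)]
   by (simp add: power_mult_distrib)
  thus "(N x * snd b x)\<^sup>2 = C x * (Q x ^ d)\<^sup>2" using N(4)[OF x(2)] by (simp add: power_mult_distrib mult_ac)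
 qed (intro real_polynomial_function_power rpoly_intros(4) N C B(4))+
 have Qz: "Q z ^ d ~= 0" using N(3) by simp
 from poly_sqrt_quotient[OF rpoly_intros(4)[OF N(1) B(4)] real_polynomial_function_power[OF N(2)] Qz C(1) sq]
 obtain r where r: "rpoly r" "!!x. N x * snd b x = r x * Q x ^ d" by blast
 have "r x = snd a (the (fst b x)) * snd b x" if "x \<in> ?W" for x
 proof (rule eq_on_dense[where g = "%x. snd a (the (fst b x)) * snd b x", OF cdom_open[OF A(3) B(3)] cont_rp[OF r(1)] _ dense_poly_nonzero[OF N(2,3)] _ that])
  show "continuous_on ?W (%x. snd a (the (fst b x)) * snd b x)"
   by (intro continuous_on_mult compose_continuous[OF B(3) A(4)] cont_rp[OF B(4)]) (auto simp: cdom_def)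
  show "r x = snd a (the (fst b x)) * snd b x" if "x \<in> {x. Q x ~= 0}" for x
   using r(2)[of x] N(4)[of x] that by simp
 qed
 thus ?thesis using r(1) by blast
qed

lemma G_mult:
 assumes a: "a \<in> GC" and b: "b \<in> GC"
 shows "G_mult a b \<in> GC" "fst (G_mult a b) = rat_comp (fst a) (fst b)"
  "x \<in> cdom (fst a) (fst b) ==> snd (G_mult a b) x = snd a (the (fst b x)) * snd b x"
proof -
 note A = GC_D[OF a] and B = GC_D[OF b]
 let ?W = "cdom (fst a) (fst b)"
 obtain r where r: "rpoly r" "!!x. x \<in> ?W ==> r x = snd a (the (fst b x)) * snd b x"
  using G_mult_ex[OF a b] by blast
 note W = cdom_dense[OF B(2) A(3)]
 have "snd (G_mult a b) = r"
  unfolding G_mult_def snd_conv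
 proof (rule the_equality)
  show "rpoly r & (\<forall>x y. fst b x = Some y & y \<in> dom (fst a) --> r x = snd a y * snd b x)"
  proof (intro conjI r(1) allI impI)
   fix x y assume "fst b x = Some y & y \<in> dom (fst a)"
   thus "r x = snd a y * snd b x" using r(2)[of x] by (auto simp: cdom_def)
  qed
  fix r' assume r': "rpoly r' & (\<forall>x y. fst b x = Some y & y \<in> dom (fst a) --> r' x = snd a y * snd b x)"
  show "r' = r"
  proof
   fix x show "r' x = r x"
   proof (rule poly_eq_dense[OF _ r(1) W])
    show "rpoly r'" using r' by simp
    fix x assume x: "x \<in> ?W"
    then obtain y where y: "fst b x = Some y" by (auto simp: cdom_def)
    hence "fst b x = Some y & y \<in> dom (fst a)" using x by (simp add: cdom_def)
    moreover from this have "r' x = snd a y * snd b x" using r' by blast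
    ultimately show "r' x = r x" using r(2)[OF x] by simp
   qed
  qed
 qed
 thus s: "x \<in> ?W ==> snd (G_mult a b) x = snd a (the (fst b x)) * snd b x" for x using r(2) by simp
 show f: "fst (G_mult a b) = rat_comp (fst a) (fst b)" by (simp add: G_mult_def)
 show "G_mult a b \<in> GC"
 proof (rule GC_I[OF _ _ W])
  show "fst (G_mult a b) \<in> co_group J" unfolding f by (rule co_group.comp[OF A(1) B(1)])
  show "rpoly (snd (G_mult a b))" using r(1) \<open>snd (G_mult a b) = r\<close> by simp
  fix x assume x: "x \<in> ?W"
  hence "x \<in> dom (fst b)" "the (fst b x) \<in> dom (fst a)" by (auto simp: cdom_def)
  thus "(snd (G_mult a b) x)\<^sup>2 = cocycle_c J (fst (G_mult a b)) x"
   using A(5) B(5) by (simp add: f s[OF x] conf_comp_cocycle[OF A(2) B(2) x] power_mult_distrib)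
 qed
qed

lemma G_mult_val:
 assumes "a \<in> GC" "b \<in> GC" "fst b x = Some y" "fst a y = Some z"
 shows "fst (G_mult a b) x = Some z" "snd (G_mult a b) x = snd a y * snd b x"
proof -
 have "x \<in> cdom (fst a) (fst b)" using assms by (auto simp: cdom_def)
 from G_mult(3)[OF assms(1,2) this] conf_comp_val(2)[OF GC_D(2)[OF assms(1)] GC_D(2)[OF assms(2)] this]
 show "fst (G_mult a b) x = Some z" "snd (G_mult a b) x = snd a y * snd b x"
  using assms by (simp_all add: G_mult(2))
qed

lemma G_assoc:
 assumes a: "a \<in> GC" and b: "b \<in> GC" and c: "c \<in> GC"
 shows "G_mult (G_mult a b) c = G_mult a (G_mult b c)"
proof -
 note A = GC_D[OF a] and B = GC_D[OF b] and C = GC_D[OF c]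
 note ab = G_mult[OF a b] and bc = G_mult[OF b c]
 show ?thesis
 proof (rule G_eqI[OF G_mult(1)[OF ab(1) c] G_mult(1)[OF a bc(1)]])
  show "fst (G_mult (G_mult a b) c) = fst (G_mult a (G_mult b c))"
   by (simp add: G_mult(2) ab bc a b c rat_comp_assoc[OF A(2) B(2) C(2)])
  show "dense_in {x \<in> dom (fst c). the (fst c x) \<in> cdom (fst a) (fst b)}"
   by (intro conf_generic C cdom_dense B A)
  fix x assume "x \<in> {x \<in> dom (fst c). the (fst c x) \<in> cdom (fst a) (fst b)}"
  then obtain y z w where 1: "fst c x = Some y" "fst b y = Some z" "fst a z = Some w"
   by (auto simp: cdom_def)
  show "snd (G_mult (G_mult a b) c) x = snd (G_mult a (G_mult b c)) x"
   using G_mult_val[OF a b 1(2,3)] G_mult_val[OF b c 1(1,2)]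
    G_mult_val[OF ab(1) c 1(1), of w] G_mult_val[OF a bc(1) _ 1(3), of x] by simp
 qed
qed

lemma dense_UNIV: "dense_in (UNIV :: 'a set)" by (auto simp: dense_in_def)

lemma G_trans_in: "G_trans v \<in> GC"
 unfolding G_trans_def
 by (rule GC_I[OF _ _ dense_UNIV])
  (simp_all add: co_group.trans rpoly_intros(2) cocycle_dg conf_translation(2) str_id(2))

lemma G_one_trans: "G_one = G_trans 0" by (simp add: G_one_def G_trans_def translation_tr_def)

lemma G_one_in: "G_one \<in> GC" unfolding G_one_trans by (rule G_trans_in)

lemma G_one_mult:
 assumes "a \<in> GC" shows "G_mult G_one a = a" "G_mult a G_one = a"
proof -
 note A = GC_D[OF assms]
 have c: "cdom Some (fst a) = dom (fst a)" "cdom (fst a) Some = dom (fst a)" by (auto simp: cdom_def)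
 show "G_mult G_one a = a"
  by (rule G_eqI[OF G_mult(1)[OF G_one_in assms] assms _ dense_dom[OF A(3)]])
   (simp_all add: G_one_def G_mult(2,3)[OF G_one_in assms, unfolded G_one_def] rat_comp_Some[OF A(3)] c)
 show "G_mult a G_one = a"
  by (rule G_eqI[OF G_mult(1)[OF assms G_one_in] assms _ dense_dom[OF A(3)]])
   (simp_all add: G_one_def G_mult(2,3)[OF assms G_one_in, unfolded G_one_def] rat_comp_Some[OF A(3)] c)
qed

lemma poly_square_one:
 assumes "rpoly q" "!!x::'a. (q x)\<^sup>2 = 1"
 shows "(\<forall>x. q x = 1) \<or> (\<forall>x. q x = - 1)"
proof (rule ccontr)
 assume "\<not> ?thesis"
 then obtain x y where "q x ~= 1" "q y ~= -1" by blast
 hence "q x - 1 ~= 0" "q y + 1 ~= 0" by simp_all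
 moreover have "rpoly (%x. q x - 1)" "rpoly (%x. q x + 1)"
  using assms(1) rpoly_intros(3)[OF assms(1) rpoly_intros(2)[of "-1"]]
   rpoly_intros(3)[OF assms(1) rpoly_intros(2)[of 1]] by simp_all
 ultimately obtain z where "q z - 1 ~= 0" "q z + 1 ~= 0"
  using two_nonzero[of "%x. q x - 1" "%x. q x + 1" x y UNIV] by auto
 moreover have "(q z - 1) * (q z + 1) = 0" using assms(2)[of z] by (simp add: algebra_simps power2_eq_square)
 ultimately show False by simp
qed

lemma G_neg: "(g, p) \<in> GC ==> (g, %x. - p x) \<in> GC"
 using rpoly_intros(4)[OF rpoly_intros(2)[of "-1"]]
 by (auto simp: G_carrier_def)

text \<open>The second component must be the reciprocal of \<open>snd a\<close> at
  \<open>h x\<close>. The square of that reciprocal is the cocycle \<open>C\<close>, so it equals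
  \<open>C x\<close> times \<open>snd a\<close> at \<open>h x\<close>, a fraction with polynomial
  square. The product with \<open>a\<close> then has square one, hence is \<open>1\<close> or
  \<open>-1\<close>, and the sign is corrected.\<close>

lemma G_left_inverse:
 assumes a: "a \<in> GC" shows "\<exists>b\<in>GC. G_mult b a = G_one"
proof -
 note A = GC_D[OF a]
 obtain h where h: "h \<in> co_group J" "rat_comp h (fst a) = Some" "rat_comp (fst a) h = Some"
  using co_group_inverse[OF A(1)] by blast
 note ch = co_group_conf[OF h(1)] and rh = conf_rational[OF co_group_conf[OF h(1)]]
 obtain N Q d z where N: "rpoly N" "rpoly Q" "Q z ~= 0"
  "!!x. Q x ~= 0 ==> x \<in> dom h & N x = Q x ^ d * snd a (the (h x))"
  by (rule compose_power[OF rh A(4)], rule that, assumption+)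
 obtain C where C: "rpoly C" "!!x. x \<in> dom h ==> cocycle_c J h x = C x"
  using conf_cocycle[OF ch] by blast
 let ?W = "cdom (fst a) h \<inter> {x. Q x ~= 0}"
 have W: "dense_in ?W" by (intro dense_in_Int cdom_dense cdom_open A ch rh dense_poly_nonzero[OF N(2,3)])
 have one: "cocycle_c J Some x = 1" for x
  using conf_translation(2)[of 0 x] by (simp add: cocycle_dg translation_tr_def str_id(2))
 have inv: "(snd a (the (h x)))\<^sup>2 * C x = 1" if "x \<in> cdom (fst a) h" for x
  using conf_comp_cocycle[OF A(2) ch that] A(5)[of "the (h x)"] C(2)[of x] that by (auto simp: h(3) one cdom_def)
 have "(C x * N x)\<^sup>2 = C x * (Q x ^ d)\<^sup>2" for x
 proof (rule poly_eq_dense[of "%x. (C x * N x)\<^sup>2" "%x. C x * (Q x ^ d)\<^sup>2" ?W])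
  fix x assume "x \<in> ?W"
  hence x: "x \<in> cdom (fst a) h" "Q x ~= 0" by auto
  have "(C x * N x)\<^sup>2 = C x * (Q x ^ d)\<^sup>2 * ((snd a (the (h x)))\<^sup>2 * C x)"
   using N(4)[OF x(2)] by (simp add: power_mult_distrib power2_eq_square mult_ac)
  thus "(C x * N x)\<^sup>2 = C x * (Q x ^ d)\<^sup>2" by (simp only: inv[OF x(1)] mult_1_right)
 qed (intro W real_polynomial_function_power rpoly_intros(4) N C)+
 moreover have "Q z ^ d ~= 0" using N(3) by simp
 ultimately obtain f where f: "rpoly f" "!!x. C x * N x = f x * Q x ^ d"
  using poly_sqrt_quotient[OF rpoly_intros(4)[OF C(1) N(1)] real_polynomial_function_power[OF N(2)] _ C(1)] by blast
 have b: "(h, f) \<in> GC"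
 proof (rule GC_I[OF _ _ W])
  fix x assume x: "x \<in> ?W" "x \<in> dom (fst (h, f))"
  hence "f x = C x * snd a (the (h x))" using f(2)[of x] N(4)[of x] by (simp add: field_simps)
  hence "(f x)\<^sup>2 = C x * ((snd a (the (h x)))\<^sup>2 * C x)" by (simp add: power2_eq_square)
  thus "(snd (h, f) x)\<^sup>2 = cocycle_c J (fst (h, f)) x" using inv[of x] x C(2)[of x] by simp
 qed (simp_all add: h f)
 have fst1: "fst (G_mult b a) = Some" if "b \<in> GC" "fst b = h" for b using G_mult(2)[OF that(1) a] that(2) h(2) by simp
 have "(\<forall>x. snd (G_mult (h, f) a) x = 1) \<or> (\<forall>x. snd (G_mult (h, f) a) x = - 1)"
  using GC_D(4,5)[OF G_mult(1)[OF b a]] fst1[OF b] by (intro poly_square_one) (auto simp: one)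
 thus ?thesis
 proof
  assume "\<forall>x. snd (G_mult (h, f) a) x = 1"
  hence "G_mult (h, f) a = G_one" using fst1[OF b] by (auto simp: G_one_def prod_eq_iff)
  thus ?thesis using b by blast
 next
  assume m: "\<forall>x. snd (G_mult (h, f) a) x = - 1"
  have b': "(h, %x. - f x) \<in> GC" by (rule G_neg[OF b])
  have "G_mult (h, %x. - f x) a = G_one"
  proof (rule G_eqI[OF G_mult(1)[OF b' a] G_one_in _ cdom_dense[OF A(2) rh]])
   show "fst (G_mult (h, %x. - f x) a) = fst G_one" using fst1[OF b'] by (simp add: G_one_def)
   show "snd (G_mult (h, %x. - f x) a) x = snd G_one x" if "x \<in> cdom h (fst a)" for x
    using G_mult(3)[OF b' a, of x] G_mult(3)[OF b a, of x] m that by (simp add: G_one_def)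
  qed
  thus ?thesis using b' by blast
 qed
qed

lemma G_inv:
 assumes a: "a \<in> GC"
 shows "G_inv J a \<in> GC" "G_mult (G_inv J a) a = G_one"
proof -
 obtain b where b: "b \<in> GC" "G_mult b a = G_one" using G_left_inverse[OF a] by blast
 obtain c where c: "c \<in> GC" "G_mult c b = G_one" using G_left_inverse[OF b(1)] by blast
 have "c = a" using G_assoc[OF c(1) b(1) a] by (simp add: b c a G_one_mult)
 hence r: "G_mult a b = G_one" using c(2) by simp
 have "G_inv J a = b" unfolding G_inv_def
 proof (rule the_equality)
  show "b \<in> GC & G_mult b a = G_one" using b by simp
  fix h assume h: "h \<in> GC & G_mult h a = G_one"
  have "G_mult (G_mult h a) b = G_mult h (G_mult a b)" using h by (intro G_assoc a b(1)) simp
  thus "h = b" using h by (simp add: r b(1) G_one_mult)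
 qed
 thus "G_inv J a \<in> GC" "G_mult (G_inv J a) a = G_one" using b by simp_all
qed

lemma G_trans_mult: "G_mult (G_trans (v :: 'a)) (G_trans w) = G_trans (v + w)"
proof (rule G_eqI[OF G_mult(1)[OF G_trans_in G_trans_in] G_trans_in _ dense_UNIV])
 note r = conf_rational[OF conf_translation(1)]
 show "fst (G_mult (G_trans v) (G_trans w)) = fst (G_trans (v + w))"
  unfolding G_mult(2)[OF G_trans_in G_trans_in] unfolding G_trans_def fst_conv
  by (rule rat_comp_eqI[OF r r r open_UNIV]) (auto simp: translation_tr_def add_ac)
 show "snd (G_mult (G_trans v) (G_trans w)) x = snd (G_trans (v + w)) x" for x
  using G_mult(3)[OF G_trans_in G_trans_in, of x v w] by (auto simp: G_trans_def translation_tr_def cdom_def)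
qed

text \<open>Two lifts of one point of the compactification differ by an element of the parabolic
  subgroup, whose multiplier at \<open>0\<close> is the multiplier of \<open>g\<close> at
  \<open>v\<close>.\<close>

lemma G_move:
 assumes g: "g \<in> GC" and y: "fst g v = Some y"
 shows "\<exists>p\<in>P_bar J. G_mult g (G_trans v) = G_mult (G_trans y) p & snd p 0 = snd g v"
proof -
 let ?h = "G_mult g (G_trans v)" and ?p = "G_mult (G_trans (- y)) (G_mult g (G_trans v))"
 have h: "?h \<in> GC" by (rule G_mult(1)[OF g G_trans_in])
 have p: "?p \<in> GC" by (rule G_mult(1)[OF G_trans_in h])
 have t: "fst (G_trans u) x = Some (x + u)" "snd (G_trans u) x = 1" for u x :: 'a
  by (simp_all add: G_trans_def translation_tr_def)
 have "fst ?h 0 = Some y" "snd ?h 0 = snd g v"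
  using G_mult_val[OF g G_trans_in[of v], of 0 v y] y by (simp_all add: t)
 with G_mult_val[OF G_trans_in[of "- y"] h, of 0 y 0] have 1: "fst ?p 0 = Some 0" "snd ?p 0 = snd g v" by (simp_all add: t)
 have "G_mult (G_trans y) ?p = ?h"
  using G_assoc[OF G_trans_in G_trans_in h, of y "- y"] G_one_mult(1)[OF h] by (simp add: G_trans_mult G_one_trans)
 thus ?thesis using 1 p by (intro bexI[of _ ?p]) (simp_all add: P_bar_def)
qed

lemma inverse_sgn_powr: "t ~= 0 ==> inverse (sgn_powr t s ep) = sgn_powr t (- s) ep"
 by (simp add: sgn_powr_def powr_minus sgn_if)

definition wt2 :: "complex => int => complex => int => ('a => real) => 'a \<times> 'a => complex" where
 "wt2 l ep m et p z = sgn_powr (p (fst z)) (- l) ep * sgn_powr (p (snd z)) (- m) et"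

lemma ind_space2_move:
 assumes f: "f \<in> ind_space2 J l ep m et" and g: "g \<in> GC" and h: "h \<in> GC" "fst h v = Some v'" "fst h w = Some w'"
 shows "f (G_mult (G_mult g h) (G_trans v), G_mult (G_mult g h) (G_trans w)) =
  wt2 l ep m et (snd h) (v, w) * f (G_mult g (G_trans v'), G_mult g (G_trans w'))"
proof -
 obtain p where p: "p \<in> P_bar J" "G_mult h (G_trans v) = G_mult (G_trans v') p" "snd p 0 = snd h v" using G_move[OF h(1,2)] by blast
 obtain q where q: "q \<in> P_bar J" "G_mult h (G_trans w) = G_mult (G_trans w') q" "snd q 0 = snd h w" using G_move[OF h(1,3)] by blast
 have pq: "p \<in> GC" "q \<in> GC" using p(1) q(1) by (auto simp: P_bar_def)
 have nz: "snd h v ~= 0" "snd h w ~= 0" using GC_D(6)[OF h(1)] h(2,3) by auto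
 have 1: "G_mult (G_mult g h) (G_trans v) = G_mult (G_mult g (G_trans v')) p" "G_mult (G_mult g h) (G_trans w) = G_mult (G_mult g (G_trans w')) q"
  using pq by (simp_all add: G_assoc g h G_trans_in p(2) q(2))
 show ?thesis using f p(1) q(1) G_mult(1)[OF g G_trans_in]
  by (simp add: 1 ind_space2_def P_char_def p(3) q(3) inverse_sgn_powr nz wt2_def)
qed

section \<open>The flow of the quadratic field\<close>

text \<open>The associative subalgebra generated by \<open>x\<close> and the unit, in which the flow
  computations take place.\<close>

definition alg :: "'a => 'a set" where "alg x = range (%p. jpoly J p x)"

lemma alg_intros: "x \<in> alg x" "e \<in> alg x" "a \<in> alg x ==> b \<in> alg x ==> a ** b \<in> alg x"
 "a \<in> alg x ==> b \<in> alg x ==> a - b \<in> alg x" "a \<in> alg x ==> c *\<^sub>R a \<in> alg x"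
proof -
 show "x \<in> alg x" "e \<in> alg x" unfolding alg_def
  by (rule range_eqI[of _ _ "[:0, 1:]"], simp) (rule range_eqI[of _ _ 1], simp)
 show "a \<in> alg x ==> b \<in> alg x ==> a ** b \<in> alg x" "a \<in> alg x ==> b \<in> alg x ==> a - b \<in> alg x"
  "a \<in> alg x ==> c *\<^sub>R a \<in> alg x"
  unfolding alg_def by (auto simp flip: jpoly_mult jpoly_diff jpoly_smult)
qed

lemma alg_assoc: "a \<in> alg x ==> b \<in> alg x ==> c \<in> alg x ==> (a ** b) ** c = a ** (b ** c)"
 unfolding alg_def using jpoly_assoc by auto

lemma alg_jd: "a \<in> alg x ==> b \<in> alg x ==> jd (a ** b) = jd a * jd b"
 unfolding alg_def using jd_mult_jpoly by auto

lemma alg_jinv: "a \<in> alg x ==> jd a ~= 0 ==> jinv J a \<in> alg x"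
 unfolding alg_def by (auto simp: jinv_jpoly jpoly_pcompose[symmetric])

lemma alg_jinv_eq:
 assumes "a \<in> alg x" "b \<in> alg x" "a ** b = e" shows "jd a ~= 0" "jinv J a = b"
proof -
 show n: "jd a ~= 0" using alg_jd[OF assms(1,2)] assms(3) by auto
 have "jinv J a ** (a ** b) = b" using alg_assoc[OF alg_jinv[OF assms(1) n] assms(1,2)] n by simp
 thus "jinv J a = b" by (simp add: assms(3))
qed

lemma jinv_neg: "jd x ~= 0 ==> jinv J (- x) = - jinv J x"
 using alg_jinv_eq(2)[of "- x" x "- jinv J x"] alg_intros(5)[OF alg_intros(1), where c = "-1"]
  alg_intros(5)[OF alg_jinv[OF alg_intros(1)], where c = "-1"] by simp

lemma dinv_mult: assumes "jd u ~= 0" shows "dinv u (u ** v) = - (jinv J u ** v)"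
proof (rule P_inj[OF assms])
 show "P u (dinv u (u ** v)) = P u (- (jinv J u ** v))"
  using P_dinv[OF assms] J_via_P(2)[OF assms, of v] by (simp add: linear_neg[OF Pb_linear(1)])
qed

text \<open>The time-\<open>s\<close> flow of the field \<open>v ** v\<close>; in one real variable
  it is \<open>v / (1 - s v)\<close>.\<close>

definition fl :: "real => 'a => 'a" where "fl s v = v ** jinv J (e - s *\<^sub>R v)"

lemma fl_alg:
 assumes "jd (e - s *\<^sub>R v) ~= 0"
 shows "jinv J (e - s *\<^sub>R v) \<in> alg v" "fl s v \<in> alg v" "(e - s *\<^sub>R v) ** fl s v = v"
proof -
 let ?u = "e - s *\<^sub>R v"
 have u: "?u \<in> alg v" by (intro alg_intros)
 show j: "jinv J ?u \<in> alg v" by (rule alg_jinv[OF u assms])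
 thus "fl s v \<in> alg v" unfolding fl_def by (intro alg_intros)
 have "?u ** (jinv J ?u ** v) = v" using alg_assoc[OF u j alg_intros(1)] assms by simp
 thus "?u ** fl s v = v" by (simp add: fl_def comm)
qed

text \<open>The left-hand sides are the time derivative of the flow and its derivative along
  \<open>v ** v\<close>, with \<open>dinv\<close> kept explicit; each equals the field at the image
  point.\<close>

lemma fl_deriv:
 assumes "jd (e - s *\<^sub>R v) ~= 0"
 shows "- (v ** dinv (e - s *\<^sub>R v) v) = fl s v ** fl s v"
  "(v ** v) ** jinv J (e - s *\<^sub>R v) - s *\<^sub>R (v ** dinv (e - s *\<^sub>R v) (v ** v)) = fl s v ** fl s v"
proof -
 let ?u = "e - s *\<^sub>R v" and ?w = "fl s v"
 note f = fl_alg[OF assms]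
 note l = dinv_linear[OF assms]
 have "dinv ?u v = - (jinv J ?u ** ?w)" using dinv_mult[OF assms, of ?w] f(3) by simp
 moreover have "v ** (jinv J ?u ** ?w) = ?w ** ?w"
  using alg_assoc[OF alg_intros(1) f(1,2)] by (simp add: fl_def)
 ultimately show 1: "- (v ** dinv ?u v) = ?w ** ?w" by simp
 have "dinv ?u v - s *\<^sub>R dinv ?u (v ** v) = - (jinv J ?u ** v)"
  using dinv_mult[OF assms, of v] by (simp add: J_diff linear_diff[OF l] linear_scale[OF l])
 hence "v ** (dinv ?u v - s *\<^sub>R dinv ?u (v ** v)) = - (v ** (jinv J ?u ** v))" by simp
 hence "v ** dinv ?u v - s *\<^sub>R (v ** dinv ?u (v ** v)) = - (v ** (jinv J ?u ** v))" by (simp add: J_diff)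
 moreover have "v ** (jinv J ?u ** v) = (v ** v) ** jinv J ?u"
  using alg_assoc[OF alg_intros(1) alg_intros(1) f(1)] by (simp add: comm)
 ultimately have "(v ** v) ** jinv J ?u - s *\<^sub>R (v ** dinv ?u (v ** v)) = - (v ** dinv ?u v)"
  by (simp add: algebra_simps)
 thus "(v ** v) ** jinv J ?u - s *\<^sub>R (v ** dinv ?u (v ** v)) = ?w ** ?w" by (simp only: 1)
qed

text \<open>The group law for times adding up to one. It rests on the factorisation of
  \<open>e - x\<close> into \<open>e - (1 - s) x\<close> and \<open>e - s y\<close>, where
  \<open>y\<close> is the image of \<open>x\<close> at time \<open>1 - s\<close>.\<close>

lemma fl_fl:
 assumes "jd (e - (1 - s) *\<^sub>R x) ~= 0" "jd (e - x) ~= 0"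
 shows "jd (e - s *\<^sub>R fl (1 - s) x) ~= 0" "fl s (fl (1 - s) x) = fl 1 x"
proof -
 let ?a = "e - (1 - s) *\<^sub>R x" and ?y = "fl (1 - s) x"
 note f = fl_alg[OF assms(1)]
 have a: "?a \<in> alg x" "e - x \<in> alg x" by (intro alg_intros)+
 have j: "jinv J (e - x) \<in> alg x" by (rule alg_jinv[OF a(2) assms(2)])
 have 1: "e - s *\<^sub>R ?y = (e - x) ** jinv J ?a"
 proof -
  have "e - s *\<^sub>R ?y = ?a ** jinv J ?a - (s *\<^sub>R x) ** jinv J ?a" using assms(1) by (simp add: fl_def)
  also have "... = (?a - s *\<^sub>R x) ** jinv J ?a" by (simp only: J_diff)
  finally have "e - s *\<^sub>R ?y = (?a - s *\<^sub>R x) ** jinv J ?a" .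
  thus ?thesis by (simp add: algebra_simps)
 qed
 have "(e - s *\<^sub>R ?y) ** (?a ** jinv J (e - x)) = e"
 proof -
  have "((e - x) ** jinv J ?a) ** (?a ** jinv J (e - x)) = (e - x) ** ((jinv J ?a ** ?a) ** jinv J (e - x))"
   using a j f(1) by (simp add: alg_assoc[of _ x] alg_intros)
  thus ?thesis using assms by (simp add: 1)
 qed
 from alg_jinv_eq[OF _ _ this, of x]
 have 2: "jd (e - s *\<^sub>R ?y) ~= 0" "jinv J (e - s *\<^sub>R ?y) = ?a ** jinv J (e - x)"
  using a j f(2) by (auto intro!: alg_intros)
 show "jd (e - s *\<^sub>R ?y) ~= 0" by (rule 2)
 have "?y ** (?a ** jinv J (e - x)) = (x ** (jinv J ?a ** ?a)) ** jinv J (e - x)"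
  unfolding fl_def using a j f(1) alg_intros(1)[of x] by (simp add: alg_assoc[of _ x] alg_intros(3))
 thus "fl s ?y = fl 1 x" using assms(1) by (simp add: fl_def[of s] 2(2)) (simp add: fl_def)
qed

definition uu :: "real \<times> ('a \<times> 'a) => ('a \<times> 'a => 'a) => 'a" where "uu w \<pi> = e - fst w *\<^sub>R \<pi> (snd w)"

definition fl2 :: "real \<times> ('a \<times> 'a) => 'a \<times> 'a" where
 "fl2 w = (fl (fst w) (fst (snd w)), fl (fst w) (snd (snd w)))"

definition O1 :: "(real \<times> ('a \<times> 'a)) set" where "O1 = {w. jd (uu w fst) ~= 0 & jd (uu w snd) ~= 0}"

lemma uu_poly: "linear \<pi> ==> pfun (%w. uu w \<pi>)"
 unfolding uu_def[abs_def]
 by (intro polynomial_function_diff polynomial_function_const pfun_scaleR rpoly_intros(1)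
   bounded_linear_fst poly_linear linear_compose[OF lin_fst_snd(2), unfolded o_def])

lemma uu_hasd:
 assumes "linear \<pi>"
 shows "((%w. uu w \<pi>) has_derivative (%h. - (fst h *\<^sub>R \<pi> (snd w) + fst w *\<^sub>R \<pi> (snd h)))) (at w)"
 unfolding uu_def[abs_def]
 using assms by (auto intro!: derivative_eq_intros bounded_linear_imp_has_derivative simp: linear_conv_bounded_linear
   bounded_linear_compose[OF _ bounded_linear_snd] fun_eq_iff)

lemma open_O1: "open O1"
proof -
 have "open {w. jd (uu w \<pi>) ~= 0}" if "linear \<pi>" for \<pi>
  using open_rpoly_nonzero[OF real_polynomial_function_compose[OF uu_poly[OF that] jd_poly]] by (simp add: o_def)
 from open_Int[OF this[OF lin_fst_snd(1)] this[OF lin_fst_snd(2)]] show ?thesis by (simp add: O1_def Int_def)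
qed

lemma fl_smooth:
 assumes "linear \<pi>"
 shows "smooth_map {w. jd (uu w \<pi>) ~= 0} (%w. \<pi> (snd w) ** jinv J (uu w \<pi>))"
 unfolding smooth_map_def
proof
 fix b
 let ?S = "{w. jd (uu w \<pi>) ~= 0}"
 have pj: "rpoly (%w. jd (uu w \<pi>))"
  using real_polynomial_function_compose[OF uu_poly[OF assms] jd_poly] by (simp add: o_def)
 have S: "open ?S" by (rule open_rpoly_nonzero[OF pj])
 have p: "pfun (%w. \<pi> (snd w) ** adj (uu w \<pi>))"
  by (intro poly_J poly_linear linear_compose[OF lin_fst_snd(2) assms, unfolded o_def]
    polynomial_function_compose[OF uu_poly[OF assms] adj_poly, unfolded o_def])
 have "smooth_on ?S (%w. inverse (cor (jd (uu w \<pi>))) * of_real ((\<pi> (snd w) ** adj (uu w \<pi>)) \<bullet> b))"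
  by (intro sm_mult sm_inverse S sm_real_poly pj pfun_inner_real[OF p]) auto
 thus "smooth_on ?S (%w. cor ((\<pi> (snd w) ** jinv J (uu w \<pi>)) \<bullet> b))"
  by (rule sm_cong[OF S, rotated]) (simp add: jinv_eq)
qed

lemma smap_pair:
 assumes "open S" "smooth_map S f" "smooth_map S g" shows "smooth_map S (%x. (f x, g x))"
 using assms by (simp add: smooth_map_def inner_prod_def sm_add)

lemma fl2_smooth: "smooth_map O1 fl2"
proof -
 have "smooth_map O1 (%w. (fst (snd w) ** jinv J (uu w fst), snd (snd w) ** jinv J (uu w snd)))"
  by (intro smap_pair open_O1 smap_subset[OF fl_smooth] lin_fst_snd) (auto simp: O1_def)
 thus ?thesis by (simp add: fl2_def[abs_def] fl_def uu_def)
qed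

lemma fl_hasd:
 assumes "linear \<pi>" "jd (uu w \<pi>) ~= 0"
 shows "((%w. fl (fst w) (\<pi> (snd w))) has_derivative (%h. \<pi> (snd w) ** dinv (uu w \<pi>) (- (fst h *\<^sub>R \<pi> (snd w) + fst w *\<^sub>R \<pi> (snd h)))
  + \<pi> (snd h) ** jinv J (uu w \<pi>))) (at w)"
proof -
 have "((%w. \<pi> (snd w)) has_derivative (%h. \<pi> (snd h))) (at w)"
  by (rule bounded_linear_imp_has_derivative)
   (use linear_compose[OF lin_fst_snd(2)[where 'c = real] assms(1)] in \<open>simp add: linear_conv_bounded_linear o_def\<close>)
 from J_hasd[OF this has_derivative_compose[OF uu_hasd[OF assms(1)] dinv[OF assms(2)]]]
 show ?thesis by (simp add: fl_def uu_def)
qed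

lemma fl2_hasd:
 assumes "w \<in> O1"
 shows "(fl2 has_derivative fderiv fl2 (at w)) (at w)"
  "fderiv fl2 (at w) (1, 0) = sq (fl2 w)"
  "fderiv fl2 (at w) (0, sq (snd w)) = sq (fl2 w)"
proof -
 have j: "jd (uu w fst) ~= 0" "jd (uu w snd) ~= 0" using assms by (auto simp: O1_def)
 note d = has_derivative_Pair[OF fl_hasd[OF lin_fst_snd(1) j(1)] fl_hasd[OF lin_fst_snd(2) j(2)]]
 show "(fl2 has_derivative fderiv fl2 (at w)) (at w)"
  by (rule smap_hasd[OF fl2_smooth assms])
 have fd: "fderiv fl2 (at w) = (%h. (fst (snd w) ** dinv (uu w fst) (- (fst h *\<^sub>R fst (snd w) + fst w *\<^sub>R fst (snd h)))
  + fst (snd h) ** jinv J (uu w fst), snd (snd w) ** dinv (uu w snd) (- (fst h *\<^sub>R snd (snd w) + fst w *\<^sub>R snd (snd h)))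
  + snd (snd h) ** jinv J (uu w snd)))"
  by (rule frechet_derivative_at[symmetric]) (use d in \<open>simp add: fl2_def[abs_def]\<close>)
 have u: "uu w \<pi> = e - fst w *\<^sub>R \<pi> (snd w)" for \<pi> by (simp add: uu_def)
 note l = dinv_linear[OF j(1)] dinv_linear[OF j(2)]
 note f1 = fl_deriv[OF j(1)[unfolded u]] and f2 = fl_deriv[OF j(2)[unfolded u]]
 show "fderiv fl2 (at w) (1, 0) = sq (fl2 w)"
  using f1(1) f2(1) by (simp add: fd linear_neg[OF l(1)] linear_neg[OF l(2)]) (simp add: u sq_def fl2_def)
 show "fderiv fl2 (at w) (0, sq (snd w)) = sq (fl2 w)"
  using f1(2) f2(2) by (simp add: fd linear_neg[OF l(1)] linear_neg[OF l(2)] linear_scale[OF l(1)] linear_scale[OF l(2)] sq_def)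
   (simp add: u sq_def fl2_def algebra_simps)
qed

lemma dd_chain:
 assumes "smooth_on S f" "(ps has_derivative D) (at x)" "ps x \<in> S"
 shows "dd [v] (%x. f (ps x)) x = fderiv f (at (ps x)) (D v)"
 using fderiv_eqI[OF has_derivative_compose[OF assms(2) sm_hasd[OF assms(1,3)]]] by simp

lemma qp_uu_smooth: "linear \<pi> ==> ep \<in> {1, -1} ==> smooth_on {w. jd (uu w \<pi>) ~= 0} (%w. qp s ep (uu w \<pi>))"
 unfolding qp_def
 using real_polynomial_function_compose[OF uu_poly jd_poly, of \<pi>]
 by (intro sm_sgn_powr open_rpoly_nonzero sm_real_poly) (auto simp: o_def)

lemma qp_uu_deriv:
 assumes "linear \<pi>" "ep \<in> {1, -1}" "jd (uu w \<pi>) ~= 0"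
 shows "dd [h] (%w. qp s ep (uu w \<pi>)) w =
  - (s * qp s ep (uu w \<pi>) * of_real (tau (jinv J (uu w \<pi>)) (fst h *\<^sub>R \<pi> (snd w) + fst w *\<^sub>R \<pi> (snd h))))"
 using fderiv_eqI[where v = h, OF has_derivative_compose[OF uu_hasd[OF assms(1)] qp_hasd[OF assms(3,2)]], of s]
 by (simp add: tau_neg tau_add tau_diff tau_scale algebra_simps)

text \<open>Pairing the inverse of \<open>e - s v\<close> with \<open>(e - s v) ** v\<close> gives
  the trace of \<open>v\<close>.\<close>

lemma tau_jinv_uu:
 assumes "jd (uu w \<pi>) ~= 0"
 shows "tau (jinv J (uu w \<pi>)) (\<pi> (snd w)) = fst w * tau (jinv J (uu w \<pi>)) (\<pi> (snd w) ** \<pi> (snd w)) + tr (\<pi> (snd w))"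
proof -
 let ?v = "\<pi> (snd w)" and ?j = "jinv J (uu w \<pi>)"
 have "tau ?j (uu w \<pi> ** ?v) = tr ?v" using assms by (simp add: tau_assoc[symmetric])
 moreover have "tau ?j (uu w \<pi> ** ?v) = tau ?j ?v - fst w * tau ?j (?v ** ?v)"
  by (subst (2) uu_def) (simp add: J_diff tau_diff tau_scale)
 ultimately show ?thesis by simp
qed

text \<open>The weighted pull-back of \<open>f\<close> by the flow at time \<open>fst w\<close>,
  kept as one function of time and point so that operators in the point commute with the time
  derivative.\<close>

definition HH :: "complex => int => complex => int => ('a \<times> 'a => complex) => real \<times> ('a \<times> 'a) => complex" where
 "HH l ep m et f w = qp (- l) ep (uu w fst) * (qp (- m) et (uu w snd) * f (fl2 w))"

definition HD :: "('a \<times> 'a) set => (real \<times> ('a \<times> 'a)) set" where "HD S = {w \<in> O1. fl2 w \<in> S}"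

context
 fixes l m :: complex and ep et :: int and S :: "('a \<times> 'a) set" and f :: "'a \<times> 'a => complex"
 assumes ep: "ep \<in> {1, -1}" and et: "et \<in> {1, -1}" and S: "open S" "smooth_on S f"
begin

lemma open_HD: "open (HD S)"
 using continuous_open_preimage[OF smap_continuous[OF fl2_smooth] open_O1 S(1)] by (simp add: HD_def vimage_def Int_def)

lemma HH_factors:
 "smooth_on (HD S) (%w. qp (- l) ep (uu w fst))" "smooth_on (HD S) (%w. qp (- m) et (uu w snd))" "smooth_on (HD S) (%w. f (fl2 w))"
proof -
 show "smooth_on (HD S) (%w. qp (- l) ep (uu w fst))" "smooth_on (HD S) (%w. qp (- m) et (uu w snd))"
  by (rule sm_subset[OF qp_uu_smooth[OF lin_fst_snd(1) ep]], force simp: HD_def O1_def)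
   (rule sm_subset[OF qp_uu_smooth[OF lin_fst_snd(2) et]], force simp: HD_def O1_def)
 show "smooth_on (HD S) (%w. f (fl2 w))"
  by (rule sm_compose[OF open_HD S(2) smap_subset[OF fl2_smooth]]) (auto simp: HD_def)
qed

lemma HH_smooth: "smooth_on (HD S) (HH l ep m et f)"
 unfolding HH_def[abs_def] by (intro sm_mult open_HD HH_factors)

text \<open>\<open>dpi\<close> generates the weighted flow: \<open>fl2_hasd\<close> handles the
  argument of \<open>f\<close>, and \<open>tau_jinv_uu\<close> matches the logarithmic derivatives
  of the two weights.\<close>

lemma HH_transport:
 assumes w: "w \<in> (HD S)"
 shows "dd [(1, 0)] (HH l ep m et f) w = dd [(0, sq (snd w))] (HH l ep m et f) w + tr2 l m (snd w) * HH l ep m et f w"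
proof -
 have O: "w \<in> O1" "fl2 w \<in> S" and j: "jd (uu w fst) ~= 0" "jd (uu w snd) ~= 0" using w by (auto simp: HD_def O1_def)
 note F = HH_factors
 note P1 = dd_product2(1)[OF open_HD F(1) sm_mult[OF open_HD F(2,3)] w]
 note P2 = dd_product2(1)[OF open_HD F(2,3) w]
 note Q = qp_uu_deriv[OF lin_fst_snd(1) ep j(1)] qp_uu_deriv[OF lin_fst_snd(2) et j(2)]
 note C = dd_chain[OF S(2) fl2_hasd(1)[OF O(1)] O(2)]
 note T = tau_jinv_uu[OF j(1)] tau_jinv_uu[OF j(2)]
 show ?thesis
  unfolding HH_def[abs_def] P1 P2 Q C fl2_hasd(2,3)[OF O(1)]
  by (simp add: T sq_def tr2_def tau_scale algebra_simps)
qed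

end

end

context source_ops begin

text \<open>\<open>G\<close> is the operator applied to the transported function; by
  \<open>iter_dpi\<close> it solves the transport equation with both weights raised by
  \<open>k\<close>. The curve \<open>y\<close> runs against the field from \<open>fl 1 x\<close> to
  \<open>x\<close>, so the weighted value \<open>h\<close> along the diagonal is constant, and its
  two ends are the two sides.\<close>

lemma flow_covariance:
 assumes ep: "ep \<in> {1, -1}" "et \<in> {1, -1}" and S: "open S" "smooth_on S f"
  and x: "!!s. 0 \<le> s ==> s \<le> 1 ==> jd (e - s *\<^sub>R x) ~= 0" and xS: "(fl 1 x, fl 1 x) \<in> S"
 shows "iter_F F l m k (%z. HH l ep m et f (1, z)) (x, x) =
  qp (- (l + m + 2 * of_nat k)) (ep * et) (e - x) * iter_F F l m k f (fl 1 x, fl 1 x)"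
proof -
 let ?A = "iter_F F l m k" and ?ka = "l + m + 2 * of_nat k" and ?H = "HH l ep m et f" and ?O = "HD S"
 note O = open_HD[OF ep S] and sm = HH_smooth[OF ep S, of l m]
 define G where "G w = (case w of (s, z) => ?A (%z. ?H (s, z)) z)" for w
 have smG: "smooth_on ?O G" unfolding G_def[abs_def] by (rule ldo_param_smooth[OF O sm ldo_iter])
 have G_transport: "dd [(1, 0)] G w = dd [(0, sq (snd w))] G w + tr2 (l + of_nat k) (m + of_nat k) (snd w) * G w"
  if w: "w \<in> ?O" for w
 proof -
  obtain s z where sz: "w = (s, z)" by (cases w)
  note wO = w[unfolded sz]
  have zU: "z \<in> {z. (s, z) \<in> ?O}" using wO by simp
  note sl = slice_right(1,2)[OF O sm, of s]
  have "dd [(1, 0)] G (s, z) = dd [1] (%s. G (s, z)) s"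
   using slice_left(3)[OF O smG wO, of "[1]"] by simp
  also have "... = dd [1] (%s. ?A (%z. ?H (s, z)) z) s" by (simp add: G_def)
  also have "... = ?A (%z. dd [1] (%s. ?H (s, z)) s) z"
   by (rule ldo_commute[OF O sm ldo_iter ldo_dir_deriv wO, symmetric])
  also have "... = ?A (dpi l m (%z. ?H (s, z))) z"
  proof (rule ldo_cong[OF ldo_iter sl(1) _ _ zU, symmetric])
   show "smooth_on {z. (s, z) \<in> ?O} (dpi l m (%z. ?H (s, z)))" by (rule ldo_smooth[OF ldo_dpi sl])
   fix y assume "y \<in> {z. (s, z) \<in> ?O}"
   hence y: "(s, y) \<in> ?O" by simp
   have "dpi l m (%z. ?H (s, z)) y = dd [sq y] (%z. ?H (s, z)) y + tr2 l m y * ?H (s, y)"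
    using dpi_frechet[OF sl(2), of y] y by simp
   also have "... = dd [(1, 0)] ?H (s, y)"
    using HH_transport[OF ep S y, of l m] slice_right(3)[OF O sm y, of "[sq y]"] by simp
   also have "... = dd [1] (%s. ?H (s, y)) s"
    using slice_left(3)[OF O sm y, of "[1]"] by simp
   finally show "dpi l m (%z. ?H (s, z)) y = dd [1] (%s. ?H (s, y)) s" .
  qed
  also have "... = dpi (l + of_nat k) (m + of_nat k) (?A (%z. ?H (s, z))) z" by (rule iter_dpi[OF sl zU])
  also have "... = dd [sq z] (%z. G (s, z)) z + tr2 (l + of_nat k) (m + of_nat k) z * G (s, z)"
   using dpi_frechet[OF ldo_smooth[OF ldo_iter sl] zU] by (simp add: G_def)
  also have "dd [sq z] (%z. G (s, z)) z = dd [(0, sq z)] G (s, z)"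
   using slice_right(3)[OF O smG wO, of "[sq z]"] by simp
  finally show ?thesis by (simp add: sz)
 qed
 define y where "y s = fl (1 - s) x" for s
 define h where "h s = qp (- ?ka) (ep * et) (e - (1 - s) *\<^sub>R x) * G (s, (y s, y s))" for s
 have j: "jd (e - (1 - s) *\<^sub>R x) ~= 0" if "s \<in> {0..1}" for s using x[of "1 - s"] that by simp
 have jx: "jd (e - x) ~= 0" using x[of 1] by simp
 have wO: "(s, (y s, y s)) \<in> ?O" if "s \<in> {0..1}" for s
  using fl_fl[OF j[OF that] jx] xS by (simp add: HD_def O1_def uu_def fl2_def y_def)
 have dh: "(h has_vector_derivative 0) (at s within {0..1})" if s: "s \<in> {0..1}" for s
 proof -
  let ?w = "(s, (y s, y s))" and ?v = "(1 - s, (x, x))"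
  have v: "jd (uu ?v fst) ~= 0" using j[OF s] by (simp add: uu_def)
  have dv: "((%s. (1 - s, (x, x))) has_derivative (%h. (- h, 0))) (at s)"
   by (auto intro!: derivative_eq_intros simp: zero_prod_def)
  have dy: "(y has_derivative (%h. - (h *\<^sub>R (y s ** y s)))) (at s)"
   using has_derivative_compose[OF dv fl_hasd[OF lin_fst_snd(1) v]]
   by (simp add: y_def[abs_def] uu_def fl_deriv(1)[OF j[OF s], symmetric] linear_scale[OF dinv_linear[OF j[OF s]]])
  have "((%s. (s, (y s, y s))) has_derivative (%h. (h, (- (h *\<^sub>R (y s ** y s)), - (h *\<^sub>R (y s ** y s)))))) (at s)"
   by (intro has_derivative_Pair dy has_derivative_ident)
  from has_derivative_compose[OF this sm_hasd[OF smG wO[OF s]]]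
  have "((%s. G (s, (y s, y s))) has_derivative (%h. fderiv G (at ?w) (h, (- (h *\<^sub>R (y s ** y s)), - (h *\<^sub>R (y s ** y s)))))) (at s)" .
  moreover have "fderiv G (at ?w) (h, (- (h *\<^sub>R (y s ** y s)), - (h *\<^sub>R (y s ** y s)))) = h *\<^sub>R (of_real (tr (y s)) * ?ka * G ?w)" for h
  proof -
   note lin = sm_linear_deriv[OF smG wO[OF s]]
   have "(h, (- (h *\<^sub>R (y s ** y s)), - (h *\<^sub>R (y s ** y s)))) = h *\<^sub>R ((1, 0) - (0, sq (y s, y s)))"
    by (simp add: sq_def)
   hence "fderiv G (at ?w) (h, (- (h *\<^sub>R (y s ** y s)), - (h *\<^sub>R (y s ** y s)))) =
    h *\<^sub>R (dd [(1, 0)] G ?w - dd [(0, sq (snd ?w))] G ?w)"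
    by (simp only: linear_scale[OF lin] linear_diff[OF lin]) simp
   thus ?thesis by (simp add: G_transport[OF wO[OF s]] tr2_def algebra_simps del: dir_deriv.simps)
  qed
  ultimately have dG: "((%s. G (s, (y s, y s))) has_derivative (%h. h *\<^sub>R (of_real (tr (y s)) * ?ka * G ?w))) (at s)" by simp
  have du: "((%s. e - (1 - s) *\<^sub>R x) has_derivative (%h. h *\<^sub>R x)) (at s)"
   by (auto intro!: derivative_eq_intros)
  have ee: "ep * et \<in> {1, -1}" using ep by auto
  have "tau (jinv J (e - (1 - s) *\<^sub>R x)) x = tr (y s)" by (simp add: y_def fl_def tau_def comm)
  with has_derivative_compose[OF du qp_hasd[OF j[OF s] ee, of "- ?ka"]]
  have dq: "((%s. qp (- ?ka) (ep * et) (e - (1 - s) *\<^sub>R x)) has_derivative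
    (%h. - ?ka * qp (- ?ka) (ep * et) (e - (1 - s) *\<^sub>R x) * of_real (h * tr (y s)))) (at s)"
   by (simp add: tau_scale)
  have "(h has_derivative (%h. 0)) (at s)"
   unfolding h_def[abs_def]
   by (rule has_derivative_eq_rhs[OF has_derivative_mult[OF dq dG]]) (simp add: fun_eq_iff scaleR_conv_of_real algebra_simps)
  thus ?thesis unfolding has_vector_derivative_def by (simp add: has_derivative_at_withinI)
 qed
 obtain c where "!!s. s \<in> {0..1} ==> h s = c"
  using has_vector_derivative_zero_constant[OF _ dh] by (metis convex_real_interval(5))
 hence eq: "h 0 = h 1" by simp
 have f1: "fl 0 v = v" for v using alg_jinv_eq(2)[of e e e] alg_intros(2)[of e] by (simp add: fl_def)
 have "h 1 = ?A (%z. ?H (1, z)) (x, x)"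
  by (simp add: h_def G_def y_def f1 qp_def sgn_powr_def)
 moreover have "h 0 = qp (- ?ka) (ep * et) (e - x) * ?A f (fl 1 x, fl 1 x)"
 proof -
  have "?A (%z. ?H (0, z)) (fl 1 x, fl 1 x) = ?A f (fl 1 x, fl 1 x)"
   by (rule ldo_cong[OF ldo_iter S _ xS, symmetric]) (simp add: HH_def uu_def fl2_def f1 qp_def sgn_powr_def)
  thus ?thesis by (simp add: h_def G_def y_def)
 qed
 ultimately show ?thesis using eq by simp
qed

end

section \<open>Covariance under the inversion\<close>

lemma pfun_complex_iff:
 fixes p :: "'b::real_normed_vector => complex"
 shows "pfun p \<longleftrightarrow> rpoly (%x. Re (p x)) & rpoly (%x. Im (p x))"
proof
 assume "pfun p"
 thus "rpoly (%x. Re (p x)) & rpoly (%x. Im (p x))"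
  using bounded_linear_Re bounded_linear_Im unfolding polynomial_function_def o_def by blast
next
 assume a: "rpoly (%x. Re (p x)) & rpoly (%x. Im (p x))"
 have "pfun (%x. Re (p x) *\<^sub>R 1 + Im (p x) *\<^sub>R \<i>)"
  using a by (intro polynomial_function_add pfun_scaleR polynomial_function_const) auto
 thus "pfun p" by (simp add: complex_eq scaleR_conv_of_real mult.commute flip: complex_eq)
qed

lemma pfun_mult_complex:
 fixes p q :: "'b::real_normed_vector => complex"
 assumes "pfun p" "pfun q"
 shows "pfun (%x. p x * q x)"
 using assms unfolding pfun_complex_iff
 by (auto intro!: rpoly_intros(4) rpoly_intros(3) real_polynomial_function_diff)

lemma pfun_of_real:
 "rpoly p ==> pfun (%x. cor (p x))"
 by (simp add: pfun_complex_iff rpoly_intros(2))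

lemma pfun_power_complex:
 fixes p :: "'b::real_normed_vector => complex"
 shows "pfun p ==> pfun (%x. p x ^ n)"
 by (induction n) (simp_all add: pfun_mult_complex)

lemma poly_dir_deriv:
 fixes p :: "'b::euclidean_space => complex"
 assumes "pfun p" shows "pfun (dd [v] p)"
proof -
 have d: "(p has_derivative fderiv p (at x)) (at x)" for x
  by (rule sm_hasd[OF sm_poly[OF assms] UNIV_I])
 have "Re (dd [v] p x) = fderiv (%x. Re (p x)) (at x) v"
  "Im (dd [v] p x) = fderiv (%x. Im (p x)) (at x) v" for x
  using frechet_derivative_at[OF has_derivative_Re[OF d[of x]]] frechet_derivative_at[OF has_derivative_Im[OF d[of x]]]
  by (simp_all add: fun_eq_iff)
 moreover have "rpoly (%x. Re (p x))" "rpoly (%x. Im (p x))"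
  using assms by (simp_all add: pfun_complex_iff)
 ultimately show ?thesis unfolding pfun_complex_iff
  by (simp add: rpoly_frechet del: dir_deriv.simps)
qed

context sjordan begin

abbreviation jj :: "'a \<times> 'a => real" where "jj z \<equiv> jd (fst z) * jd (snd z)"

text \<open>The functions on pairs of invertible elements whose only denominators are powers of the
  two determinants; one common power suffices and keeps the class closed under sums, products and
  derivatives.\<close>

definition ratf :: "('a \<times> 'a => complex) => bool" where
 "ratf R \<longleftrightarrow> (\<exists>p N. pfun p & (\<forall>z\<in>inv2. R z = p z / of_real (jj z) ^ N))"

lemma ratfI: "pfun p ==> (!!z. z \<in> inv2 ==> R z = p z / of_real (jj z) ^ N) ==> ratf R"
 unfolding ratf_def by blast

lemma ratf_poly: "pfun p ==> ratf p"
 by (rule ratfI[of p _ 0]) simp_all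

lemma jj_nonzero: "z \<in> inv2 ==> cor (jj z) ~= 0" by (simp add: inv2_def)

lemma jj_power_poly: "pfun (%z. cor (jj z) ^ N)"
 by (intro pfun_power_complex pfun_of_real jd2_poly)

lemma ratf_add: assumes "ratf R" "ratf R'" shows "ratf (%z. R z + R' z)"
proof -
 obtain p N q M where p: "pfun p" "!!z. z \<in> inv2 ==> R z = p z / of_real (jj z) ^ N"
  and q: "pfun q" "!!z. z \<in> inv2 ==> R' z = q z / of_real (jj z) ^ M"
  using assms unfolding ratf_def by metis
 show ?thesis
 proof (rule ratfI[of "%z. p z * of_real (jj z) ^ M + q z * of_real (jj z) ^ N" _ "N + M"])
  show "pfun (%z. p z * of_real (jj z) ^ M + q z * of_real (jj z) ^ N)"
   by (intro polynomial_function_add pfun_mult_complex p q jj_power_poly)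
  show "R z + R' z = (p z * of_real (jj z) ^ M + q z * of_real (jj z) ^ N) / of_real (jj z) ^ (N + M)" if "z \<in> inv2" for z
   using jj_nonzero[OF that] p(2)[OF that] q(2)[OF that] by (simp add: power_add add_divide_distrib del: of_real_mult)
 qed
qed

lemma ratf_mult: assumes "ratf R" "ratf R'" shows "ratf (%z. R z * R' z)"
proof -
 obtain p N q M where p: "pfun p" "!!z. z \<in> inv2 ==> R z = p z / of_real (jj z) ^ N"
  and q: "pfun q" "!!z. z \<in> inv2 ==> R' z = q z / of_real (jj z) ^ M"
  using assms unfolding ratf_def by metis
 show ?thesis
  by (rule ratfI[of "%z. p z * q z" _ "N + M"]) (simp_all add: p q pfun_mult_complex power_add)
qed

lemma ratf_const: "ratf (%_. c)" by (rule ratf_poly) simp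

lemma ratf_sum_list: "(!!t. t \<in> set T ==> ratf (R t)) ==> ratf (%z. \<Sum>t\<leftarrow>T. R t z)"
 by (induction T) (simp_all add: ratf_const ratf_add)

lemma ratf_cong: "ratf R ==> (!!z. z \<in> inv2 ==> R' z = R z) ==> ratf R'"
 unfolding ratf_def by metis

lemma ratf_smooth: assumes "ratf R" shows "smooth_on inv2 R"
proof -
 obtain p N where p: "pfun p" "!!z. z \<in> inv2 ==> R z = p z / of_real (jj z) ^ N"
  using assms unfolding ratf_def by blast
 have "smooth_on inv2 (%z. p z * inverse (of_real (jj z) ^ N))"
  using jj_nonzero by (intro sm_mult sm_inverse open_inv2 sm_poly p jj_power_poly) auto
 thus ?thesis by (rule sm_cong[OF open_inv2, rotated]) (simp add: p(2) divide_inverse)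
qed

lemma ratf_dir_deriv: assumes "ratf R" shows "ratf (dd [v] R)"
proof -
 obtain p N where p: "pfun p" "!!z. z \<in> inv2 ==> R z = p z / of_real (jj z) ^ N"
  using assms unfolding ratf_def by blast
 let ?K = "%z. cor (jj z) ^ N"
 have K: "pfun ?K" by (rule jj_power_poly)
 show ?thesis
 proof (rule ratfI[of "%z. dd [v] p z * ?K z + (- 1) * (p z * dd [v] ?K z)" _ "N + N"])
  show "pfun (%z. dd [v] p z * ?K z + (- 1) * (p z * dd [v] ?K z))"
   by (intro polynomial_function_add pfun_mult_complex poly_dir_deriv p K polynomial_function_const)
  fix z assume z: "z \<in> inv2"
  have "dd [v] p z = dd [v] (%z. R z * ?K z) z"
   by (rule dd_cong[OF open_inv2 _ z]) (use jj_nonzero in \<open>simp add: p(2)\<close>)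
  also have "... = R z * dd [v] ?K z + dd [v] R z * ?K z"
   by (rule dd_product2(1)[OF open_inv2 ratf_smooth[OF assms] sm_poly[OF K] z])
  finally show "dd [v] R z = (dd [v] p z * ?K z + (- 1) * (p z * dd [v] ?K z)) / of_real (jj z) ^ (N + N)"
   using jj_nonzero[OF z] by (simp add: p(2)[OF z] power_add field_simps del: dir_deriv.simps of_real_mult)
 qed
qed

text \<open>On the diagonal the numerator is a polynomial, so vanishing on one open set spreads to
  all invertible elements, whatever component they lie in.\<close>

lemma ratf_diag_zero:
 assumes "ratf R" "open U" "U ~= {}" "!!x. x \<in> U ==> jd x ~= 0 ==> R (x, x) = 0" "jd x ~= 0"
 shows "R (x, x) = 0"
proof -
 obtain p N where p: "pfun p" "!!z. z \<in> inv2 ==> R z = p z / of_real (jj z) ^ N"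
  using assms(1) unfolding ratf_def by blast
 have i: "(y, y) \<in> inv2 \<longleftrightarrow> jd y ~= 0" for y by (simp add: inv2_def)
 have "linear (%x::'a. (x, x))" by (rule linearI) simp_all
 from polynomial_function_compose[OF poly_linear[OF this] p(1)]
 have pd: "pfun (%x. p (x, x))" by (simp add: o_def)
 let ?U = "U \<inter> {x. jd x ~= 0}"
 have "?U ~= {}" using rpoly_nonzero_open[OF jd_poly _ assms(2,3), of e] by auto
 hence "p (x, x) = 0"
 proof (rule polynomial_eqI[OF pd polynomial_function_const open_Int[OF assms(2) open_invertibles]])
  fix y assume "y \<in> ?U"
  thus "p (y, y) = 0" using assms(4)[of y] p(2)[of "(y, y)"] by (simp add: i)
 qed
 thus ?thesis using p(2)[of "(x, x)"] assms(5) by (simp add: i)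
qed

section \<open>The inversion on pairs, and operators pulled back by it\<close>

definition io :: "'a \<times> 'a => 'a \<times> 'a" where "io z = (- jinv J (fst z), - jinv J (snd z))"

definition ion :: "'a \<times> 'a => 'a \<times> 'a" where
 "ion z = (jd (snd z) *\<^sub>R (- adj (fst z)), jd (fst z) *\<^sub>R (- adj (snd z)))"

lemma io_ion: "z \<in> inv2 ==> io z = ion z /\<^sub>R jj z"
 by (auto simp: io_def ion_def inv2_def jinv_eq divide_simps)

lemma jd_pair_poly: "rpoly (%z::'a\<times>'a. jd (fst z))" "rpoly (%z::'a\<times>'a. jd (snd z))"
 using real_polynomial_function_compose[OF poly_linear[OF lin_fst_snd(1)] jd_poly]
  real_polynomial_function_compose[OF poly_linear[OF lin_fst_snd(2)] jd_poly] by (simp_all add: o_def)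

lemma adj_pair_poly: "pfun (%z::'a\<times>'a. adj (fst z))" "pfun (%z::'a\<times>'a. adj (snd z))"
 using polynomial_function_compose[OF poly_linear[OF lin_fst_snd(1)] adj_poly]
  polynomial_function_compose[OF poly_linear[OF lin_fst_snd(2)] adj_poly] by (simp_all add: o_def)

lemma ion_poly: "pfun ion"
proof -
 have li: "linear inl" "linear inr" by (rule linearI; simp)+
 have "pfun (%z. inl (jd (snd z) *\<^sub>R (- adj (fst z))) + inr (jd (fst z) *\<^sub>R (- adj (snd z))))"
  by (intro polynomial_function_add polynomial_function_compose[OF _ poly_linear[OF li(1)], unfolded o_def]
    polynomial_function_compose[OF _ poly_linear[OF li(2)], unfolded o_def]
    pfun_scaleR polynomial_function_minus jd_pair_poly adj_pair_poly)
 thus ?thesis by (simp add: ion_def[abs_def])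
qed

lemma ratf_io: "ratf (%z. of_real (io z \<bullet> b))"
 by (rule ratfI[of "%z. of_real (ion z \<bullet> b)" _ 1, OF pfun_of_real[OF pfun_inner_real[OF ion_poly]]])
  (simp add: io_ion divide_inverse mult_ac)

lemma io_smooth: "smooth_map inv2 io"
 unfolding smooth_map_def by (intro allI ratf_smooth ratf_io)

lemma ratf_Dio: "ratf (%z. of_real (fderiv io (at z) v \<bullet> b))"
 by (rule ratf_cong[OF ratf_dir_deriv[OF ratf_io[of b], of v]]) (simp add: smap_frechet_inner[OF io_smooth])

lemma ratf_poly_io:
 fixes p :: "'a \<times> 'a => complex"
 assumes "pfun p" shows "ratf (%z. p (io z))"
proof -
 obtain M d where N: "pfun M" "!!z. jj z ~= 0 ==> M z = (jj z ^ d) *\<^sub>R p (ion z /\<^sub>R jj z)"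
  using poly_substitute[OF assms ion_poly jd2_poly] by blast
 show ?thesis
  by (rule ratfI[OF N(1), of _ d]) (simp add: io_ion N(2) inv2_alt scaleR_conv_of_real)
qed

text \<open>The logarithmic derivative of \<open>QQ s ep t et\<close> in direction
  \<open>v\<close>.\<close>

definition om :: "complex => complex => 'a \<times> 'a => 'a \<times> 'a => complex" where
 "om s t v z = s * of_real (tau (jinv J (fst z)) (fst v)) + t * of_real (tau (jinv J (snd z)) (snd v))"

lemma ratf_om: "ratf (om s t v)"
proof -
 have q: "om s t v z = - s * of_real (io z \<bullet> inl (Sg (fst v))) + - t * of_real (io z \<bullet> inr (Sg (snd v)))" for z
  by (simp add: om_def io_def tau_inner inner_minus_left)
 show ?thesis unfolding q[abs_def] by (intro ratf_add ratf_mult ratf_const ratf_io)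
qed

lemma QQ_deriv:
 assumes z: "z \<in> inv2" and ep: "ep \<in> {1, -1}" "et \<in> {1, -1}"
 shows "dd [v] (QQ s ep t et) z = QQ s ep t et z * om s t v z"
proof -
 have j: "jd (fst z) ~= 0" "jd (snd z) ~= 0" using z by (auto simp: inv2_def)
 have "(QQ s ep t et has_derivative (%h. qp s ep (fst z) * (t * qp t et (snd z) * of_real (tau (jinv J (snd z)) (snd h)))
   + s * qp s ep (fst z) * of_real (tau (jinv J (fst z)) (fst h)) * qp t et (snd z))) (at z)"
  unfolding QQ_def[abs_def]
  by (intro has_derivative_mult has_derivative_compose[OF has_derivative_fst qp_hasd]
    has_derivative_compose[OF has_derivative_snd qp_hasd] has_derivative_ident j ep)
 from fderiv_eqI[OF this] show ?thesis by (simp add: QQ_def om_def algebra_simps)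
qed

context
 fixes s t :: complex and ep et :: int
 assumes ep: "ep \<in> {1, -1}" and et: "et \<in> {1, -1}"
begin

abbreviation Q :: "'a \<times> 'a => complex" where "Q \<equiv> QQ s ep t et"

abbreviation pb :: "(('a \<times> 'a => complex) \<times> ('a \<times> 'a) list) list => ('a \<times> 'a => complex) => 'a \<times> 'a => complex" where
 "pb T f z \<equiv> Q z * (\<Sum>(R, ws)\<leftarrow>T. R z * dd ws f (io z))"

lemma open_io: "open S ==> open {z \<in> inv2. io z \<in> S}"
 using continuous_open_preimage[OF smap_continuous[OF io_smooth] open_inv2] by (simp add: vimage_def Int_def)

lemma pb_smooth_term:
 assumes "ratf R" "open S" "smooth_on S f"
 shows "smooth_on {z \<in> inv2. io z \<in> S} (%z. Q z * (R z * dd ws f (io z)))"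
proof (intro sm_mult open_io assms(2))
 let ?I = "{z \<in> inv2. io z \<in> S}"
 show "smooth_on ?I Q" by (rule sm_subset[OF QQ_smooth[OF ep et]]) auto
 show "smooth_on ?I R" by (rule sm_subset[OF ratf_smooth[OF assms(1)]]) auto
 show "smooth_on ?I (%z. dd ws f (io z))"
  by (rule sm_compose[OF open_io[OF assms(2)] sm_dir_deriv[OF assms(3)] smap_subset[OF io_smooth]]) auto
qed

text \<open>One list \<open>T\<close> serves all functions \<open>f\<close>, so that what is learnt
  about the coefficients from exponentials transfers to every \<open>f\<close>.\<close>

definition pulled_by :: "(('a \<times> 'a => complex) \<times> ('a \<times> 'a) list) list => (('a \<times> 'a => complex) => 'a \<times> 'a => complex) => bool" where
 "pulled_by T U \<longleftrightarrow> (\<forall>(R, ws)\<in>set T. ratf R) &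
  (\<forall>S f z. open S --> smooth_on S f --> z \<in> inv2 --> io z \<in> S --> U f z = pb T f z)"

definition pulled :: "(('a \<times> 'a => complex) => 'a \<times> 'a => complex) => bool" where
 "pulled U \<longleftrightarrow> (\<exists>T. pulled_by T U)"

lemma pulled_byD: "pulled_by T U ==> (R, ws) \<in> set T ==> ratf R"
 "pulled_by T U ==> open S ==> smooth_on S f ==> z \<in> inv2 ==> io z \<in> S ==> U f z = pb T f z"
 unfolding pulled_by_def by blast+

lemma pulled_byI:
 assumes "!!R ws. (R, ws) \<in> set T ==> ratf R"
  "!!S f z. open S ==> smooth_on S f ==> z \<in> inv2 ==> io z \<in> S ==> U f z = pb T f z"
 shows "pulled_by T U"
 unfolding pulled_by_def by (intro conjI allI impI assms(2)) (use assms(1) in auto)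

lemma pulledI: "pulled_by T U ==> pulled U"
 unfolding pulled_def by (rule exI)

text \<open>The derivative falls on the weight, giving \<open>om\<close>, on the coefficient, or on
  the inner function, where the chain rule adds one term per basis direction.\<close>

lemma pb_deriv_term:
 assumes R: "ratf R"
 shows "pulled (%f. dd [v] (%z. Q z * (R z * dd ws f (io z))))"
proof -
 obtain bl :: "('a \<times> 'a) list" where bl: "set bl = Basis" "distinct bl" using finite_distinct_list[OF finite_Basis] by blast
 let ?T = "(%z. om s t v z * R z + dd [v] R z, ws) # map (%b. (%z. R z * of_real (fderiv io (at z) v \<bullet> b), b # ws)) bl"
 have 1: "!!R ws. (R, ws) \<in> set ?T ==> ratf R" using R by (auto intro!: ratf_add ratf_mult ratf_om ratf_dir_deriv[of R v, simplified] ratf_Dio)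
 have 2: "dd [v] (%z. Q z * (R z * dd ws f (io z))) z = pb ?T f z"
  if S: "open S" "smooth_on S f" and z: "z \<in> inv2" "io z \<in> S" for S f z
 proof -
  let ?I = "{z \<in> inv2. io z \<in> S}" and ?g = "dd ws f"
  note O = open_io[OF S(1)] and sg = sm_dir_deriv[OF S(2), of ws]
  have sQ: "smooth_on ?I Q" by (rule sm_subset[OF QQ_smooth[OF ep et]]) auto
  have sR: "smooth_on ?I R" by (rule sm_subset[OF ratf_smooth[OF R]]) auto
  have sc: "smooth_on ?I (%z. ?g (io z))"
   by (rule sm_compose[OF O sg smap_subset[OF io_smooth]]) auto
  have zI: "z \<in> ?I" using z by simp
  have c: "dd [v] (%z. ?g (io z)) z = (\<Sum>b\<in>Basis. of_real (fderiv io (at z) v \<bullet> b) * dd (b # ws) f (io z))"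
   using fderiv_compose_smooth[OF sg io_smooth z(1,2), of v] by simp
  have "(\<Sum>b\<in>Basis. of_real (fderiv io (at z) v \<bullet> b) * dd (b # ws) f (io z)) =
   (\<Sum>b\<leftarrow>bl. of_real (fderiv io (at z) v \<bullet> b) * dd (b # ws) f (io z))"
   using bl by (simp only: sum_list_distinct_conv_sum_set)
  with c show ?thesis
   unfolding dd_product2(1)[OF O sQ sm_mult[OF O sR sc] zI] dd_product2(1)[OF O sR sc zI] QQ_deriv[OF z(1) ep et]
   by (simp add: algebra_simps o_def sum_list_const_mult del: dir_deriv.simps)
 qed
 show ?thesis by (rule pulledI[OF pulled_byI[OF 1 2]])
qed

lemma pulled_zero: "pulled (%f z. 0)"
 by (rule pulledI[OF pulled_byI[of "[]"]]) simp_all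

lemma pulled_add: assumes "pulled U" "pulled W" shows "pulled (%f z. U f z + W f z)"
proof -
 obtain T T' where T: "pulled_by T U" "pulled_by T' W" using assms unfolding pulled_def by blast
 show ?thesis
  by (rule pulledI[OF pulled_byI[of "T @ T'"]])
   (use pulled_byD(1)[OF T(1)] pulled_byD(1)[OF T(2)] pulled_byD(2)[OF T(1)] pulled_byD(2)[OF T(2)] in \<open>auto simp: distrib_left\<close>)
qed

lemma pulled_cong:
 assumes "pulled U" "!!S f z. open S ==> smooth_on S f ==> z \<in> inv2 ==> io z \<in> S ==> W f z = U f z"
 shows "pulled W"
proof -
 obtain T where T: "pulled_by T U" using assms(1) unfolding pulled_def by blast
 show ?thesis
 proof (rule pulledI[OF pulled_byI[of T]])
  show "W f z = pb T f z" if "open S" "smooth_on S f" "z \<in> inv2" "io z \<in> S" for S f z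
   using assms(2)[OF that] pulled_byD(2)[OF T that] by simp
 qed (rule pulled_byD(1)[OF T])
qed

lemma pb_deriv: "(!!R ws. (R, ws) \<in> set T ==> ratf R) ==> pulled (%f. dd [v] (pb T f))"
proof (induction T)
 case Nil
 show ?case using pulled_zero by (simp add: dd_zero[of "[v]", simplified])
next
 case (Cons t T)
 obtain R ws where t: "t = (R, ws)" by (cases t)
 have R: "ratf R" and RT: "!!R ws. (R, ws) \<in> set T ==> ratf R" using Cons.prems t by auto
 show ?case
 proof (rule pulled_cong[OF pulled_add[OF pb_deriv_term[OF R] Cons.IH[OF RT]]])
  fix S f z assume S: "open S" "smooth_on S f" "z \<in> inv2" "io z \<in> S"
  have "smooth_on {z \<in> inv2. io z \<in> S} (%z. \<Sum>t\<leftarrow>T. Q z * (fst t z * dd (snd t) f (io z)))"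
   by (intro sm_sum_list pb_smooth_term open_io S) (auto intro: RT)
  hence sT: "smooth_on {z \<in> inv2. io z \<in> S} (pb T f)" by (simp add: sum_list_const_mult case_prod_unfold)
  have "dd [v] (pb (t # T) f) z = dd [v] (%z. Q z * (R z * dd ws f (io z)) + pb T f z) z"
   by (simp add: t distrib_left)
  also have "... = dd [v] (%z. Q z * (R z * dd ws f (io z))) z + dd [v] (pb T f) z"
   by (rule dd_add[OF open_io[OF S(1)] pb_smooth_term[OF R S(1,2)] sT]) (use S in simp)
  finally show "dd [v] (pb (t # T) f) z = dd [v] (%z. Q z * (R z * dd ws f (io z))) z + dd [v] (pb T f) z" .
 qed
qed

lemma pulled_base: "pulled (%f z. Q z * f (io z))"
 by (rule pulledI[OF pulled_byI[of "[(%_. 1, [])]"]]) (simp_all add: ratf_const)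

lemma pulled_mult: assumes "pulled U" "pfun p" shows "pulled (%f z. p z * U f z)"
proof -
 obtain T where T: "pulled_by T U" using assms(1) unfolding pulled_def by blast
 show ?thesis
  by (rule pulledI[OF pulled_byI[of "map (%(R, ws). (%z. p z * R z, ws)) T"]])
   (use pulled_byD[OF T] assms(2) in \<open>auto intro!: ratf_mult[OF ratf_poly] simp: o_def case_prod_unfold mult.assoc sum_list_const_mult\<close>)
qed

lemma pulled_deriv: assumes "pulled U" shows "pulled (%f. dd [v] (U f))"
proof -
 obtain T where T: "pulled_by T U" using assms unfolding pulled_def by blast
 show ?thesis
 proof (rule pulled_cong[OF pb_deriv[OF pulled_byD(1)[OF T]]])
  show "dd [v] (U f) z = dd [v] (pb T f) z" if "open S" "smooth_on S f" "z \<in> inv2" "io z \<in> S" for S f z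
   by (rule dd_cong[OF open_io[OF that(1)]]) (use pulled_byD(2)[OF T that(1,2)] that in auto)
 qed
qed

lemma pulled_derivs: "pulled U ==> pulled (%f. dd vs (U f))"
proof (induction vs)
 case (Cons v vs)
 from pulled_deriv[OF Cons.IH[OF Cons.prems], of v] show ?case by simp
qed simp

lemma pulled_diff_op:
 assumes "poly_diff_op B" "pulled U" shows "pulled (%f. B (U f))"
proof -
 obtain T where T: "\<forall>(p, vs)\<in>set T. pfun p" "B = diff_op T"
  using assms(1) unfolding poly_diff_op_def by (elim exE conjE) (rule that)
 from T(1) have "pulled (%f z. \<Sum>(p, vs)\<leftarrow>T. p z * dd vs (U f) z)"
 proof (induction T)
  case Nil show ?case using pulled_zero by simp
 next
  case (Cons t T)
  obtain p vs where t: "t = (p, vs)" by (cases t)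
  have "pulled (%f z. p z * dd vs (U f) z + (\<Sum>(p, vs)\<leftarrow>T. p z * dd vs (U f) z))"
   using Cons t by (intro pulled_add pulled_mult pulled_derivs assms(2)) auto
  thus ?case by (simp add: t)
 qed
 thus ?thesis unfolding T(2) diff_op_def[abs_def] .
qed

end

lemma poly_diff_op_E:
 assumes "poly_diff_op B" "pfun p"
 shows "\<exists>q. pfun q & B (%z. p z * E c th z) = (%z. q z * E c th z)"
proof -
 have d: "\<exists>q. pfun q & dd vs (%z. p z * E c th z) = (%z. q z * E c th z)" for vs
 proof (induction vs)
  case Nil show ?case using assms(2) by auto
 next
  case (Cons v vs)
  then obtain q where q: "pfun q" "dd vs (%z. p z * E c th z) = (%z. q z * E c th z)" by blast
  have "dd (v # vs) (%z. p z * E c th z) z = dd [v] (%z. q z * E c th z) z" for z using q(2) by simp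
  also have "... z = (q z * (c * of_real (tau2 v th)) + dd [v] q z) * E c th z" for z
   unfolding dd_product2(1)[OF open_UNIV sm_poly[OF q(1)] E_smooth UNIV_I] E_dir_deriv
   by (simp add: algebra_simps)
  finally have "dd (v # vs) (%z. p z * E c th z) = (%z. (q z * (c * of_real (tau2 v th)) + dd [v] q z) * E c th z)"
   by (rule ext)
  moreover have "pfun (%z. q z * (c * of_real (tau2 v th)) + dd [v] q z)"
   by (intro polynomial_function_add pfun_mult_complex poly_dir_deriv q polynomial_function_const)
  ultimately show ?case by blast
 qed
 obtain T where T: "\<forall>(p, vs)\<in>set T. pfun p" "B = diff_op T"
  using assms(1) unfolding poly_diff_op_def by (elim exE conjE) (rule that)
 from T(1) have "\<exists>q. pfun q & (\<forall>z. (\<Sum>(p', vs)\<leftarrow>T. p' z * dd vs (%z. p z * E c th z) z) = q z * E c th z)"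
 proof (induction T)
  case Nil show ?case by (intro exI[of _ "%_. 0"]) simp
 next
  case (Cons t T)
  obtain p' vs where t: "t = (p', vs)" by (cases t)
  obtain q where q: "pfun q" "\<forall>z. (\<Sum>(p', vs)\<leftarrow>T. p' z * dd vs (%z. p z * E c th z) z) = q z * E c th z"
   using Cons by auto
  obtain q' where q': "pfun q'" "dd vs (%z. p z * E c th z) = (%z. q' z * E c th z)" using d by blast
  show ?case
   by (rule exI[of _ "%z. p' z * q' z + q z"])
    (use Cons.prems q q' t in \<open>auto intro!: pfun_mult_complex simp: algebra_simps\<close>)
 qed
 thus ?thesis unfolding T(2) diff_op_def[abs_def] by (auto simp: fun_eq_iff)
qed

section \<open>Weighted pull-backs and their domains\<close>

definition gg :: "('a \<rightharpoonup> 'a) => 'a \<times> 'a => 'a \<times> 'a" where "gg g z = (the (g (fst z)), the (g (snd z)))"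

definition CD :: "('a \<rightharpoonup> 'a) => ('a => real) => ('a \<times> 'a) set => ('a \<times> 'a) set" where
 "CD g p S = {z \<in> (dom g \<inter> {x. p x ~= 0}) \<times> (dom g \<inter> {x. p x ~= 0}). gg g z \<in> S}"

lemma smap_linear_compose:
 assumes "open S" "smooth_map S f" "linear (\<pi> :: 'c::euclidean_space => 'd::euclidean_space)"
 shows "smooth_map {z. \<pi> z \<in> S} (%z. f (\<pi> z))"
 unfolding smooth_map_def
proof
 fix b
 show "smooth_on {z. \<pi> z \<in> S} (%z. cor (f (\<pi> z) \<bullet> b))"
  using sm_linear_compose[OF assms(1) _ assms(3), of "%x. cor (f x \<bullet> b)"] assms(2)
  by (simp add: smooth_map_def)
qed

lemma gg_smooth: assumes "rational_map g" shows "smooth_map (dom g \<times> dom g) (gg g)"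
proof -
 note o = rat_dom_open[OF assms] and s = rat_smooth_map[OF assms]
 have "smooth_map (dom g \<times> dom g) (%z. (the (g (fst z)), the (g (snd z))))"
  by (intro smap_pair open_Times o
    smap_subset[OF smap_linear_compose[OF o s lin_fst_snd(1)]] smap_subset[OF smap_linear_compose[OF o s lin_fst_snd(2)]])
   auto
 thus ?thesis by (simp add: gg_def[abs_def])
qed

lemma open_CD:
 assumes "rational_map g" "rpoly p" "open S" shows "open (CD g p S)"
proof -
 let ?U = "(dom g \<inter> {x. p x ~= 0}) \<times> (dom g \<inter> {x. p x ~= 0})"
 have "open ?U" by (intro open_Times open_Int rat_dom_open open_rpoly_nonzero assms)
 moreover have "continuous_on ?U (gg g)"
  by (rule smap_continuous[OF smap_subset[OF gg_smooth[OF assms(1)]]]) auto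
 ultimately show ?thesis
  using continuous_open_preimage[of ?U "gg g" S] assms(3) by (simp add: CD_def vimage_def Int_def)
qed

lemma sgn_powr_smooth_poly:
 assumes "rpoly p" "ep \<in> {1, -1}" shows "smooth_on {x. p x ~= 0} (%x. sgn_powr (p x) s ep)"
 by (rule sm_sgn_powr[OF open_rpoly_nonzero[OF assms(1)] sm_real_poly[OF assms(1)] _ assms(2)]) simp

lemma CD_smooth:
 assumes g: "rational_map g" and p: "rpoly p" and S: "open S" "smooth_on S f"
  and ep: "ep \<in> {1, -1}" "et \<in> {1, -1}"
 shows "smooth_on (CD g p S) (%z. wt2 l ep m et p z * f (gg g z))"
 unfolding wt2_def
proof (intro sm_mult open_CD g p S)
 note o = open_rpoly_nonzero[OF p]
 show "smooth_on (CD g p S) (%z. sgn_powr (p (fst z)) (- l) ep)"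
  by (rule sm_subset[OF sm_linear_compose[OF o sgn_powr_smooth_poly[OF p ep(1)] lin_fst_snd(1)]]) (auto simp: CD_def)
 show "smooth_on (CD g p S) (%z. sgn_powr (p (snd z)) (- m) et)"
  by (rule sm_subset[OF sm_linear_compose[OF o sgn_powr_smooth_poly[OF p ep(2)] lin_fst_snd(2)]]) (auto simp: CD_def)
 show "smooth_on (CD g p S) (%z. f (gg g z))"
  by (rule sm_compose[OF open_CD[OF g p S(1)] S(2) smap_subset[OF gg_smooth[OF g]]]) (auto simp: CD_def)
qed

lemma sgn_powr_uminus: "ep \<in> {1, -1} ==> sgn_powr (- t) s ep = of_int ep * sgn_powr t s ep"
 by (auto simp: sgn_powr_def sgn_minus)

lemma sgn_powr_mult: "sgn_powr (a * b) s ep = sgn_powr a s ep * sgn_powr b s ep"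
 by (simp add: sgn_powr_def abs_mult sgn_mult powr_times_real)

lemma sgn_powr_combine:
 assumes "t ~= 0" "ep \<in> {1, -1}" "et \<in> {1, -1}"
 shows "sgn_powr t (- l) ep * sgn_powr t (- m) et = sgn_powr t (- (l + m)) (ep * et)"
 using assms by (auto simp: sgn_powr_def powr_add powr_diff powr_minus sgn_if field_simps)

text \<open>An even integral shift of the exponent does not see the sign of \<open>t\<close>, so it
  splits off as an ordinary power.\<close>

lemma sgn_powr_even_shift:
 assumes "t ~= 0" shows "sgn_powr t (- (s + 2 * of_nat k)) ep = sgn_powr t (- s) ep / of_real (t ^ (2 * k))"
proof -
 have "cor \<bar>t\<bar> powr (- (s + 2 * of_nat k)) = of_real \<bar>t\<bar> powr (- s - of_nat (2 * k))" by (simp add: algebra_simps)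
 also have "... = of_real \<bar>t\<bar> powr (- s) / of_real \<bar>t\<bar> powr (of_nat (2 * k))" by (rule powr_diff)
 also have "cor \<bar>t\<bar> powr (of_nat (2 * k)) = of_real (\<bar>t\<bar> ^ (2 * k))"
  using assms by (subst powr_nat') auto
 also have "\<bar>t\<bar> ^ (2 * k) = t ^ (2 * k)" by (simp add: power_even_abs)
 finally show ?thesis by (simp only: sgn_powr_def times_divide_eq_right)
qed

end

context source_ops begin

context
 fixes l m :: complex and ep et :: int and k :: nat
 assumes ep: "ep \<in> {1, -1}" and et: "et \<in> {1, -1}"
begin

abbreviation "AA \<equiv> iter_F F l m k"
abbreviation "wt \<equiv> wt2 l ep m et"
abbreviation "kap \<equiv> l + m + 2 * of_nat k"

lemma epet: "ep * et \<in> {1, -1}" using ep et by auto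

text \<open>Covariance at one diagonal point, for all germs there. Being local, the notion applies
  to partially defined maps and can be chained along composites.\<close>

definition covat :: "('a \<rightharpoonup> 'a) => ('a => real) => 'a => bool" where
 "covat g p x \<longleftrightarrow> (\<forall>S f. open S --> smooth_on S f --> gg g (x, x) \<in> S -->
   AA (%z. wt p z * f (gg g z)) (x, x) = sgn_powr (p x) (- kap) (ep * et) * AA f (gg g (x, x)))"

lemma covatD: "covat g p x ==> open S ==> smooth_on S f ==> gg g (x, x) \<in> S ==>
  AA (%z. wt p z * f (gg g z)) (x, x) = sgn_powr (p x) (- kap) (ep * et) * AA f (gg g (x, x))"
 unfolding covat_def by blast

text \<open>Both sides acquire the factor \<open>ep * et\<close>; so it is enough to treat one of
  the two square roots of a cocycle.\<close>

lemma covat_neg: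
 assumes g: "rational_map g" "rpoly p" and x: "x \<in> dom g" "p x ~= 0" and c: "covat g p x"
 shows "covat g (%x. - p x) x"
 unfolding covat_def
proof (intro allI impI)
 fix S f assume S: "open S" "smooth_on S f" "gg g (x, x) \<in> S"
 have w: "wt (%x. - p x) z = of_int (ep * et) * wt p z" for z
  by (simp add: wt2_def sgn_powr_uminus[OF ep] sgn_powr_uminus[OF et])
 have "AA (%z. wt (%x. - p x) z * f (gg g z)) (x, x) = of_int (ep * et) * AA (%z. wt p z * f (gg g z)) (x, x)"
  unfolding w mult.assoc
  by (rule ldo_cmult[OF ldo_iter open_CD[OF g S(1)] CD_smooth[OF g S(1,2) ep et]]) (use x S(3) in \<open>simp add: CD_def\<close>)
 thus "AA (%z. wt (%x. - p x) z * f (gg g z)) (x, x) = sgn_powr (- p x) (- kap) (ep * et) * AA f (gg g (x, x))"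
  by (simp add: covatD[OF c S] sgn_powr_uminus[OF epet])
qed

lemma covat_translation: "covat (translation_tr v) (%_. 1) x"
 unfolding covat_def
proof (intro allI impI)
 fix S f assume S: "open S" "smooth_on S f" "gg (translation_tr v) (x, x) \<in> S"
 have g: "gg (translation_tr v) z = (v, v) + z" for z by (simp add: gg_def translation_tr_def prod_eq_iff add.commute)
 show "AA (%z. wt (%_. 1) z * f (gg (translation_tr v) z)) (x, x) = sgn_powr 1 (- kap) (ep * et) * AA f (gg (translation_tr v) (x, x))"
  using iter_translate[OF S(1,2), of v "(x, x)"] S(3) unfolding g by (simp add: wt2_def sgn_powr_def)
qed

text \<open>The factor \<open>str_char J g ^ k\<close> from \<open>iter_str\<close> is the
  multiplier to the power \<open>- 2 * k\<close>, which is the shift of the weight.\<close>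

lemma covat_str:
 assumes g: "g \<in> str_group_pos J" shows "covat (linear_tr g) (%_. 1 / sqrt (str_char J g)) x"
 unfolding covat_def
proof (intro allI impI)
 fix S f assume S: "open S" "smooth_on S f" "gg (linear_tr g) (x, x) \<in> S"
 let ?c = "str_char J g" and ?q = "1 / sqrt (str_char J g)"
 have G: "gg (linear_tr g) = map2 g" by (rule ext) (simp add: gg_def linear_tr_def map2_def)
 note gl = map2_linear[OF strp_D(1)[OF g]]
 have q: "?q > 0" "inverse (?q ^ 2) = ?c" using strp_D(3)[OF g] by (simp_all add: power_divide)
 have w: "wt (%_. ?q) z = sgn_powr ?q (- (l + m)) (ep * et)" for z
  unfolding wt2_def by (rule sgn_powr_combine[OF _ ep et]) (use q(1) in linarith)
 have "AA (%z. wt (%_. ?q) z * f (map2 g z)) (x, x) = sgn_powr ?q (- (l + m)) (ep * et) * AA (%z. f (map2 g z)) (x, x)"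
  unfolding w
  by (rule ldo_cmult[OF ldo_iter open_vimage_linear[OF S(1) gl] sm_linear_compose[OF S(1,2) gl]]) (use S(3) in \<open>simp add: G\<close>)
 also have "... = sgn_powr ?q (- (l + m)) (ep * et) * (of_real ?c ^ k * AA f (map2 g (x, x)))"
  using iter_str[OF g S(1,2), of "(x, x)"] S(3) by (simp add: G)
 also have "sgn_powr ?q (- (l + m)) (ep * et) * (of_real ?c ^ k * AA f (map2 g (x, x))) = sgn_powr ?q (- kap) (ep * et) * AA f (map2 g (x, x))"
 proof -
  have "sgn_powr t (- (l + m)) (ep * et) * (of_real (inverse (t ^ 2)) ^ k * X) = sgn_powr t (- kap) (ep * et) * X"
   if "t > 0" for t X
   using that sgn_powr_even_shift[of t "l + m" k "ep * et"] by (simp add: power_mult power_inverse divide_inverse)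
  from this[OF q(1)] show ?thesis unfolding q(2) .
 qed
 finally show "AA (%z. wt (%_. ?q) z * f (gg (linear_tr g) z)) (x, x) = sgn_powr ?q (- kap) (ep * et) * AA f (gg (linear_tr g) (x, x))"
  by (simp only: G)
qed

abbreviation "io1 \<equiv> inversion_tr J"

lemma gg_io: "z \<in> inv2 ==> gg io1 z = io z"
 by (simp add: gg_def io_def inversion_tr_def invertibles_iff inv2_def)

lemma dom_io: "dom io1 = {x. jd x ~= 0}"
 by (auto simp: inversion_tr_def invertibles_iff split: if_splits)

lemma CD_io: "CD io1 jd S = {z \<in> inv2. io z \<in> S}"
proof -
 have "z \<in> (dom io1 \<inter> {x. jd x ~= 0}) \<times> (dom io1 \<inter> {x. jd x ~= 0}) \<longleftrightarrow> z \<in> inv2" for z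
  by (cases z) (simp add: dom_io inv2_def)
 thus ?thesis unfolding CD_def using gg_io by auto
qed

lemma jd_uminus_poly: "rpoly (%x. jd (- x))"
 unfolding jd_neg by (intro rpoly_intros(2,4) jd_poly)

text \<open>For \<open>x = v - e\<close> one has
  \<open>- jinv J x = jinv J (e - v) = e + fl 1 v\<close>, and \<open>jd (- x) = jd (e - v)\<close>
  is the weight of the flow at time one.\<close>

lemma iota_near:
 assumes v: "!!s. 0 \<le> s ==> s \<le> 1 ==> jd (e - s *\<^sub>R v) ~= 0"
 shows "covat io1 (%x. jd (- x)) (v - e)"
 unfolding covat_def
proof (intro allI impI)
 let ?x = "v - e" and ?p = "%x. jd (- x)"
 fix S f assume S: "open S" "smooth_on S f" "gg io1 (?x, ?x) \<in> S"
 have j1: "jd (e - v) ~= 0" using v[of 1] by simp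
 have ji: "jd (y - e) ~= 0" "the (io1 (y - e)) = jinv J (e - y)" "fl 1 y = jinv J (e - y) - e" if "jd (e - y) ~= 0" for y
 proof -
  show n: "jd (y - e) ~= 0" using that jd_neg[of "e - y"] by simp
  show "the (io1 (y - e)) = jinv J (e - y)" using jinv_neg[OF n] n by (simp add: inversion_tr_def invertibles_iff)
  have "y ** jinv J (e - y) = jinv J (e - y) - (e - y) ** jinv J (e - y)" by (simp add: J_diff)
  thus "fl 1 y = jinv J (e - y) - e" using that by (simp add: fl_def)
 qed
 let ?S = "{y. (e, e) + y \<in> S}" and ?f = "%y. f ((e, e) + y)" and ?G = "%z. wt ?p z * f (gg io1 z)"
 have oS: "open ?S" using open_vimage[OF S(1), of "%y. (e, e) + y"] by (simp add: vimage_def continuous_intros)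
 have sf: "smooth_on ?S ?f" by (rule sm_affine[OF S(1,2), of "%y. y"]) simp
 have ggx: "(e, e) + (fl 1 v, fl 1 v) = gg io1 (?x, ?x)" by (simp add: gg_def ji[OF j1])
 let ?C = "CD io1 ?p S"
 note C = open_CD[OF rat_inversion jd_uminus_poly S(1)] and sG = CD_smooth[OF rat_inversion jd_uminus_poly S(1,2) ep et, of l m]
 have xC: "(- e, - e) + (v, v) \<in> ?C"
  using S(3) ji(1)[OF j1] j1 by (simp add: CD_def dom_io algebra_simps)
 have CD: "open {z. (- e, - e) + z \<in> ?C}" using open_vimage[OF C, of "%y. (- e, - e) + y"] by (simp add: vimage_def continuous_intros)
 have "AA (%z. HH l ep m et ?f (1, z)) (v, v) = AA (%z. ?G ((- e, - e) + z)) (v, v)"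
 proof (rule ldo_cong[OF ldo_iter CD, symmetric])
  show "smooth_on {z. (- e, - e) + z \<in> ?C} (%z. ?G ((- e, - e) + z))"
   by (rule sm_affine[OF C sG, of "%y. y"]) simp
  fix z assume "z \<in> {z. (- e, - e) + z \<in> ?C}"
  hence z: "jd (e - fst z) ~= 0" "jd (e - snd z) ~= 0"
   by (auto simp: CD_def mem_Times_iff algebra_simps)
  have "gg io1 ((- e, - e) + z) = (e, e) + (fl 1 (fst z), fl 1 (snd z))"
   using ji[OF z(1)] ji[OF z(2)] by (simp add: gg_def algebra_simps)
  thus "?G ((- e, - e) + z) = HH l ep m et ?f (1, z)"
   by (simp add: HH_def wt2_def qp_def uu_def fl2_def algebra_simps)
 qed (use xC in simp)
 also have "... = AA ?G (?x, ?x)" using iter_translate[OF C sG, of "- e" "(v, v)"] xC by (simp add: algebra_simps)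
 finally have "AA ?G (?x, ?x) = AA (%z. HH l ep m et ?f (1, z)) (v, v)" ..
 also have "... = qp (- kap) (ep * et) (e - v) * AA ?f (fl 1 v, fl 1 v)"
  by (rule flow_covariance[OF ep et oS sf v]) (use S(3) ggx in auto)
 also have "AA ?f (fl 1 v, fl 1 v) = AA f (gg io1 (?x, ?x))"
  using iter_translate[OF S(1,2), of e "(fl 1 v, fl 1 v)"] S(3) unfolding ggx by simp
 finally show "AA ?G (?x, ?x) = sgn_powr (?p ?x) (- kap) (ep * et) * AA f (gg io1 (?x, ?x))"
  by (simp add: qp_def)
qed

text \<open>\<open>jd (- x)\<close> and \<open>jd x\<close> differ by \<open>(-1)^r\<close>; for odd
  rank this is the passage to the other square root.\<close>

lemma iota_near':
 assumes v: "!!s. 0 \<le> s ==> s \<le> 1 ==> jd (e - s *\<^sub>R v) ~= 0"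
 shows "covat io1 jd (v - e)"
proof (cases "even r")
 case True thus ?thesis using iota_near[OF v] by (simp add: jd_neg)
next
 case False
 have n: "jd (- (v - e)) ~= 0" using v[of 1] by simp
 hence "v - e \<in> dom io1" by (simp only: dom_io jd_neg[of "v - e"]) simp
 from covat_neg[OF rat_inversion jd_uminus_poly this n iota_near[OF v]] False show ?thesis by (simp add: jd_neg)
qed

lemma poly_diff_F: "poly_diff_op (F l' m')" using Fsrc[of l' m'] unfolding is_source_F_def by (rule conjunct1)

lemma pulled_iter: "pulled (- l) (- m) ep et (%f. iter_F F l' m' k' (%z. QQ (- l) ep (- m) et z * f (io z)))"
proof (induction k')
 case 0 show ?case using pulled_base[OF ep et] by simp
next
 case (Suc k') show ?case using pulled_diff_op[OF ep et poly_diff_F Suc.IH] by simp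
qed

lemma iter_E: "\<exists>q. pfun q & iter_F F l' m' k' (E c th) = (%z. q z * E c th z)"
proof (induction k')
 case 0 show ?case by (intro exI[of _ "%_. 1"]) simp
next
 case (Suc k')
 then obtain q where "pfun q" "iter_F F l' m' k' (E c th) = (%z. q z * E c th z)" by blast
 with poly_diff_op_E[OF poly_diff_F this(1)] show ?case by simp
qed

lemma near_e: "\<exists>d>0. \<forall>v\<in>ball 0 d. \<forall>s. 0 \<le> s --> s \<le> 1 --> jd (e - s *\<^sub>R v) ~= 0"
proof -
 obtain d where d: "d > 0" "ball e d \<subseteq> {x. jd x ~= 0}"
  by (rule openE[OF open_invertibles, of e]) (simp, rule that)
 have "jd (e - s *\<^sub>R v) ~= 0" if "v \<in> ball 0 d" "0 \<le> s" "s \<le> 1" for v s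
 proof -
  have "norm (s *\<^sub>R v) \<le> norm v" using that(2,3) by (simp add: mult_left_le_one_le)
  hence "e - s *\<^sub>R v \<in> ball e d" using that(1) by (simp add: dist_norm)
  thus ?thesis using d(2) by blast
 qed
 thus ?thesis using d(1) by blast
qed

lemma wt_diag: "jd x ~= 0 ==> sgn_powr (jd x) (- kap) (ep * et) = QQ (- l) ep (- m) et (x, x) / of_real (jj (x, x)) ^ k"
 using sgn_powr_even_shift[of "jd x" "l + m" k "ep * et"] sgn_powr_combine[OF _ ep et, of "jd x" l m]
 by (simp add: QQ_def qp_def power_mult power2_eq_square)

theorem covat_inversion:
 assumes x: "jd x ~= 0" shows "covat io1 jd x"
proof -
 let ?Q = "QQ (- l) ep (- m) et"
 have wtQ: "wt jd = ?Q" by (rule ext) (simp add: wt2_def QQ_def qp_def)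
 obtain T where "pulled_by (- l) (- m) ep et T (%f. AA (%z. ?Q z * f (io z)))"
  using pulled_iter unfolding pulled_def[OF ep et] by blast
 note T = pulled_byD[OF ep et this]
 have lhs: "AA (%z. wt jd z * f (gg io1 z)) (y, y) = ?Q (y, y) * (\<Sum>(R, ws)\<leftarrow>T. R (y, y) * dd ws f (io (y, y)))"
  if y: "jd y ~= 0" and S: "open S" "smooth_on S f" "io (y, y) \<in> S" for y S f
 proof -
  have yi: "(y, y) \<in> inv2" using y by (simp add: inv2_def)
  have "AA (%z. wt jd z * f (gg io1 z)) (y, y) = AA (%z. ?Q z * f (io z)) (y, y)"
   by (rule ldo_cong[OF ldo_iter open_CD[OF rat_inversion jd_poly S(1)] CD_smooth[OF rat_inversion jd_poly S(1,2) ep et]])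
    (use yi S(3) in \<open>simp_all add: CD_io wtQ gg_io\<close>)
  thus ?thesis using T(2)[OF S(1,2) yi S(3)] by simp
 qed
 have E_eq: "(\<Sum>(R, ws)\<leftarrow>T. R (x, x) * dd ws (E 1 th) (io (x, x))) = AA (E 1 th) (io (x, x)) / of_real (jj (x, x)) ^ k" for th
 proof -
  obtain q where q: "pfun q" "AA (E 1 th) = (%z. q z * E 1 th z)" using iter_E[of l m k 1 th] by (elim exE conjE) (rule that)
  \<comment> \<open>The difference of the two sides on one exponential after removal of the common
    factors \<open>QQ\<close> and \<open>E\<close>: the symbol of the pulled-back operator minus
    that of the iterated operator divided by the power of the determinants.\<close>
  define ph where "ph z = (\<Sum>t\<leftarrow>T. fst t z * (\<Prod>w\<leftarrow>snd t. 1 * of_real (tau2 w th))) + (- 1) * (q (io z) * inverse (of_real (jj z) ^ k))" for z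
  have inv: "ratf (%z. inverse (of_real (jj z) ^ k))" by (rule ratfI[of "%_. 1" _ k]) (simp_all add: divide_inverse)
  have r: "ratf ph" unfolding ph_def[abs_def]
   by (intro ratf_add ratf_sum_list ratf_mult ratf_const ratf_poly_io q inv) (use T(1) in auto)
  have ph_E: "ph (y, y) * E 1 th (io (y, y)) = (\<Sum>(R, ws)\<leftarrow>T. R (y, y) * dd ws (E 1 th) (io (y, y))) - AA (E 1 th) (io (y, y)) / of_real (jj (y, y)) ^ k" for y
   unfolding ph_def E_dir_deriv q(2)
   by (simp add: algebra_simps case_prod_unfold divide_inverse flip: sum_list_const_mult)
  obtain d where d: "d > 0" "!!v s. v \<in> ball 0 d ==> 0 \<le> s ==> s \<le> 1 ==> jd (e - s *\<^sub>R v) ~= 0"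
   using near_e by blast
  have "ph (x, x) = 0"
  proof (rule ratf_diag_zero[OF r open_ball _ _ x])
   show "ball (- e) d ~= {}" using d(1) by simp
   fix y assume y: "y \<in> ball (- e) d" and jy: "jd y ~= 0"
   have "y + e \<in> ball 0 d" using y by (simp add: dist_norm norm_minus_commute add.commute)
   from iota_near'[OF d(2)[OF this]] have c: "covat io1 jd y" by simp
   have yi: "(y, y) \<in> inv2" using jy by (simp add: inv2_def)
   have "?Q (y, y) * (\<Sum>(R, ws)\<leftarrow>T. R (y, y) * dd ws (E 1 th) (io (y, y))) = ?Q (y, y) * (AA (E 1 th) (io (y, y)) / of_real (jj (y, y)) ^ k)"
    using covatD[OF c open_UNIV E_smooth UNIV_I, of 1 th] lhs[OF jy open_UNIV E_smooth UNIV_I, of 1 th] wt_diag[OF jy]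
    by (simp add: gg_io[OF yi])
   from this[unfolded mult_left_cancel[OF QQ_nonzero[OF yi]]] have "ph (y, y) * E 1 th (io (y, y)) = 0"
    unfolding ph_E by (simp only: right_minus_eq)
   thus "ph (y, y) = 0" by simp
  qed
  thus ?thesis using ph_E[of x] by simp
 qed
 show ?thesis unfolding covat_def
 proof (intro allI impI)
  fix S f assume S: "open S" "smooth_on S f" "gg io1 (x, x) \<in> S"
  have xi: "(x, x) \<in> inv2" using x by (simp add: inv2_def)
  have S3: "io (x, x) \<in> S" using S(3) by (simp add: gg_io[OF xi])
  \<comment> \<open>With \<open>x\<close> fixed the rational coefficients are constants, so both
    sides are differential operators evaluated at the image point, and agreement on exponentials
    suffices.\<close>
  have 1: "ldo (%f y. \<Sum>(R, ws)\<leftarrow>T. R (x, x) * dd ws f y)"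
   by (rule ldoI[of "map (%(R, ws). (%_. R (x, x), ws)) T"]) (auto simp: diff_op_def o_def case_prod_unfold)
  have 2: "ldo (%f y. inverse (of_real (jj (x, x)) ^ k) * AA f y)" by (rule ldo_mult[OF sm_const ldo_iter])
  have "(\<Sum>(R, ws)\<leftarrow>T. R (x, x) * dd ws f (io (x, x))) = inverse (of_real (jj (x, x)) ^ k) * AA f (io (x, x))"
   by (rule ldo_eqI_E[OF 1 2 _ S(1,2) S3, of 1]) (simp_all add: E_eq divide_inverse mult.commute)
  thus "AA (%z. wt jd z * f (gg io1 z)) (x, x) = sgn_powr (jd x) (- kap) (ep * et) * AA f (gg io1 (x, x))"
   unfolding lhs[OF x S(1,2) S3] gg_io[OF xi] wt_diag[OF x] by (simp add: divide_inverse)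
 qed
qed

section \<open>Covariance under the conformal group\<close>

text \<open>Where the pointwise composite exists the two covariances chain by the cocycle rule; the
  other points of the domain of the rational composite are reached by density and
  continuity.\<close>

lemma covat_mult:
 assumes a: "a \<in> GC" "!!y. y \<in> dom (fst a) ==> covat (fst a) (snd a) y"
  and b: "b \<in> GC" "!!y. y \<in> dom (fst b) ==> covat (fst b) (snd b) y"
  and x: "x \<in> dom (fst (G_mult a b))"
 shows "covat (fst (G_mult a b)) (snd (G_mult a b)) x"
 unfolding covat_def
proof (intro allI impI)
 let ?g = "fst a" and ?h = "fst b" and ?c = "G_mult a b"
 let ?k = "fst ?c"
 note A = GC_D[OF a(1)] and B = GC_D[OF b(1)] and C = GC_D[OF G_mult(1)[OF a(1) b(1)]]
 have k: "?k = rat_comp ?g ?h" by (rule G_mult(2)[OF a(1) b(1)])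
 fix S f assume S: "open S" "smooth_on S f" "gg ?k (x, x) \<in> S"
 let ?L = "%y. AA (%z. wt (snd ?c) z * f (gg ?k z)) (y, y)"
  and ?R = "%y. sgn_powr (snd ?c y) (- kap) (ep * et) * AA f (gg ?k (y, y))"
 let ?D = "{y. (y, y) \<in> CD ?k (snd ?c) S}"
 have ld: "linear (%y::'a. (y, y))" by (rule linearI) simp_all
 note oC = open_CD[OF C(3,4) S(1)] and sC = CD_smooth[OF C(3,4) S(1,2) ep et, of l m]
 have cont: "continuous_on ?D (%y. (y, y))" by (intro continuous_intros)
 show "?L x = ?R x"
 proof (rule eq_on_dense[OF open_vimage_linear[OF oC ld] _ _ cdom_dense[OF B(2) A(3)]])
  show "continuous_on ?D ?L"
   by (rule continuous_on_compose2[OF sm_continuous[OF ldo_smooth[OF ldo_iter oC sC]] cont]) auto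
  have "continuous_on ?D (%y. AA f (gg ?k (y, y)))"
  proof (rule continuous_on_compose2[OF sm_continuous[OF ldo_smooth[OF ldo_iter S(1,2)]]])
   show "continuous_on ?D (%y. gg ?k (y, y))"
    by (rule continuous_on_compose2[OF smap_continuous[OF gg_smooth[OF C(3)]] cont]) (auto simp: CD_def)
  qed (auto simp: CD_def)
  moreover have "continuous_on ?D (%y. sgn_powr (snd ?c y) (- kap) (ep * et))"
   by (rule continuous_on_subset[OF sm_continuous[OF sgn_powr_smooth_poly[OF C(4) epet]]]) (auto simp: CD_def)
  ultimately show "continuous_on ?D ?R" by (intro continuous_on_mult)
  show "x \<in> ?D" using x S(3) C(6)[OF x] by (simp add: CD_def)
  fix y assume y: "y \<in> ?D" "y \<in> cdom ?g ?h"
  have comp: "gg ?k z = gg ?g (gg ?h z)" "wt (snd ?c) z = wt (snd b) z * wt (snd a) (gg ?h z)"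
   if "fst z \<in> cdom ?g ?h" "snd z \<in> cdom ?g ?h" for z
   using that by (simp_all add: gg_def k conf_comp_val(2)[OF A(2) B(2)] wt2_def G_mult(3)[OF a(1) b(1)] sgn_powr_mult)
  let ?F1 = "%w. wt (snd a) w * f (gg ?g w)"
  note oA = open_CD[OF A(3,4) S(1)] and sA = CD_smooth[OF A(3,4) S(1,2) ep et, of l m]
  have yh: "y \<in> dom ?h" "the (?h y) \<in> dom ?g" using y(2) by (auto simp: cdom_def)
  have yS: "gg ?g (gg ?h (y, y)) \<in> S" using y comp[of "(y, y)"] by (simp add: CD_def)
  have yA: "gg ?h (y, y) \<in> CD ?g (snd a) S"
   using yS yh(2) A(6)[OF yh(2)] by (simp add: CD_def gg_def)
  have O: "open (CD ?k (snd ?c) S \<inter> cdom ?g ?h \<times> cdom ?g ?h)" by (intro open_Int oC open_Times cdom_open A B)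
  have "?L y = AA (%z. wt (snd b) z * ?F1 (gg ?h z)) (y, y)"
   by (rule ldo_cong[OF ldo_iter O sm_subset[OF sC]]) (use y in \<open>auto simp: comp mult.assoc\<close>)
  also have "... = sgn_powr (snd b y) (- kap) (ep * et) * AA ?F1 (gg ?h (y, y))"
   by (rule covatD[OF b(2)[OF yh(1)] oA sA yA])
  also have "gg ?h (y, y) = (the (?h y), the (?h y))" by (simp add: gg_def)
  also have "AA ?F1 (the (?h y), the (?h y)) = sgn_powr (snd a (the (?h y))) (- kap) (ep * et) * AA f (gg ?g (the (?h y), the (?h y)))"
   by (rule covatD[OF a(2)[OF yh(2)] S(1,2)]) (use yS in \<open>simp add: gg_def\<close>)
  also have "sgn_powr (snd b y) (- kap) (ep * et) * ... = ?R y"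
   using comp(1)[of "(y, y)"] y(2) by (simp add: G_mult(3)[OF a(1) b(1)] sgn_powr_mult gg_def mult_ac)
  finally show "?L y = ?R y" .
 qed
qed

lemma exists_covariant:
 "g \<in> co_group J ==> \<exists>p. (g, p) \<in> GC & (\<forall>x\<in>dom g. covat g p x)"
proof (induction rule: co_group.induct)
 case (str g)
 let ?p = "%_::'a. 1 / sqrt (str_char J g)"
 have "(linear_tr g, ?p) \<in> GC"
  by (rule GC_I[OF _ _ dense_UNIV])
   (use strp_D(3)[OF str] in \<open>simp_all add: co_group.str[OF str] rpoly_intros(2) cocycle_dg
    conf_linear(2)[OF str] power_divide divide_inverse power_inverse\<close>)
 thus ?case using covat_str[OF str] by blast
next
 case (trans v)
 thus ?case using G_trans_in[of v] covat_translation unfolding G_trans_def by blast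
next
 case inversion
 have "(io1, jd) \<in> GC"
  by (rule GC_I[OF _ _ dense_UNIV])
   (auto simp: co_group.inversion jd_poly cocycle_dg dom_io conf_inversion_dg(3))
 thus ?case using covat_inversion by (auto simp: dom_io)
next
 case (comp g h)
 then obtain p q where p: "(g, p) \<in> GC" "\<forall>x\<in>dom g. covat g p x" and q: "(h, q) \<in> GC" "\<forall>x\<in>dom h. covat h q x" by blast
 let ?c = "G_mult (g, p) (h, q)"
 have c: "?c = (rat_comp g h, snd ?c)" using G_mult(2)[OF p(1) q(1)] by (simp add: prod_eq_iff)
 have "?c \<in> GC" by (rule G_mult(1)[OF p(1) q(1)])
 moreover have "covat (fst ?c) (snd ?c) x" if "x \<in> dom (fst ?c)" for x
  by (rule covat_mult[OF p(1) _ q(1) _ that]) (use p(2) q(2) in auto)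
 ultimately show ?case using c by (metis fst_conv)
qed

text \<open>On a nonempty domain two polynomial square roots of the cocycle agree up to a global
  sign, and \<open>covat_neg\<close> settles the sign.\<close>

theorem GC_covariant:
 assumes a: "a \<in> GC" "x \<in> dom (fst a)" shows "covat (fst a) (snd a) x"
proof -
 note A = GC_D[OF a(1)]
 obtain p where p: "(fst a, p) \<in> GC" "\<forall>x\<in>dom (fst a). covat (fst a) p x" using exists_covariant[OF A(1)] by blast
 note P = GC_D[OF p(1), simplified]
 have ra: "rpoly (%x. snd a x - p x)" "rpoly (%x. snd a x + p x)"
  by (intro real_polynomial_function_diff rpoly_intros(3) A(4) P(4))+
 have "(snd a x - p x) * (snd a x + p x) = 0" if "x \<in> dom (fst a)" for x
  using A(5)[OF that] P(5)[OF that] by (simp add: algebra_simps power2_eq_square)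
 moreover have "dom (fst a) ~= {}" using a(2) by auto
 ultimately have "(\<forall>x. snd a x - p x = 0) \<or> (\<forall>x. snd a x + p x = 0)"
  using two_nonzero[OF ra _ _ rat_dom_open[OF A(3)]] by (metis mult_eq_0_iff)
 thus ?thesis
 proof
  assume "\<forall>x. snd a x - p x = 0"
  hence "snd a = p" by (simp add: fun_eq_iff)
  thus ?thesis using p(2) a(2) by simp
 next
  assume "\<forall>x. snd a x + p x = 0"
  hence s: "snd a = (%x. - p x)" by (simp add: fun_eq_iff add_eq_0_iff)
  have "covat (fst a) (%x. - p x) x"
   by (rule covat_neg[OF P(3,4) a(2) P(6)[OF a(2)]]) (use p(2) a(2) in simp)
  thus ?thesis by (simp only: s)
 qed
qed

end

text \<open>The function on \<open>V \<times> V\<close> that represents \<open>ph\<close> in the chart \<open>v \<mapsto> g n\<^sub>v\<close>.\<close>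

definition chart :: "('a gelem \<times> 'a gelem => complex) => 'a gelem => 'a \<times> 'a => complex" where
 "chart ph g z = ph (G_mult g (G_trans (fst z)), G_mult g (G_trans (snd z)))"

lemma chart_smooth:
 assumes "ph \<in> ind_space2 J l ep m et" "g \<in> GC" shows "smooth_on UNIV (chart ph g)"
 using assms unfolding ind_space2_def chart_def[abs_def] by (simp add: case_prod_unfold)

lemma chart_translate:
 assumes "g \<in> GC" shows "chart ph (G_mult g (G_trans v)) z = chart ph g ((v, v) + z)"
 by (simp add: chart_def G_assoc[OF assms G_trans_in G_trans_in] G_trans_mult)

lemma chart_mult:
 assumes "ph \<in> ind_space2 J l ep m et" "g \<in> GC" "h \<in> GC" "fst z \<in> dom (fst h)" "snd z \<in> dom (fst h)"
 shows "chart ph (G_mult g h) z = wt2 l ep m et (snd h) z * chart ph g (gg (fst h) z)"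
proof -
 obtain v w where "fst h (fst z) = Some v" "fst h (snd z) = Some w" using assms(4,5) by blast
 from ind_space2_move[OF assms(1-3) this] this show ?thesis by (simp add: chart_def gg_def)
qed

end

section \<open>The operator in all charts of the compactification\<close>

context source_ops begin

lemma B_op_apply: "B_op F l m k f x = iter_F F l m k f (x, x)"
 by (simp add: B_op_def res_def)

context
 fixes l m :: complex and ep et :: int and k :: nat and ph
 assumes ep: "ep \<in> {1, -1}" and et: "et \<in> {1, -1}" and ph: "ph \<in> ind_space2 J l ep m et"
begin

abbreviation "Bk \<equiv> B_op F l m k"

lemma B_chart_smooth: assumes "g \<in> GC" shows "smooth_on UNIV (Bk (chart ph g))"
proof -
 have "linear (%x::'a. (x, x))" by (rule linearI) simp_all
 from sm_linear_compose[OF open_UNIV ldo_smooth[OF ldo_iter open_UNIV chart_smooth[OF ph assms]] this]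
 show ?thesis by (simp add: B_op_apply[abs_def])
qed

text \<open>Multiplying by \<open>h\<close> on the right changes the chart;
  \<open>chart_mult\<close> turns this into the weighted pull-back to which covariance at a diagonal
  point applies.\<close>

lemma B_chart_mult:
 assumes g: "g \<in> GC" and h: "h \<in> GC" "fst h x = Some y"
 shows "Bk (chart ph (G_mult g h)) x = sgn_powr (snd h x) (- (l + m + 2 * of_nat k)) (ep * et) * Bk (chart ph g) y"
proof -
 note H = GC_D[OF h(1)]
 have x: "x \<in> dom (fst h)" using h(2) by auto
 have O: "open (dom (fst h) \<times> dom (fst h))" by (intro open_Times rat_dom_open H)
 have "Bk (chart ph (G_mult g h)) x = iter_F F l m k (%z. wt2 l ep m et (snd h) z * chart ph g (gg (fst h) z)) (x, x)"
  unfolding B_op_apply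
  by (rule ldo_cong[OF ldo_iter O sm_subset[OF chart_smooth[OF ph G_mult(1)[OF g h(1)]]]])
   (use x chart_mult[OF ph g h(1)] in \<open>simp_all add: mem_Times_iff\<close>)
 also have "... = sgn_powr (snd h x) (- (l + m + 2 * of_nat k)) (ep * et) * iter_F F l m k (chart ph g) (gg (fst h) (x, x))"
  by (rule covatD[OF ep et GC_covariant[OF ep et h(1) x] open_UNIV chart_smooth[OF ph g] UNIV_I])
 finally show ?thesis by (simp add: B_op_apply gg_def h(2))
qed

lemma B_chart_translate:
 assumes "g \<in> GC" shows "Bk (chart ph (G_mult g (G_trans v))) x = Bk (chart ph g) (v + x)"
 using iter_translate[OF open_UNIV chart_smooth[OF ph assms], of v "(x, x)"]
 by (simp add: B_op_apply chart_translate[OF assms, abs_def])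

lemma B_H_space: "Bk (chart ph G_one) \<in> H_space J (l + m + 2 * of_nat k) (ep * et)"
proof -
 \<comment> \<open>The value at the centre of the chart of \<open>g\<close> defines a function on
   the group whose noncompact picture is \<open>Bk (chart ph G_one)\<close>.\<close>
 let ?f = "%g. Bk (chart ph g) 0"
 have tr: "?f (G_mult g (G_trans v)) = Bk (chart ph g) v" if "g \<in> GC" for g v
  by (simp add: B_chart_translate[OF that])
 have "?f \<in> ind_space J (l + m + 2 * of_nat k) (ep * et)"
  unfolding ind_space_def
 proof (intro CollectI conjI ballI)
  fix g p assume g: "g \<in> GC" and p: "p \<in> P_bar J"
  have p': "p \<in> GC" "fst p 0 = Some 0" using p by (auto simp: P_bar_def)
  have "snd p 0 ~= 0" using GC_D(6)[OF p'(1)] p'(2) by auto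
  thus "?f (G_mult g p) = inverse (P_char (l + m + 2 * of_nat k) (ep * et) p) * ?f g"
   by (simp add: B_chart_mult[OF g p'] P_char_def inverse_sgn_powr)
 next
  fix g assume g: "g \<in> GC"
  show "smooth_on UNIV (%v. ?f (G_mult g (G_trans v)))" using B_chart_smooth[OF g] by (simp add: tr[OF g])
 qed
 moreover have "Bk (chart ph G_one) = (%x. ?f (G_trans x))"
  using tr[OF G_one_in] by (simp add: G_one_mult G_trans_in fun_eq_iff)
 ultimately show ?thesis unfolding H_space_def by (intro CollectI exI[of _ ?f] conjI)
qed

text \<open>Acting by \<open>g\<close> is passing to the chart of the inverse: that function is
  continuous everywhere and satisfies the action formula where the formula makes sense, which is a
  dense set and so determines it.\<close>

lemma rep2_chart:
 assumes g: "g \<in> GC" shows "rep2 J l ep m et g (chart ph G_one) = chart ph (G_inv J g)"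
 unfolding rep2_def
proof (rule the_equality)
 note h = G_inv(1)[OF g]
 note H = GC_D[OF h]
 let ?h = "G_inv J g"
 have val: "chart ph ?h (x, y) = sgn_powr (snd ?h x) (- l) ep * sgn_powr (snd ?h y) (- m) et * chart ph G_one (x', y')"
  if "fst ?h x = Some x'" "fst ?h y = Some y'" for x y x' y'
  using chart_mult[OF ph G_one_in h, of "(x, y)"] that by (auto simp: G_one_mult(1)[OF h] wt2_def gg_def)
 have cont: "continuous_on UNIV (chart ph ?h)" by (rule sm_continuous[OF chart_smooth[OF ph h]])
 show "continuous_on UNIV (chart ph ?h) & (\<forall>x x' y y'. fst ?h x = Some x' & fst ?h y = Some y' -->
  chart ph ?h (x, y) = sgn_powr (snd ?h x) (- l) ep * sgn_powr (snd ?h y) (- m) et * chart ph G_one (x', y'))"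
  using cont val by blast
 fix ps assume ps: "continuous_on UNIV ps & (\<forall>x x' y y'. fst ?h x = Some x' & fst ?h y = Some y' -->
  ps (x, y) = sgn_powr (snd ?h x) (- l) ep * sgn_powr (snd ?h y) (- m) et * chart ph G_one (x', y'))"
 have d: "dense_in (dom (fst ?h) \<times> dom (fst ?h))"
  unfolding dense_in_def
 proof (intro allI impI)
  fix U :: "('a \<times> 'a) set" assume U: "open U" "U ~= {}"
  then obtain u where "u \<in> U" by blast
  then obtain A1 B1 where AB: "open A1" "open B1" "u \<in> A1 \<times> B1" "A1 \<times> B1 \<subseteq> U" by (rule open_prod_elim[OF U(1)])
  obtain a where "a \<in> A1" "a \<in> dom (fst ?h)" using rat_dom_dense[OF H(3) AB(1)] AB(3) by auto
  moreover obtain b where "b \<in> B1" "b \<in> dom (fst ?h)" using rat_dom_dense[OF H(3) AB(2)] AB(3) by auto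
  ultimately show "\<exists>z\<in>U. z \<in> dom (fst ?h) \<times> dom (fst ?h)" using AB(4) by (intro bexI[of _ "(a, b)"]) auto
 qed
 show "ps = chart ph ?h"
 proof
  fix z
  show "ps z = chart ph ?h z"
  proof (rule eq_on_dense[OF open_UNIV conjunct1[OF ps] cont d _ UNIV_I])
   fix z assume "z \<in> dom (fst ?h) \<times> dom (fst ?h)"
   then obtain x y x' y' where z: "z = (x, y)" "fst ?h x = Some x'" "fst ?h y = Some y'" by (cases z) auto
   show "ps z = chart ph ?h z" using val[OF z(2,3)] conjunct2[OF ps, rule_format, OF conjI[OF z(2,3)]] by (simp add: z(1))
  qed
 qed
qed

lemma rep_B_chart:
 assumes g: "g \<in> GC"
 shows "rep J (l + m + 2 * of_nat k) (ep * et) g (Bk (chart ph G_one)) = Bk (chart ph (G_inv J g))"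
 unfolding rep_def
proof (rule the_equality)
 note h = G_inv(1)[OF g]
 note H = GC_D[OF h]
 let ?h = "G_inv J g" and ?ka = "l + m + 2 * of_nat k"
 have val: "Bk (chart ph ?h) x = sgn_powr (snd ?h x) (- ?ka) (ep * et) * Bk (chart ph G_one) x'" if "fst ?h x = Some x'" for x x'
  using B_chart_mult[OF G_one_in h that] by (simp add: G_one_mult(1)[OF h])
 have cont: "continuous_on UNIV (Bk (chart ph ?h))" by (rule sm_continuous[OF B_chart_smooth[OF h]])
 show "continuous_on UNIV (Bk (chart ph ?h)) & (\<forall>x x'. fst ?h x = Some x' -->
  Bk (chart ph ?h) x = sgn_powr (snd ?h x) (- ?ka) (ep * et) * Bk (chart ph G_one) x')"
  using cont val by blast
 fix ps assume ps: "continuous_on UNIV ps & (\<forall>x x'. fst ?h x = Some x' -->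
  ps x = sgn_powr (snd ?h x) (- ?ka) (ep * et) * Bk (chart ph G_one) x')"
 show "ps = Bk (chart ph ?h)"
 proof
  fix x
  show "ps x = Bk (chart ph ?h) x"
  proof (rule eq_on_dense[OF open_UNIV conjunct1[OF ps] cont dense_dom[OF H(3)] _ UNIV_I])
   fix x assume "x \<in> dom (fst ?h)"
   then obtain x' where "fst ?h x = Some x'" by blast
   thus "ps x = Bk (chart ph ?h) x" using val conjunct2[OF ps] by simp
  qed
 qed
qed

end

end

theorem proposition5p1:
 fixes J :: "'a::euclidean_space \<Rightarrow> 'a \<Rightarrow> 'a"
  and \<Delta> :: "('a \<times> 'a \<Rightarrow> complex) \<Rightarrow> 'a \<times> 'a \<Rightarrow> complex"
  and D F :: "complex \<Rightarrow> complex \<Rightarrow> ('a \<times> 'a \<Rightarrow> complex) \<Rightarrow> 'a \<times> 'a \<Rightarrow> complex"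
  and l m :: complex and \<epsilon> \<eta> :: int and k :: nat
 assumes "simple_unital_jordan_algebra J"
  and "is_det_diff_op J \<Delta>"
  and "\<And>s t. is_source_D J \<Delta> s t (D s t)"
  and "\<And>l' m'. is_source_F J D l' m' (F l' m')"
  and "\<epsilon> \<in> {1, -1}" and "\<eta> \<in> {1, -1}"
  and "k \<ge> 1"
 shows "(\<forall>f\<in>H_space2 J l \<epsilon> m \<eta>.
      B_op F l m k f \<in> H_space J (l + m + 2 * of_nat k) (\<epsilon> * \<eta>)) \<and>
     (\<forall>g\<in>G_carrier J. \<forall>f\<in>H_space2 J l \<epsilon> m \<eta>.
      B_op F l m k (rep2 J l \<epsilon> m \<eta> g f) =
      rep J (l + m + 2 * of_nat k) (\<epsilon> * \<eta>) g (B_op F l m k f))"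
proof -
 interpret source_ops J \<Delta> D F using assms(1-4) by unfold_locales
 have f: "\<exists>\<phi>\<in>ind_space2 J l \<epsilon> m \<eta>. f = chart \<phi> G_one" if fH: "f \<in> H_space2 J l \<epsilon> m \<eta>" for f
 proof -
  obtain \<phi> where \<phi>: "\<phi> \<in> ind_space2 J l \<epsilon> m \<eta>" "f = (\<lambda>(x, y). \<phi> (G_trans x, G_trans y))"
   using fH unfolding H_space2_def by blast
  have "f = chart \<phi> G_one"
   unfolding \<phi>(2) by (simp add: fun_eq_iff chart_def G_one_mult(1) G_trans_in)
  thus ?thesis using \<phi>(1) by blast
 qed
 show ?thesis
 proof (intro conjI ballI)
  fix f assume "f \<in> H_space2 J l \<epsilon> m \<eta>"
  then obtain \<phi> where "\<phi> \<in> ind_space2 J l \<epsilon> m \<eta>" "f = chart \<phi> G_one" using f by blast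
  thus "B_op F l m k f \<in> H_space J (l + m + 2 * of_nat k) (\<epsilon> * \<eta>)"
   using B_H_space[OF assms(5,6)] by simp
 next
  fix g f assume g: "g \<in> G_carrier J" and "f \<in> H_space2 J l \<epsilon> m \<eta>"
  then obtain \<phi> where \<phi>: "\<phi> \<in> ind_space2 J l \<epsilon> m \<eta>" "f = chart \<phi> G_one" using f by blast
  show "B_op F l m k (rep2 J l \<epsilon> m \<eta> g f) = rep J (l + m + 2 * of_nat k) (\<epsilon> * \<eta>) g (B_op F l m k f)"
   using rep2_chart[OF assms(5,6) \<phi>(1) g] rep_B_chart[OF assms(5,6) \<phi>(1) g] by (simp add: \<phi>(2))
 qed
qed

end
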